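(* Let $M$ be an object of $\mathcal{O}$ that is finitely generated as a $U$-module. Then $M$ can be written as a finite direct sum of indecomposable objects of $\mathcal{O}$, and such a decomposition is unique up to reordering and isomorphisms.
   Context: Setting. Let $\mathfrak{g}$ be a semisimple complex Lie algebra with root system $R$, weight lattice $X$, a fixed basis $\Pi\subset R$ and positive roots $R^+$. Let $\{e_\alpha,f_\alpha,h_\beta\mid\alpha\in R^+,\beta\in\Pi\}$ be a Chevalley basis and let $U_{\mathbb{Z}}\subset U(\mathfrak{g})$ be Kostant's integral form, the unital subring generated by $e_\alpha^{(n)}=e_\alpha^n/n!$, $f_\alpha^{(n)}=f_\alpha^n/n!$, $\binom{h_\beta}{n}=\frac{h_\beta(h_\beta-1)\cdots(h_\beta-n+1)}{n!}$ ($n>0$); $U_{\mathbb{Z}}^+,U_{\mathbb{Z}}^-,U_{\mathbb{Z}}^0$ are the subrings generated by the $e_\alpha^{(n)}$, the $f_\alpha^{(n)}$, the $\binom{h_\beta}{n}$ respectively. Let $k$ be a field of characteristic $p>0$, $U=U_{\mathbb{Z}}\otimes_{\mathbb{Z}}k$, and similarly $U^\pm,U^0$. For $\lambda\in X$ let $\chi_\lambda\colon U^0\to k$ be the character sending $\binom{h_\beta}{n}$ to the image of $\binom{\langle\lambda,\beta^\vee\rangle}{n}$ in $k$, and $M_\lambda=\{m\in M\mid hm=\chi_\lambda(h)m\ \forall h\in U^0\}$. $M$ is a weight module if $M=\bigoplus_{\lambda\in X}M_\lambda$. $M$ is $U^+$-locally finite if it is the union of its finite dimensional $U^+$-submodules.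 $\mathcal{O}$ is the full subcategory of $U$-modules that are weight modules and $U^+$-locally finite. *)

theory Defs
  imports Complex_Main "HOL-Algebra.Algebra" "HOL-Algebra.Algebraic_Closure_Type"
begin

section \<open>Monoid rings and tensor products\<close>

text \<open>
  The monoid ring of a monoid with coefficients in a commutative ring, realised as finitely
  supported functions with convolution. Taking words as the monoid gives the free algebra.
\<close>

definition monoid_ring :: "('a, 'b) monoid_scheme \<Rightarrow> ('a \<Rightarrow> 'c::comm_ring_1) ring" where
  "monoid_ring G =
    \<lparr>carrier = {u. finite {x. u x \<noteq> 0} \<and> {x. u x \<noteq> 0} \<subseteq> carrier G},
     monoid.mult = (\<lambda>u v x. \<Sum>(a, b) \<in> {a. u a \<noteq> 0} \<times> {b. v b \<noteq> 0}.
                if a \<otimes>\<^bsub>G\<^esub> b = x then u a * v b else 0),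
     one = (\<lambda>x. if x = \<one>\<^bsub>G\<^esub> then 1 else 0),
     ring.zero = (\<lambda>x. 0),
     add = (\<lambda>u v x. u x + v x)\<rparr>"

definition single :: "'a \<Rightarrow> 'c::comm_ring_1 \<Rightarrow> 'a \<Rightarrow> 'c" where
  "single a c = (\<lambda>x. if x = a then c else 0)"

definition word_monoid :: "'a list monoid" where
  "word_monoid = \<lparr>carrier = UNIV, monoid.mult = (@), one = []\<rparr>"

text \<open>
  The tensor product over the integers of two rings: the free abelian group on pairs, with
  multiplication of pairs componentwise, modulo biadditivity. The subgroup spanned by the
  biadditivity relations is already an ideal, so it is the ideal they generate.
\<close>

definition tensor_ideal :: "('a, 'b) ring_scheme \<Rightarrow> ('c, 'd) ring_scheme \<Rightarrow> ('a \<times> 'c \<Rightarrow> int) set" where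
  "tensor_ideal A B = (let F = monoid_ring (A \<times>\<times> B) in
     Idl\<^bsub>F\<^esub>
      ({single (a \<oplus>\<^bsub>A\<^esub> a', b) 1 \<ominus>\<^bsub>F\<^esub> single (a, b) 1 \<ominus>\<^bsub>F\<^esub> single (a', b) 1 | a a' b.
          a \<in> carrier A \<and> a' \<in> carrier A \<and> b \<in> carrier B}
     \<union> {single (a, b \<oplus>\<^bsub>B\<^esub> b') 1 \<ominus>\<^bsub>F\<^esub> single (a, b) 1 \<ominus>\<^bsub>F\<^esub> single (a, b') 1 | a b b'.
          a \<in> carrier A \<and> b \<in> carrier B \<and> b' \<in> carrier B}))"

definition tensor_ring :: "('a, 'b) ring_scheme \<Rightarrow> ('c, 'd) ring_scheme \<Rightarrow> ('a \<times> 'c \<Rightarrow> int) set ring" where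
  "tensor_ring A B = monoid_ring (A \<times>\<times> B) Quot tensor_ideal A B"

definition tensor :: "('a, 'b) ring_scheme \<Rightarrow> ('c, 'd) ring_scheme \<Rightarrow> 'a \<Rightarrow> 'c \<Rightarrow> ('a \<times> 'c \<Rightarrow> int) set" where
  "tensor A B a b = tensor_ideal A B +>\<^bsub>monoid_ring (A \<times>\<times> B)\<^esub> single (a, b) 1"

text \<open>
  For a subring \<open>A'\<close> of \<open>A\<close>, this is the natural homomorphism from \<open>A' \<otimes> B\<close> to \<open>A \<otimes> B\<close>. The
  relations of \<open>A' \<otimes> B\<close> hold in \<open>A \<otimes> B\<close>, so a coset of the smaller ideal generates a coset of
  the larger one.
\<close>

definition tensor_incl ::
  "('a, 'b) ring_scheme \<Rightarrow> ('c, 'd) ring_scheme \<Rightarrow> ('a \<times> 'c \<Rightarrow> int) set \<Rightarrow> ('a \<times> 'c \<Rightarrow> int) set" where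
  "tensor_incl A B t = tensor_ideal A B <+>\<^bsub>monoid_ring (A \<times>\<times> B)\<^esub> t"


section \<open>Left modules over a ring\<close>

text \<open>
  Modules over noncommutative rings. The module is a set \<open>M\<close> in an abelian group; the values of
  the action outside \<open>M\<close> are irrelevant.
\<close>

definition left_module ::
  "('u, 'b) ring_scheme \<Rightarrow> ('u \<Rightarrow> 'm \<Rightarrow> 'm) \<Rightarrow> 'm::ab_group_add set \<Rightarrow> bool" where
  "left_module A act M \<longleftrightarrow>
     0 \<in> M \<and> (\<forall>x\<in>M. \<forall>y\<in>M. x + y \<in> M) \<and> (\<forall>x\<in>M. - x \<in> M) \<and>
     (\<forall>a\<in>carrier A. \<forall>x\<in>M. act a x \<in> M) \<and>
     (\<forall>x\<in>M. act \<one>\<^bsub>A\<^esub> x = x) \<and>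
     (\<forall>a\<in>carrier A. \<forall>b\<in>carrier A. \<forall>x\<in>M. act (a \<otimes>\<^bsub>A\<^esub> b) x = act a (act b x)) \<and>
     (\<forall>a\<in>carrier A. \<forall>b\<in>carrier A. \<forall>x\<in>M. act (a \<oplus>\<^bsub>A\<^esub> b) x = act a x + act b x) \<and>
     (\<forall>a\<in>carrier A. \<forall>x\<in>M. \<forall>y\<in>M. act a (x + y) = act a x + act a y)"

definition finitely_generated ::
  "('u, 'b) ring_scheme \<Rightarrow> ('u \<Rightarrow> 'm \<Rightarrow> 'm) \<Rightarrow> 'm::ab_group_add set \<Rightarrow> bool" where
  "finitely_generated A act M \<longleftrightarrow>
     (\<exists>S. finite S \<and> S \<subseteq> M \<and> (\<forall>N. left_module A act N \<and> S \<subseteq> N \<and> N \<subseteq> M \<longrightarrow> N = M))"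

definition module_isomorphic ::
  "('u, 'b) ring_scheme \<Rightarrow> ('u \<Rightarrow> 'm \<Rightarrow> 'm) \<Rightarrow> 'm::ab_group_add set \<Rightarrow> 'm set \<Rightarrow> bool" where
  "module_isomorphic A act M N \<longleftrightarrow>
     (\<exists>\<phi>. bij_betw \<phi> M N \<and> (\<forall>x\<in>M. \<forall>y\<in>M. \<phi> (x + y) = \<phi> x + \<phi> y) \<and>
          (\<forall>a\<in>carrier A. \<forall>x\<in>M. \<phi> (act a x) = act a (\<phi> x)))"

definition internal_direct_sum :: "'i set \<Rightarrow> ('i \<Rightarrow> 'm set) \<Rightarrow> 'm::ab_group_add set \<Rightarrow> bool" where
  "internal_direct_sum I N M \<longleftrightarrow>
     (\<forall>i\<in>I. N i \<subseteq> M) \<and>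
     (\<forall>x\<in>M. \<exists>!v. (\<forall>i\<in>I. v i \<in> N i) \<and> (\<forall>i. i \<notin> I \<longrightarrow> v i = 0) \<and>
                 finite {i. v i \<noteq> 0} \<and> x = (\<Sum>i | v i \<noteq> 0. v i))"


section \<open>Semisimple complex Lie algebras\<close>

locale complex_lie_algebra = vector_space scale
  for scale :: "complex \<Rightarrow> 'g::ab_group_add \<Rightarrow> 'g" +
  fixes br :: "'g \<Rightarrow> 'g \<Rightarrow> 'g"
  assumes br_add_left: "br (x + y) z = br x z + br y z"
    and br_add_right: "br x (y + z) = br x y + br x z"
    and br_scale_left: "br (scale c x) y = scale c (br x y)"
    and br_scale_right: "br x (scale c y) = scale c (br x y)"
    and br_self: "br x x = 0"
    and jacobi: "br x (br y z) + br y (br z x) + br z (br x y) = 0"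
    and finite_dimensional: "\<exists>B. finite B \<and> span B = UNIV"
begin

definition br_span :: "'g set \<Rightarrow> 'g set \<Rightarrow> 'g set" where
  "br_span A B = span {br x y | x y. x \<in> A \<and> y \<in> B}"

primrec derived_series :: "'g set \<Rightarrow> nat \<Rightarrow> 'g set" where
  "derived_series I 0 = I"
| "derived_series I (Suc n) = br_span (derived_series I n) (derived_series I n)"

primrec lower_central_series :: "'g set \<Rightarrow> nat \<Rightarrow> 'g set" where
  "lower_central_series I 0 = I"
| "lower_central_series I (Suc n) = br_span I (lower_central_series I n)"

definition lie_ideal :: "'g set \<Rightarrow> bool" where
  "lie_ideal I \<longleftrightarrow> subspace I \<and> (\<forall>x. \<forall>y\<in>I. br x y \<in> I)"

definition semisimple :: bool where
  "semisimple \<longleftrightarrow> (\<forall>I. lie_ideal I \<and> (\<exists>n. derived_series I n = {0}) \<longrightarrow> I = {0})"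

text \<open>Nilpotent self-normalizing subalgebras.\<close>

definition cartan_subalgebra :: "'g set \<Rightarrow> bool" where
  "cartan_subalgebra H \<longleftrightarrow>
     subspace H \<and> (\<forall>x\<in>H. \<forall>y\<in>H. br x y \<in> H) \<and>
     (\<exists>n. lower_central_series H n = {0}) \<and>
     {x. \<forall>y\<in>H. br x y \<in> H} = H"

text \<open>Linear functionals on \<open>H\<close> are represented by their extension by zero.\<close>

definition dual :: "'g set \<Rightarrow> ('g \<Rightarrow> complex) set" where
  "dual H = {\<mu>. (\<forall>x\<in>H. \<forall>y\<in>H. \<mu> (x + y) = \<mu> x + \<mu> y) \<and>
                (\<forall>c. \<forall>x\<in>H. \<mu> (scale c x) = c * \<mu> x) \<and> (\<forall>x. x \<notin> H \<longrightarrow> \<mu> x = 0)}"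

definition root_space :: "'g set \<Rightarrow> ('g \<Rightarrow> complex) \<Rightarrow> 'g set" where
  "root_space H \<alpha> = {x. \<forall>t\<in>H. br t x = scale (\<alpha> t) x}"

definition roots :: "'g set \<Rightarrow> ('g \<Rightarrow> complex) set" where
  "roots H = {\<alpha> \<in> dual H. (\<exists>t\<in>H. \<alpha> t \<noteq> 0) \<and> root_space H \<alpha> \<noteq> {0}}"

text \<open>
  The coroot of \<open>\<alpha>\<close> is the element \<open>t\<close> of the line \<open>[\<gg>\<^sub>\<alpha>, \<gg>\<^sub>-\<^sub>\<alpha>]\<close> with \<open>\<alpha> t = 2\<close>.
\<close>

definition is_coroot :: "'g set \<Rightarrow> ('g \<Rightarrow> complex) \<Rightarrow> 'g \<Rightarrow> bool" where
  "is_coroot H \<alpha> t \<longleftrightarrow>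
     t \<in> br_span (root_space H \<alpha>) (root_space H (\<lambda>s. - \<alpha> s)) \<and> \<alpha> t = 2"

definition weight_lattice :: "'g set \<Rightarrow> ('g \<Rightarrow> complex) set" where
  "weight_lattice H = {\<mu> \<in> dual H. \<forall>\<alpha>\<in>roots H. \<forall>t. is_coroot H \<alpha> t \<longrightarrow> \<mu> t \<in> \<int>}"

definition nonneg_combination :: "('g \<Rightarrow> complex) set \<Rightarrow> ('g \<Rightarrow> complex) \<Rightarrow> bool" where
  "nonneg_combination P \<alpha> \<longleftrightarrow>
     (\<exists>n :: ('g \<Rightarrow> complex) \<Rightarrow> nat. \<forall>t. \<alpha> t = (\<Sum>\<beta>\<in>P. of_nat (n \<beta>) * \<beta> t))"

text \<open>
  The roots span the dual of \<open>H\<close>, so a basis of the root system is linearly independent over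
  the complex numbers.
\<close>

definition root_basis :: "'g set \<Rightarrow> ('g \<Rightarrow> complex) set \<Rightarrow> bool" where
  "root_basis H P \<longleftrightarrow>
     finite P \<and> P \<subseteq> roots H \<and>
     (\<forall>c :: ('g \<Rightarrow> complex) \<Rightarrow> complex.
        (\<forall>t. (\<Sum>\<beta>\<in>P. c \<beta> * \<beta> t) = 0) \<longrightarrow> (\<forall>\<beta>\<in>P. c \<beta> = 0)) \<and>
     (\<forall>\<alpha>\<in>roots H. nonneg_combination P \<alpha> \<or> nonneg_combination P (\<lambda>t. - \<alpha> t))"

definition pos_roots :: "'g set \<Rightarrow> ('g \<Rightarrow> complex) set \<Rightarrow> ('g \<Rightarrow> complex) set" where
  "pos_roots H P = {\<alpha> \<in> roots H. nonneg_combination P \<alpha>}"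

text \<open>
  The last condition is Chevalley's normalization: \<open>[x\<^sub>\<alpha>, x\<^sub>\<beta>] = \<plusminus>(r + 1) x\<^sub>\<alpha>\<^sub>+\<^sub>\<beta>\<close>, where
  \<open>x\<^sub>\<alpha> = e\<^sub>\<alpha>\<close> and \<open>x\<^sub>-\<^sub>\<alpha> = f\<^sub>\<alpha>\<close> for positive \<open>\<alpha>\<close>, and \<open>r\<close> is the largest integer such that
  \<open>\<beta> - r\<alpha>\<close> is a root.
\<close>

definition chevalley_basis ::
  "'g set \<Rightarrow> ('g \<Rightarrow> complex) set \<Rightarrow> (('g \<Rightarrow> complex) \<Rightarrow> 'g) \<Rightarrow> (('g \<Rightarrow> complex) \<Rightarrow> 'g) \<Rightarrow>
   (('g \<Rightarrow> complex) \<Rightarrow> 'g) \<Rightarrow> bool" where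
  "chevalley_basis H P e f h \<longleftrightarrow>
     (let Rp = pos_roots H P;
          B = e ` Rp \<union> f ` Rp \<union> h ` P;
          x = (\<lambda>\<alpha>. if \<alpha> \<in> Rp then e \<alpha> else f (\<lambda>t. - \<alpha> t))
      in
       independent B \<and> span B = UNIV \<and> inj_on h P \<and>
       (\<forall>\<alpha>\<in>Rp. e \<alpha> \<in> root_space H \<alpha> \<and> f \<alpha> \<in> root_space H (\<lambda>t. - \<alpha> t) \<and>
               is_coroot H \<alpha> (br (e \<alpha>) (f \<alpha>))) \<and>
       (\<forall>\<beta>\<in>P. h \<beta> = br (e \<beta>) (f \<beta>)) \<and>
       (\<forall>\<alpha>\<in>roots H. \<forall>\<beta>\<in>roots H. (\<lambda>t. \<alpha> t + \<beta> t) \<in> roots H \<longrightarrow>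
          (let r = (GREATEST r::nat. (\<lambda>t. \<beta> t - of_nat r * \<alpha> t) \<in> roots H)
           in \<exists>s\<in>{1, -1}. br (x \<alpha>) (x \<beta>) = scale (s * of_nat (r + 1)) (x (\<lambda>t. \<alpha> t + \<beta> t)))))"


subsection \<open>The universal enveloping algebra\<close>

definition env_ideal :: "('g list \<Rightarrow> complex) set" where
  "env_ideal = (let F = monoid_ring word_monoid in
     Idl\<^bsub>F\<^esub>
      ({single [x + y] 1 \<ominus>\<^bsub>F\<^esub> single [x] 1 \<ominus>\<^bsub>F\<^esub> single [y] 1 | x y. True}
     \<union> {single [scale c x] 1 \<ominus>\<^bsub>F\<^esub> single [x] c | c x. True}
     \<union> {single [x, y] 1 \<ominus>\<^bsub>F\<^esub> single [y, x] 1 \<ominus>\<^bsub>F\<^esub> single [br x y] 1 | x y. True}))"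

definition env :: "('g list \<Rightarrow> complex) set ring" where
  "env = monoid_ring word_monoid Quot env_ideal"

definition env_incl :: "'g \<Rightarrow> ('g list \<Rightarrow> complex) set" where
  "env_incl x = env_ideal +>\<^bsub>monoid_ring word_monoid\<^esub> single [x] 1"

definition env_scalar :: "complex \<Rightarrow> ('g list \<Rightarrow> complex) set" where
  "env_scalar c = env_ideal +>\<^bsub>monoid_ring word_monoid\<^esub> single [] c"

definition divided_power :: "'g \<Rightarrow> nat \<Rightarrow> ('g list \<Rightarrow> complex) set" where
  "divided_power x n = env_scalar (1 / fact n) \<otimes>\<^bsub>env\<^esub> (env_incl x [^]\<^bsub>env\<^esub> n)"

primrec falling_factorial :: "'g \<Rightarrow> nat \<Rightarrow> ('g list \<Rightarrow> complex) set" where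
  "falling_factorial x 0 = \<one>\<^bsub>env\<^esub>"
| "falling_factorial x (Suc n) =
     falling_factorial x n \<otimes>\<^bsub>env\<^esub> (env_incl x \<ominus>\<^bsub>env\<^esub> env_scalar (of_nat n))"

definition hbinom :: "'g \<Rightarrow> nat \<Rightarrow> ('g list \<Rightarrow> complex) set" where
  "hbinom x n = env_scalar (1 / fact n) \<otimes>\<^bsub>env\<^esub> falling_factorial x n"

end


section \<open>Hyperalgebras and the category O\<close>

type_synonym ('g, 'k) hyperalg = "(('g list \<Rightarrow> complex) set \<times> 'k \<Rightarrow> int) set"

locale chevalley_setup = complex_lie_algebra scale br
  for scale :: "complex \<Rightarrow> 'g::ab_group_add \<Rightarrow> 'g" and br :: "'g \<Rightarrow> 'g \<Rightarrow> 'g" +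
  fixes H :: "'g set"
    and P :: "('g \<Rightarrow> complex) set"
    and e f h :: "('g \<Rightarrow> complex) \<Rightarrow> 'g"
  assumes semisimple: semisimple
    and cartan: "cartan_subalgebra H"
    and root_basis: "root_basis H P"
    and chevalley_basis: "chevalley_basis H P e f h"
begin

definition gens_pos :: "('g list \<Rightarrow> complex) set set" where
  "gens_pos = {divided_power (e \<alpha>) n | \<alpha> n. \<alpha> \<in> pos_roots H P \<and> n > 0}"

definition gens_neg :: "('g list \<Rightarrow> complex) set set" where
  "gens_neg = {divided_power (f \<alpha>) n | \<alpha> n. \<alpha> \<in> pos_roots H P \<and> n > 0}"

definition gens_zero :: "('g list \<Rightarrow> complex) set set" where
  "gens_zero = {hbinom (h \<beta>) n | \<beta> n. \<beta> \<in> P \<and> n > 0}"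

definition UZ :: "('g list \<Rightarrow> complex) set ring" where
  "UZ = env\<lparr>carrier := generate_ring env (gens_pos \<union> gens_neg \<union> gens_zero)\<rparr>"

definition UZ_pos :: "('g list \<Rightarrow> complex) set ring" where
  "UZ_pos = env\<lparr>carrier := generate_ring env gens_pos\<rparr>"

definition UZ_zero :: "('g list \<Rightarrow> complex) set ring" where
  "UZ_zero = env\<lparr>carrier := generate_ring env gens_zero\<rparr>"

definition U :: "('g, 'k::field) hyperalg ring" where
  "U = tensor_ring UZ ring_of_type_algebra"

definition U_pos :: "('g, 'k::field) hyperalg ring" where
  "U_pos = tensor_ring UZ_pos ring_of_type_algebra"

definition U_zero :: "('g, 'k::field) hyperalg ring" where
  "U_zero = tensor_ring UZ_zero ring_of_type_algebra"

text \<open>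
  \<open>U_pos\<close> and \<open>U_zero\<close> act on \<open>U\<close>-modules through their natural homomorphisms to \<open>U\<close>, and the
  field acts through its embedding in \<open>U\<close>.
\<close>

definition to_U :: "('g, 'k::field) hyperalg \<Rightarrow> ('g, 'k) hyperalg" where
  "to_U = tensor_incl UZ ring_of_type_algebra"

definition scalar_U :: "'k::field \<Rightarrow> ('g, 'k) hyperalg" where
  "scalar_U c = tensor UZ ring_of_type_algebra \<one>\<^bsub>UZ\<^esub> c"

text \<open>
  \<open>\<chi>\<close> is the character of \<open>U_zero\<close> attached to the weight \<open>\<mu>\<close>. Its values on the algebra generators
  are prescribed, so \<open>\<chi>\<close> is unique on the carrier. The integer division is exact: it computes
  the binomial coefficient, whose upper argument may be negative.
\<close>

definition weight_character ::
  "('g \<Rightarrow> complex) \<Rightarrow> (('g, 'k::field) hyperalg \<Rightarrow> 'k) \<Rightarrow> bool" where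
  "weight_character \<mu> \<chi> \<longleftrightarrow>
     \<chi> \<in> ring_hom U_zero ring_of_type_algebra \<and>
     (\<forall>c. \<chi> (tensor UZ_zero ring_of_type_algebra \<one>\<^bsub>UZ_zero\<^esub> c) = c) \<and>
     (\<forall>\<beta>\<in>P. \<forall>n>0. \<forall>z::int. \<mu> (h \<beta>) = of_int z \<longrightarrow>
        \<chi> (tensor UZ_zero ring_of_type_algebra (hbinom (h \<beta>) n) 1) =
          of_int ((\<Prod>i<n. z - int i) div fact n))"

definition weight_space ::
  "(('g, 'k::field) hyperalg \<Rightarrow> 'm \<Rightarrow> 'm) \<Rightarrow> 'm::ab_group_add set \<Rightarrow> ('g \<Rightarrow> complex) \<Rightarrow> 'm set" where
  "weight_space act M \<mu> =
     {m \<in> M. \<exists>\<chi>. weight_character \<mu> \<chi> \<and>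
        (\<forall>u\<in>carrier U_zero. act (to_U u) m = act (scalar_U (\<chi> u)) m)}"

definition weight_module ::
  "(('g, 'k::field) hyperalg \<Rightarrow> 'm \<Rightarrow> 'm) \<Rightarrow> 'm::ab_group_add set \<Rightarrow> bool" where
  "weight_module act M \<longleftrightarrow> internal_direct_sum (weight_lattice H) (weight_space act M) M"

definition finite_dim ::
  "(('g, 'k::field) hyperalg \<Rightarrow> 'm \<Rightarrow> 'm) \<Rightarrow> 'm::ab_group_add set \<Rightarrow> bool" where
  "finite_dim act N \<longleftrightarrow>
     (\<exists>B. finite B \<and> B \<subseteq> N \<and> (\<forall>x\<in>N. \<exists>c. x = (\<Sum>b\<in>B. act (scalar_U (c b)) b)))"

definition locally_finite ::
  "(('g, 'k::field) hyperalg \<Rightarrow> 'm \<Rightarrow> 'm) \<Rightarrow> 'm::ab_group_add set \<Rightarrow> bool" where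
  "locally_finite act M \<longleftrightarrow>
     M = \<Union>{N. N \<subseteq> M \<and> left_module U_pos (\<lambda>u. act (to_U u)) N \<and> finite_dim act N}"

definition cat_O ::
  "(('g, 'k::field) hyperalg \<Rightarrow> 'm \<Rightarrow> 'm) \<Rightarrow> 'm::ab_group_add set \<Rightarrow> bool" where
  "cat_O act M \<longleftrightarrow> left_module U act M \<and> weight_module act M \<and> locally_finite act M"

definition indecomposable_O ::
  "(('g, 'k::field) hyperalg \<Rightarrow> 'm \<Rightarrow> 'm) \<Rightarrow> 'm::ab_group_add set \<Rightarrow> bool" where
  "indecomposable_O act N \<longleftrightarrow>
     cat_O act N \<and> N \<noteq> {0} \<and>
     (\<forall>A B. cat_O act A \<and> cat_O act B \<and> A \<inter> B = {0} \<and> N = {a + b | a b. a \<in> A \<and> b \<in> B}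
        \<longrightarrow> A = {0} \<or> B = {0})"

definition indecomposable_decomposition ::
  "(('g, 'k::field) hyperalg \<Rightarrow> 'm \<Rightarrow> 'm) \<Rightarrow> 'm::ab_group_add set \<Rightarrow> nat \<Rightarrow> (nat \<Rightarrow> 'm set) \<Rightarrow> bool" where
  "indecomposable_decomposition act M n N \<longleftrightarrow>
     (\<forall>i<n. indecomposable_O act (N i)) \<and> internal_direct_sum {..<n} N M"

end

end

theory Submission
  imports Defs "HOL-Library.Function_Algebras" "HOL-Computational_Algebra.Formal_Power_Series" "HOL.Binomial_Plus"
begin

text \<open>
  Uniqueness is Azumaya's argument. If every endomorphism of the summands is bijective or
  nilpotent, then a sum of non-bijective endomorphisms of a summand is not bijective. The
  identity of a summand is the sum of the maps that go through the summands of a second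
  decomposition, so one of these maps is bijective, and the two summands can be exchanged
  (\<open>exchange_partner\<close>, \<open>krull_schmidt_azumaya\<close>).

  Two facts about objects of the category replace finite length: a finitely generated object has
  finite-dimensional weight spaces, and finitely many of them generate it
  (\<open>finite_weight_spaces\<close>). An endomorphism \<open>\<phi>\<close> preserves the weight spaces. On the finitely many
  generating ones the images of the powers of \<open>\<phi>\<close> become stable at a common exponent \<open>n\<close>, and a
  surjective endomorphism of a finite-dimensional space is injective; so the module is the sum of
  the image and the kernel of \<open>\<phi>\<^sup>n\<close>. An indecomposable module therefore satisfies the hypothesis of
  Azumaya's theorem (\<open>fitting_lemma\<close>). For existence, let \<open>F\<close> be the sum of the generating weight
  spaces. A projection to a summand maps \<open>F\<close> into itself and vanishes if it vanishes on \<open>F\<close>. Hence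
  every non-zero summand meets \<open>F\<close>, and splitting a summand lowers the dimension of its
  intersection with \<open>F\<close> (\<open>decomposition_exists\<close>).

  For the finiteness of the weight spaces, the generators are placed in the span of a finite set
  \<open>V\<close> of weight vectors that is stable under the divided powers of the simple \<open>e\<^sub>\<beta>\<close>; this is local
  finiteness. The products of divided powers of simple \<open>f\<^sub>\<beta>\<close>, applied to \<open>V\<close>, span a submodule:
  moving \<open>e\<^sub>\<beta>\<^sup>(\<^sup>n\<^sup>)\<close> to the right past \<open>f\<^sub>\<beta>\<^sup>(\<^sup>m\<^sup>)\<close> produces only lower divided powers and binomials in \<open>h\<^sub>\<beta>\<close>
  (\<open>kostant_commutation\<close>, \<open>lowering_span_submodule\<close>). As the simple roots are linearly independent,
  only finitely many of these products lead from a given weight to another.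

  This requires that the divided powers of the simple root vectors and the binomials generate
  Kostant's integral form (\<open>carrier_UZ_simple\<close>). Let \<open>\<mu>\<close> be the first and \<open>\<alpha>\<close> the last root of a
  \<open>\<beta>\<close>-string. In the product of divided powers of \<open>e\<^sub>\<beta>\<close> and \<open>e\<^sub>\<mu>\<close>, moving \<open>e\<^sub>\<beta>\<close> to the right leaves the
  divided powers of \<open>e\<^sub>\<alpha>\<close> as leading coefficients (\<open>string_end_dpow_mem\<close>). Every root is reached from
  the simple roots and their negatives by passing from the first to the last root of a string
  (\<open>roots_generated\<close>). The facts about roots used here - integrality, unbroken strings, the
  positive form - are derived from the Chevalley basis.

  Identities in the enveloping algebra are computed in a ring of linear operators in which it is
  embedded (\<open>env_operators\<close>).
\<close>

section \<open>Finitely supported functions and monoid rings\<close>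

text \<open>
  The value at \<open>u\<close> of the linear extension of \<open>\<phi>\<close> from points to finitely supported functions.
\<close>

definition pairing :: "('a \<Rightarrow> 'c::comm_ring_1) \<Rightarrow> ('a \<Rightarrow> 'c) \<Rightarrow> 'c" where
  "pairing u \<phi> = (\<Sum>a | u a \<noteq> 0. u a * \<phi> a)"

lemma pairing_superset:
  assumes "finite S" "{a. u a \<noteq> 0} \<subseteq> S"
  shows "pairing u \<phi> = (\<Sum>a\<in>S. u a * \<phi> a)"
  unfolding pairing_def using assms by (intro sum.mono_neutral_left) auto

lemma pairing_add_left:
  assumes "finite {a. u a \<noteq> 0}" "finite {a. v a \<noteq> 0}"
  shows "pairing (\<lambda>x. u x + v x) \<phi> = pairing u \<phi> + pairing v \<phi>"
proof -
  let ?S = "{a. u a \<noteq> 0} \<union> {a. v a \<noteq> 0}"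
  have f: "finite ?S" using assms by auto
  have "pairing (\<lambda>x. u x + v x) \<phi> = (\<Sum>a\<in>?S. (u a + v a) * \<phi> a)"
    by (rule pairing_superset[OF f]) auto
  moreover have "pairing u \<phi> = (\<Sum>a\<in>?S. u a * \<phi> a)" "pairing v \<phi> = (\<Sum>a\<in>?S. v a * \<phi> a)"
    by (rule pairing_superset[OF f]; auto)+
  ultimately show ?thesis by (simp add: distrib_right sum.distrib)
qed

lemma pairing_add_right: "pairing u (\<lambda>a. \<phi> a + \<psi> a) = pairing u \<phi> + pairing u \<psi>"
  by (simp add: pairing_def distrib_left sum.distrib)

lemma pairing_delta:
  "finite {a. u a \<noteq> 0} \<Longrightarrow> pairing u (\<lambda>a. if a = x then 1 else 0) = u x"
  by (simp add: pairing_def if_distrib cong: if_cong)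

lemma pairing_cong:
  "(\<And>a. u a \<noteq> 0 \<Longrightarrow> \<phi> a = \<psi> a) \<Longrightarrow> pairing u \<phi> = pairing u \<psi>"
  by (simp add: pairing_def)

lemma pairing_eqI:
  assumes "finite {a. u a \<noteq> 0}" "finite {a. v a \<noteq> 0}" "\<And>\<phi>. pairing u \<phi> = pairing v \<phi>"
  shows "u = v"
  using assms pairing_delta by (metis ext)

context
  fixes G :: "('a, 'b) monoid_scheme"
  assumes G: "monoid G"
begin

abbreviation (input) "mul u v \<equiv> u \<otimes>\<^bsub>monoid_ring G\<^esub> (v :: 'a \<Rightarrow> 'c::comm_ring_1)"

lemma monoid_ring_carrier:
  "u \<in> carrier (monoid_ring G) \<longleftrightarrow> finite {x. u x \<noteq> 0} \<and> {x. u x \<noteq> 0} \<subseteq> carrier G"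
  by (simp add: monoid_ring_def)

lemma monoid_ring_mult_pairing:
  "mul u v x = pairing u (\<lambda>a. pairing v (\<lambda>b. if a \<otimes>\<^bsub>G\<^esub> b = x then 1 else 0))"
proof -
  have "mul u v x = (\<Sum>a | u a \<noteq> 0. \<Sum>b | v b \<noteq> 0. if a \<otimes>\<^bsub>G\<^esub> b = x then u a * v b else 0)"
    by (simp add: monoid_ring_def sum.cartesian_product)
  also have "\<dots> = pairing u (\<lambda>a. pairing v (\<lambda>b. if a \<otimes>\<^bsub>G\<^esub> b = x then 1 else 0))"
    unfolding pairing_def by (intro sum.cong refl) (auto simp: sum_distrib_left intro!: sum.cong)
  finally show ?thesis .
qed

lemma monoid_ring_mult_support:
  "{x. mul u v x \<noteq> 0} \<subseteq> (\<lambda>(a, b). a \<otimes>\<^bsub>G\<^esub> b) ` ({a. u a \<noteq> 0} \<times> {b. v b \<noteq> 0})"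
proof
  fix x assume "x \<in> {x. mul u v x \<noteq> 0}"
  hence "(\<Sum>(a, b) \<in> {a. u a \<noteq> 0} \<times> {b. v b \<noteq> 0}. if a \<otimes>\<^bsub>G\<^esub> b = x then u a * v b else 0) \<noteq> 0"
    by (simp add: monoid_ring_def)
  then obtain q where "q \<in> {a. u a \<noteq> 0} \<times> {b. v b \<noteq> 0}"
    "(case q of (a, b) \<Rightarrow> if a \<otimes>\<^bsub>G\<^esub> b = x then u a * v b else 0) \<noteq> 0"
    by (meson sum.neutral)
  thus "x \<in> (\<lambda>(a, b). a \<otimes>\<^bsub>G\<^esub> b) ` ({a. u a \<noteq> 0} \<times> {b. v b \<noteq> 0})"
    by (auto split: if_splits intro!: image_eqI[where x = q])
qed

lemma monoid_ring_mult_closed: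
  assumes "u \<in> carrier (monoid_ring G)" "v \<in> carrier (monoid_ring G)"
  shows "mul u v \<in> carrier (monoid_ring G)"
proof -
  let ?S = "(\<lambda>(a, b). a \<otimes>\<^bsub>G\<^esub> b) ` ({a. u a \<noteq> 0} \<times> {b. v b \<noteq> 0})"
  have "finite ?S" "?S \<subseteq> carrier G"
    using assms by (auto simp: monoid_ring_carrier intro!: monoid.m_closed[OF G])
  thus ?thesis using monoid_ring_mult_support[of u v]
    unfolding monoid_ring_carrier by (meson finite_subset order_trans)
qed

text \<open>
  Evaluating against all functions turns the convolution into an iterated sum, in which the
  ring laws are visible.
\<close>

lemma pairing_mult:
  assumes "u \<in> carrier (monoid_ring G)" "v \<in> carrier (monoid_ring G)"
  shows "pairing (mul u v) \<phi> = pairing u (\<lambda>a. pairing v (\<lambda>b. \<phi> (a \<otimes>\<^bsub>G\<^esub> b)))"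
proof -
  let ?A = "{a. u a \<noteq> 0}" and ?B = "{b. v b \<noteq> 0}"
  let ?S = "(\<lambda>(a, b). a \<otimes>\<^bsub>G\<^esub> b) ` (?A \<times> ?B)"
  have fin: "finite ?S" "finite ?A" "finite ?B" using assms by (auto simp: monoid_ring_carrier)
  have "pairing (mul u v) \<phi> = (\<Sum>x\<in>?S. mul u v x * \<phi> x)"
    by (rule pairing_superset[OF fin(1) monoid_ring_mult_support])
  also have "\<dots> = (\<Sum>x\<in>?S. \<Sum>a\<in>?A. \<Sum>b\<in>?B. (if a \<otimes>\<^bsub>G\<^esub> b = x then u a * v b * \<phi> x else 0))"
    unfolding monoid_ring_mult_pairing pairing_def
    by (intro sum.cong refl)
      (auto simp: sum_distrib_left sum_distrib_right mult.assoc intro!: sum.cong)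
  also have "\<dots> = (\<Sum>a\<in>?A. \<Sum>b\<in>?B. \<Sum>x\<in>?S. (if a \<otimes>\<^bsub>G\<^esub> b = x then u a * v b * \<phi> x else 0))"
    by (rule trans[OF sum.swap]) (intro sum.cong refl sum.swap)
  also have "\<dots> = (\<Sum>a\<in>?A. \<Sum>b\<in>?B. u a * v b * \<phi> (a \<otimes>\<^bsub>G\<^esub> b))"
    using fin by (intro sum.cong refl) (subst sum.delta', auto)
  finally show ?thesis by (simp add: pairing_def sum_distrib_left mult.assoc)
qed

lemma pairing_single: "pairing (single a c) \<phi> = c * \<phi> a"
  by (subst pairing_superset[of "{a}"]) (auto simp: single_def)

lemma single_closed: "a \<in> carrier G \<Longrightarrow> single a c \<in> carrier (monoid_ring G)"
  by (auto simp: monoid_ring_def single_def)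

lemma monoid_ring_eqI:
  assumes "u \<in> carrier (monoid_ring G)" "v \<in> carrier (monoid_ring G)"
    "\<And>\<phi>. pairing u \<phi> = pairing v \<phi>"
  shows "u = v"
  using assms by (intro pairing_eqI) (auto simp: monoid_ring_carrier)

lemma monoid_ring_add: "u \<oplus>\<^bsub>monoid_ring G\<^esub> v = (\<lambda>x. u x + v x)"
  and monoid_ring_zero: "\<zero>\<^bsub>monoid_ring G\<^esub> = (\<lambda>x. 0)"
  and monoid_ring_one: "\<one>\<^bsub>monoid_ring G\<^esub> = single \<one>\<^bsub>G\<^esub> 1"
  by (simp_all add: monoid_ring_def single_def)

lemma monoid_ring_add_closed:
  assumes "u \<in> carrier (monoid_ring G)" "v \<in> carrier (monoid_ring G)"
  shows "(\<lambda>x. u x + v x) \<in> carrier (monoid_ring G)"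
proof -
  have "{x. u x + v x \<noteq> 0} \<subseteq> {x. u x \<noteq> 0} \<union> {x. v x \<noteq> 0}" by auto
  thus ?thesis using assms unfolding monoid_ring_carrier by (meson finite_UnI finite_subset le_sup_iff order_trans)
qed

lemma pairing_add:
  assumes "u \<in> carrier (monoid_ring G)" "v \<in> carrier (monoid_ring G)"
  shows "pairing (\<lambda>x. u x + v x) \<phi> = pairing u \<phi> + pairing v \<phi>"
  using assms by (intro pairing_add_left) (auto simp: monoid_ring_carrier)

lemma monoid_ring_ring: "ring (monoid_ring G :: ('a \<Rightarrow> 'c::comm_ring_1) ring)"
proof (rule ringI)
  let ?F = "monoid_ring G :: ('a \<Rightarrow> 'c::comm_ring_1) ring"
  have zero: "\<zero>\<^bsub>?F\<^esub> \<in> carrier ?F" by (simp add: monoid_ring_def)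
  have neg: "\<exists>v\<in>carrier ?F. v \<oplus>\<^bsub>?F\<^esub> u = \<zero>\<^bsub>?F\<^esub>" if "u \<in> carrier ?F" for u
    using that by (intro bexI[of _ "\<lambda>x. - u x"]) (auto simp: monoid_ring_def)
  show "abelian_group ?F"
    by (rule abelian_groupI)
      (use zero neg monoid_ring_add_closed in \<open>auto simp: monoid_ring_add monoid_ring_zero add_ac\<close>)
  have one: "\<one>\<^bsub>?F\<^esub> \<in> carrier ?F"
    unfolding monoid_ring_one by (rule single_closed[OF monoid.one_closed[OF G]])
  show "monoid ?F"
  proof (rule monoidI)
    fix u v w assume h: "u \<in> carrier ?F" "v \<in> carrier ?F" "w \<in> carrier ?F"
    show "u \<otimes>\<^bsub>?F\<^esub> v \<otimes>\<^bsub>?F\<^esub> w = u \<otimes>\<^bsub>?F\<^esub> (v \<otimes>\<^bsub>?F\<^esub> w)"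
    proof (rule monoid_ring_eqI)
      fix \<phi> :: "'a \<Rightarrow> 'c"
      have "pairing (mul (mul u v) w) \<phi> =
          pairing u (\<lambda>a. pairing v (\<lambda>b. pairing w (\<lambda>c. \<phi> (a \<otimes>\<^bsub>G\<^esub> b \<otimes>\<^bsub>G\<^esub> c))))"
        by (simp only: pairing_mult h monoid_ring_mult_closed)
      also have "\<dots> = pairing u (\<lambda>a. pairing v (\<lambda>b. pairing w (\<lambda>c. \<phi> (a \<otimes>\<^bsub>G\<^esub> (b \<otimes>\<^bsub>G\<^esub> c)))))"
        using h by (intro pairing_cong) (auto simp: monoid_ring_carrier subset_iff monoid.m_assoc[OF G])
      also have "\<dots> = pairing (mul u (mul v w)) \<phi>"
        by (simp only: pairing_mult h monoid_ring_mult_closed)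
      finally show "pairing (mul (mul u v) w) \<phi> = pairing (mul u (mul v w)) \<phi>" .
    qed (intro h monoid_ring_mult_closed)+
  next
    fix u assume h: "u \<in> carrier ?F"
    show "\<one>\<^bsub>?F\<^esub> \<otimes>\<^bsub>?F\<^esub> u = u"
    proof (rule monoid_ring_eqI)
      fix \<phi> :: "'a \<Rightarrow> 'c"
      have "pairing (mul \<one>\<^bsub>?F\<^esub> u) \<phi> = pairing u (\<lambda>b. \<phi> (\<one>\<^bsub>G\<^esub> \<otimes>\<^bsub>G\<^esub> b))"
        by (simp add: pairing_mult[OF one h]) (simp add: monoid_ring_one pairing_single)
      also have "\<dots> = pairing u \<phi>"
        using h by (intro pairing_cong) (auto simp: monoid_ring_carrier subset_iff monoid.l_one[OF G])
      finally show "pairing (mul \<one>\<^bsub>?F\<^esub> u) \<phi> = pairing u \<phi>" .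
    qed (intro h one monoid_ring_mult_closed)+
    show "u \<otimes>\<^bsub>?F\<^esub> \<one>\<^bsub>?F\<^esub> = u"
    proof (rule monoid_ring_eqI)
      fix \<phi> :: "'a \<Rightarrow> 'c"
      have "pairing (mul u \<one>\<^bsub>?F\<^esub>) \<phi> = pairing u (\<lambda>a. \<phi> (a \<otimes>\<^bsub>G\<^esub> \<one>\<^bsub>G\<^esub>))"
        by (simp add: pairing_mult[OF h one]) (simp add: monoid_ring_one pairing_single)
      also have "\<dots> = pairing u \<phi>"
        using h by (intro pairing_cong) (auto simp: monoid_ring_carrier subset_iff monoid.r_one[OF G])
      finally show "pairing (mul u \<one>\<^bsub>?F\<^esub>) \<phi> = pairing u \<phi>" .
    qed (intro h one monoid_ring_mult_closed)+
  qed (use one monoid_ring_mult_closed in auto)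
  fix u v w assume h: "u \<in> carrier ?F" "v \<in> carrier ?F" "w \<in> carrier ?F"
  show "(u \<oplus>\<^bsub>?F\<^esub> v) \<otimes>\<^bsub>?F\<^esub> w = u \<otimes>\<^bsub>?F\<^esub> w \<oplus>\<^bsub>?F\<^esub> v \<otimes>\<^bsub>?F\<^esub> w"
    unfolding monoid_ring_add
    by (rule monoid_ring_eqI)
      (simp_all add: h monoid_ring_mult_closed monoid_ring_add_closed pairing_mult pairing_add)
  show "w \<otimes>\<^bsub>?F\<^esub> (u \<oplus>\<^bsub>?F\<^esub> v) = w \<otimes>\<^bsub>?F\<^esub> u \<oplus>\<^bsub>?F\<^esub> w \<otimes>\<^bsub>?F\<^esub> v"
    unfolding monoid_ring_add
    by (rule monoid_ring_eqI)
      (simp_all add: h monoid_ring_mult_closed monoid_ring_add_closed pairing_mult pairing_add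
        pairing_add_right)
qed

lemma monoid_ring_uminus:
  assumes "u \<in> carrier (monoid_ring G :: ('a \<Rightarrow> 'c::comm_ring_1) ring)"
  shows "\<ominus>\<^bsub>monoid_ring G\<^esub> u = (\<lambda>x. - u x)"
proof -
  interpret F: ring "monoid_ring G :: ('a \<Rightarrow> 'c) ring" by (rule monoid_ring_ring)
  have "(\<lambda>x. - u x) \<in> carrier (monoid_ring G)" using assms by (simp add: monoid_ring_carrier)
  moreover have "(\<lambda>x. - u x) \<oplus>\<^bsub>monoid_ring G\<^esub> u = \<zero>\<^bsub>monoid_ring G\<^esub>"
    by (simp add: monoid_ring_add monoid_ring_zero)
  ultimately show ?thesis using assms by (metis F.minus_equality)
qed

lemma monoid_ring_minus:
  assumes "u \<in> carrier (monoid_ring G :: ('a \<Rightarrow> 'c::comm_ring_1) ring)" "v \<in> carrier (monoid_ring G)"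
  shows "u \<ominus>\<^bsub>monoid_ring G\<^esub> v = (\<lambda>x. u x - v x)"
  using assms by (simp add: a_minus_def monoid_ring_uminus monoid_ring_add)

lemma single_mult:
  assumes "a \<in> carrier G" "b \<in> carrier G"
  shows "mul (single a c) (single b d) = single (a \<otimes>\<^bsub>G\<^esub> b) (c * d)"
  by (rule monoid_ring_eqI)
    (simp_all add: assms single_closed monoid_ring_mult_closed monoid.m_closed[OF G] pairing_mult
      pairing_single mult.assoc)

text \<open>Finitely supported functions are sums of multiples of point masses.\<close>

lemma monoid_ring_induct [consumes 1, case_names zero add]:
  fixes u :: "'a \<Rightarrow> 'c::comm_ring_1"
  assumes "u \<in> carrier (monoid_ring G)"
    and "Q (\<lambda>x. 0)"
    and "\<And>u a c. u \<in> carrier (monoid_ring G) \<Longrightarrow> a \<in> carrier G \<Longrightarrow> Q u \<Longrightarrow> Q (\<lambda>x. u x + single a c x)"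
  shows "Q u"
proof -
  have "\<forall>u. {x. u x \<noteq> 0} = S \<longrightarrow> Q u" if "finite S" "S \<subseteq> carrier G" for S
    using that
  proof (induction S rule: finite_induct)
    case empty
    show ?case using assms(2) by (auto simp: fun_eq_iff[symmetric])
  next
    case (insert a S)
    show ?case
    proof (intro allI impI)
      fix u :: "'a \<Rightarrow> 'c" assume u: "{x. u x \<noteq> 0} = insert a S"
      let ?u = "u(a := 0)"
      have s: "{x. ?u x \<noteq> 0} = S" using u insert.hyps by auto
      hence "Q ?u" "?u \<in> carrier (monoid_ring G)"
        using insert by (auto simp: monoid_ring_carrier)
      hence "Q (\<lambda>x. ?u x + single a (u a) x)" using assms(3) insert.prems by blast
      moreover have "(\<lambda>x. ?u x + single a (u a) x) = u" by (auto simp: single_def)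
      ultimately show "Q u" by simp
    qed
  qed
  thus ?thesis using assms(1) by (auto simp: monoid_ring_carrier)
qed

end

lemma word_monoid: "monoid word_monoid"
  by (rule monoidI) (auto simp: word_monoid_def)

section \<open>Tensor products of rings\<close>

locale tensor_product = A: ring A + B: ring B
  for A :: "('a, 'c) ring_scheme" and B :: "('b, 'd) ring_scheme"
begin

definition F :: "('a \<times> 'b \<Rightarrow> int) ring" where "F = monoid_ring (A \<times>\<times> B)"

definition relators :: "('a \<times> 'b \<Rightarrow> int) set" where
  "relators =
      ({single (a \<oplus>\<^bsub>A\<^esub> a', b) 1 \<ominus>\<^bsub>F\<^esub> single (a, b) 1 \<ominus>\<^bsub>F\<^esub> single (a', b) 1 | a a' b.
          a \<in> carrier A \<and> a' \<in> carrier A \<and> b \<in> carrier B}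
     \<union> {single (a, b \<oplus>\<^bsub>B\<^esub> b') 1 \<ominus>\<^bsub>F\<^esub> single (a, b) 1 \<ominus>\<^bsub>F\<^esub> single (a, b') 1 | a b b'.
          a \<in> carrier A \<and> b \<in> carrier B \<and> b' \<in> carrier B})"

abbreviation "I \<equiv> tensor_ideal A B"
abbreviation "T \<equiv> tensor_ring A B"
abbreviation "tens \<equiv> tensor A B"

lemma pairs_monoid: "monoid (A \<times>\<times> B)"
  using A.is_monoid B.is_monoid by (rule DirProd_monoid)

sublocale F: ring F
  unfolding F_def by (rule monoid_ring_ring[OF pairs_monoid])

lemma I_eq: "I = Idl\<^bsub>F\<^esub> relators"
  by (simp add: tensor_ideal_def relators_def F_def Let_def)

lemma point_closed: "a \<in> carrier A \<Longrightarrow> b \<in> carrier B \<Longrightarrow> single (a, b) n \<in> carrier F"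
  unfolding F_def by (rule single_closed[OF pairs_monoid]) (simp add: DirProd_def)

lemma relators_closed: "relators \<subseteq> carrier F"
  by (auto simp: relators_def intro!: F.minus_closed point_closed)

sublocale I: ideal I F
  unfolding I_eq by (rule F.genideal_ideal[OF relators_closed])

lemma T_eq: "T = F Quot I"
  by (simp add: tensor_ring_def F_def)

lemma tens_eq: "tens a b = I +>\<^bsub>F\<^esub> single (a, b) 1"
  by (simp add: tensor_def F_def)

sublocale T: ring T
  unfolding T_eq by (rule I.quotient_is_ring)

lemma tens_closed: "a \<in> carrier A \<Longrightarrow> b \<in> carrier B \<Longrightarrow> tens a b \<in> carrier T"
  unfolding T_eq tens_eq by (rule ring_hom_closed[OF I.rcos_ring_hom point_closed])

lemma coset_add:
  "u \<in> carrier F \<Longrightarrow> v \<in> carrier F \<Longrightarrow> I +>\<^bsub>F\<^esub> (u \<oplus>\<^bsub>F\<^esub> v) = (I +>\<^bsub>F\<^esub> u) \<oplus>\<^bsub>T\<^esub> (I +>\<^bsub>F\<^esub> v)"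
  unfolding T_eq by (rule ring_hom_add[OF I.rcos_ring_hom])

lemma point_mult:
  assumes "a \<in> carrier A" "b \<in> carrier B" "a' \<in> carrier A" "b' \<in> carrier B"
  shows "single (a, b) m \<otimes>\<^bsub>F\<^esub> single (a', b') n = single (a \<otimes>\<^bsub>A\<^esub> a', b \<otimes>\<^bsub>B\<^esub> b') (m * n)"
proof -
  have "(a, b) \<in> carrier (A \<times>\<times> B)" "(a', b') \<in> carrier (A \<times>\<times> B)"
    using assms by (simp_all add: DirProd_def)
  from single_mult[OF pairs_monoid this] show ?thesis by (simp add: F_def)
qed

lemma point_one: "\<one>\<^bsub>F\<^esub> = single (\<one>\<^bsub>A\<^esub>, \<one>\<^bsub>B\<^esub>) 1"
  using monoid_ring_one[OF pairs_monoid] by (simp add: F_def)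

lemma tens_mult:
  "\<lbrakk>a \<in> carrier A; b \<in> carrier B; a' \<in> carrier A; b' \<in> carrier B\<rbrakk> \<Longrightarrow>
    tens a b \<otimes>\<^bsub>T\<^esub> tens a' b' = tens (a \<otimes>\<^bsub>A\<^esub> a') (b \<otimes>\<^bsub>B\<^esub> b')"
  unfolding T_eq tens_eq
  by (simp add: ring_hom_mult[OF I.rcos_ring_hom, symmetric] point_closed point_mult)

lemma tens_one: "\<one>\<^bsub>T\<^esub> = tens \<one>\<^bsub>A\<^esub> \<one>\<^bsub>B\<^esub>"
  unfolding T_eq tens_eq
  by (simp only: ring_hom_one[OF I.rcos_ring_hom, symmetric] point_one)

lemma coset_eq_sum:
  assumes "u \<in> carrier F" "v \<in> carrier F" "w \<in> carrier F" "u \<ominus>\<^bsub>F\<^esub> v \<ominus>\<^bsub>F\<^esub> w \<in> relators"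
  shows "I +>\<^bsub>F\<^esub> u = (I +>\<^bsub>F\<^esub> v) \<oplus>\<^bsub>T\<^esub> (I +>\<^bsub>F\<^esub> w)"
proof -
  have "u \<ominus>\<^bsub>F\<^esub> (v \<oplus>\<^bsub>F\<^esub> w) = u \<ominus>\<^bsub>F\<^esub> v \<ominus>\<^bsub>F\<^esub> w"
    using assms by (simp add: a_minus_def F.minus_add F.a_assoc)
  hence "u \<ominus>\<^bsub>F\<^esub> (v \<oplus>\<^bsub>F\<^esub> w) \<in> I"
    using assms(4) F.genideal_self[OF relators_closed] by (auto simp: I_eq)
  hence "I +>\<^bsub>F\<^esub> u = I +>\<^bsub>F\<^esub> (v \<oplus>\<^bsub>F\<^esub> w)"
    using F.quotient_eq_iff_same_a_r_cos[OF I.is_ideal] assms by simp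
  thus ?thesis by (simp add: coset_add assms)
qed

lemma tens_add_left:
  "\<lbrakk>a \<in> carrier A; a' \<in> carrier A; b \<in> carrier B\<rbrakk> \<Longrightarrow>
    tens (a \<oplus>\<^bsub>A\<^esub> a') b = tens a b \<oplus>\<^bsub>T\<^esub> tens a' b"
  unfolding tens_eq by (rule coset_eq_sum) (auto simp: point_closed relators_def)

lemma tens_add_right:
  "\<lbrakk>a \<in> carrier A; b \<in> carrier B; b' \<in> carrier B\<rbrakk> \<Longrightarrow>
    tens a (b \<oplus>\<^bsub>B\<^esub> b') = tens a b \<oplus>\<^bsub>T\<^esub> tens a b'"
  unfolding tens_eq by (rule coset_eq_sum) (auto simp: point_closed relators_def)

lemma tens_zero_left:
  assumes "b \<in> carrier B" shows "tens \<zero>\<^bsub>A\<^esub> b = \<zero>\<^bsub>T\<^esub>"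
proof -
  have "tens \<zero>\<^bsub>A\<^esub> b = tens \<zero>\<^bsub>A\<^esub> b \<oplus>\<^bsub>T\<^esub> tens \<zero>\<^bsub>A\<^esub> b"
    using tens_add_left[of "\<zero>\<^bsub>A\<^esub>" "\<zero>\<^bsub>A\<^esub>" b] assms by simp
  thus ?thesis using assms tens_closed by (metis A.zero_closed T.add.r_cancel_one)
qed

lemma coset_closed: "u \<in> carrier F \<Longrightarrow> I +>\<^bsub>F\<^esub> u \<in> carrier T"
  unfolding T_eq by (rule ring_hom_closed[OF I.rcos_ring_hom])

lemma carrier_coset: "t \<in> carrier T \<Longrightarrow> \<exists>u\<in>carrier F. t = I +>\<^bsub>F\<^esub> u"
  unfolding T_eq FactRing_def A_RCOSETS_def' by auto

lemma coset_zero: "I +>\<^bsub>F\<^esub> \<zero>\<^bsub>F\<^esub> = \<zero>\<^bsub>T\<^esub>"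
  using I.rcos_ring_hom_ring unfolding T_eq by (metis ring_hom_ring.homh ring_hom_zero F.ring_axioms I.quotient_is_ring)

text \<open>
  A sign can be moved into the left factor, so sums of pure tensors already exhaust the
  tensor product.
\<close>

lemma tensor_induct [consumes 1, case_names zero add]:
  assumes "t \<in> carrier T"
    and zero: "Q \<zero>\<^bsub>T\<^esub>"
    and add: "\<And>t a b. \<lbrakk>t \<in> carrier T; Q t; a \<in> carrier A; b \<in> carrier B\<rbrakk> \<Longrightarrow> Q (t \<oplus>\<^bsub>T\<^esub> tens a b)"
  shows "Q t"
proof -
  have point: "\<forall>t\<in>carrier T. Q t \<longrightarrow> Q (t \<oplus>\<^bsub>T\<^esub> (I +>\<^bsub>F\<^esub> single (a, b) n))"
    if ab: "a \<in> carrier A" "b \<in> carrier B" for a b n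
  proof (induction n rule: int_induct[where k = 0])
    case base
    have "single (a, b) 0 = \<zero>\<^bsub>F\<^esub>" by (auto simp: single_def F_def monoid_ring_zero[OF pairs_monoid])
    thus ?case using coset_zero by simp
  next
    case (step1 n)
    have "single (a, b) (n + 1) = single (a, b) n \<oplus>\<^bsub>F\<^esub> single (a, b) 1"
      by (auto simp: single_def F_def monoid_ring_add[OF pairs_monoid])
    hence e: "I +>\<^bsub>F\<^esub> single (a, b) (n + 1) = (I +>\<^bsub>F\<^esub> single (a, b) n) \<oplus>\<^bsub>T\<^esub> tens a b"
      by (simp add: coset_add point_closed ab tens_eq)
    show ?case
      using step1 ab by (auto simp: e T.a_assoc[symmetric] coset_closed point_closed tens_closed add)
  next
    case (step2 n)
    have "single (a, b) n = single (a, b) (n - 1) \<oplus>\<^bsub>F\<^esub> single (a, b) 1"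
      by (auto simp: single_def F_def monoid_ring_add[OF pairs_monoid])
    hence e: "I +>\<^bsub>F\<^esub> single (a, b) n = (I +>\<^bsub>F\<^esub> single (a, b) (n - 1)) \<oplus>\<^bsub>T\<^esub> tens a b"
      by (simp add: coset_add point_closed ab tens_eq)
    have n: "tens a b \<oplus>\<^bsub>T\<^esub> tens (\<ominus>\<^bsub>A\<^esub> a) b = \<zero>\<^bsub>T\<^esub>"
      using ab by (simp add: tens_add_left[symmetric] A.r_neg tens_zero_left)
    have "I +>\<^bsub>F\<^esub> single (a, b) (n - 1) = (I +>\<^bsub>F\<^esub> single (a, b) n) \<oplus>\<^bsub>T\<^esub> tens (\<ominus>\<^bsub>A\<^esub> a) b"
      using ab n by (simp add: e T.a_assoc coset_closed point_closed tens_closed)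
    thus ?case
      using step2 ab
      by (auto simp: T.a_assoc[symmetric] coset_closed point_closed tens_closed add)
  qed
  obtain u where u: "u \<in> carrier F" "t = I +>\<^bsub>F\<^esub> u" using carrier_coset assms(1) by blast
  have "u \<in> carrier (monoid_ring (A \<times>\<times> B))" using u(1) by (simp add: F_def)
  hence "Q (I +>\<^bsub>F\<^esub> u)"
  proof (induction u rule: monoid_ring_induct[OF pairs_monoid, consumes 1, case_names zero add])
    case zero
    have "(\<lambda>x. 0) = \<zero>\<^bsub>F\<^esub>" by (simp add: F_def monoid_ring_zero[OF pairs_monoid])
    thus ?case using coset_zero \<open>Q \<zero>\<^bsub>T\<^esub>\<close> by simp
  next
    case (add u q c)
    obtain a b where q: "q = (a, b)" "a \<in> carrier A" "b \<in> carrier B"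
      using add(2) by (auto simp: DirProd_def)
    have "(\<lambda>x. u x + single q c x) = u \<oplus>\<^bsub>F\<^esub> single q c"
      by (simp add: F_def monoid_ring_add[OF pairs_monoid])
    thus ?case using point[OF q(2,3)] add q
      by (simp add: coset_add point_closed coset_closed F_def[symmetric])
  qed
  thus ?thesis using u by simp
qed

end

text \<open>Functoriality in the first factor, for a subring.\<close>

locale tensor_subring = big: tensor_product A B + small: tensor_product A' B
  for A :: "('a, 'c) ring_scheme" and B :: "('b, 'd) ring_scheme" and A' :: "('a, 'c) ring_scheme" + fixes C :: "'a set"
  assumes sub: "A' = A\<lparr>carrier := C\<rparr>" "C \<subseteq> carrier A"
begin

lemma F_mult: "u \<otimes>\<^bsub>small.F\<^esub> v = u \<otimes>\<^bsub>big.F\<^esub> v"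
  unfolding small.F_def big.F_def unfolding monoid_ring_def sub(1) by (simp add: DirProd_def)

lemma F_add: "u \<oplus>\<^bsub>small.F\<^esub> v = u \<oplus>\<^bsub>big.F\<^esub> v"
  by (simp add: small.F_def big.F_def monoid_ring_def)

lemma F_sub: "carrier small.F \<subseteq> carrier big.F"
  unfolding small.F_def big.F_def unfolding monoid_ring_def sub(1) using sub(2) by (auto simp: DirProd_def)

lemma F_zero: "\<zero>\<^bsub>small.F\<^esub> = \<zero>\<^bsub>big.F\<^esub>" and F_one: "\<one>\<^bsub>small.F\<^esub> = \<one>\<^bsub>big.F\<^esub>"
  unfolding small.F_def big.F_def unfolding monoid_ring_def sub(1) by (simp_all add: DirProd_def)

lemma F_minus:
  assumes "u \<in> carrier small.F" "v \<in> carrier small.F"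
  shows "u \<ominus>\<^bsub>small.F\<^esub> v = u \<ominus>\<^bsub>big.F\<^esub> v"
proof -
  have "u \<in> carrier big.F" "v \<in> carrier big.F" using assms F_sub by auto
  thus ?thesis using assms
    by (simp add: big.F_def small.F_def monoid_ring_minus big.pairs_monoid small.pairs_monoid)
qed

lemma relators_sub: "small.relators \<subseteq> big.relators"
proof
  fix r assume "r \<in> small.relators"
  then consider (l) a a' b where "a \<in> carrier A'" "a' \<in> carrier A'" "b \<in> carrier B"
      "r = single (a \<oplus>\<^bsub>A'\<^esub> a', b) 1 \<ominus>\<^bsub>small.F\<^esub> single (a, b) 1 \<ominus>\<^bsub>small.F\<^esub> single (a', b) 1"
    | (r) a b b' where "a \<in> carrier A'" "b \<in> carrier B" "b' \<in> carrier B"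
      "r = single (a, b \<oplus>\<^bsub>B\<^esub> b') 1 \<ominus>\<^bsub>small.F\<^esub> single (a, b) 1 \<ominus>\<^bsub>small.F\<^esub> single (a, b') 1"
    unfolding small.relators_def by auto
  thus "r \<in> big.relators"
  proof cases
    case l
    hence "r = single (a \<oplus>\<^bsub>A'\<^esub> a', b) 1 \<ominus>\<^bsub>big.F\<^esub> single (a, b) 1 \<ominus>\<^bsub>big.F\<^esub> single (a', b) 1"
      by (simp only: F_minus[symmetric] small.F.minus_closed small.point_closed small.A.a_closed)
    hence "r = single (a \<oplus>\<^bsub>A\<^esub> a', b) 1 \<ominus>\<^bsub>big.F\<^esub> single (a, b) 1 \<ominus>\<^bsub>big.F\<^esub> single (a', b) 1"
      by (simp add: sub(1))
    thus ?thesis using l sub by (auto simp: big.relators_def)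
  next
    case r
    hence "r = single (a, b \<oplus>\<^bsub>B\<^esub> b') 1 \<ominus>\<^bsub>big.F\<^esub> single (a, b) 1 \<ominus>\<^bsub>big.F\<^esub> single (a, b') 1"
      by (simp only: F_minus[symmetric] small.F.minus_closed small.point_closed big.B.a_closed)
    thus ?thesis using r sub by (auto simp: big.relators_def)
  qed
qed

text \<open>
  The part of the larger ideal that lies in the smaller ring is an ideal of it and contains
  its relators.
\<close>

lemma ideal_sub: "small.I \<subseteq> big.I"
proof -
  let ?J = "big.I \<inter> carrier small.F"
  have "ideal ?J small.F"
  proof (rule idealI)
    show "ring small.F" by (rule small.F.ring_axioms)
    show "subgroup ?J (add_monoid small.F)"
    proof (rule small.F.add.subgroupI)
      show "?J \<subseteq> carrier small.F" by auto
      show "?J \<noteq> {}"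
        using big.I.zero_closed[unfolded F_zero[symmetric]] small.F.zero_closed by blast
    next
      fix a assume a: "a \<in> ?J"
      have "\<ominus>\<^bsub>small.F\<^esub> a = \<ominus>\<^bsub>big.F\<^esub> a"
        using a F_sub
        by (auto simp: big.F_def small.F_def monoid_ring_uminus big.pairs_monoid small.pairs_monoid)
      thus "\<ominus>\<^bsub>small.F\<^esub> a \<in> ?J" using a by (metis IntD1 IntD2 IntI big.I.a_inv_closed small.F.a_inv_closed)
    next
      fix a b assume "a \<in> ?J" "b \<in> ?J"
      thus "a \<oplus>\<^bsub>small.F\<^esub> b \<in> ?J"
        by (metis F_add IntD1 IntD2 IntI big.I.a_closed small.F.a_closed)
    qed
  next
    fix a x assume "a \<in> ?J" "x \<in> carrier small.F"
    thus "x \<otimes>\<^bsub>small.F\<^esub> a \<in> ?J" "a \<otimes>\<^bsub>small.F\<^esub> x \<in> ?J"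
      using F_sub by (auto simp: F_mult[symmetric]) (auto simp: F_mult big.I.I_l_closed big.I.I_r_closed)
  qed
  moreover have "small.relators \<subseteq> ?J"
    using relators_sub small.relators_closed big.F.genideal_self[OF big.relators_closed]
    by (auto simp: big.I_eq)
  ultimately show ?thesis
    using small.F.genideal_minimal unfolding small.I_eq by blast
qed

text \<open>
  The larger ideal absorbs the smaller one, so adding it to a coset of the smaller ideal gives
  a coset.
\<close>

lemma incl_coset:
  assumes "u \<in> carrier small.F"
  shows "tensor_incl A B (small.I +>\<^bsub>small.F\<^esub> u) = big.I +>\<^bsub>big.F\<^esub> u"
proof -
  have u: "u \<in> carrier big.F" using assms F_sub by auto
  have "tensor_incl A B (small.I +>\<^bsub>small.F\<^esub> u) =
      {x \<oplus>\<^bsub>big.F\<^esub> (y \<oplus>\<^bsub>big.F\<^esub> u) | x y. x \<in> big.I \<and> y \<in> small.I}"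
    unfolding tensor_incl_def set_add_def' a_r_coset_def' big.F_def[symmetric] F_add[symmetric] by auto
  also have "\<dots> = {x \<oplus>\<^bsub>big.F\<^esub> u | x. x \<in> big.I}"
  proof (intro equalityI subsetI)
    fix z assume "z \<in> {x \<oplus>\<^bsub>big.F\<^esub> (y \<oplus>\<^bsub>big.F\<^esub> u) | x y. x \<in> big.I \<and> y \<in> small.I}"
    then obtain x y where z: "z = x \<oplus>\<^bsub>big.F\<^esub> (y \<oplus>\<^bsub>big.F\<^esub> u)" "x \<in> big.I" "y \<in> big.I"
      using ideal_sub by auto
    hence "z = (x \<oplus>\<^bsub>big.F\<^esub> y) \<oplus>\<^bsub>big.F\<^esub> u" using u by (simp add: big.F.a_assoc)
    thus "z \<in> {x \<oplus>\<^bsub>big.F\<^esub> u | x. x \<in> big.I}" using z by (auto intro: big.I.a_closed)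
  next
    fix z assume "z \<in> {x \<oplus>\<^bsub>big.F\<^esub> u | x. x \<in> big.I}"
    then obtain x where "z = x \<oplus>\<^bsub>big.F\<^esub> u" "x \<in> big.I" by auto
    moreover have "\<zero>\<^bsub>big.F\<^esub> \<in> small.I" using small.I.zero_closed by (simp add: F_zero)
    ultimately show "z \<in> {x \<oplus>\<^bsub>big.F\<^esub> (y \<oplus>\<^bsub>big.F\<^esub> u) | x y. x \<in> big.I \<and> y \<in> small.I}"
      using u by (intro CollectI exI[of _ x] exI[of _ "\<zero>\<^bsub>big.F\<^esub>"]) simp
  qed
  finally show ?thesis by (auto simp: a_r_coset_def')
qed

lemma incl_tens:
  "a \<in> C \<Longrightarrow> b \<in> carrier B \<Longrightarrow> tensor_incl A B (small.tens a b) = big.tens a b"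
  unfolding small.tens_eq big.tens_eq by (rule incl_coset, rule small.point_closed) (simp_all add: sub(1))

lemma incl_add:
  assumes "s \<in> carrier small.T" "t \<in> carrier small.T"
  shows "tensor_incl A B (s \<oplus>\<^bsub>small.T\<^esub> t) = tensor_incl A B s \<oplus>\<^bsub>big.T\<^esub> tensor_incl A B t"
proof -
  obtain u v where uv: "u \<in> carrier small.F" "v \<in> carrier small.F"
      "s = small.I +>\<^bsub>small.F\<^esub> u" "t = small.I +>\<^bsub>small.F\<^esub> v"
    using small.carrier_coset assms by meson
  have uv': "u \<in> carrier big.F" "v \<in> carrier big.F" using uv F_sub by auto
  have "s \<oplus>\<^bsub>small.T\<^esub> t = small.I +>\<^bsub>small.F\<^esub> (u \<oplus>\<^bsub>small.F\<^esub> v)"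
    using uv by (simp add: small.coset_add)
  thus ?thesis using uv uv'
    by (simp add: incl_coset small.F.a_closed) (simp add: F_add big.coset_add)
qed

lemma incl_zero: "tensor_incl A B \<zero>\<^bsub>small.T\<^esub> = \<zero>\<^bsub>big.T\<^esub>"
  using incl_coset[OF small.F.zero_closed]
  unfolding small.coset_zero unfolding F_zero big.coset_zero .

lemma incl_closed: "t \<in> carrier small.T \<Longrightarrow> tensor_incl A B t \<in> carrier big.T"
  using F_sub by (auto dest!: small.carrier_coset simp: incl_coset intro!: big.coset_closed)

end

section \<open>Quotients of complex monoid rings as rings of operators\<close>

lemma vector_space_fun: "vector_space (\<lambda>c (v :: 'x \<Rightarrow> complex) w. c * v w)"
  by unfold_locales (auto simp: fun_eq_iff algebra_simps)

text \<open>
  Operators on a space of functions form a type with a ring structure, so that identities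
  between divided powers can be proved in a type class.
\<close>

typedef 'x linop = "{f :: ('x \<Rightarrow> complex) \<Rightarrow> ('x \<Rightarrow> complex).
    (\<forall>u v. f (\<lambda>w. u w + v w) = (\<lambda>w. f u w + f v w)) \<and> (\<forall>c u. f (\<lambda>w. c * u w) = (\<lambda>w. c * f u w))}"
  by (rule exI[of _ id]) auto

setup_lifting type_definition_linop

instantiation linop :: (type) real_algebra_1
begin

lift_definition zero_linop :: "'x linop" is "\<lambda>u w. 0" by auto
lift_definition one_linop :: "'x linop" is "\<lambda>u. u" by auto
lift_definition plus_linop :: "'x linop \<Rightarrow> 'x linop \<Rightarrow> 'x linop" is "\<lambda>f g u w. f u w + g u w"
  by (auto simp: fun_eq_iff algebra_simps)
lift_definition minus_linop :: "'x linop \<Rightarrow> 'x linop \<Rightarrow> 'x linop" is "\<lambda>f g u w. f u w - g u w"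
  by (auto simp: fun_eq_iff algebra_simps)
lift_definition uminus_linop :: "'x linop \<Rightarrow> 'x linop" is "\<lambda>f u w. - f u w"
  by (auto simp: fun_eq_iff algebra_simps)
lift_definition times_linop :: "'x linop \<Rightarrow> 'x linop \<Rightarrow> 'x linop" is "\<lambda>f g u. f (g u)"
  by auto
lift_definition scaleR_linop :: "real \<Rightarrow> 'x linop \<Rightarrow> 'x linop" is "\<lambda>r f u w. complex_of_real r * f u w"
  by (auto simp: fun_eq_iff algebra_simps)

instance
proof
  fix a b c :: "'x linop" and r s :: real
  show "a + b + c = a + (b + c)" by transfer (simp add: fun_eq_iff)
  show "a + b = b + a" by transfer (simp add: fun_eq_iff)
  show "0 + a = a" by transfer simp
  show "- a + a = 0" by transfer simp
  show "a - b = a + - b" by transfer simp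
  show "a * b * c = a * (b * c)" by transfer simp
  show "1 * a = a" by transfer simp
  show "a * 1 = a" by transfer simp
  show "(a + b) * c = a * c + b * c" by transfer simp
  show "a * (b + c) = a * b + a * c" by transfer auto
  show "(0 :: 'x linop) \<noteq> 1"
  proof transfer
    have "(\<lambda>w. 0 :: complex) \<noteq> (\<lambda>w :: 'x. 1)" by (auto simp: fun_eq_iff)
    thus "(\<lambda>(u :: 'x \<Rightarrow> complex) w. 0 :: complex) \<noteq> (\<lambda>u. u)" by metis
  qed
  show "r *\<^sub>R (a + b) = r *\<^sub>R a + r *\<^sub>R b" by transfer (simp add: fun_eq_iff distrib_left)
  show "(r + s) *\<^sub>R a = r *\<^sub>R a + s *\<^sub>R a" by transfer (simp add: fun_eq_iff distrib_right)
  show "r *\<^sub>R s *\<^sub>R a = (r * s) *\<^sub>R a" by transfer (simp add: fun_eq_iff)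
  show "1 *\<^sub>R a = a" by transfer simp
  show "(r *\<^sub>R a) * b = r *\<^sub>R (a * b)" by transfer simp
  show "a * (r *\<^sub>R b) = r *\<^sub>R (a * b)" by transfer simp
qed

end

text \<open>
  A subspace \<open>I\<close> of \<open>F\<close> has a complement in \<open>F\<close>; the map below is the projection to it along
  \<open>I\<close>, continued to the whole space.
\<close>

lemma (in vector_space) complement_projection:
  assumes I: "subspace I" and F: "subspace F" and "I \<subseteq> F"
  shows "\<exists>\<pi>. Vector_Spaces.linear scale scale \<pi> \<and> (\<forall>v. \<pi> v \<in> F) \<and> (\<forall>v\<in>I. \<pi> v = 0) \<and> (\<forall>v\<in>F. v - \<pi> v \<in> I) \<and>
    (\<forall>v. \<pi> (\<pi> v) = \<pi> v)"
proof -
  interpret vector_space_pair scale scale by unfold_locales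
  obtain BI where BI: "BI \<subseteq> I" "independent BI" "I \<subseteq> span BI"
    by (rule maximal_independent_subset[of I])
  obtain BF where BF: "BI \<subseteq> BF" "BF \<subseteq> F" "independent BF" "F \<subseteq> span BF"
    by (rule maximal_independent_subset_extend[of BI F]) (use BI \<open>I \<subseteq> F\<close> in auto)
  obtain B where B: "BF \<subseteq> B" "independent B" "UNIV \<subseteq> span B"
    by (rule maximal_independent_subset_extend[of BF UNIV]) (use BF in auto)
  obtain \<pi> where lin: "Vector_Spaces.linear scale scale \<pi>"
    and val: "\<And>x. x \<in> B \<Longrightarrow> \<pi> x = (if x \<in> BF - BI then x else 0)"
    using linear_independent_extend[OF B(2), of "\<lambda>x. if x \<in> BF - BI then x else 0"] by blast
  interpret p: Vector_Spaces.linear scale scale \<pi> by fact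
  have z: "\<pi> v = 0" if "v \<in> I" for v
  proof -
    have "v \<in> span BI" using BI that by blast
    thus ?thesis
    proof (induction rule: span_induct_alt)
      case base show ?case by (rule p.zero)
    next
      case (step c x y)
      thus ?case using val[of x] B BF by (auto simp: p.add p.scale)
    qed
  qed
  have r: "\<pi> v \<in> F \<and> \<pi> (\<pi> v) = \<pi> v" for v
  proof -
    have "v \<in> span B" using B by blast
    thus ?thesis
    proof (induction rule: span_induct_alt)
      case base show ?case using F by (simp add: p.zero subspace_0)
    next
      case (step c x y)
      have "\<pi> x \<in> F" "\<pi> (\<pi> x) = \<pi> x"
        using val[of x] step BF F by (auto simp: p.zero subspace_0)
      thus ?case using step F by (auto simp: p.add p.scale intro!: subspace_add subspace_scale)
    qed
  qed
  have d: "v - \<pi> v \<in> I" if "v \<in> F" for v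
  proof -
    have "v \<in> span BF" using BF that by blast
    thus ?thesis
    proof (induction rule: span_induct_alt)
      case base show ?case using I by (simp add: p.zero subspace_0)
    next
      case (step c x y)
      have "x - \<pi> x \<in> I"
      proof (cases "x \<in> BI")
        case True
        hence "\<pi> x = 0" "x \<in> I" using val[of x] BI(1) BF(1) B(1) by auto
        thus ?thesis by simp
      next
        case False
        hence "\<pi> x = x" using val[of x] step(1) B by auto
        thus ?thesis using I by (simp add: subspace_0)
      qed
      hence "scale c (x - \<pi> x) + (y - \<pi> y) \<in> I" using step I by (intro subspace_add subspace_scale)
      thus ?case by (simp add: p.add p.scale scale_right_diff_distrib algebra_simps)
    qed
  qed
  show ?thesis using lin z r d by blast
qed

lemma pairing_scale: "pairing (\<lambda>x. c * u x) \<phi> = (c :: complex) * pairing u \<phi>"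
  by (cases "c = 0") (auto simp: pairing_def sum_distrib_left mult.assoc)

text \<open>
  A quotient of a complex monoid ring is isomorphic to a ring of linear operators. It acts on a
  complement of the ideal by multiplication followed by projection; to preserve the unit, a
  character of the quotient acts on the rest of the space.
\<close>

lemma monoid_ring_quotient_operators:
  fixes G :: "('a, 'b) monoid_scheme" and \<epsilon> :: "('a \<Rightarrow> complex) \<Rightarrow> complex"
  defines "R \<equiv> monoid_ring G"
  assumes G: "monoid G" and I: "ideal I R"
    and e: "\<And>x y. x \<in> carrier R \<Longrightarrow> y \<in> carrier R \<Longrightarrow> \<epsilon> (x \<otimes>\<^bsub>R\<^esub> y) = \<epsilon> x * \<epsilon> y"
      "\<And>x y. x \<in> carrier R \<Longrightarrow> y \<in> carrier R \<Longrightarrow> \<epsilon> (x \<oplus>\<^bsub>R\<^esub> y) = \<epsilon> x + \<epsilon> y"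
      "\<And>c. \<epsilon> (single \<one>\<^bsub>G\<^esub> c) = c" "\<And>x. x \<in> I \<Longrightarrow> \<epsilon> x = 0"
  shows "\<exists>\<rho> :: ('a \<Rightarrow> complex) set \<Rightarrow> 'a linop. inj_on \<rho> (carrier (R Quot I)) \<and>
    (\<forall>s\<in>carrier (R Quot I). \<forall>t\<in>carrier (R Quot I).
       \<rho> (s \<otimes>\<^bsub>R Quot I\<^esub> t) = \<rho> s * \<rho> t \<and> \<rho> (s \<oplus>\<^bsub>R Quot I\<^esub> t) = \<rho> s + \<rho> t) \<and>
    (\<forall>r. \<rho> (I +>\<^bsub>R\<^esub> single \<one>\<^bsub>G\<^esub> (of_real r)) = r *\<^sub>R 1)"
proof -
  interpret V: vector_space "\<lambda>c (v :: 'a \<Rightarrow> complex) w. c * v w" by (rule vector_space_fun)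
  interpret R: ring R unfolding R_def by (rule monoid_ring_ring[OF G])
  interpret I: ideal I R by fact
  note Rdefs = monoid_ring_carrier[OF G] monoid_ring_add[OF G] monoid_ring_zero[OF G]
  note pm = pairing_mult[OF G, where 'c = complex, folded R_def]
    and eqI = monoid_ring_eqI[OF G, where 'c = complex, folded R_def]
  have plus: "x \<oplus>\<^bsub>R\<^esub> y = x + y" "\<zero>\<^bsub>R\<^esub> = 0" for x y
    by (auto simp: R_def Rdefs fun_eq_iff)
  have minus: "x \<ominus>\<^bsub>R\<^esub> y = x - y" if "x \<in> carrier R" "y \<in> carrier R" for x y
    using that monoid_ring_minus[OF G, of x y] by (auto simp: R_def fun_eq_iff)
  have unit: "single \<one>\<^bsub>G\<^esub> c \<in> carrier R" for c
    unfolding R_def by (rule single_closed[OF G monoid.one_closed[OF G]])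
  have scale_closed: "(\<lambda>w. c * u w) \<in> carrier R" if "u \<in> carrier R" for c u
  proof -
    have "{w. c * u w \<noteq> 0} \<subseteq> {w. u w \<noteq> 0}" by auto
    thus ?thesis using that unfolding R_def Rdefs by (meson finite_subset order_trans)
  qed
  have scale: "single \<one>\<^bsub>G\<^esub> c \<otimes>\<^bsub>R\<^esub> u = (\<lambda>w. c * u w)" if "u \<in> carrier R" for c u
  proof (rule eqI)
    fix \<phi> :: "'a \<Rightarrow> complex"
    have "pairing (single \<one>\<^bsub>G\<^esub> c \<otimes>\<^bsub>R\<^esub> u) \<phi> = c * pairing u (\<lambda>b. \<phi> (\<one>\<^bsub>G\<^esub> \<otimes>\<^bsub>G\<^esub> b))"
      using pm[OF unit that] by (simp add: pairing_single[OF G])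
    also have "pairing u (\<lambda>b. \<phi> (\<one>\<^bsub>G\<^esub> \<otimes>\<^bsub>G\<^esub> b)) = pairing u \<phi>"
      using that by (intro pairing_cong) (auto simp: R_def Rdefs subset_iff monoid.l_one[OF G])
    finally show "pairing (single \<one>\<^bsub>G\<^esub> c \<otimes>\<^bsub>R\<^esub> u) \<phi> = pairing (\<lambda>w. c * u w) \<phi>"
      by (simp add: pairing_scale)
  qed (use that unit scale_closed in auto)
  have scale_right: "x \<otimes>\<^bsub>R\<^esub> (\<lambda>w. c * u w) = (\<lambda>w. c * (x \<otimes>\<^bsub>R\<^esub> u) w)"
    if "x \<in> carrier R" "u \<in> carrier R" for c x u
  proof (rule eqI)
    fix \<phi> :: "'a \<Rightarrow> complex"
    show "pairing (x \<otimes>\<^bsub>R\<^esub> (\<lambda>w. c * u w)) \<phi> = pairing (\<lambda>w. c * (x \<otimes>\<^bsub>R\<^esub> u) w) \<phi>"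
      using that by (simp add: pairing_scale pm scale_closed)
        (simp add: pairing_def sum_distrib_left mult_ac)
  qed (use that scale_closed in auto)
  have subF: "V.subspace (carrier R)"
    using R.zero_closed R.a_closed scale_closed by (auto simp: V.subspace_def plus)
  have subI: "V.subspace I"
    unfolding V.subspace_def
  proof (intro conjI allI ballI)
    show "0 \<in> I" using I.zero_closed by (simp add: plus)
  next
    fix x y assume "x \<in> I" "y \<in> I" thus "x + y \<in> I" using I.a_closed[of x y] by (simp add: plus)
  next
    fix c x assume x: "x \<in> I"
    hence "single \<one>\<^bsub>G\<^esub> c \<otimes>\<^bsub>R\<^esub> x \<in> I" using I.I_l_closed unit by blast
    thus "(\<lambda>w. c * x w) \<in> I" using scale x I.a_Hcarr by simp
  qed
  have IF: "I \<subseteq> carrier R" using I.a_Hcarr by auto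
  obtain \<pi> where lin: "Vector_Spaces.linear (\<lambda>c (v :: 'a \<Rightarrow> complex) w. c * v w) (\<lambda>c v w. c * v w) \<pi>"
    and p: "\<And>v. \<pi> v \<in> carrier R" "\<And>v. v \<in> I \<Longrightarrow> \<pi> v = 0" "\<And>v. v \<in> carrier R \<Longrightarrow> v - \<pi> v \<in> I"
      "\<And>v. \<pi> (\<pi> v) = \<pi> v"
    using V.complement_projection[OF subI subF IF] by blast
  interpret p: Vector_Spaces.linear "\<lambda>c (v :: 'a \<Rightarrow> complex) w. c * v w" "\<lambda>c v w. c * v w" \<pi> by fact
  \<comment> \<open>On the complement \<open>\<pi> v\<close> this is multiplication in the quotient, on the kernel of \<open>\<pi>\<close>
    the scalar \<open>\<epsilon> x\<close>.\<close>
  define L where "L x v = \<pi> (x \<otimes>\<^bsub>R\<^esub> \<pi> v) + (\<lambda>w. \<epsilon> x * (v - \<pi> v) w)" for x v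
  have L_op: "L x (\<lambda>w. u w + v w) = (\<lambda>w. L x u w + L x v w)" "L x (\<lambda>w. c * u w) = (\<lambda>w. c * L x u w)"
    if x: "x \<in> carrier R" for x u v c
  proof -
    have "x \<otimes>\<^bsub>R\<^esub> (\<pi> u + \<pi> v) = x \<otimes>\<^bsub>R\<^esub> \<pi> u + x \<otimes>\<^bsub>R\<^esub> \<pi> v"
      using R.r_distr[OF p(1) p(1) x, of u v] by (simp add: plus)
    hence "L x (u + v) = L x u + L x v"
      unfolding L_def p.add by (simp add: p.add) (simp add: fun_eq_iff algebra_simps)
    moreover have "u + v = (\<lambda>w. u w + v w)" "L x u + L x v = (\<lambda>w. L x u w + L x v w)" by auto
    ultimately show "L x (\<lambda>w. u w + v w) = (\<lambda>w. L x u w + L x v w)" by metis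
    show "L x (\<lambda>w. c * u w) = (\<lambda>w. c * L x u w)"
      unfolding L_def p.scale scale_right[OF x p(1)]
      by (simp add: fun_eq_iff algebra_simps)
  qed
  define \<rho>0 where "\<rho>0 x = Abs_linop (L x)" for x
  have rep: "Rep_linop (\<rho>0 x) = L x" if "x \<in> carrier R" for x
    unfolding \<rho>0_def using L_op[OF that] by (intro Abs_linop_inverse) auto
  have proj_killed: "\<pi> (\<lambda>w. c * (v - \<pi> v) w) = 0" for c v
    using p.scale[of c "v - \<pi> v"] by (simp add: p.diff p(4) fun_eq_iff)
  have proj_mod: "\<pi> (x \<otimes>\<^bsub>R\<^esub> \<pi> v) = \<pi> (x \<otimes>\<^bsub>R\<^esub> v)" if "x \<in> carrier R" "v \<in> carrier R" for x v
  proof -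
    have "x \<otimes>\<^bsub>R\<^esub> (v \<ominus>\<^bsub>R\<^esub> \<pi> v) \<in> I"
      using that p by (simp add: minus I.I_l_closed)
    moreover have "x \<otimes>\<^bsub>R\<^esub> (v \<ominus>\<^bsub>R\<^esub> \<pi> v) = x \<otimes>\<^bsub>R\<^esub> v \<ominus>\<^bsub>R\<^esub> x \<otimes>\<^bsub>R\<^esub> \<pi> v"
      using that p(1)[of v] by algebra
    ultimately have "\<pi> (x \<otimes>\<^bsub>R\<^esub> v - x \<otimes>\<^bsub>R\<^esub> \<pi> v) = 0"
      using p that by (simp add: minus)
    thus ?thesis by (simp add: p.diff)
  qed
  have mult: "\<rho>0 (x \<otimes>\<^bsub>R\<^esub> y) = \<rho>0 x * \<rho>0 y" if "x \<in> carrier R" "y \<in> carrier R" for x y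
  proof -
    have "L (x \<otimes>\<^bsub>R\<^esub> y) v = L x (L y v)" for v
    proof -
      have py: "\<pi> (L y v) = \<pi> (y \<otimes>\<^bsub>R\<^esub> \<pi> v)"
        by (simp only: L_def p.add p(4) proj_killed add_0_right)
      have "L x (L y v) = \<pi> (x \<otimes>\<^bsub>R\<^esub> (y \<otimes>\<^bsub>R\<^esub> \<pi> v)) + (\<lambda>w. \<epsilon> x * (L y v - \<pi> (y \<otimes>\<^bsub>R\<^esub> \<pi> v)) w)"
        using that p(1) by (simp add: L_def[of x] py proj_mod)
      also have "(\<lambda>w. \<epsilon> x * (L y v - \<pi> (y \<otimes>\<^bsub>R\<^esub> \<pi> v)) w) = (\<lambda>w. \<epsilon> (x \<otimes>\<^bsub>R\<^esub> y) * (v - \<pi> v) w)"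
        by (simp add: L_def e that fun_eq_iff)
      finally show ?thesis unfolding L_def[of "x \<otimes>\<^bsub>R\<^esub> y"] R.m_assoc[OF that p(1)] by (rule sym)
    qed
    thus ?thesis using that rep[of x] rep[of y] rep[of "x \<otimes>\<^bsub>R\<^esub> y"]
      by (intro Rep_linop_inject[THEN iffD1]) (auto simp: times_linop.rep_eq)
  qed
  have add: "\<rho>0 (x \<oplus>\<^bsub>R\<^esub> y) = \<rho>0 x + \<rho>0 y" if "x \<in> carrier R" "y \<in> carrier R" for x y
  proof -
    have "(x \<oplus>\<^bsub>R\<^esub> y) \<otimes>\<^bsub>R\<^esub> \<pi> v = x \<otimes>\<^bsub>R\<^esub> \<pi> v + y \<otimes>\<^bsub>R\<^esub> \<pi> v" for v
      using R.l_distr[OF that p(1)] by (simp add: plus)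
    hence "L (x \<oplus>\<^bsub>R\<^esub> y) v = (\<lambda>w. L x v w + L y v w)" for v
      by (simp add: L_def p.add e that) (simp add: fun_eq_iff algebra_simps)
    thus ?thesis using that rep[of x] rep[of y] rep[of "x \<oplus>\<^bsub>R\<^esub> y"]
      by (intro Rep_linop_inject[THEN iffD1]) (auto simp: plus_linop.rep_eq)
  qed
  have vanish: "\<rho>0 x = 0" if x: "x \<in> I" for x
  proof -
    have "L x v = (\<lambda>w. 0)" for v
      using x p I.I_r_closed[OF x p(1)] by (simp add: L_def e fun_eq_iff)
    thus ?thesis using rep[of x] IF x
      by (intro Rep_linop_inject[THEN iffD1]) (auto simp: zero_linop.rep_eq fun_eq_iff)
  qed
  have faithful: "x \<in> I" if x: "x \<in> carrier R" "\<rho>0 x = 0" for x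
  proof -
    \<comment> \<open>An element represented by zero sends the unit into the ideal.\<close>
    let ?u = "\<one>\<^bsub>R\<^esub>"
    have "L x ?u = 0"
      using rep[OF x(1)] x(2) by (simp add: zero_linop.rep_eq fun_eq_iff)
    hence "\<pi> (L x ?u) = 0" by (simp add: p.zero)
    hence "\<pi> (x \<otimes>\<^bsub>R\<^esub> ?u) = 0"
      by (simp only: L_def p.add p(4) proj_killed add_0_right proj_mod x R.one_closed)
    thus ?thesis using p(3)[OF x(1)] x by simp
  qed
  have scalar: "\<rho>0 (single \<one>\<^bsub>G\<^esub> (of_real r)) = r *\<^sub>R 1" for r
  proof -
    have "L (single \<one>\<^bsub>G\<^esub> (of_real r)) v = (\<lambda>w. of_real r * v w)" for v
      unfolding L_def scale[OF p(1)] p.scale p(4) e(3) by (simp add: fun_eq_iff algebra_simps)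
    thus ?thesis using rep[OF unit]
      by (intro Rep_linop_inject[THEN iffD1]) (auto simp: scaleR_linop.rep_eq one_linop.rep_eq)
  qed
  have coset: "\<rho>0 x = \<rho>0 y" if "x \<in> carrier R" "y \<in> carrier R" "I +>\<^bsub>R\<^esub> x = I +>\<^bsub>R\<^esub> y" for x y
  proof -
    have "x \<ominus>\<^bsub>R\<^esub> y \<in> I" using R.quotient_eq_iff_same_a_r_cos[OF I that(1,2)] that(3) by blast
    hence "\<rho>0 (x \<ominus>\<^bsub>R\<^esub> y) = 0" by (rule vanish)
    moreover have "\<rho>0 ((x \<ominus>\<^bsub>R\<^esub> y) \<oplus>\<^bsub>R\<^esub> y) = \<rho>0 (x \<ominus>\<^bsub>R\<^esub> y) + \<rho>0 y"
      using that by (intro add) auto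
    moreover have "(x \<ominus>\<^bsub>R\<^esub> y) \<oplus>\<^bsub>R\<^esub> y = x" using that(1,2) by algebra
    ultimately show ?thesis by simp
  qed
  define \<rho> where "\<rho> t = \<rho>0 (SOME x. x \<in> carrier R \<and> t = I +>\<^bsub>R\<^esub> x)" for t
  have val: "\<rho> (I +>\<^bsub>R\<^esub> x) = \<rho>0 x" if "x \<in> carrier R" for x
  proof -
    have "\<exists>y. y \<in> carrier R \<and> I +>\<^bsub>R\<^esub> x = I +>\<^bsub>R\<^esub> y" using that by auto
    from someI_ex[OF this] show ?thesis unfolding \<rho>_def using coset that by metis
  qed
  have ex: "\<exists>x\<in>carrier R. t = I +>\<^bsub>R\<^esub> x" if "t \<in> carrier (R Quot I)" for t
    using that unfolding FactRing_def A_RCOSETS_def' by auto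
  have hom: "\<rho> (s \<otimes>\<^bsub>R Quot I\<^esub> t) = \<rho> s * \<rho> t" "\<rho> (s \<oplus>\<^bsub>R Quot I\<^esub> t) = \<rho> s + \<rho> t"
    if st: "s \<in> carrier (R Quot I)" "t \<in> carrier (R Quot I)" for s t
  proof -
    obtain x y where xy: "x \<in> carrier R" "y \<in> carrier R" "s = I +>\<^bsub>R\<^esub> x" "t = I +>\<^bsub>R\<^esub> y"
      using ex st by meson
    show "\<rho> (s \<otimes>\<^bsub>R Quot I\<^esub> t) = \<rho> s * \<rho> t"
      using xy by (simp add: ring_hom_mult[OF I.rcos_ring_hom, symmetric] val mult)
    show "\<rho> (s \<oplus>\<^bsub>R Quot I\<^esub> t) = \<rho> s + \<rho> t"
      using xy by (simp add: ring_hom_add[OF I.rcos_ring_hom, symmetric] val add)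
  qed
  have inj: "inj_on \<rho> (carrier (R Quot I))"
  proof (rule inj_onI)
    fix s t assume st: "s \<in> carrier (R Quot I)" "t \<in> carrier (R Quot I)" "\<rho> s = \<rho> t"
    obtain x y where xy: "x \<in> carrier R" "y \<in> carrier R" "s = I +>\<^bsub>R\<^esub> x" "t = I +>\<^bsub>R\<^esub> y"
      using ex st by meson
    have "(x \<ominus>\<^bsub>R\<^esub> y) \<oplus>\<^bsub>R\<^esub> y = x" using xy(1,2) by algebra
    hence "\<rho>0 x = \<rho>0 (x \<ominus>\<^bsub>R\<^esub> y) + \<rho>0 y" using add[of "x \<ominus>\<^bsub>R\<^esub> y" y] xy by simp
    hence "\<rho>0 (x \<ominus>\<^bsub>R\<^esub> y) = 0" using st xy by (simp add: val)
    hence "x \<ominus>\<^bsub>R\<^esub> y \<in> I" using faithful xy by simp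
    thus "s = t" using R.quotient_eq_iff_same_a_r_cos[OF I xy(1,2)] xy by simp
  qed
  show ?thesis
    using inj hom val[OF unit] scalar by (intro exI[of _ \<rho>]) auto
qed

section \<open>Divided powers, binomials and Kostant's commutation formula\<close>

definition dpow :: "'a::real_algebra_1 \<Rightarrow> nat \<Rightarrow> 'a" where
  "dpow x n = (1 / fact n) *\<^sub>R x ^ n"

text \<open>
  The binomial coefficient \<open>x (x - 1) \<dots> (x - n + 1) / n!\<close>.
\<close>

primrec bin :: "'a::real_algebra_1 \<Rightarrow> nat \<Rightarrow> 'a" where
  "bin x 0 = 1"
| "bin x (Suc n) = (1 / real (Suc n)) *\<^sub>R (bin x n * (x - of_nat n))"

lemma dpow_0 [simp]: "dpow x 0 = 1" and dpow_1: "dpow x (Suc 0) = x"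
  by (simp_all add: dpow_def)

lemma dpow_Suc: "x * dpow x n = real (Suc n) *\<^sub>R dpow x (Suc n)"
  by (simp add: dpow_def field_simps del: of_nat_Suc)

lemma bin_intertwine:
  assumes "h * y = y * h'"
  shows "bin h m * y = y * bin h' m"
proof (induction m)
  case (Suc m)
  have "(h - of_nat m) * y = y * (h' - of_nat m)"
    using assms by (simp add: algebra_simps mult_of_nat_commute)
  hence "bin h m * (h - of_nat m) * y = y * (bin h' m * (h' - of_nat m))"
    using Suc by (metis mult.assoc)
  thus ?case by simp
qed auto

text \<open>Each factor \<open>x\<close> shifts \<open>h\<close> by \<open>c\<close>.\<close>

lemma dpow_weight:
  assumes "h * x - x * h = of_int c * (x :: 'a::real_algebra_1)"
  shows "h * dpow x n = dpow x n * (h + of_int (int n * c))"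
proof -
  have b: "h * x = x * (h + of_int c)"
    using assms by (simp add: algebra_simps mult_of_int_commute)
  have "h * x ^ n = x ^ n * (h + of_int (int n * c))"
  proof (induction n)
    case (Suc n)
    have "h * x ^ Suc n = x * (h + of_int c) * x ^ n" using b by (simp add: mult.assoc[symmetric])
    also have "\<dots> = x * (h * x ^ n + of_int c * x ^ n)" by (simp add: algebra_simps)
    also have "\<dots> = x * (x ^ n * (h + of_int (int n * c)) + x ^ n * of_int c)"
      by (simp only: Suc mult_of_int_commute)
    also have "\<dots> = x ^ Suc n * (h + of_int (int (Suc n) * c))" by (simp add: algebra_simps)
    finally show ?case .
  qed simp
  thus ?thesis by (simp add: dpow_def)
qed

lemma bin_dpow_weight:
  assumes "h * x - x * h = of_int c * (x :: 'a::real_algebra_1)"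
  shows "bin h m * dpow x n = dpow x n * bin (h + of_int (int n * c)) m"
  by (rule bin_intertwine) (rule dpow_weight[OF assms])

lemma bin_commute: "x * bin x n = bin x n * x"
  using bin_intertwine[of x x x n] by simp

lemma scaleR_left_cancel_Suc:
  "real (Suc n) *\<^sub>R x = real (Suc n) *\<^sub>R y \<Longrightarrow> x = (y :: 'a::real_vector)"
  by (simp del: of_nat_Suc)

lemma bin_Suc: "real (Suc n) *\<^sub>R bin x (Suc n) = bin x n * (x - of_nat n)"
  by (simp del: of_nat_Suc)

lemma bin_pascal: "bin (x + 1) (Suc n) = bin x (Suc n) + bin x n"
proof (induction n)
  case (Suc n)
  have "real (Suc (Suc n)) *\<^sub>R bin (x + 1) (Suc (Suc n)) = bin (x + 1) (Suc n) * (x - of_nat n)"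
    by (simp only: bin_Suc) simp
  also have "\<dots> = bin x (Suc n) * (x - of_nat n) + bin x n * (x - of_nat n)"
    by (simp only: Suc distrib_right)
  also have "\<dots> = bin x (Suc n) * (x - of_nat n) + real (Suc n) *\<^sub>R bin x (Suc n)"
    by (simp only: bin_Suc)
  also have "\<dots> = bin x (Suc n) * (x - of_nat (Suc n)) + real (Suc (Suc n)) *\<^sub>R bin x (Suc n)"
    by (simp add: algebra_simps scaleR_conv_of_real mult_2 del: bin.simps)
  also have "\<dots> = real (Suc (Suc n)) *\<^sub>R (bin x (Suc (Suc n)) + bin x (Suc n))"
    by (simp only: bin_Suc scaleR_right_distrib)
  finally show ?case by (rule scaleR_left_cancel_Suc)
qed simp

text \<open>
  On its way through a power of \<open>f\<close>, \<open>e\<close> leaves one \<open>h\<close> for each factor; these are collected on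
  the right.
\<close>

lemma raise_dpow:
  assumes ef: "e * f - f * e = h" and hf: "h * f - f * h = of_int (- 2) * (f :: 'a::real_algebra_1)"
  shows "e * dpow f (Suc m) = dpow f (Suc m) * e + dpow f m * (h - of_nat m)"
proof (induction m)
  case 0
  show ?case using ef by (simp add: dpow_1 algebra_simps)
next
  case (Suc m)
  let ?F = "\<lambda>n. dpow f n"
  have hF: "h * ?F n = ?F n * (h - of_nat (2 * n))" for n
    using dpow_weight[OF hf, of n] by (simp add: mult.commute)
  have "real (Suc (Suc m)) *\<^sub>R (e * ?F (Suc (Suc m))) = e * (f * ?F (Suc m))"
    by (simp only: dpow_Suc mult_scaleR_right)
  also have "\<dots> = f * (e * ?F (Suc m)) + h * ?F (Suc m)"
    using ef by (metis (no_types, lifting) add.commute diff_add_cancel distrib_right mult.assoc)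
  also have "\<dots> = f * ?F (Suc m) * e + f * ?F m * (h - of_nat m) + ?F (Suc m) * (h - of_nat (2 * Suc m))"
    by (simp only: Suc hF distrib_left mult.assoc)
  also have "\<dots> = real (Suc (Suc m)) *\<^sub>R (?F (Suc (Suc m)) * e)
      + real (Suc m) *\<^sub>R (?F (Suc m) * (h - of_nat m)) + ?F (Suc m) * (h - of_nat (2 * Suc m))"
    by (simp only: dpow_Suc mult_scaleR_left)
  also have "\<dots> = real (Suc (Suc m)) *\<^sub>R (?F (Suc (Suc m)) * e)
      + real (Suc (Suc m)) *\<^sub>R (?F (Suc m) * (h - of_nat (Suc m)))"
  proof -
    have "real (Suc m) *\<^sub>R (h - of_nat m) + (h - of_nat (2 * Suc m)) = real (Suc (Suc m)) *\<^sub>R (h - of_nat (Suc m))"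
      by (simp add: algebra_simps scaleR_conv_of_real mult_2 mult_2_right)
    from arg_cong[OF this, of "\<lambda>x. ?F (Suc m) * x"] show ?thesis
      by (simp only: distrib_left mult_scaleR_right add.assoc)
  qed
  finally have "real (Suc (Suc m)) *\<^sub>R (e * ?F (Suc (Suc m))) =
      real (Suc (Suc m)) *\<^sub>R (?F (Suc (Suc m)) * e + ?F (Suc m) * (h - of_nat (Suc m)))"
    by (simp only: scaleR_right_distrib add.assoc)
  thus ?case by (rule scaleR_left_cancel_Suc)
qed

text \<open>
  Kostant's commutation formula in \<open>\<ss>\<ll>\<^sub>2\<close>, by induction on \<open>n\<close>. Multiplication by one more \<open>e\<close>
  either lowers the power of \<open>f\<close> or raises the power of \<open>e\<close>, and Pascal's rule adds the two
  contributions to a term. The summand is zero for \<open>t > m\<close>, which spares a case distinction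
  between \<open>m\<close> and \<open>n\<close>.
\<close>

lemma kostant_commutation:
  assumes ef: "e * f - f * e = h" and he: "h * e - e * h = of_int 2 * (e :: 'a::real_algebra_1)"
    and hf: "h * f - f * h = of_int (- 2) * f"
  shows "dpow e n * dpow f m =
    (\<Sum>t\<le>n. (if t \<le> m then dpow f (m - t) else 0) *
      bin (h + of_int (2 * int t - int m - int n)) t * dpow e (n - t))"
proof (induction n)
  case (Suc n)
  define G where "G t = (if t \<le> m then dpow f (m - t) else 0)" for t
  define B where "B c t = bin (h + of_int c) t" for c t
  define wt where "wt s = 2 * int s - int m - int n - 2" for s
  have eG: "e * G t = G t * e + G (Suc t) * (h + of_int (int t + 1 - int m))" for t
  proof (cases "t < m")
    case True
    then obtain j where j: "m = t + Suc j" by (metis less_iff_Suc_add add_Suc_right)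
    thus ?thesis using raise_dpow[OF ef hf, of j] by (simp add: G_def)
  qed (auto simp: G_def)
  have eB: "e * B c t = B (c - 2) t * e" for c t
    unfolding B_def
    by (rule bin_intertwine[symmetric]) (use he in \<open>simp add: algebra_simps mult_of_int_commute\<close>)
  have eE: "e * dpow e (n - t) = (real n + 1 - real t) *\<^sub>R dpow e (Suc n - t)" if "t \<le> n" for t
    using that by (simp add: dpow_Suc Suc_diff_le of_nat_diff algebra_simps)
  have wt: "2 * int t - int m - int n - 2 = wt t" "2 * int t - int m - int n = wt (Suc t)" for t
    by (simp_all add: wt_def)
  \<comment> \<open>The two contributions to the summand with index \<open>Suc r\<close>.\<close>
  have comb: "(real n + 1 - real (Suc r)) *\<^sub>R B (wt (Suc r)) (Suc r)
      + (h + of_int (int r + 1 - int m)) * B (wt (Suc r)) r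
      = real (Suc n) *\<^sub>R B (wt (Suc r) + 1) (Suc r)" for r
  proof -
    let ?x = "h + of_int (wt (Suc r))"
    have p: "B (wt (Suc r) + 1) (Suc r) = bin ?x (Suc r) + bin ?x r"
      using bin_pascal[of ?x r] by (simp add: B_def add.assoc)
    have h: "h + of_int (int r + 1 - int m) = ?x + of_int (int n - int r + 1)"
    proof -
      have "int r + 1 - int m = wt (Suc r) + (int n - int r + 1)" by (simp add: wt_def)
      thus ?thesis by (simp only: of_int_add add.assoc)
    qed
    have s: "bin ?x r * ?x = real (Suc r) *\<^sub>R bin ?x (Suc r) + real r *\<^sub>R bin ?x r"
      unfolding bin_Suc by (simp add: right_diff_distrib scaleR_conv_of_real mult_of_nat_commute)
    have "(?x + of_int (int n - int r + 1)) * bin ?x r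
        = bin ?x r * ?x + (real n - real r + 1) *\<^sub>R bin ?x r"
      unfolding distrib_right bin_commute by (simp add: scaleR_conv_of_real)
    thus ?thesis unfolding h p unfolding B_def s by (simp add: algebra_simps del: bin.simps)
  qed
  have "real (Suc n) *\<^sub>R (dpow e (Suc n) * dpow f m) = e * (dpow e n * dpow f m)"
    by (simp only: dpow_Suc mult.assoc[symmetric] mult_scaleR_left)
  also have "\<dots> = (\<Sum>t\<le>n. e * G t * B (wt (Suc t)) t * dpow e (n - t))"
    unfolding Suc G_def[symmetric] B_def[symmetric] wt sum_distrib_left by (simp add: mult.assoc)
  also have "\<dots> = (\<Sum>t\<le>n. (real n + 1 - real t) *\<^sub>R (G t * B (wt t) t * dpow e (Suc n - t)) +
      G (Suc t) * ((h + of_int (int t + 1 - int m)) * B (wt (Suc t)) t) * dpow e (n - t))"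
  proof (intro sum.cong refl)
    fix t assume "t \<in> {..n}"
    hence t: "t \<le> n" by simp
    have "G t * e * B (wt (Suc t)) t * dpow e (n - t) = G t * (e * B (wt (Suc t)) t) * dpow e (n - t)"
      by (simp only: mult.assoc)
    also have "\<dots> = G t * B (wt t) t * (e * dpow e (n - t))"
    proof -
      have "wt (Suc t) - 2 = wt t" by (simp add: wt_def)
      thus ?thesis unfolding eB by (simp only: mult.assoc)
    qed
    also have "\<dots> = (real n + 1 - real t) *\<^sub>R (G t * B (wt t) t * dpow e (Suc n - t))"
      unfolding eE[OF t] by simp
    finally show "e * G t * B (wt (Suc t)) t * dpow e (n - t) =
        (real n + 1 - real t) *\<^sub>R (G t * B (wt t) t * dpow e (Suc n - t)) +
        G (Suc t) * ((h + of_int (int t + 1 - int m)) * B (wt (Suc t)) t) * dpow e (n - t)"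
      unfolding eG by (simp only: distrib_right mult.assoc)
  qed
  also have "\<dots> = (\<Sum>t\<le>Suc n. (real n + 1 - real t) *\<^sub>R (G t * B (wt t) t * dpow e (Suc n - t))) +
      (\<Sum>t\<le>n. G (Suc t) * ((h + of_int (int t + 1 - int m)) * B (wt (Suc t)) t) * dpow e (n - t))"
    by (simp add: sum.distrib)
  also have "\<dots> = real (Suc n) *\<^sub>R (G 0 * B (wt 0) 0 * dpow e (Suc n)) +
      (\<Sum>t\<le>n. (real n + 1 - real (Suc t)) *\<^sub>R (G (Suc t) * B (wt (Suc t)) (Suc t) * dpow e (n - t)) +
        G (Suc t) * ((h + of_int (int t + 1 - int m)) * B (wt (Suc t)) t) * dpow e (n - t))"
    unfolding sum.atMost_Suc_shift sum.distrib by (simp add: add.assoc add.commute)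
  also have "\<dots> = real (Suc n) *\<^sub>R (G 0 * B (wt 0 + 1) 0 * dpow e (Suc n)) +
      (\<Sum>t\<le>n. real (Suc n) *\<^sub>R (G (Suc t) * B (wt (Suc t) + 1) (Suc t) * dpow e (n - t)))"
  proof (intro arg_cong2[of _ _ _ _ "(+)"] sum.cong refl)
    fix t assume "t \<in> {..n}"
    have "(real n + 1 - real (Suc t)) *\<^sub>R (G (Suc t) * B (wt (Suc t)) (Suc t) * dpow e (n - t)) +
        G (Suc t) * ((h + of_int (int t + 1 - int m)) * B (wt (Suc t)) t) * dpow e (n - t) =
        G (Suc t) * ((real n + 1 - real (Suc t)) *\<^sub>R B (wt (Suc t)) (Suc t)
          + (h + of_int (int t + 1 - int m)) * B (wt (Suc t)) t) * dpow e (n - t)"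
      by (simp only: distrib_left distrib_right mult_scaleR_left mult_scaleR_right)
    thus "(real n + 1 - real (Suc t)) *\<^sub>R (G (Suc t) * B (wt (Suc t)) (Suc t) * dpow e (n - t)) +
        G (Suc t) * ((h + of_int (int t + 1 - int m)) * B (wt (Suc t)) t) * dpow e (n - t) =
        real (Suc n) *\<^sub>R (G (Suc t) * B (wt (Suc t) + 1) (Suc t) * dpow e (n - t))"
      unfolding comb by (simp only: mult_scaleR_left mult_scaleR_right)
  qed (simp add: B_def)
  also have "\<dots> = real (Suc n) *\<^sub>R (\<Sum>t\<le>Suc n. G t * B (wt t + 1) t * dpow e (Suc n - t))"
    unfolding sum.atMost_Suc_shift scaleR_right_distrib scaleR_sum_right by simp
  finally have "dpow e (Suc n) * dpow f m = (\<Sum>t\<le>Suc n. G t * B (wt t + 1) t * dpow e (Suc n - t))"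
    by (rule scaleR_left_cancel_Suc)
  thus ?case by (simp add: G_def B_def wt_def algebra_simps)
qed simp

definition ring_closed :: "'a::ring_1 set \<Rightarrow> bool" where
  "ring_closed R \<longleftrightarrow> 1 \<in> R \<and> (\<forall>x\<in>R. \<forall>y\<in>R. x + y \<in> R \<and> x * y \<in> R) \<and> (\<forall>x\<in>R. - x \<in> R)"

context
  fixes R :: "'a::real_algebra_1 set"
  assumes R: "ring_closed R"
begin

lemma rc_1: "1 \<in> R" and rc_add: "x \<in> R \<Longrightarrow> y \<in> R \<Longrightarrow> x + y \<in> R"
  and rc_mult: "x \<in> R \<Longrightarrow> y \<in> R \<Longrightarrow> x * y \<in> R" and rc_minus: "x \<in> R \<Longrightarrow> - x \<in> R"
  using R by (auto simp: ring_closed_def)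

lemma rc_diff: "x \<in> R \<Longrightarrow> y \<in> R \<Longrightarrow> x - y \<in> R"
  using rc_add[of x "- y"] rc_minus[of y] by simp

lemma rc_0: "0 \<in> R"
  using rc_diff[OF rc_1 rc_1] by simp

lemma rc_sum: "(\<And>i. i \<in> I \<Longrightarrow> u i \<in> R) \<Longrightarrow> sum u I \<in> R"
  by (induction I rule: infinite_finite_induct) (auto intro: rc_0 rc_add)

text \<open>
  Pascal's rule expresses the binomials of \<open>h + 1\<close> through those of \<open>h\<close>, and conversely by
  induction on the lower index.
\<close>

lemma bin_shift_mem:
  assumes "\<And>n. bin h n \<in> R"
  shows "bin (h + of_int c) n \<in> R"
proof (induction c arbitrary: n rule: int_induct[where k = 0])
  case base thus ?case using assms by simp
next
  case (step1 c)
  have e: "h + of_int (c + 1) = (h + of_int c) + 1" by simp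
  show ?case unfolding e
  proof (cases n)
    case (Suc k)
    show "bin ((h + of_int c) + 1) n \<in> R"
      unfolding Suc bin_pascal by (intro rc_add step1)
  qed (simp add: rc_1)
next
  case (step2 c)
  show ?case
  proof (induction n)
    case (Suc n)
    have e: "h + of_int c = (h + of_int (c - 1)) + 1" by simp
    have "bin (h + of_int (c - 1)) (Suc n) = bin (h + of_int c) (Suc n) - bin (h + of_int (c - 1)) n"
      unfolding e bin_pascal by (simp del: bin.simps)
    thus ?case using step2(2) Suc rc_diff by metis
  qed (simp add: rc_1)
qed

text \<open>
  The divided powers of the end of a string: the generating series \<open>E\<close> of the divided powers
  of \<open>e\<close> satisfies \<open>E a\<^sub>0 = A E\<close> with \<open>A = \<Sum> a\<^sub>i t\<^sup>i\<close>, hence \<open>E a\<^sub>0\<^sup>n = A\<^sup>n E\<close>,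
  and the leading coefficient of \<open>A\<^sup>n\<close> is the \<open>n\<close>-th power of the last \<open>a\<^sub>i\<close>.
\<close>

lemma string_end_dpow_mem:
  fixes a :: "nat \<Rightarrow> 'a"
  assumes step: "\<And>i. e * a i - a i * e = real (Suc i) *\<^sub>R a (Suc i)"
    and beyond: "\<And>i. i > q \<Longrightarrow> a i = 0"
    and e: "\<And>n. dpow e n \<in> R" and a0: "\<And>n. dpow (a 0) n \<in> R"
  shows "dpow (a q) n \<in> R"
proof -
  have coeff: "dpow e N * a 0 = (\<Sum>i\<le>N. a i * dpow e (N - i))" for N
  proof (induction N)
    case (Suc N)
    have "real (Suc N) *\<^sub>R (dpow e (Suc N) * a 0) = e * (dpow e N * a 0)"
      by (simp only: dpow_Suc mult.assoc[symmetric] mult_scaleR_left)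
    also have "\<dots> = (\<Sum>i\<le>N. e * a i * dpow e (N - i))"
      unfolding Suc sum_distrib_left by (simp only: mult.assoc)
    also have "\<dots> = (\<Sum>i\<le>N. (real (Suc N) - real i) *\<^sub>R (a i * dpow e (Suc N - i)) +
        real (Suc i) *\<^sub>R (a (Suc i) * dpow e (N - i)))"
    proof (intro sum.cong refl)
      fix i assume i: "i \<in> {..N}"
      have "e * dpow e (N - i) = (real (Suc N) - real i) *\<^sub>R dpow e (Suc N - i)"
        using i by (simp add: dpow_Suc Suc_diff_le of_nat_diff algebra_simps)
      moreover have "e * a i = a i * e + real (Suc i) *\<^sub>R a (Suc i)"
        using step[of i] by (simp add: algebra_simps)
      ultimately show "e * a i * dpow e (N - i) = (real (Suc N) - real i) *\<^sub>R (a i * dpow e (Suc N - i)) +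
        real (Suc i) *\<^sub>R (a (Suc i) * dpow e (N - i))"
        by (simp only: distrib_right mult.assoc mult_scaleR_left mult_scaleR_right)
    qed
    also have "\<dots> = (\<Sum>i\<le>Suc N. (real (Suc N) - real i) *\<^sub>R (a i * dpow e (Suc N - i))) +
        (\<Sum>i\<le>Suc N. real i *\<^sub>R (a i * dpow e (Suc N - i)))"
      by (subst (2) sum.atMost_Suc_shift) (simp add: sum.distrib)
    also have "\<dots> = real (Suc N) *\<^sub>R (\<Sum>i\<le>Suc N. a i * dpow e (Suc N - i))"
      unfolding sum.distrib[symmetric] scaleR_sum_right
      by (intro sum.cong refl) (simp add: scaleR_left_distrib[symmetric])
    finally show ?case by (rule scaleR_left_cancel_Suc)
  qed simp
  define E where "E = Abs_fps (dpow e)"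
  define A where "A = Abs_fps a"
  have "E * fps_const (a 0) = A * E"
    by (rule fps_ext) (simp add: E_def A_def coeff fps_mult_nth[of "Abs_fps a"] atLeast0AtMost)
  hence pow: "E * fps_const (a 0) ^ n = A ^ n * E" for n
  proof (induction n)
    case (Suc n)
    thus ?case by (metis mult.assoc power_Suc power_Suc2)
  qed simp
  have coeff': "dpow e N * a 0 ^ n = (\<Sum>i\<le>N. (A ^ n) $ i * dpow e (N - i))" for n N
    using arg_cong[OF pow[of n], of "\<lambda>F. F $ N"]
    by (simp add: fps_const_power E_def fps_mult_nth[of "A ^ n"] atLeast0AtMost)
  have mem: "(1 / fact n) *\<^sub>R (A ^ n) $ N \<in> R" for N
  proof (induction N rule: less_induct)
    case (less N)
    have "(A ^ n) $ N = dpow e N * a 0 ^ n - (\<Sum>i<N. (A ^ n) $ i * dpow e (N - i))"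
      unfolding coeff' by (simp add: lessThan_Suc_atMost[symmetric])
    hence "(1 / fact n) *\<^sub>R (A ^ n) $ N = dpow e N * dpow (a 0) n -
        (\<Sum>i<N. (1 / fact n) *\<^sub>R (A ^ n) $ i * dpow e (N - i))"
      by (simp add: dpow_def[of "a 0"] scaleR_right_diff_distrib scaleR_sum_right)
    also have "\<dots> \<in> R"
      unfolding mult_scaleR_left[symmetric] using less e a0 by (intro rc_diff rc_mult rc_sum) auto
    finally show ?case .
  qed
  \<comment> \<open>\<open>A\<close> is a polynomial of degree at most \<open>q\<close> with leading coefficient \<open>a q\<close>.\<close>
  have lead: "(A ^ n) $ (q * n) = a q ^ n \<and> (\<forall>N > q * n. (A ^ n) $ N = 0)" for n
  proof (induction n)
    case (Suc n)
    have z: "A $ i * (A ^ n) $ (N - i) = 0" if "N \<ge> q + q * n" "i \<noteq> q \<or> N > q + q * n" "i \<le> N" for i N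
    proof (cases "i > q")
      case True thus ?thesis using beyond by (simp add: A_def)
    next
      case False
      hence "N - i > q * n" using that by auto
      thus ?thesis using Suc by simp
    qed
    have "(A ^ Suc n) $ N = (\<Sum>i\<le>N. A $ i * (A ^ n) $ (N - i))" for N
      by (simp add: fps_mult_nth atLeast0AtMost)
    moreover have "(\<Sum>i\<le>q + q * n. A $ i * (A ^ n) $ (q + q * n - i)) =
        (\<Sum>i\<le>q + q * n. if i = q then a q * a q ^ n else 0)"
      by (intro sum.cong refl) (use Suc z[of "q + q * n"] in \<open>auto simp: A_def\<close>)
    moreover have "(\<Sum>i\<le>N. A $ i * (A ^ n) $ (N - i)) = 0" if "N > q + q * n" for N
      by (intro sum.neutral) (use z[of N] that in auto)
    ultimately show ?case by simp
  qed simp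
  show ?thesis using mem[of "q * n"] lead by (simp add: dpow_def)
qed

end

section \<open>Root vectors and Cartan integers\<close>

context complex_lie_algebra
begin

lemma br_0_left [simp]: "br 0 y = 0" and br_0_right [simp]: "br x 0 = 0"
  using br_add_left[of 0 0 y] br_add_right[of x 0 0] by auto

lemma br_minus_right: "br x (- y) = - br x y"
  using br_add_right[of x y "- y"] by (simp add: eq_neg_iff_add_eq_0 add.commute)

lemma br_antisym: "br x y = - br y x"
proof -
  have "br (x + y) (x + y) = br x y + br y x"
    unfolding br_add_left br_add_right by (simp add: br_self)
  thus ?thesis by (simp add: br_self eq_neg_iff_add_eq_0)
qed

lemma jacobi_derivation: "br x (br y z) = br (br x y) z + br y (br x z)"
proof -
  have "br x (br y z) = - br y (br z x) - br z (br x y)"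
    using jacobi[of x y z] by (simp add: eq_neg_iff_add_eq_0 algebra_simps)
  moreover have "br y (br z x) = - br y (br x z)" by (subst br_antisym[of z x]) (rule br_minus_right)
  moreover have "br z (br x y) = - br (br x y) z" by (rule br_antisym)
  ultimately show ?thesis by simp
qed

lemma root_space_subspace: "subspace (root_space H \<mu>)"
  unfolding subspace_def root_space_def
  by (auto simp: br_add_right br_scale_right scale_right_distrib scale_left_commute)

lemma root_space_br:
  assumes "x \<in> root_space H \<alpha>" "y \<in> root_space H \<beta>"
  shows "br x y \<in> root_space H (\<lambda>t. \<alpha> t + \<beta> t)"
  using assms by (auto simp: root_space_def jacobi_derivation[of _ x y] br_scale_left br_scale_right
      scale_left_distrib)

end

context chevalley_setup
begin

definition Rp :: "('g \<Rightarrow> complex) set" where "Rp = pos_roots H P"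
definition R :: "('g \<Rightarrow> complex) set" where "R = roots H"
definition ng :: "('g \<Rightarrow> complex) \<Rightarrow> 'g \<Rightarrow> complex" where "ng \<alpha> = (\<lambda>t. - \<alpha> t)"

text \<open>
  The \<open>\<beta>\<close>-string through \<open>\<alpha>\<close>, with an integer parameter so that both directions are treated
  alike.
\<close>

definition str :: "('g \<Rightarrow> complex) \<Rightarrow> ('g \<Rightarrow> complex) \<Rightarrow> int \<Rightarrow> 'g \<Rightarrow> complex" where
  "str \<alpha> \<beta> j = (\<lambda>t. \<alpha> t + of_int j * \<beta> t)"

text \<open>
  For negative roots the Chevalley basis indexes the root vector by the opposite root.
\<close>

definition xv :: "('g \<Rightarrow> complex) \<Rightarrow> 'g" where
  "xv \<alpha> = (if \<alpha> \<in> Rp then e \<alpha> else f (ng \<alpha>))"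
definition Bas :: "'g set" where "Bas = e ` Rp \<union> f ` Rp \<union> h ` P"

lemma ng_ng [simp]: "ng (ng \<alpha>) = \<alpha>" by (simp add: ng_def)
lemma ng_apply: "ng \<alpha> t = - \<alpha> t" by (simp add: ng_def)
lemma str_apply: "str \<alpha> \<beta> j t = \<alpha> t + of_int j * \<beta> t" by (simp add: str_def)
lemma str_0 [simp]: "str \<alpha> \<beta> 0 = \<alpha>" by (simp add: str_def)
lemma str_str [simp]: "str (str \<alpha> \<beta> i) \<beta> j = str \<alpha> \<beta> (i + j)"
  by (simp add: str_def algebra_simps)
lemma ng_str: "ng (str \<alpha> \<beta> j) = str (ng \<alpha>) (ng \<beta>) j" by (simp add: str_def ng_def fun_eq_iff)
lemma str_ng: "str \<alpha> (ng \<beta>) j = str \<alpha> \<beta> (- j)" by (simp add: str_def ng_def)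

lemma chevalley:
  "independent Bas" "span Bas = UNIV" "inj_on h P"
  "\<And>\<alpha>. \<alpha> \<in> Rp \<Longrightarrow> e \<alpha> \<in> root_space H \<alpha>"
  "\<And>\<alpha>. \<alpha> \<in> Rp \<Longrightarrow> f \<alpha> \<in> root_space H (ng \<alpha>)"
  "\<And>\<alpha>. \<alpha> \<in> Rp \<Longrightarrow> is_coroot H \<alpha> (br (e \<alpha>) (f \<alpha>))"
  "\<And>\<beta>. \<beta> \<in> P \<Longrightarrow> h \<beta> = br (e \<beta>) (f \<beta>)"
  using chevalley_basis unfolding chevalley_basis_def Let_def Rp_def[symmetric] Bas_def[symmetric] ng_def
  by auto

lemma chevalley_structure:
  assumes "\<alpha> \<in> R" "\<beta> \<in> R" "(\<lambda>t. \<alpha> t + \<beta> t) \<in> R"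
  shows "\<exists>s\<in>{1, -1}. br (xv \<alpha>) (xv \<beta>) =
    scale (s * of_nat ((GREATEST r::nat. (\<lambda>t. \<beta> t - of_nat r * \<alpha> t) \<in> R) + 1)) (xv (\<lambda>t. \<alpha> t + \<beta> t))"
  using chevalley_basis assms
  unfolding chevalley_basis_def Let_def Rp_def[symmetric] R_def[symmetric] xv_def[abs_def] ng_def
  by blast

lemma basis:
  "finite P" "P \<subseteq> R"
  "\<And>c. (\<And>t. (\<Sum>\<beta>\<in>P. c \<beta> * \<beta> t) = 0) \<Longrightarrow> \<beta> \<in> P \<Longrightarrow> c \<beta> = 0"
  "\<And>\<alpha>. \<alpha> \<in> R \<Longrightarrow> nonneg_combination P \<alpha> \<or> nonneg_combination P (ng \<alpha>)"
  using root_basis unfolding root_basis_def R_def[symmetric] ng_def by (blast+)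

lemma R_dual: "\<alpha> \<in> R \<Longrightarrow> \<alpha> \<in> dual H" and R_nonzero: "\<alpha> \<in> R \<Longrightarrow> \<exists>t\<in>H. \<alpha> t \<noteq> 0"
  by (auto simp: R_def roots_def)

lemma RI: "\<mu> \<in> dual H \<Longrightarrow> t \<in> H \<Longrightarrow> \<mu> t \<noteq> 0 \<Longrightarrow> x \<in> root_space H \<mu> \<Longrightarrow> x \<noteq> 0 \<Longrightarrow> \<mu> \<in> R"
  by (auto simp: R_def roots_def)

lemma H_sub: "subspace H" and H_self_norm: "(\<And>y. y \<in> H \<Longrightarrow> br x y \<in> H) \<Longrightarrow> x \<in> H"
  using cartan by (auto simp: cartan_subalgebra_def)

lemma dual_str: "\<alpha> \<in> dual H \<Longrightarrow> \<beta> \<in> dual H \<Longrightarrow> str \<alpha> \<beta> j \<in> dual H"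
  by (auto simp: dual_def str_def algebra_simps)

lemma dual_ng: "\<alpha> \<in> dual H \<Longrightarrow> ng \<alpha> \<in> dual H"
  by (auto simp: dual_def ng_def)

lemma dual_eqI: "\<alpha> \<in> dual H \<Longrightarrow> \<beta> \<in> dual H \<Longrightarrow> (\<And>t. t \<in> H \<Longrightarrow> \<alpha> t = \<beta> t) \<Longrightarrow> \<alpha> = \<beta>"
proof (rule ext)
  fix x assume "\<alpha> \<in> dual H" "\<beta> \<in> dual H" "\<And>t. t \<in> H \<Longrightarrow> \<alpha> t = \<beta> t"
  thus "\<alpha> x = \<beta> x" by (cases "x \<in> H") (simp_all add: dual_def)
qed

lemma Rp_R: "\<alpha> \<in> Rp \<Longrightarrow> \<alpha> \<in> R"
  by (simp add: Rp_def R_def pos_roots_def)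

lemma Rp_iff: "\<alpha> \<in> Rp \<longleftrightarrow> \<alpha> \<in> R \<and> nonneg_combination P \<alpha>"
  by (simp add: Rp_def R_def pos_roots_def)

lemma independent_coeffs:
  assumes "\<And>t. (\<Sum>\<beta>\<in>P. c \<beta> * \<beta> t) = (\<Sum>\<beta>\<in>P. d \<beta> * \<beta> t)" "\<beta> \<in> P"
  shows "c \<beta> = (d \<beta> :: complex)"
  using basis(3)[of "\<lambda>\<beta>. c \<beta> - d \<beta>" \<beta>] assms by (simp add: left_diff_distrib sum_subtractf)

lemma not_both_nonneg:
  assumes "\<alpha> \<in> R" "nonneg_combination P \<alpha>" shows "\<not> nonneg_combination P (ng \<alpha>)"
proof
  assume "nonneg_combination P (ng \<alpha>)"
  then obtain m :: "('g \<Rightarrow> complex) \<Rightarrow> nat" where m: "\<And>t. - \<alpha> t = (\<Sum>\<beta>\<in>P. of_nat (m \<beta>) * \<beta> t)"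
    unfolding nonneg_combination_def ng_def by blast
  obtain n :: "('g \<Rightarrow> complex) \<Rightarrow> nat" where n: "\<And>t. \<alpha> t = (\<Sum>\<beta>\<in>P. of_nat (n \<beta>) * \<beta> t)"
    using assms(2) unfolding nonneg_combination_def by blast
  have "of_nat (n \<beta> + m \<beta>) = (0 :: complex)" if "\<beta> \<in> P" for \<beta>
  proof (rule basis(3)[OF _ that])
    fix t
    have "(\<Sum>\<beta>\<in>P. of_nat (n \<beta> + m \<beta>) * \<beta> t) = (\<Sum>\<beta>\<in>P. of_nat (n \<beta>) * \<beta> t) + (\<Sum>\<beta>\<in>P. of_nat (m \<beta>) * \<beta> t)"
      by (simp add: sum.distrib algebra_simps)
    thus "(\<Sum>\<beta>\<in>P. of_nat (n \<beta> + m \<beta>) * \<beta> t) = 0" by (simp add: m[symmetric] n[symmetric])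
  qed
  hence "n \<beta> = 0" if "\<beta> \<in> P" for \<beta> using that by (metis add_is_0 of_nat_eq_0_iff)
  hence "\<alpha> t = 0" for t by (simp add: n)
  thus False using R_nonzero assms(1) by blast
qed

lemma Rp_ng: "\<alpha> \<in> Rp \<Longrightarrow> ng \<alpha> \<in> R" and ng_notin_Rp: "\<alpha> \<in> Rp \<Longrightarrow> ng \<alpha> \<notin> Rp"
proof -
  assume a: "\<alpha> \<in> Rp"
  obtain t where t: "t \<in> H" "\<alpha> t \<noteq> 0" using R_nonzero Rp_R a by blast
  have "f \<alpha> \<noteq> 0" using chevalley(1) a dependent_zero by (auto simp: Bas_def)
  thus "ng \<alpha> \<in> R"
    using chevalley(5)[OF a] t a by (intro RI[of _ t "f \<alpha>"]) (auto simp: ng_def intro: dual_ng[unfolded ng_def] R_dual Rp_R)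
  show "ng \<alpha> \<notin> Rp" using not_both_nonneg a by (auto simp: Rp_iff)
qed

lemma span_weights:
  assumes "\<And>b. b \<in> Bas \<Longrightarrow> br t b = scale (w b) b"
  shows "representation Bas (br t x) b = w b * representation Bas x b"
proof -
  have "x \<in> span Bas" using chevalley(2) by simp
  thus ?thesis
  proof (induction rule: span_induct_alt)
    case base
    show ?case by (simp add: representation_zero)
  next
    case (step c v y)
    have s: "span Bas = UNIV" by (rule chevalley)
    note r = representation_add[OF chevalley(1)] representation_scale[OF chevalley(1)]
    have "representation Bas (scale c (scale (w v) v)) b = w b * representation Bas (scale c v) b"
      using step(1) by (simp add: s r representation_basis[OF chevalley(1)])
    thus ?case using step assms
      by (simp add: br_add_right br_scale_right s r algebra_simps)
  qed
qed

lemma h_centralizes: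
  assumes "x \<in> root_space H \<alpha>" "y \<in> root_space H (ng \<alpha>)" "t \<in> H"
  shows "br t (br x y) = 0"
  using root_space_br[OF assms(1,2)] assms(3) by (simp add: root_space_def ng_def)

lemma basis_weights:
  assumes "b \<in> Bas"
  shows "(\<exists>\<alpha>\<in>R. b = xv \<alpha> \<and> b \<in> root_space H \<alpha>) \<or> (\<forall>t\<in>H. br t b = 0)"
proof -
  consider (e) \<alpha> where "\<alpha> \<in> Rp" "b = e \<alpha>" | (f) \<alpha> where "\<alpha> \<in> Rp" "b = f \<alpha>" | (h) \<beta> where "\<beta> \<in> P" "b = h \<beta>"
    using assms unfolding Bas_def by auto
  thus ?thesis
  proof cases
    case e thus ?thesis using chevalley(4)[of \<alpha>] Rp_R by (auto simp: xv_def)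
  next
    case f
    hence "ng \<alpha> \<in> R" "b = xv (ng \<alpha>)" "b \<in> root_space H (ng \<alpha>)"
      using Rp_ng ng_notin_Rp chevalley(5)[of \<alpha>] by (auto simp: xv_def)
    thus ?thesis by blast
  next
    case h
    have "nonneg_combination P \<beta>"
      unfolding nonneg_combination_def using h basis(1)
      by (intro exI[of _ "\<lambda>\<gamma>. if \<gamma> = \<beta> then 1 else 0"]) (simp add: if_distrib[of of_nat] if_distrib[of "\<lambda>x. x * _"] cong: if_cong)
    hence "\<beta> \<in> Rp" using h basis(2) Rp_iff by blast
    thus ?thesis using h chevalley(4,5,7) h_centralizes by metis
  qed
qed

lemma P_Rp: "\<beta> \<in> P \<Longrightarrow> \<beta> \<in> Rp"
  unfolding Rp_iff nonneg_combination_def using basis(1,2)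
  by (intro conjI exI[of _ "\<lambda>\<gamma>. if \<gamma> = \<beta> then 1 else 0"]) (auto simp: if_distrib[of of_nat] if_distrib[of "\<lambda>x. x * _"] cong: if_cong)

text \<open>Distinct basis vectors outside \<open>H\<close> have distinct weights, so root spaces are lines.\<close>

lemma root_space_basis:
  assumes "\<alpha> \<in> R" "x \<in> root_space H \<alpha>" "representation Bas x b \<noteq> 0"
  shows "b = xv \<alpha>" "b \<in> root_space H \<alpha>"
proof -
  have b: "b \<in> Bas" using assms(3) representation_ne_zero by metis
  define w where "w b' = (if \<exists>\<gamma>\<in>R. b' = xv \<gamma> \<and> b' \<in> root_space H \<gamma> then
    (SOME \<gamma>. \<gamma> \<in> R \<and> b' = xv \<gamma> \<and> b' \<in> root_space H \<gamma>) else (\<lambda>t. 0))" for b'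
  have w: "(\<exists>\<gamma>\<in>R. w b' = \<gamma> \<and> b' = xv \<gamma> \<and> b' \<in> root_space H \<gamma>) \<or> (w b' = (\<lambda>t. 0) \<and> (\<forall>t\<in>H. br t b' = 0))"
    if "b' \<in> Bas" for b'
  proof (cases "\<exists>\<gamma>\<in>R. b' = xv \<gamma> \<and> b' \<in> root_space H \<gamma>")
    case True
    hence "\<exists>\<gamma>. \<gamma> \<in> R \<and> b' = xv \<gamma> \<and> b' \<in> root_space H \<gamma>" by blast
    from someI_ex[OF this] show ?thesis using True unfolding w_def by auto
  next
    case False
    thus ?thesis using basis_weights[OF that] unfolding w_def by auto
  qed
  have act: "br t b' = scale (w b' t) b'" if "t \<in> H" "b' \<in> Bas" for t b'
    using w[OF that(2)] that(1) by (auto simp: root_space_def)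
  have eq: "w b t = \<alpha> t" if "t \<in> H" for t
  proof -
    have "representation Bas (br t x) b = w b t * representation Bas x b"
      by (rule span_weights) (rule act[OF that])
    moreover have "br t x = scale (\<alpha> t) x" using assms(2) that by (simp add: root_space_def)
    ultimately show ?thesis
      using assms(3) chevalley(2) by (simp add: representation_scale[OF chevalley(1)])
  qed
  obtain t where t: "t \<in> H" "\<alpha> t \<noteq> 0" using R_nonzero assms(1) by blast
  hence "w b \<noteq> (\<lambda>t. 0)" using eq[of t] by metis
  then obtain \<gamma> where g: "\<gamma> \<in> R" "w b = \<gamma>" "b = xv \<gamma>" "b \<in> root_space H \<gamma>" using w[OF b] by blast
  hence "\<gamma> = \<alpha>" using eq assms(1) by (intro dual_eqI R_dual) auto
  thus "b = xv \<alpha>" "b \<in> root_space H \<alpha>" using g by auto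
qed

lemma root_vector:
  assumes "\<alpha> \<in> R" shows "xv \<alpha> \<in> Bas" "xv \<alpha> \<in> root_space H \<alpha>" "xv \<alpha> \<noteq> 0"
proof -
  have "0 \<in> root_space H \<alpha>" using root_space_subspace subspace_0 by blast
  then obtain x where x: "x \<in> root_space H \<alpha>" "x \<noteq> 0"
    using assms unfolding R_def roots_def by auto
  have "x \<in> span Bas" using chevalley(2) by simp
  hence "(\<Sum>b | representation Bas x b \<noteq> 0. scale (representation Bas x b) b) = x"
    by (rule sum_nonzero_representation_eq[OF chevalley(1)])
  then obtain b where b: "representation Bas x b \<noteq> 0" using x(2)
    by (metis (mono_tags, lifting) mem_Collect_eq sum.neutral)
  show B: "xv \<alpha> \<in> Bas" using root_space_basis[OF assms x(1) b] representation_ne_zero b by metis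
  show "xv \<alpha> \<in> root_space H \<alpha>" using root_space_basis[OF assms x(1) b] by simp
  show "xv \<alpha> \<noteq> 0" using B chevalley(1) dependent_zero by metis
qed

lemma root_space_line:
  assumes "\<alpha> \<in> R" "x \<in> root_space H \<alpha>" shows "\<exists>c. x = scale c (xv \<alpha>)"
proof -
  have "x \<in> span Bas" using chevalley(2) by simp
  hence "x = (\<Sum>b | representation Bas x b \<noteq> 0. scale (representation Bas x b) b)"
    by (simp add: sum_nonzero_representation_eq[OF chevalley(1)])
  also have "\<dots> = (\<Sum>b\<in>{xv \<alpha>}. scale (representation Bas x b) b)"
    using root_space_basis[OF assms] by (intro sum.mono_neutral_left) auto
  finally show ?thesis by auto
qed

text \<open>
  If \<open>\<alpha>\<close> is not positive, then its root vector is a member of the Chevalley basis, and comparison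
  of weights leaves only some \<open>f\<^sub>\<gamma>\<close> with \<open>\<gamma> = -\<alpha>\<close>.
\<close>

lemma R_ng: assumes "\<alpha> \<in> R" shows "ng \<alpha> \<in> R"
proof (cases "\<alpha> \<in> Rp")
  case True thus ?thesis by (rule Rp_ng)
next
  case False
  hence b: "f (ng \<alpha>) \<in> Bas" and rs: "f (ng \<alpha>) \<in> root_space H \<alpha>"
    using root_vector[OF assms] by (auto simp: xv_def)
  from b consider (e) \<gamma> where "\<gamma> \<in> Rp" "f (ng \<alpha>) = e \<gamma>" | (f) \<gamma> where "\<gamma> \<in> Rp" "f (ng \<alpha>) = f \<gamma>"
    | (h) \<gamma> where "\<gamma> \<in> P" "f (ng \<alpha>) = h \<gamma>" unfolding Bas_def by auto
  thus ?thesis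
  proof cases
    case e
    have "\<alpha> t = \<gamma> t" if "t \<in> H" for t
      using rs chevalley(4)[OF e(1)] e(2) that root_vector(3)[OF assms] False
      by (auto simp: root_space_def xv_def dest: scale_right_imp_eq)
    hence "\<alpha> = \<gamma>" using e assms Rp_R by (intro dual_eqI R_dual) auto
    thus ?thesis using e False by simp
  next
    case f
    have "\<alpha> t = ng \<gamma> t" if "t \<in> H" for t
      using rs chevalley(5)[OF f(1)] f(2) that root_vector(3)[OF assms] False
      by (auto simp: root_space_def xv_def dest: scale_right_imp_eq)
    hence "\<alpha> = ng \<gamma>" using f assms Rp_R Rp_ng by (intro dual_eqI R_dual) auto
    thus ?thesis using f Rp_R by simp
  next
    case h
    obtain t where t: "t \<in> H" "\<alpha> t \<noteq> 0" using R_nonzero assms by blast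
    have "br t (h \<gamma>) = 0" using h P_Rp chevalley(4,5,7) h_centralizes t by metis
    hence "scale (\<alpha> t) (h \<gamma>) = 0" using rs h t by (simp add: root_space_def)
    thus ?thesis using t h root_vector(3)[OF assms] False by (simp add: xv_def)
  qed
qed

lemma R_ng_iff [simp]: "ng \<alpha> \<in> R \<longleftrightarrow> \<alpha> \<in> R"
  using R_ng[of \<alpha>] R_ng[of "ng \<alpha>"] by auto

lemma R_cases: "\<alpha> \<in> R \<Longrightarrow> \<alpha> \<in> Rp \<or> ng \<alpha> \<in> Rp"
  using basis(4)[of \<alpha>] by (auto simp: Rp_iff)

lemma finite_R: "finite R"
proof -
  obtain B where "finite B" "span B = UNIV" using finite_dimensional by blast
  hence "finite Bas" using independent_span_bound[of B Bas] chevalley(1) by simp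
  moreover have "inj_on xv R"
  proof (rule inj_onI)
    fix \<alpha> \<beta> assume h: "\<alpha> \<in> R" "\<beta> \<in> R" "xv \<alpha> = xv \<beta>"
    have "\<alpha> t = \<beta> t" if "t \<in> H" for t
      using root_vector[OF h(1)] root_vector[OF h(2)] h(3) that
      by (auto simp: root_space_def dest: scale_right_imp_eq)
    thus "\<alpha> = \<beta>" using h by (intro dual_eqI R_dual) auto
  qed
  moreover have "xv ` R \<subseteq> Bas" using root_vector by auto
  ultimately show ?thesis by (meson finite_imageD finite_subset)
qed

definition coroot :: "('g \<Rightarrow> complex) \<Rightarrow> 'g" where "coroot \<alpha> = br (xv \<alpha>) (xv (ng \<alpha>))"

lemma coroot_ng: "coroot (ng \<alpha>) = - coroot \<alpha>"
  unfolding coroot_def by (subst br_antisym) simp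

lemma coroot_H: assumes "\<alpha> \<in> R" shows "coroot \<alpha> \<in> H"
proof (rule H_self_norm)
  fix y assume "y \<in> H"
  hence "br y (coroot \<alpha>) = 0"
    unfolding coroot_def using h_centralizes root_vector assms R_ng by blast
  hence "br (coroot \<alpha>) y = 0" using br_antisym[of "coroot \<alpha>" y] by simp
  thus "br (coroot \<alpha>) y \<in> H" using H_sub subspace_0 by simp
qed

lemma dual_minus: "\<mu> \<in> dual H \<Longrightarrow> t \<in> H \<Longrightarrow> \<mu> (- t) = - \<mu> t"
proof -
  assume a: "\<mu> \<in> dual H" "t \<in> H"
  hence "\<mu> (scale (- 1) t) = - 1 * \<mu> t" unfolding dual_def by blast
  thus ?thesis by simp
qed

lemma coroot_Rp: "\<alpha> \<in> Rp \<Longrightarrow> coroot \<alpha> = br (e \<alpha>) (f \<alpha>)"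
  using ng_notin_Rp by (simp add: coroot_def xv_def)

lemma coroot_P: "\<beta> \<in> P \<Longrightarrow> coroot \<beta> = h \<beta>"
  using P_Rp coroot_Rp chevalley(7) by simp

lemma root_coroot: assumes "\<alpha> \<in> R" shows "\<alpha> (coroot \<alpha>) = 2"
proof -
  have pos: "\<alpha> (coroot \<alpha>) = 2" if "\<alpha> \<in> Rp" for \<alpha>
    using chevalley(6)[OF that] coroot_Rp[OF that] by (simp add: is_coroot_def)
  show ?thesis
  proof (cases "\<alpha> \<in> Rp")
    case False
    hence "ng \<alpha> (coroot (ng \<alpha>)) = 2" using R_cases assms pos by blast
    thus ?thesis using dual_minus[OF R_dual[OF assms] coroot_H[OF assms]] by (simp add: coroot_ng ng_apply)
  qed (rule pos)
qed

lemma br_coroot: "\<alpha> \<in> R \<Longrightarrow> x \<in> root_space H \<mu> \<Longrightarrow> br (coroot \<alpha>) x = scale (\<mu> (coroot \<alpha>)) x"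
  using coroot_H by (simp add: root_space_def)

lemma br_roots_zero:
  assumes "\<alpha> \<in> R" "\<beta> \<in> R" "str \<beta> \<alpha> 1 \<notin> R" "\<beta> \<noteq> ng \<alpha>"
  shows "br (xv \<alpha>) (xv \<beta>) = 0"
proof (rule ccontr)
  assume n: "br (xv \<alpha>) (xv \<beta>) \<noteq> 0"
  have s: "(\<lambda>t. \<alpha> t + \<beta> t) = str \<beta> \<alpha> 1" by (simp add: str_def add.commute)
  have d: "str \<beta> \<alpha> 1 \<in> dual H" using assms R_dual dual_str by blast
  have "\<exists>t\<in>H. str \<beta> \<alpha> 1 t \<noteq> 0"
  proof (rule ccontr)
    assume "\<not> ?thesis"
    hence "\<beta> t = ng \<alpha> t" if "t \<in> H" for t
      using that by (auto simp: str_def ng_def eq_neg_iff_add_eq_0)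
    hence "\<beta> = ng \<alpha>" using assms R_dual dual_ng by (intro dual_eqI) auto
    thus False using assms by simp
  qed
  then obtain t where "t \<in> H" "str \<beta> \<alpha> 1 t \<noteq> 0" by blast
  hence "str \<beta> \<alpha> 1 \<in> R"
    using RI[OF d] n root_space_br[OF root_vector(2)[OF assms(1)] root_vector(2)[OF assms(2)]] by (simp add: s)
  thus False using assms by simp
qed

lemma br_roots_int:
  assumes "\<alpha> \<in> R" "\<beta> \<in> R" "str \<beta> \<alpha> 1 \<in> R"
  shows "\<exists>s\<in>{1, -1}. br (xv \<alpha>) (xv \<beta>) =
    scale (s * of_nat ((GREATEST r::nat. str \<beta> \<alpha> (- int r) \<in> R) + 1)) (xv (str \<beta> \<alpha> 1))"
proof -
  have "(\<lambda>t. \<alpha> t + \<beta> t) = str \<beta> \<alpha> 1" by (simp add: str_def add.commute)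
  moreover have "(\<lambda>t. \<beta> t - of_nat r * \<alpha> t) = str \<beta> \<alpha> (- int r)" for r by (simp add: str_def)
  ultimately show ?thesis using chevalley_structure[OF assms(1,2)] assms(3) by simp
qed

lemma br_roots_int':
  assumes "\<alpha> \<in> R" "\<beta> \<in> R" "\<beta> \<noteq> ng \<alpha>"
  shows "\<exists>z::int. br (xv \<alpha>) (xv \<beta>) = scale (of_int z) (xv (str \<beta> \<alpha> 1)) \<and> (z = 0 \<longleftrightarrow> str \<beta> \<alpha> 1 \<notin> R)"
proof (cases "str \<beta> \<alpha> 1 \<in> R")
  case True
  then obtain s r where s: "s \<in> {1, -1 :: complex}" "br (xv \<alpha>) (xv \<beta>) = scale (s * of_nat (r + 1)) (xv (str \<beta> \<alpha> 1))"
    using br_roots_int assms by blast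
  define z where "z = (if s = 1 then int r + 1 else - int r - 1)"
  have "s * of_nat (r + 1) = of_int z" "z \<noteq> 0" using s(1) by (auto simp: z_def)
  thus ?thesis using True s(2) by (intro exI[of _ z]) simp
next
  case False
  thus ?thesis using br_roots_zero assms by (intro exI[of _ 0]) simp
qed

text \<open>
  By the Jacobi identity \<open>[h\<^sub>\<beta>, x\<^sub>\<alpha>]\<close> is the difference of \<open>[x\<^sub>\<beta>, [x\<^sub>-\<^sub>\<beta>, x\<^sub>\<alpha>]]\<close> and \<open>[x\<^sub>-\<^sub>\<beta>, [x\<^sub>\<beta>, x\<^sub>\<alpha>]]\<close>.
  Both are integral multiples of \<open>x\<^sub>\<alpha>\<close>, since the structure constants are integers.
\<close>

lemma cartan_integer:
  assumes "\<alpha> \<in> R" "\<beta> \<in> R" shows "\<exists>z::int. \<alpha> (coroot \<beta>) = of_int z"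
proof -
  consider "\<alpha> = \<beta>" | "\<alpha> = ng \<beta>" | "\<alpha> \<noteq> \<beta>" "\<alpha> \<noteq> ng \<beta>" by blast
  thus ?thesis
  proof cases
    case 1 thus ?thesis using root_coroot assms by (intro exI[of _ 2]) simp
  next
    case 2 thus ?thesis using root_coroot assms by (intro exI[of _ "-2"]) (simp add: ng_apply)
  next
    case 3
    have down: "\<exists>z::int. br (xv \<beta>) (br (xv (ng \<beta>)) (xv \<alpha>)) = scale (of_int z) (xv \<alpha>)"
      if b: "\<beta> \<in> R" "\<alpha> \<noteq> \<beta>" "\<alpha> \<noteq> ng \<beta>" for \<beta>
    proof -
      obtain z :: int where z: "br (xv (ng \<beta>)) (xv \<alpha>) = scale (of_int z) (xv (str \<alpha> (ng \<beta>) 1))"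
        "z = 0 \<longleftrightarrow> str \<alpha> (ng \<beta>) 1 \<notin> R"
        using br_roots_int'[of "ng \<beta>" \<alpha>] assms b by auto
      show ?thesis
      proof (cases "z = 0")
        case True thus ?thesis using z by (intro exI[of _ 0]) simp
      next
        case False
        hence r: "str \<alpha> (ng \<beta>) 1 \<in> R" using z by simp
        have "str \<alpha> (ng \<beta>) 1 \<noteq> ng \<beta>"
        proof
          assume "str \<alpha> (ng \<beta>) 1 = ng \<beta>"
          hence "str \<alpha> (ng \<beta>) 1 t = ng \<beta> t" for t by simp
          hence "\<alpha> t = 0" for t by (simp add: str_def ng_def)
          thus False using R_nonzero assms by blast
        qed
        then obtain y :: int where "br (xv \<beta>) (xv (str \<alpha> (ng \<beta>) 1)) = scale (of_int y) (xv (str (str \<alpha> (ng \<beta>) 1) \<beta> 1))"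
          using br_roots_int'[OF b(1) r] by blast
        moreover have "str (str \<alpha> (ng \<beta>) 1) \<beta> 1 = \<alpha>" by (simp add: str_ng)
        ultimately show ?thesis using z by (intro exI[of _ "z * y"]) (simp add: br_scale_right)
      qed
    qed
    obtain y where y: "br (xv \<beta>) (br (xv (ng \<beta>)) (xv \<alpha>)) = scale (of_int y) (xv \<alpha>)" using down assms 3 by blast
    obtain z where z: "br (xv (ng \<beta>)) (br (xv \<beta>) (xv \<alpha>)) = scale (of_int z) (xv \<alpha>)"
      using down[of "ng \<beta>"] assms 3 by auto
    have "br (coroot \<beta>) (xv \<alpha>) = scale (of_int (y - z)) (xv \<alpha>)"
      using jacobi_derivation[of "xv \<beta>" "xv (ng \<beta>)" "xv \<alpha>"] y z
      by (simp add: coroot_def scale_left_diff_distrib algebra_simps)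
    hence "scale (\<alpha> (coroot \<beta>)) (xv \<alpha>) = scale (of_int (y - z)) (xv \<alpha>)"
      using br_coroot[OF assms(2) root_vector(2)[OF assms(1)]] by simp
    thus ?thesis using root_vector(3)[OF assms(1)] scale_right_imp_eq by blast
  qed
qed

end

section \<open>Root strings and the Killing form\<close>

context chevalley_setup
begin

text \<open>
  The vectors \<open>v\<^sub>j = ad(x\<^sub>-\<^sub>\<beta>)\<^sup>j x\<^sub>\<gamma>\<close> satisfy \<open>[x\<^sub>\<beta>, v\<^sub>j\<^sub>+\<^sub>1] = (j + 1) (m - j) v\<^sub>j\<close>, where \<open>m\<close> is the value of \<open>\<gamma>\<close>
  at the coroot of \<open>\<beta>\<close>. Only finitely many weights occur, so some \<open>v\<^sub>j\<close> vanishes. This forces \<open>m\<close>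
  to be a natural number, and the vectors up to \<open>v\<^sub>m\<close> are non-zero.
\<close>

lemma highest_weight:
  assumes b: "\<beta> \<in> R" and g: "\<gamma> \<in> R" and top: "str \<gamma> \<beta> 1 \<notin> R" and ne: "\<gamma> \<noteq> ng \<beta>"
  shows "\<exists>l::nat. \<gamma> (coroot \<beta>) = of_nat l \<and> (\<forall>j\<le>l. str \<gamma> \<beta> (- int j) \<in> R \<or> (\<forall>t\<in>H. str \<gamma> \<beta> (- int j) t = 0))"
proof -
  define m where "m = \<gamma> (coroot \<beta>)"
  define v where "v = rec_nat (xv \<gamma>) (\<lambda>_. br (xv (ng \<beta>)))"
  have v0: "v 0 = xv \<gamma>" and vS: "v (Suc j) = br (xv (ng \<beta>)) (v j)" for j by (simp_all add: v_def)
  have vrs: "v j \<in> root_space H (str \<gamma> \<beta> (- int j))" for j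
  proof (induction j)
    case 0 thus ?case using root_vector g by (simp add: v0)
  next
    case (Suc j)
    have "(\<lambda>t. ng \<beta> t + str \<gamma> \<beta> (- int j) t) = str \<gamma> \<beta> (- int (Suc j))"
      by (simp add: ng_def str_def algebra_simps)
    thus ?case using root_space_br[OF root_vector(2)[OF R_ng[OF b]] Suc] by (simp add: vS)
  qed
  have up: "br (xv \<beta>) (v (Suc j)) = scale (of_nat (Suc j) * (m - of_nat j)) (v j)" for j
  proof -
    have e: "br (xv \<beta>) (v (Suc j)) = br (coroot \<beta>) (v j) + br (xv (ng \<beta>)) (br (xv \<beta>) (v j))" for j
      using jacobi_derivation[of "xv \<beta>" "xv (ng \<beta>)" "v j"] by (simp add: vS coroot_def)
    have hv: "br (coroot \<beta>) (v j) = scale (m - 2 * of_nat j) (v j)" for j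
      using br_coroot[OF b vrs[of j]] root_coroot[OF b] by (simp add: str_def m_def mult.commute)
    show ?thesis
    proof (induction j)
      case 0
      show ?case using br_roots_zero[OF b g top ne] e[of 0] hv[of 0] by (simp add: v0)
    next
      case (Suc j)
      have "br (xv \<beta>) (v (Suc (Suc j))) = scale (m - 2 * of_nat (Suc j)) (v (Suc j)) +
          scale (of_nat (Suc j) * (m - of_nat j)) (v (Suc j))"
        using e[of "Suc j"] hv[of "Suc j"] Suc by (simp add: br_scale_right vS[of j])
      also have "\<dots> = scale ((m - 2 * of_nat (Suc j)) + of_nat (Suc j) * (m - of_nat j)) (v (Suc j))"
        by (simp only: scale_left_distrib)
      also have "(m - 2 * of_nat (Suc j)) + of_nat (Suc j) * (m - of_nat j) = of_nat (Suc (Suc j)) * (m - of_nat (Suc j))"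
        by (simp add: algebra_simps)
      finally show ?case .
    qed
  qed
  have nonzero: "v j \<noteq> 0" if "\<And>i. i < j \<Longrightarrow> m \<noteq> of_nat i" for j
    using that
  proof (induction j)
    case 0 thus ?case using root_vector(3)[OF g] by (simp add: v0)
  next
    case (Suc j)
    have "scale (of_nat (Suc j) * (m - of_nat j)) (v j) \<noteq> 0"
      using Suc.IH Suc.prems[of j] Suc.prems less_SucI by (auto simp del: of_nat_Suc)
    thus ?case using up[of j] by auto
  qed
  have root: "str \<gamma> \<beta> (- int j) \<in> R \<or> (\<forall>t\<in>H. str \<gamma> \<beta> (- int j) t = 0)" if "v j \<noteq> 0" for j
    using RI[OF dual_str[OF R_dual[OF g] R_dual[OF b]] _ _ vrs that] by blast
  have bound: "\<exists>l. m = of_nat l"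
  proof (rule ccontr)
    assume "\<nexists>l. m = of_nat l"
    hence r: "str \<gamma> \<beta> (- int j) \<in> R \<or> (\<forall>t\<in>H. str \<gamma> \<beta> (- int j) t = 0)" for j using nonzero root by blast
    obtain t where t: "t \<in> H" "\<beta> t \<noteq> 0" using R_nonzero b by blast
    have inj: "inj (\<lambda>j. str \<gamma> \<beta> (- int j) t)"
      using t by (auto simp: inj_def str_def)
    have "(\<lambda>j. str \<gamma> \<beta> (- int j) t) ` UNIV \<subseteq> insert 0 ((\<lambda>\<mu>. \<mu> t) ` R)"
    proof
      fix y assume "y \<in> (\<lambda>j. str \<gamma> \<beta> (- int j) t) ` UNIV"
      then obtain j where "y = str \<gamma> \<beta> (- int j) t" by blast
      thus "y \<in> insert 0 ((\<lambda>\<mu>. \<mu> t) ` R)" using r[of j] t(1) by blast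
    qed
    hence "finite (range (\<lambda>j. str \<gamma> \<beta> (- int j) t))"
      by (rule finite_subset) (simp add: finite_R)
    thus False using finite_imageD[OF _ inj] infinite_UNIV_nat by blast
  qed
  then obtain l where l: "m = of_nat l" by blast
  have "str \<gamma> \<beta> (- int j) \<in> R \<or> (\<forall>t\<in>H. str \<gamma> \<beta> (- int j) t = 0)" if "j \<le> l" for j
    using that by (intro root nonzero) (auto simp: l)
  thus ?thesis using l unfolding m_def by blast
qed

text \<open>
  The bracket of a root vector with itself vanishes, but by Chevalley's normalization the
  structure constant of two roots whose sum is a root does not.
\<close>

lemma no_double: assumes "\<beta> \<in> R" shows "str \<beta> \<beta> 1 \<notin> R"
proof
  assume r: "str \<beta> \<beta> 1 \<in> R"
  have "\<beta> \<noteq> ng \<beta>"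
  proof
    assume "\<beta> = ng \<beta>"
    hence "\<beta> (coroot \<beta>) = - \<beta> (coroot \<beta>)" using ng_apply[of \<beta> "coroot \<beta>"] by simp
    thus False using root_coroot[OF assms] by simp
  qed
  then obtain z :: int where z: "br (xv \<beta>) (xv \<beta>) = scale (of_int z) (xv (str \<beta> \<beta> 1))" "z = 0 \<longleftrightarrow> str \<beta> \<beta> 1 \<notin> R"
    using br_roots_int'[OF assms assms] by blast
  thus False using r root_vector(3)[OF r] by (simp add: br_self)
qed

text \<open>
  If \<open>(k + 2) \<beta>\<close> is a root and \<open>(k + 1) \<beta>\<close> is not, then \<open>(k + 2) \<beta>\<close> is a highest weight in the
  direction of \<open>-\<beta>\<close>; but it is negative on the coroot of \<open>-\<beta>\<close>.
\<close>

lemma multiples: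
  assumes b: "\<beta> \<in> R" and k: "(\<lambda>t. of_int k * \<beta> t) \<in> R" shows "k = 1 \<or> k = -1"
proof -
  have pos: False if b: "\<beta> \<in> R" and r: "(\<lambda>t. of_int (int k + 2) * \<beta> t) \<in> R" for k \<beta>
    using r
  proof (induction k)
    case 0
    have "(\<lambda>t. of_int (int 0 + 2) * \<beta> t) = str \<beta> \<beta> 1" by (simp add: str_def)
    thus ?case using 0 no_double b by simp
  next
    case (Suc k)
    let ?\<gamma> = "\<lambda>t. of_int (int (Suc k) + 2) * \<beta> t"
    have s: "str ?\<gamma> (ng \<beta>) 1 = (\<lambda>t. of_int (int k + 2) * \<beta> t)"
      by (simp add: str_def ng_def algebra_simps)
    have n: "str ?\<gamma> (ng \<beta>) 1 \<notin> R" using Suc.IH unfolding s by blast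
    have "?\<gamma> \<noteq> ng (ng \<beta>)"
    proof
      assume "?\<gamma> = ng (ng \<beta>)"
      hence "?\<gamma> (coroot \<beta>) = \<beta> (coroot \<beta>)" unfolding ng_ng by (rule fun_cong)
      hence "of_int ((int (Suc k) + 2) * 2) = (of_int 2 :: complex)" using root_coroot[OF b] by simp
      hence "(int (Suc k) + 2) * 2 = 2" by (simp only: of_int_eq_iff)
      thus False by simp
    qed
    then obtain l :: nat where "?\<gamma> (coroot (ng \<beta>)) = of_nat l"
      using highest_weight[OF R_ng[OF b] Suc.prems n] by blast
    moreover have "\<beta> (coroot (ng \<beta>)) = - 2"
      using root_coroot[OF b] dual_minus[OF R_dual[OF b] coroot_H[OF b]] by (simp add: coroot_ng)
    ultimately have "of_int ((int (Suc k) + 2) * (- 2)) = (of_int (int l) :: complex)" by simp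
    hence "(int (Suc k) + 2) * (- 2) = int l" by (simp only: of_int_eq_iff)
    thus False by simp
  qed
  have "k \<noteq> 0" using R_nonzero[OF k] by auto
  moreover have "\<not> k \<ge> 2" using pos[OF b, of "nat (k - 2)"] k by auto
  moreover have "\<not> k \<le> - 2"
  proof
    assume "k \<le> - 2"
    moreover have "(\<lambda>t. of_int k * \<beta> t) = (\<lambda>t. of_int (- k) * ng \<beta> t)" by (simp add: ng_def)
    ultimately show False using pos[OF R_ng[OF b], of "nat (- k - 2)"] k by auto
  qed
  ultimately show ?thesis by linarith
qed

lemma str_not_multiple:
  assumes "\<alpha> \<in> R" "\<beta> \<in> R" "\<alpha> \<noteq> \<beta>" "\<alpha> \<noteq> ng \<beta>"
  shows "str \<alpha> \<beta> j \<noteq> \<beta>" "str \<alpha> \<beta> j \<noteq> ng \<beta>" "\<exists>t\<in>H. str \<alpha> \<beta> j t \<noteq> 0"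
proof -
  have *: "\<not> (\<forall>t\<in>H. \<alpha> t = of_int k * \<beta> t)" for k
  proof
    assume a: "\<forall>t\<in>H. \<alpha> t = of_int k * \<beta> t"
    have "(\<lambda>t. of_int k * \<beta> t) \<in> dual H" using R_dual[OF assms(2)] by (auto simp: dual_def algebra_simps)
    hence e: "\<alpha> = (\<lambda>t. of_int k * \<beta> t)" using a assms R_dual by (intro dual_eqI) auto
    hence "k = 1 \<or> k = - 1" using multiples assms by metis
    thus False using e assms by (auto simp: ng_def)
  qed
  show "str \<alpha> \<beta> j \<noteq> \<beta>"
  proof
    assume "str \<alpha> \<beta> j = \<beta>"
    hence "\<alpha> t + of_int j * \<beta> t = \<beta> t" for t by (metis str_apply)
    hence "\<alpha> t = of_int (1 - j) * \<beta> t" for t by (simp add: algebra_simps)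
    thus False using * by blast
  qed
  show "str \<alpha> \<beta> j \<noteq> ng \<beta>"
  proof
    assume "str \<alpha> \<beta> j = ng \<beta>"
    hence "\<alpha> t + of_int j * \<beta> t = - \<beta> t" for t by (metis str_apply ng_apply)
    hence "\<alpha> t = of_int (- 1 - j) * \<beta> t" for t by (simp add: algebra_simps)
    thus False using * by blast
  qed
  show "\<exists>t\<in>H. str \<alpha> \<beta> j t \<noteq> 0"
  proof (rule ccontr)
    assume "\<not> ?thesis"
    hence "\<forall>t\<in>H. \<alpha> t + of_int j * \<beta> t = 0" by (simp add: str_apply)
    hence "\<forall>t\<in>H. \<alpha> t = of_int (- j) * \<beta> t" by (simp add: add_eq_0_iff)
    thus False using * by blast
  qed
qed

definition cartan_int :: "('g \<Rightarrow> complex) \<Rightarrow> ('g \<Rightarrow> complex) \<Rightarrow> int" where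
  "cartan_int \<alpha> \<beta> = (THE z. \<alpha> (coroot \<beta>) = of_int z)"

lemma cartan_int: "\<alpha> \<in> R \<Longrightarrow> \<beta> \<in> R \<Longrightarrow> \<alpha> (coroot \<beta>) = of_int (cartan_int \<alpha> \<beta>)"
  using cartan_integer[of \<alpha> \<beta>] unfolding cartan_int_def by (auto intro: theI2)

lemma cartan_int_eqI: "\<alpha> (coroot \<beta>) = of_int z \<Longrightarrow> cartan_int \<alpha> \<beta> = z"
  unfolding cartan_int_def by auto

lemma cartan_int_self: "\<beta> \<in> R \<Longrightarrow> cartan_int \<beta> \<beta> = 2"
  by (rule cartan_int_eqI) (simp add: root_coroot)

lemma cartan_int_ng_left: "\<alpha> \<in> R \<Longrightarrow> \<beta> \<in> R \<Longrightarrow> cartan_int (ng \<alpha>) \<beta> = - cartan_int \<alpha> \<beta>"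
  by (rule cartan_int_eqI) (simp add: ng_apply cartan_int)

lemma cartan_int_ng_right: "\<alpha> \<in> R \<Longrightarrow> \<beta> \<in> R \<Longrightarrow> cartan_int \<alpha> (ng \<beta>) = - cartan_int \<alpha> \<beta>"
  by (rule cartan_int_eqI) (simp add: coroot_ng cartan_int dual_minus[OF R_dual coroot_H])

lemma cartan_int_str: "\<alpha> \<in> R \<Longrightarrow> \<beta> \<in> R \<Longrightarrow> cartan_int (str \<alpha> \<beta> j) \<beta> = cartan_int \<alpha> \<beta> + 2 * j"
  by (rule cartan_int_eqI) (simp add: str_apply cartan_int cartan_int_self)

text \<open>
  At the upper end of a run of roots in the string the pairing with the coroot of \<open>\<beta>\<close> is not
  negative, at a lower end it is not positive, and it increases along the string; so there is no
  gap. The reflection of each end is in the string, which gives the Cartan integer.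
\<close>

lemma root_string:
  assumes a: "\<alpha> \<in> R" and b: "\<beta> \<in> R" and ne: "\<alpha> \<noteq> \<beta>" "\<alpha> \<noteq> ng \<beta>"
  shows "\<exists>p q::nat. (\<forall>j. str \<alpha> \<beta> j \<in> R \<longleftrightarrow> - int p \<le> j \<and> j \<le> int q) \<and> cartan_int \<alpha> \<beta> = int p - int q"
proof -
  define J where "J = {j. str \<alpha> \<beta> j \<in> R}"
  note nm = str_not_multiple[OF a b ne]
  have up: "cartan_int \<alpha> \<beta> + 2 * j \<ge> 0 \<and> - cartan_int \<alpha> \<beta> - j \<in> J" if "j \<in> J" "j + 1 \<notin> J" for j
  proof -
    have "str \<alpha> \<beta> j \<in> R" "str (str \<alpha> \<beta> j) \<beta> 1 \<notin> R" using that by (auto simp: J_def)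
    then obtain l :: nat where l: "str \<alpha> \<beta> j (coroot \<beta>) = of_nat l"
        "str (str \<alpha> \<beta> j) \<beta> (- int l) \<in> R \<or> (\<forall>t\<in>H. str (str \<alpha> \<beta> j) \<beta> (- int l) t = 0)"
      using highest_weight[OF b _ _ nm(2)] by blast
    have "of_int (cartan_int \<alpha> \<beta> + 2 * j) = (of_int (int l) :: complex)"
      using l(1) by (simp add: str_apply cartan_int cartan_int_self a b mult.commute)
    hence "cartan_int \<alpha> \<beta> + 2 * j = int l" by (simp only: of_int_eq_iff)
    moreover have "str \<alpha> \<beta> (j - int l) \<in> R" using l(2) nm(3)[of "j - int l"] by auto
    ultimately show ?thesis by (simp add: J_def) (smt (verit))
  qed
  have down: "cartan_int \<alpha> \<beta> + 2 * j \<le> 0 \<and> - cartan_int \<alpha> \<beta> - j \<in> J" if "j \<in> J" "j - 1 \<notin> J" for j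
  proof -
    have "str \<alpha> \<beta> j \<in> R" "str (str \<alpha> \<beta> j) (ng \<beta>) 1 \<notin> R" using that by (auto simp: J_def str_ng)
    then obtain l :: nat where l: "str \<alpha> \<beta> j (coroot (ng \<beta>)) = of_nat l"
        "str (str \<alpha> \<beta> j) (ng \<beta>) (- int l) \<in> R \<or> (\<forall>t\<in>H. str (str \<alpha> \<beta> j) (ng \<beta>) (- int l) t = 0)"
      using highest_weight[OF R_ng[OF b], of "str \<alpha> \<beta> j"] nm(1) by auto
    have "str \<alpha> \<beta> j (coroot (ng \<beta>)) = of_int (- (cartan_int \<alpha> \<beta> + 2 * j))"
      using dual_minus[OF dual_str[OF R_dual[OF a] R_dual[OF b]] coroot_H[OF b]]
      by (simp add: str_apply cartan_int cartan_int_self a b coroot_ng)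
    hence "of_int (- (cartan_int \<alpha> \<beta> + 2 * j)) = (of_int (int l) :: complex)" using l(1) by simp
    hence "- (cartan_int \<alpha> \<beta> + 2 * j) = int l" by (simp only: of_int_eq_iff)
    moreover have "str \<alpha> \<beta> (j + int l) \<in> R" using l(2) nm(3)[of "j + int l"] by (auto simp: str_ng)
    ultimately show ?thesis by (simp add: J_def) (smt (verit))
  qed
  have fin: "finite J"
  proof -
    obtain t where t: "t \<in> H" "\<beta> t \<noteq> 0" using R_nonzero b by blast
    have "inj_on (str \<alpha> \<beta>) J"
    proof (rule inj_onI)
      fix i j assume "str \<alpha> \<beta> i = str \<alpha> \<beta> j"
      hence "\<alpha> t + of_int i * \<beta> t = \<alpha> t + of_int j * \<beta> t" by (metis str_apply)
      thus "i = j" using t by simp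
    qed
    moreover have "str \<alpha> \<beta> ` J \<subseteq> R" by (auto simp: J_def)
    ultimately show ?thesis using finite_R by (meson finite_imageD finite_subset)
  qed
  have J0: "0 \<in> J" using a by (simp add: J_def)
  define q where "q = Max J"
  define p where "p = Min J"
  have q: "q \<in> J" "q + 1 \<notin> J" "0 \<le> q" and p: "p \<in> J" "p - 1 \<notin> J" "p \<le> 0"
    using fin J0 Max_ge[OF fin, of "q + 1"] Min_le[OF fin, of "p - 1"] unfolding q_def p_def
    by (auto intro: Max_in Min_in)
  have range: "p \<le> j" "j \<le> q" if "j \<in> J" for j
    using that fin by (auto simp: p_def q_def)
  have full: "j \<in> J" if "p \<le> j" "j \<le> q" for j
  proof (rule ccontr)
    assume n: "j \<notin> J"
    define i where "i = Max {i \<in> J. i < j}"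
    define k where "k = Min {i \<in> J. i > j}"
    have "p \<in> {i \<in> J. i < j}" "q \<in> {i \<in> J. i > j}" using that p q n by (auto simp: order.order_iff_strict)
    hence "{i \<in> J. i < j} \<noteq> {}" "{i \<in> J. i > j} \<noteq> {}" by blast+
    hence "i \<in> {i \<in> J. i < j}" "k \<in> {i \<in> J. i > j}"
      unfolding i_def k_def by (intro Max_in Min_in finite_subset[OF _ fin]; blast)+
    hence ik: "i \<in> J" "i < j" "k \<in> J" "j < k" by auto
    have "i + 1 \<notin> J"
    proof
      assume "i + 1 \<in> J"
      hence "i + 1 \<in> {i \<in> J. i < j}" using ik n by (cases "i + 1 = j") auto
      hence "i + 1 \<le> i" unfolding i_def using fin by (intro Max_ge) auto
      thus False by simp
    qed
    moreover have "k - 1 \<notin> J"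
    proof
      assume "k - 1 \<in> J"
      hence "k - 1 \<in> {i \<in> J. i > j}" using ik n by (cases "k - 1 = j") auto
      hence "k \<le> k - 1" unfolding k_def using fin by (intro Min_le) auto
      thus False by simp
    qed
    ultimately show False using up[OF ik(1)] down[OF ik(3)] ik by linarith
  qed
  have "- cartan_int \<alpha> \<beta> - q \<in> J" "- cartan_int \<alpha> \<beta> - p \<in> J" using up[OF q(1,2)] down[OF p(1,2)] by auto
  hence "cartan_int \<alpha> \<beta> = - p - q" using range[of "- cartan_int \<alpha> \<beta> - q"] range[of "- cartan_int \<alpha> \<beta> - p"] by linarith
  moreover have "str \<alpha> \<beta> j \<in> R \<longleftrightarrow> p \<le> j \<and> j \<le> q" for j
    using range full by (auto simp: J_def)
  ultimately show ?thesis
    using p(3) q(3) by (intro exI[of _ "nat (- p)"] exI[of _ "nat q"]) auto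
qed

lemma reflection:
  assumes a: "\<alpha> \<in> R" and b: "\<beta> \<in> R" shows "str \<alpha> \<beta> (- cartan_int \<alpha> \<beta>) \<in> R"
proof -
  consider "\<alpha> = \<beta>" | "\<alpha> = ng \<beta>" | "\<alpha> \<noteq> \<beta>" "\<alpha> \<noteq> ng \<beta>" by blast
  thus ?thesis
  proof cases
    case 1
    hence "str \<alpha> \<beta> (- cartan_int \<alpha> \<beta>) = ng \<beta>" using cartan_int_self b by (simp add: str_def ng_def)
    thus ?thesis using b by simp
  next
    case 2
    hence "cartan_int \<alpha> \<beta> = - 2" using cartan_int_self cartan_int_ng_left b by simp
    hence "str \<alpha> \<beta> (- cartan_int \<alpha> \<beta>) = \<beta>" using 2 by (simp add: str_def ng_def)
    thus ?thesis using b by simp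
  next
    case 3
    obtain p q :: nat where "\<And>j. str \<alpha> \<beta> j \<in> R \<longleftrightarrow> - int p \<le> j \<and> j \<le> int q" "cartan_int \<alpha> \<beta> = int p - int q"
      using root_string[OF a b 3] by blast
    thus ?thesis by simp
  qed
qed

text \<open>The Killing form on \<open>H\<close>, written through the roots.\<close>

definition killing :: "'g \<Rightarrow> 'g \<Rightarrow> complex" where
  "killing s t = (\<Sum>\<gamma>\<in>R. \<gamma> s * \<gamma> t)"

text \<open>
  The reflection in \<open>\<beta>\<close> permutes the roots; summing over the reflected roots gives the same
  value.
\<close>

lemma killing_coroot:
  assumes b: "\<beta> \<in> R" and t: "t \<in> H"
  shows "2 * killing (coroot \<beta>) t = \<beta> t * killing (coroot \<beta>) (coroot \<beta>)"
proof -
  define S where "S \<gamma> = str \<gamma> \<beta> (- cartan_int \<gamma> \<beta>)" for \<gamma>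
  have SR: "S \<gamma> \<in> R" if "\<gamma> \<in> R" for \<gamma> using reflection that b by (simp add: S_def)
  have SS: "S (S \<gamma>) = \<gamma>" if "\<gamma> \<in> R" for \<gamma> using that b by (simp add: S_def cartan_int_str)
  have bij: "bij_betw S R R" by (rule bij_betw_byWitness[where f' = S]) (use SR SS in auto)
  have S1: "S \<gamma> (coroot \<beta>) = - \<gamma> (coroot \<beta>)" if "\<gamma> \<in> R" for \<gamma>
    using that b by (simp add: S_def str_apply cartan_int cartan_int_self)
  have S2: "S \<gamma> t = \<gamma> t - \<beta> t * \<gamma> (coroot \<beta>)" if "\<gamma> \<in> R" for \<gamma>
    using that b by (simp add: S_def str_apply cartan_int)
  have "killing (coroot \<beta>) t = (\<Sum>\<gamma>\<in>R. S \<gamma> (coroot \<beta>) * S \<gamma> t)"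
    unfolding killing_def by (rule sum.reindex_bij_betw[OF bij, symmetric])
  also have "\<dots> = (\<Sum>\<gamma>\<in>R. \<beta> t * (\<gamma> (coroot \<beta>) * \<gamma> (coroot \<beta>)) - \<gamma> (coroot \<beta>) * \<gamma> t)"
    by (intro sum.cong refl) (simp add: S1 S2 algebra_simps)
  also have "\<dots> = \<beta> t * killing (coroot \<beta>) (coroot \<beta>) - killing (coroot \<beta>) t"
    by (simp add: killing_def sum_subtractf sum_distrib_left)
  finally show ?thesis by simp
qed

definition kil :: "('g \<Rightarrow> complex) \<Rightarrow> ('g \<Rightarrow> complex) \<Rightarrow> int" where
  "kil \<alpha> \<beta> = (\<Sum>\<gamma>\<in>R. cartan_int \<gamma> \<alpha> * cartan_int \<gamma> \<beta>)"

lemma killing_kil: "\<alpha> \<in> R \<Longrightarrow> \<beta> \<in> R \<Longrightarrow> killing (coroot \<alpha>) (coroot \<beta>) = of_int (kil \<alpha> \<beta>)"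
  by (simp add: killing_def kil_def cartan_int)

lemma kil_pos: "\<beta> \<in> R \<Longrightarrow> kil \<beta> \<beta> > 0"
  unfolding kil_def by (rule sum_pos2[of R \<beta>]) (auto simp: finite_R cartan_int_self)

lemma kil_cartan_int:
  assumes "\<alpha> \<in> R" "\<beta> \<in> R" shows "2 * kil \<alpha> \<beta> = cartan_int \<alpha> \<beta> * kil \<alpha> \<alpha>"
proof -
  have "(of_int (2 * kil \<alpha> \<beta>) :: complex) = of_int (cartan_int \<alpha> \<beta> * kil \<alpha> \<alpha>)"
    using killing_coroot[OF assms(1) coroot_H[OF assms(2)]] assms by (simp add: killing_kil cartan_int)
  thus ?thesis by (simp only: of_int_eq_iff)
qed

lemma kil_sym: "kil \<alpha> \<beta> = kil \<beta> \<alpha>"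
  by (simp add: kil_def mult.commute)

text \<open>
  The Cauchy-Schwarz inequality for the coroots.
\<close>

lemma cartan_int_bounds:
  assumes a: "\<alpha> \<in> R" and b: "\<beta> \<in> R"
  shows "cartan_int \<alpha> \<beta> * cartan_int \<beta> \<alpha> \<le> 4" "sgn (cartan_int \<alpha> \<beta>) = sgn (cartan_int \<beta> \<alpha>)"
proof -
  have pos: "kil \<alpha> \<alpha> > 0" "kil \<beta> \<beta> > 0" using kil_pos a b by auto
  have k: "2 * kil \<alpha> \<beta> = cartan_int \<alpha> \<beta> * kil \<alpha> \<alpha>" "2 * kil \<alpha> \<beta> = cartan_int \<beta> \<alpha> * kil \<beta> \<beta>"
    using kil_cartan_int[OF a b] kil_cartan_int[OF b a] kil_sym[of \<alpha> \<beta>] by simp_all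
  have "sgn (cartan_int \<alpha> \<beta>) * sgn (kil \<alpha> \<alpha>) = sgn (cartan_int \<beta> \<alpha>) * sgn (kil \<beta> \<beta>)"
    unfolding sgn_mult[symmetric] k[symmetric] ..
  thus "sgn (cartan_int \<alpha> \<beta>) = sgn (cartan_int \<beta> \<alpha>)" using pos by simp
  have cs: "(kil \<alpha> \<beta>)\<^sup>2 \<le> kil \<beta> \<beta> * kil \<alpha> \<alpha>"
  proof -
    have "0 \<le> (\<Sum>\<gamma>\<in>R. (kil \<beta> \<beta> * cartan_int \<gamma> \<alpha> - kil \<alpha> \<beta> * cartan_int \<gamma> \<beta>)\<^sup>2)" by (intro sum_nonneg) simp
    also have "\<dots> = (\<Sum>\<gamma>\<in>R. kil \<beta> \<beta> * kil \<beta> \<beta> * (cartan_int \<gamma> \<alpha> * cartan_int \<gamma> \<alpha>)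
        - 2 * kil \<beta> \<beta> * kil \<alpha> \<beta> * (cartan_int \<gamma> \<alpha> * cartan_int \<gamma> \<beta>) + kil \<alpha> \<beta> * kil \<alpha> \<beta> * (cartan_int \<gamma> \<beta> * cartan_int \<gamma> \<beta>))"
      by (intro sum.cong refl) (simp add: power2_eq_square algebra_simps)
    also have "\<dots> = kil \<beta> \<beta> * kil \<beta> \<beta> * kil \<alpha> \<alpha> - 2 * kil \<beta> \<beta> * kil \<alpha> \<beta> * kil \<alpha> \<beta> + kil \<alpha> \<beta> * kil \<alpha> \<beta> * kil \<beta> \<beta>"
      by (simp only: sum.distrib sum_subtractf sum_distrib_left[symmetric] kil_def[symmetric])
    also have "\<dots> = kil \<beta> \<beta> * (kil \<beta> \<beta> * kil \<alpha> \<alpha> - (kil \<alpha> \<beta>)\<^sup>2)"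
      by (simp add: power2_eq_square algebra_simps)
    finally show ?thesis using pos by (simp add: zero_le_mult_iff)
  qed
  have "(cartan_int \<alpha> \<beta> * cartan_int \<beta> \<alpha>) * (kil \<beta> \<beta> * kil \<alpha> \<alpha>) = (cartan_int \<alpha> \<beta> * kil \<alpha> \<alpha>) * (cartan_int \<beta> \<alpha> * kil \<beta> \<beta>)" by simp
  also have "\<dots> = 4 * (kil \<alpha> \<beta>)\<^sup>2"
    unfolding k[symmetric] by (simp add: power2_eq_square)
  also have "\<dots> \<le> 4 * (kil \<beta> \<beta> * kil \<alpha> \<alpha>)" using cs by simp
  finally show "cartan_int \<alpha> \<beta> * cartan_int \<beta> \<alpha> \<le> 4" using pos by (simp add: mult_le_cancel_right)
qed

text \<open>
  If \<open>\<alpha>\<close> paired non-positively with all simple roots, then the element of \<open>H\<close> dual to \<open>\<alpha>\<close>, which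
  is a non-negative combination of the simple coroots, would have non-positive length for the
  Killing form.
\<close>

lemma positive_pairing:
  assumes a: "\<alpha> \<in> Rp" shows "\<exists>\<beta>\<in>P. cartan_int \<alpha> \<beta> > 0"
proof (rule ccontr)
  assume "\<not> ?thesis"
  hence neg: "cartan_int \<alpha> \<beta> \<le> 0" if "\<beta> \<in> P" for \<beta> using that by force
  have PR: "\<beta> \<in> R" if "\<beta> \<in> P" for \<beta> using that basis(2) by blast
  note aR = Rp_R[OF a]
  obtain n :: "('g \<Rightarrow> complex) \<Rightarrow> nat" where n: "\<And>t. \<alpha> t = (\<Sum>\<beta>\<in>P. of_nat (n \<beta>) * \<beta> t)"
    using a unfolding Rp_iff nonneg_combination_def by blast
  \<comment> \<open>Twice the Killing product with the coroot of \<open>\<beta>\<close> is \<open>kil \<beta> \<beta>\<close> times \<open>\<beta>\<close>, so these are the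
    coefficients of the dual of \<open>\<alpha>\<close>.\<close>
  define c where "c \<beta> = 2 * real (n \<beta>) / real_of_int (kil \<beta> \<beta>)" for \<beta>
  have c0: "c \<beta> \<ge> 0" if "\<beta> \<in> P" for \<beta>
    using kil_pos[OF PR[OF that]] by (simp add: c_def)
  define t where "t = (\<Sum>\<beta>\<in>P. scale (of_real (c \<beta>)) (coroot \<beta>))"
  have tH: "t \<in> H" unfolding t_def
    using H_sub coroot_H PR by (intro subspace_sum subspace_scale) auto
  have eval: "\<gamma> t = (\<Sum>\<beta>\<in>P. of_real (c \<beta>) * \<gamma> (coroot \<beta>))" if "\<gamma> \<in> dual H" for \<gamma>
  proof -
    have "\<gamma> (\<Sum>\<beta>\<in>Q. scale (of_real (c \<beta>)) (coroot \<beta>)) = (\<Sum>\<beta>\<in>Q. of_real (c \<beta>) * \<gamma> (coroot \<beta>))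
        \<and> (\<Sum>\<beta>\<in>Q. scale (of_real (c \<beta>)) (coroot \<beta>)) \<in> H"
      if "finite Q" "Q \<subseteq> P" for Q
      using that
    proof (induction Q rule: finite_induct)
      case empty
      have "\<gamma> (scale 0 0) = 0 * \<gamma> 0" using \<open>\<gamma> \<in> dual H\<close> H_sub subspace_0 unfolding dual_def by blast
      thus ?case using H_sub subspace_0 by simp
    next
      case (insert \<beta> Q)
      have "scale (of_real (c \<beta>)) (coroot \<beta>) \<in> H" using insert coroot_H PR H_sub subspace_scale by auto
      thus ?case using insert \<open>\<gamma> \<in> dual H\<close> coroot_H PR H_sub subspace_add by (simp add: dual_def)
    qed
    thus ?thesis unfolding t_def using basis(1) by blast
  qed
  have dual: "killing t s = \<alpha> s" if "s \<in> H" for s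
  proof -
    have "killing t s = (\<Sum>\<gamma>\<in>R. \<Sum>\<beta>\<in>P. of_real (c \<beta>) * \<gamma> (coroot \<beta>) * \<gamma> s)"
      unfolding killing_def by (intro sum.cong refl) (simp add: eval R_dual sum_distrib_right)
    also have "\<dots> = (\<Sum>\<beta>\<in>P. of_real (c \<beta>) * killing (coroot \<beta>) s)"
      unfolding killing_def by (subst sum.swap) (simp add: sum_distrib_left mult.assoc)
    also have "\<dots> = (\<Sum>\<beta>\<in>P. of_nat (n \<beta>) * \<beta> s)"
    proof (intro sum.cong refl)
      fix \<beta> assume b: "\<beta> \<in> P"
      have "2 * killing (coroot \<beta>) s = \<beta> s * of_int (kil \<beta> \<beta>)"
        using killing_coroot[OF PR[OF b] that] by (simp add: killing_kil PR b)
      hence k: "killing (coroot \<beta>) s = \<beta> s * of_int (kil \<beta> \<beta>) / 2" by (simp add: field_simps)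
      have "of_int (kil \<beta> \<beta>) \<noteq> (0 :: complex)" using kil_pos[OF PR[OF b]] by simp
      thus "of_real (c \<beta>) * killing (coroot \<beta>) s = of_nat (n \<beta>) * \<beta> s"
        unfolding k c_def by simp
    qed
    finally show ?thesis by (simp add: n[symmetric])
  qed
  define r where "r \<gamma> = (\<Sum>\<beta>\<in>P. c \<beta> * real_of_int (cartan_int \<gamma> \<beta>))" for \<gamma>
  have r: "\<gamma> t = of_real (r \<gamma>)" if "\<gamma> \<in> R" for \<gamma>
    using that by (simp add: eval R_dual r_def cartan_int PR)
  have "of_real (\<Sum>\<gamma>\<in>R. (r \<gamma>)\<^sup>2) = killing t t"
    by (simp add: killing_def r power2_eq_square)
  also have "\<dots> = of_real (r \<alpha>)" using dual[OF tH] r aR by simp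
  finally have "(\<Sum>\<gamma>\<in>R. (r \<gamma>)\<^sup>2) = r \<alpha>" by (simp only: of_real_eq_iff)
  moreover have "r \<alpha> \<le> 0"
    unfolding r_def using neg c0 by (intro sum_nonpos mult_nonneg_nonpos) auto
  ultimately have "(\<Sum>\<gamma>\<in>R. (r \<gamma>)\<^sup>2) = 0" by (smt (verit) sum_nonneg zero_le_power2)
  hence "r \<gamma> = 0" if "\<gamma> \<in> R" for \<gamma>
    using that finite_R by (simp add: sum_nonneg_eq_0_iff)
  hence "killing t (coroot \<alpha>) = 0" by (simp add: killing_def r)
  thus False using dual[OF coroot_H[OF aR]] root_coroot[OF aR] by simp
qed

end

section \<open>Generation of the roots from the simple roots\<close>

context chevalley_setup
begin

text \<open>
  Here \<open>\<alpha>\<close> is the last root of its \<open>\<beta>\<close>-string and \<open>\<alpha> - p \<beta>\<close> the first one.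
\<close>

definition end_closed :: "('g \<Rightarrow> complex) set \<Rightarrow> bool" where
  "end_closed S \<longleftrightarrow> (\<forall>\<alpha>\<in>R. \<forall>\<beta>\<in>R. \<forall>p::nat. \<alpha> \<noteq> \<beta> \<longrightarrow> \<alpha> \<noteq> ng \<beta> \<longrightarrow> \<beta> \<in> S \<longrightarrow> str \<alpha> \<beta> (- int p) \<in> S \<longrightarrow>
     str \<alpha> \<beta> 1 \<notin> R \<longrightarrow> (\<forall>j > int p. str \<alpha> \<beta> (- j) \<notin> R) \<longrightarrow> \<alpha> \<in> S)"

lemma end_closedD:
  assumes "end_closed S" "\<alpha> \<in> R" "\<beta> \<in> R" "\<alpha> \<noteq> \<beta>" "\<alpha> \<noteq> ng \<beta>" "\<beta> \<in> S" "str \<alpha> \<beta> (- int p) \<in> S" "str \<alpha> \<beta> 1 \<notin> R"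
    "\<And>j. j > int p \<Longrightarrow> str \<alpha> \<beta> (- j) \<notin> R"
  shows "\<alpha> \<in> S"
  using assms unfolding end_closed_def by blast

text \<open>
  The hypothesis on the Cartan integer places \<open>\<alpha>\<close> in the upper half of its \<open>\<beta>\<close>-string. If it is not
  the last root, then the bound on Cartan integers leaves only one root \<open>\<delta> = \<alpha> + \<beta>\<close> beyond it. The
  root \<open>\<delta>\<close> is the end of the \<open>\<beta>\<close>-string, and \<open>\<alpha>\<close> is the end of the \<open>\<delta>\<close>-string that starts at \<open>-\<beta>\<close>.
\<close>

lemma upper_half_step:
  assumes ends: "end_closed S"
    and a: "\<alpha> \<in> R" and b: "\<beta> \<in> R" and ne: "\<alpha> \<noteq> \<beta>" "\<alpha> \<noteq> ng \<beta>"
    and S: "\<beta> \<in> S" "ng \<beta> \<in> S" and pos: "cartan_int \<alpha> \<beta> > 0"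
    and low: "\<And>p. str \<alpha> \<beta> (- int p) \<in> R \<Longrightarrow> str \<alpha> \<beta> (- int p - 1) \<notin> R \<Longrightarrow> p > 0 \<Longrightarrow> str \<alpha> \<beta> (- int p) \<in> S"
  shows "\<alpha> \<in> S"
proof -
  obtain p q :: nat where pq: "\<And>j. str \<alpha> \<beta> j \<in> R \<longleftrightarrow> - int p \<le> j \<and> j \<le> int q" "cartan_int \<alpha> \<beta> = int p - int q"
    using root_string[OF a b ne] by blast
  have p: "p > q" using pos pq by simp
  have mS: "str \<alpha> \<beta> (- int p) \<in> S" using low[of p] p by (simp add: pq)
  show ?thesis
  proof (cases "q = 0")
    case True
    show ?thesis using end_closedD[OF ends a b ne S(1) mS] pq True by auto
  next
    case False
    let ?m = "str \<alpha> \<beta> (- int p)"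
    have mR: "?m \<in> R" by (simp add: pq)
    have "cartan_int ?m \<beta> = - (int p + int q)" using pq(2) a b by (simp add: cartan_int_str)
    moreover have "cartan_int ?m \<beta> * cartan_int \<beta> ?m \<le> 4" "sgn (cartan_int ?m \<beta>) = sgn (cartan_int \<beta> ?m)" using cartan_int_bounds[OF mR b] by auto
    ultimately have m: "- (int p + int q) * cartan_int \<beta> ?m \<le> 4" "cartan_int \<beta> ?m < 0"
      using p by (auto simp: sgn_if split: if_splits)
    have "(int p + int q) * 1 \<le> (int p + int q) * (- cartan_int \<beta> ?m)" using m(2) by (intro mult_left_mono) auto
    also have "\<dots> = - (int p + int q) * cartan_int \<beta> ?m" by (simp only: mult_minus_left mult_minus_right)
    also have "\<dots> \<le> 4" by (rule m(1))
    finally have "int p + int q \<le> 4" by simp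
    hence q: "q = 1" using p False by linarith
    define \<delta> where "\<delta> = str \<alpha> \<beta> 1"
    have dR: "\<delta> \<in> R" by (simp add: \<delta>_def pq q)
    have dne: "\<delta> \<noteq> \<beta>" "\<delta> \<noteq> ng \<beta>" using str_not_multiple[OF a b ne] by (auto simp: \<delta>_def)
    have dS: "\<delta> \<in> S"
    proof (rule end_closedD[OF ends dR b dne S(1)])
      have "str \<delta> \<beta> (- int (p + 1)) = ?m" by (simp add: \<delta>_def)
      thus "str \<delta> \<beta> (- int (p + 1)) \<in> S" using mS by simp
      show "str \<delta> \<beta> 1 \<notin> R" by (simp add: \<delta>_def pq q)
      show "str \<delta> \<beta> (- j) \<notin> R" if "j > int (p + 1)" for j
        using that by (simp add: \<delta>_def pq q)
    qed
    have nbd: "str (ng \<beta>) \<delta> 1 = \<alpha>" by (simp add: \<delta>_def str_def ng_def)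
    have bn: "ng \<beta> \<noteq> \<delta>" "ng \<beta> \<noteq> ng \<delta>" using dne ng_ng by metis+
    obtain p' q' :: nat where pq': "\<And>j. str (ng \<beta>) \<delta> j \<in> R \<longleftrightarrow> - int p' \<le> j \<and> j \<le> int q'"
        "cartan_int (ng \<beta>) \<delta> = int p' - int q'"
      using root_string[OF R_ng[OF b] dR bn] by blast
    have "str (ng \<beta>) \<delta> (- 1) = ng (str \<alpha> \<beta> 2)" by (simp add: \<delta>_def str_def ng_def algebra_simps)
    hence "str (ng \<beta>) \<delta> (- 1) \<notin> R" using pq q by simp
    hence p': "p' = 0" using pq'(1)[of "- 1"] by simp
    have c: "cartan_int \<beta> \<delta> = int q'" using pq' p' cartan_int_ng_left[OF b dR] by simp
    have "cartan_int \<delta> \<beta> = int p + 1" using pq q a b by (simp add: \<delta>_def cartan_int_str)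
    hence c4: "(int p + 1) * cartan_int \<beta> \<delta> \<le> 4" "cartan_int \<beta> \<delta> > 0"
      using cartan_int_bounds[OF dR b] p by (auto simp: sgn_if split: if_splits)
    have "3 * cartan_int \<beta> \<delta> \<le> (int p + 1) * cartan_int \<beta> \<delta>" using p q c4(2) by (intro mult_right_mono) auto
    hence q': "q' = 1" using c4 c by linarith
    have st: "str \<alpha> \<delta> j = str (ng \<beta>) \<delta> (j + 1)" for j
      using nbd str_str[of "ng \<beta>" \<delta> 1 j] by (simp add: add.commute)
    have ad: "\<alpha> \<noteq> \<delta>" "\<alpha> \<noteq> ng \<delta>"
      using str_not_multiple[OF R_ng[OF b] dR bn, of 1] unfolding nbd by auto
    show ?thesis
    proof (rule end_closedD[OF ends a dR ad dS])
      show "str \<alpha> \<delta> (- int 1) \<in> S" using S(2) by (simp add: st)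
      show "str \<alpha> \<delta> 1 \<notin> R" by (simp add: st pq' q')
      show "str \<alpha> \<delta> (- j) \<notin> R" if "j > int 1" for j using that by (simp add: st pq' p')
    qed
  qed
qed

text \<open>
  Induction on the height. A positive root that is not simple pairs positively with some simple
  root \<open>\<beta>\<close>, and the roots below it in the \<open>\<beta>\<close>-string are positive roots of smaller height. The
  opposite root is treated in the same way with \<open>-\<beta>\<close>.
\<close>

theorem roots_generated:
  assumes ends: "end_closed S"
    and simple: "\<And>\<beta>. \<beta> \<in> P \<Longrightarrow> \<beta> \<in> S \<and> ng \<beta> \<in> S"
  shows "R \<subseteq> S"
proof -
  have main: "\<alpha> \<in> S \<and> ng \<alpha> \<in> S"
    if "\<alpha> \<in> R" "\<And>t. \<alpha> t = (\<Sum>\<beta>\<in>P. of_nat (n \<beta>) * \<beta> t)" for \<alpha> and n :: "('g \<Rightarrow> complex) \<Rightarrow> nat"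
    using that
  proof (induction "\<Sum>\<beta>\<in>P. n \<beta>" arbitrary: \<alpha> n rule: less_induct)
    case less
    note aR = less.prems(1) and n = less.prems(2)
    have aRp: "\<alpha> \<in> Rp" unfolding Rp_iff nonneg_combination_def using less.prems by blast
    show ?case
    proof (cases "\<alpha> \<in> P")
      case True thus ?thesis using simple by blast
    next
      case False
      obtain \<beta> where b: "\<beta> \<in> P" "cartan_int \<alpha> \<beta> > 0" using positive_pairing[OF aRp] by blast
      have bR: "\<beta> \<in> R" using b basis(2) by blast
      have ne: "\<alpha> \<noteq> \<beta>" "\<alpha> \<noteq> ng \<beta>" using False b aRp ng_notin_Rp[OF P_Rp] by auto
      \<comment> \<open>A second simple root with a positive coefficient keeps the roots of the \<open>\<beta>\<close>-string
        positive.\<close>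
      have "\<exists>\<gamma>\<in>P. \<gamma> \<noteq> \<beta> \<and> n \<gamma> \<noteq> 0"
      proof (rule ccontr)
        assume "\<not> ?thesis"
        hence z: "n \<gamma> = 0" if "\<gamma> \<in> P" "\<gamma> \<noteq> \<beta>" for \<gamma> using that by blast
        have "\<alpha> t = of_nat (n \<beta>) * \<beta> t" for t
        proof -
          have "\<alpha> t = (\<Sum>\<gamma>\<in>P. if \<gamma> = \<beta> then of_nat (n \<beta>) * \<beta> t else 0)"
            unfolding n using z by (intro sum.cong) auto
          thus ?thesis using basis(1) b by simp
        qed
        hence "\<alpha> = (\<lambda>t. of_int (int (n \<beta>)) * \<beta> t)" by auto
        hence "int (n \<beta>) = 1 \<or> int (n \<beta>) = - 1" using multiples[OF bR] aR by metis
        hence "n \<beta> = 1" by simp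
        hence "\<alpha> = \<beta>" using \<open>\<alpha> = (\<lambda>t. of_int (int (n \<beta>)) * \<beta> t)\<close> by simp
        thus False using ne by simp
      qed
      then obtain \<gamma> where g: "\<gamma> \<in> P" "\<gamma> \<noteq> \<beta>" "n \<gamma> \<noteq> 0" by blast
      have low: "str \<alpha> \<beta> (- int p) \<in> S \<and> ng (str \<alpha> \<beta> (- int p)) \<in> S"
        if r: "str \<alpha> \<beta> (- int p) \<in> R" and p: "p > 0" for p
      proof -
        let ?m = "str \<alpha> \<beta> (- int p)"
        have mc: "?m t = (\<Sum>\<gamma>\<in>P. (of_nat (n \<gamma>) - (if \<gamma> = \<beta> then of_nat p else 0)) * \<gamma> t)" for t
        proof -
          have "(\<Sum>\<gamma>\<in>P. (if \<gamma> = \<beta> then of_nat p else 0) * \<gamma> t) = (\<Sum>\<gamma>\<in>P. if \<gamma> = \<beta> then of_nat p * \<beta> t else 0)"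
            by (intro sum.cong) auto
          also have "\<dots> = of_nat p * \<beta> t" using basis(1) b by simp
          finally show ?thesis by (simp add: str_apply n left_diff_distrib sum_subtractf)
        qed
        have "nonneg_combination P ?m"
        proof (rule ccontr)
          assume "\<not> nonneg_combination P ?m"
          hence "nonneg_combination P (ng ?m)" using basis(4)[OF r] by blast
          then obtain k :: "('g \<Rightarrow> complex) \<Rightarrow> nat" where k: "\<And>t. ng ?m t = (\<Sum>\<beta>\<in>P. of_nat (k \<beta>) * \<beta> t)"
            unfolding nonneg_combination_def by blast
          have "(\<Sum>\<gamma>\<in>P. - of_nat (k \<gamma>) * \<gamma> t) = ?m t" for t
            by (simp only: mult_minus_left sum_negf k[symmetric] ng_apply minus_minus)
          hence "- of_nat (k \<gamma>) = (of_nat (n \<gamma>) - (if \<gamma> = \<beta> then of_nat p else 0) :: complex)"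
            by (intro independent_coeffs[OF _ g(1)]) (simp only: mc)
          hence "- of_nat (k \<gamma>) = (of_nat (n \<gamma>) :: complex)" using g(2) by simp
          hence "(of_nat (n \<gamma> + k \<gamma>) :: complex) = 0" unfolding of_nat_add by (metis add.left_inverse)
          thus False unfolding of_nat_eq_0_iff using g(3) by simp
        qed
        then obtain k :: "('g \<Rightarrow> complex) \<Rightarrow> nat" where k: "\<And>t. ?m t = (\<Sum>\<beta>\<in>P. of_nat (k \<beta>) * \<beta> t)"
          unfolding nonneg_combination_def by blast
        have kn: "n \<gamma> = k \<gamma> + (if \<gamma> = \<beta> then p else 0)" if "\<gamma> \<in> P" for \<gamma>
        proof -
          have "(of_nat (k \<gamma>) :: complex) = of_nat (n \<gamma>) - (if \<gamma> = \<beta> then of_nat p else 0)"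
            by (rule independent_coeffs[OF _ that]) (simp only: mc[symmetric] k[symmetric])
          hence "(of_nat (n \<gamma>) :: complex) = of_nat (k \<gamma> + (if \<gamma> = \<beta> then p else 0))" by auto
          thus ?thesis by (simp only: of_nat_eq_iff)
        qed
        have "(\<Sum>\<gamma>\<in>P. n \<gamma>) = (\<Sum>\<gamma>\<in>P. k \<gamma>) + (\<Sum>\<gamma>\<in>P. if \<gamma> = \<beta> then p else 0)"
          unfolding sum.distrib[symmetric] by (intro sum.cong refl kn)
        also have "(\<Sum>\<gamma>\<in>P. if \<gamma> = \<beta> then p else 0) = p" using basis(1) b by simp
        finally have "(\<Sum>\<gamma>\<in>P. k \<gamma>) < (\<Sum>\<gamma>\<in>P. n \<gamma>)" using p by simp
        thus ?thesis using less.hyps[OF _ r k] by blast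
      qed
      have "\<alpha> \<in> S"
        by (rule upper_half_step[OF ends aR bR ne]) (use simple b low in auto)
      moreover have "ng \<alpha> \<in> S"
      proof (rule upper_half_step[OF ends, of "ng \<alpha>" "ng \<beta>"])
        show "ng \<alpha> \<in> R" "ng \<beta> \<in> R" using aR bR by auto
        show "ng \<alpha> \<noteq> ng \<beta>" "ng \<alpha> \<noteq> ng (ng \<beta>)" using ne ng_ng by metis+
        show "ng \<beta> \<in> S" "ng (ng \<beta>) \<in> S" using simple b by auto
        show "cartan_int (ng \<alpha>) (ng \<beta>) > 0" using b aR bR by (simp add: cartan_int_ng_left cartan_int_ng_right)
        show "str (ng \<alpha>) (ng \<beta>) (- int p) \<in> S"
          if "str (ng \<alpha>) (ng \<beta>) (- int p) \<in> R" "p > 0" for p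
          using low[of p] that unfolding ng_str[symmetric] by simp
      qed
      ultimately show ?thesis by blast
    qed
  qed
  show ?thesis
  proof
    fix \<alpha> assume a: "\<alpha> \<in> R"
    have pos: "\<alpha> \<in> S \<and> ng \<alpha> \<in> S" if "\<alpha> \<in> Rp" for \<alpha>
      using main Rp_R[OF that] that unfolding Rp_iff nonneg_combination_def by blast
    show "\<alpha> \<in> S" using R_cases[OF a] pos[of \<alpha>] pos[of "ng \<alpha>"] by auto
  qed
qed

text \<open>
  Along a string that starts at its first root, Chevalley's normalization makes the iterated
  brackets divided by factorials equal to root vectors up to sign.
\<close>

lemma string_vectors:
  assumes a: "\<alpha> \<in> R" and b: "\<beta> \<in> R" and ne: "\<alpha> \<noteq> \<beta>" "\<alpha> \<noteq> ng \<beta>"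
    and top: "str \<alpha> \<beta> 1 \<notin> R" and m: "str \<alpha> \<beta> (- int p) \<in> R"
    and bot: "\<And>j. j > int p \<Longrightarrow> str \<alpha> \<beta> (- j) \<notin> R"
  shows "\<exists>v. v 0 = xv (str \<alpha> \<beta> (- int p)) \<and> (\<forall>i. br (xv \<beta>) (v i) = scale (of_nat (Suc i)) (v (Suc i))) \<and>
    (\<forall>i>p. v i = 0) \<and> (v p = xv \<alpha> \<or> v p = - xv \<alpha>)"
proof -
  obtain p' q' :: nat where pq: "\<And>j. str \<alpha> \<beta> j \<in> R \<longleftrightarrow> - int p' \<le> j \<and> j \<le> int q'"
    using root_string[OF a b ne] by blast
  have q: "q' = 0" using top pq[of 1] by auto
  have "p \<le> p'" using m pq by simp
  moreover have "\<not> p' > p" using bot[of "int p'"] pq by auto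
  ultimately have p: "p' = p" by simp
  define r where "r i = str \<alpha> \<beta> (int i - int p)" for i
  have rR: "r i \<in> R \<longleftrightarrow> i \<le> p" for i by (auto simp: r_def pq p q)
  have rS: "str (r i) \<beta> 1 = r (Suc i)" for i by (simp add: r_def algebra_simps)
  have rn: "r i \<noteq> ng \<beta>" for i using str_not_multiple[OF a b ne] by (simp add: r_def)
  have step: "\<exists>s\<in>{1, -1}. br (xv \<beta>) (xv (r i)) = scale (s * of_nat (Suc i)) (xv (r (Suc i)))" if "i < p" for i
  proof -
    have "(GREATEST j::nat. str (r i) \<beta> (- int j) \<in> R) = i"
      using that by (intro Greatest_equality) (auto simp: r_def pq p q)
    thus ?thesis using br_roots_int[OF b, of "r i"] that rR by (simp add: rS)
  qed
  have last: "br (xv \<beta>) (xv (r p)) = 0"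
    using br_roots_zero[OF b, of "r p"] rR rn by (simp add: rS)
  define c where "c i = (SOME s. s \<in> {1, -1} \<and> br (xv \<beta>) (xv (r i)) = scale (s * of_nat (Suc i)) (xv (r (Suc i))))" for i
  have c: "c i \<in> {1, -1 :: complex}" "br (xv \<beta>) (xv (r i)) = scale (c i * of_nat (Suc i)) (xv (r (Suc i)))" if "i < p" for i
  proof -
    have "\<exists>s. s \<in> {1, -1} \<and> br (xv \<beta>) (xv (r i)) = scale (s * of_nat (Suc i)) (xv (r (Suc i)))" using step[OF that] by blast
    from someI_ex[OF this] show "c i \<in> {1, -1 :: complex}" "br (xv \<beta>) (xv (r i)) = scale (c i * of_nat (Suc i)) (xv (r (Suc i)))"
      unfolding c_def by auto
  qed
  define v where "v i = (if i \<le> p then scale (\<Prod>j<i. c j) (xv (r i)) else 0)" for i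
  have sign: "(\<Prod>j<i. c j) = 1 \<or> (\<Prod>j<i. c j) = -1" if "i \<le> p" for i
    using that
  proof (induction i)
    case (Suc i) thus ?case using c(1)[of i] by auto
  qed simp
  have "br (xv \<beta>) (v i) = scale (of_nat (Suc i)) (v (Suc i))" for i
  proof -
    consider "i < p" | "i = p" | "i > p" by linarith
    thus ?thesis
    proof cases
      case 1
      thus ?thesis using c(2)[of i] by (simp add: v_def br_scale_right mult.assoc del: of_nat_Suc)
    next
      case 2 thus ?thesis using last by (simp add: v_def br_scale_right)
    qed (simp add: v_def)
  qed
  moreover have "v p = xv \<alpha> \<or> v p = - xv \<alpha>"
    using sign[of p] by (auto simp: v_def r_def)
  ultimately show ?thesis by (intro exI[of _ v]) (auto simp: v_def r_def)
qed

text \<open>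
  Its coefficients would have both signs.
\<close>

lemma simple_difference: assumes "\<beta> \<in> P" "\<gamma> \<in> P" "\<beta> \<noteq> \<gamma>" shows "str \<beta> \<gamma> (- 1) \<notin> R"
proof
  assume r: "str \<beta> \<gamma> (- 1) \<in> R"
  have co: "str \<beta> \<gamma> (- 1) t = (\<Sum>\<delta>\<in>P. (if \<delta> = \<beta> then 1 else if \<delta> = \<gamma> then - 1 else 0) * \<delta> t)" for t
  proof -
    have "(\<Sum>\<delta>\<in>P. (if \<delta> = \<beta> then 1 else if \<delta> = \<gamma> then - 1 else 0) * \<delta> t)
        = (\<Sum>\<delta>\<in>P. (if \<delta> = \<beta> then \<beta> t else 0) - (if \<delta> = \<gamma> then \<gamma> t else 0))"
      using assms by (intro sum.cong) auto
    also have "\<dots> = \<beta> t - \<gamma> t" using assms basis(1) by (simp add: sum_subtractf)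
    finally show ?thesis by (simp add: str_apply)
  qed
  consider "nonneg_combination P (str \<beta> \<gamma> (- 1))" | "nonneg_combination P (ng (str \<beta> \<gamma> (- 1)))"
    using basis(4)[OF r] by blast
  thus False
  proof cases
    case 1
    then obtain n :: "('g \<Rightarrow> complex) \<Rightarrow> nat" where n: "\<And>t. str \<beta> \<gamma> (- 1) t = (\<Sum>\<beta>\<in>P. of_nat (n \<beta>) * \<beta> t)"
      unfolding nonneg_combination_def by blast
    have "of_nat (n \<gamma>) = (if \<gamma> = \<beta> then 1 else if \<gamma> = \<gamma> then - 1 else 0 :: complex)"
      by (rule independent_coeffs[of "\<lambda>\<delta>. of_nat (n \<delta>)" "\<lambda>\<delta>. if \<delta> = \<beta> then 1 else if \<delta> = \<gamma> then - 1 else 0", OF _ assms(2)])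
        (simp only: co[symmetric] n[symmetric])
    hence "of_nat (n \<gamma> + 1) = (0 :: complex)" using assms by simp
    thus False unfolding of_nat_eq_0_iff by simp
  next
    case 2
    then obtain n :: "('g \<Rightarrow> complex) \<Rightarrow> nat" where n: "\<And>t. ng (str \<beta> \<gamma> (- 1)) t = (\<Sum>\<beta>\<in>P. of_nat (n \<beta>) * \<beta> t)"
      unfolding nonneg_combination_def by blast
    have "(\<Sum>\<delta>\<in>P. - of_nat (n \<delta>) * \<delta> t) = str \<beta> \<gamma> (- 1) t" for t
      by (simp only: mult_minus_left sum_negf n[symmetric] ng_apply minus_minus)
    hence "- of_nat (n \<beta>) = (if \<beta> = \<beta> then 1 else if \<beta> = \<gamma> then - 1 else 0 :: complex)"
      by (intro independent_coeffs[of "\<lambda>\<delta>. - of_nat (n \<delta>)" "\<lambda>\<delta>. if \<delta> = \<beta> then 1 else if \<delta> = \<gamma> then - 1 else 0", OF _ assms(1)])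
        (simp only: co)
    hence "- of_nat (n \<beta>) = (1 :: complex)" by simp
    hence "of_nat (n \<beta> + 1) = (0 :: complex)" unfolding of_nat_add of_nat_1 by (metis add.right_inverse)
    thus False unfolding of_nat_eq_0_iff by simp
  qed
qed

text \<open>
  Root spaces are lines, so \<open>coroot \<gamma>\<close> is the only coroot of \<open>\<gamma>\<close>.
\<close>

lemma roots_in_weight_lattice: assumes a: "\<alpha> \<in> R" shows "\<alpha> \<in> weight_lattice H"
proof -
  have "\<alpha> t \<in> \<int>" if g: "\<gamma> \<in> R" and t: "is_coroot H \<gamma> t" for \<gamma> t
  proof -
    have "{br x y |x y. x \<in> root_space H \<gamma> \<and> y \<in> root_space H (\<lambda>s. - \<gamma> s)} \<subseteq> span {coroot \<gamma>}"
    proof clarify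
      fix x y assume xy: "x \<in> root_space H \<gamma>" "y \<in> root_space H (\<lambda>s. - \<gamma> s)"
      obtain c where c: "x = scale c (xv \<gamma>)" using root_space_line[OF g xy(1)] by blast
      obtain d where d: "y = scale d (xv (ng \<gamma>))" using root_space_line[OF R_ng[OF g], of y] xy(2) by (auto simp: ng_def)
      show "br x y \<in> span {coroot \<gamma>}" unfolding c d br_scale_left br_scale_right coroot_def[symmetric]
        by (intro span_scale span_base) simp
    qed
    hence "br_span (root_space H \<gamma>) (root_space H (\<lambda>s. - \<gamma> s)) \<subseteq> span {coroot \<gamma>}"
      unfolding br_span_def by (rule span_minimal) (rule subspace_span)
    hence "t \<in> span {coroot \<gamma>}" using t by (auto simp: is_coroot_def)
    then obtain c where c: "t = scale c (coroot \<gamma>)" by (auto simp: span_singleton)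
    have ev: "\<mu> t = c * \<mu> (coroot \<gamma>)" if "\<mu> \<in> dual H" for \<mu>
      using that coroot_H[OF g] unfolding c dual_def by blast
    have "c * 2 = 2" using t ev[OF R_dual[OF g]] root_coroot[OF g] by (simp add: is_coroot_def)
    hence "c = 1" by simp
    hence "\<alpha> t = of_int (cartan_int \<alpha> \<gamma>)" using ev[OF R_dual[OF a]] cartan_int a g by simp
    thus ?thesis by simp
  qed
  thus ?thesis using R_dual[OF a] by (simp add: weight_lattice_def R_def)
qed

lemma weight_lattice_str:
  assumes "\<mu> \<in> weight_lattice H" "\<alpha> \<in> R" shows "str \<mu> \<alpha> j \<in> weight_lattice H"
proof -
  have "str \<mu> \<alpha> j \<in> dual H"
    using assms roots_in_weight_lattice by (intro dual_str) (auto simp: weight_lattice_def)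
  moreover have "str \<mu> \<alpha> j t \<in> \<int>" if "\<gamma> \<in> roots H" "is_coroot H \<gamma> t" for \<gamma> t
    using assms(1) roots_in_weight_lattice[OF assms(2)] that by (auto simp: weight_lattice_def str_apply intro!: Ints_add Ints_mult)
  ultimately show ?thesis by (simp add: weight_lattice_def)
qed

lemma weight_integer:
  assumes "\<mu> \<in> weight_lattice H" "\<beta> \<in> P" shows "\<exists>z::int. \<mu> (h \<beta>) = of_int z"
proof -
  have "is_coroot H \<beta> (h \<beta>)" using chevalley(6,7) P_Rp assms(2) by metis
  moreover have "\<beta> \<in> roots H" using basis(2) assms(2) by (auto simp: R_def)
  ultimately have "\<mu> (h \<beta>) \<in> \<int>" using assms(1) by (auto simp: weight_lattice_def)
  thus ?thesis by (auto elim: Ints_cases)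
qed

end

section \<open>The enveloping algebra and Kostant's integral form\<close>

context complex_lie_algebra
begin

text \<open>
  The free algebra on the set of elements of the Lie algebra.
\<close>

definition FA :: "('g list \<Rightarrow> complex) ring" where "FA = monoid_ring word_monoid"

definition env_relators :: "('g list \<Rightarrow> complex) set" where
  "env_relators =
      {single [x + y] 1 \<ominus>\<^bsub>FA\<^esub> single [x] 1 \<ominus>\<^bsub>FA\<^esub> single [y] 1 | x y. True}
     \<union> {single [scale c x] 1 \<ominus>\<^bsub>FA\<^esub> single [x] c | c x. True}
     \<union> {single [x, y] 1 \<ominus>\<^bsub>FA\<^esub> single [y, x] 1 \<ominus>\<^bsub>FA\<^esub> single [br x y] 1 | x y. True}"

lemma FA_ring: "ring FA"
  unfolding FA_def by (rule monoid_ring_ring[OF word_monoid])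

lemma word_closed: "single w c \<in> carrier FA"
  unfolding FA_def by (rule single_closed[OF word_monoid]) (simp add: word_monoid_def)

lemma word_mult: "single v c \<otimes>\<^bsub>FA\<^esub> single w d = single (v @ w) (c * d)"
  using single_mult[OF word_monoid, of v w c d] by (simp add: FA_def word_monoid_def)

lemma FA_minus: "u \<in> carrier FA \<Longrightarrow> v \<in> carrier FA \<Longrightarrow> u \<ominus>\<^bsub>FA\<^esub> v = (\<lambda>x. u x - v x)"
  unfolding FA_def by (rule monoid_ring_minus[OF word_monoid])

lemma env_relators_closed: "env_relators \<subseteq> carrier FA"
  using FA_ring word_closed by (auto simp: env_relators_def intro!: ring.ring_simprules(4))

lemma env_ideal_eq: "env_ideal = Idl\<^bsub>FA\<^esub> env_relators"
  by (simp add: env_ideal_def FA_def env_relators_def Let_def)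

lemma env_eq: "env = FA Quot env_ideal" by (simp add: env_def FA_def)

lemma env_ideal_ideal: "ideal env_ideal FA"
  unfolding env_ideal_eq using ring.genideal_ideal[OF FA_ring env_relators_closed] .

lemma env_ring: "ring env"
  unfolding env_eq by (rule ideal.quotient_is_ring[OF env_ideal_ideal])

text \<open>
  The constant term is the character of the enveloping algebra that the construction of the
  operators needs.
\<close>

lemma constant_term_mult:
  assumes "u \<in> carrier FA" "v \<in> carrier FA"
  shows "(u \<otimes>\<^bsub>FA\<^esub> v) [] = u [] * v []"
proof -
  have fin: "finite {a. u a \<noteq> 0}" "finite {a. v a \<noteq> 0}"
    using assms by (simp_all add: FA_def monoid_ring_carrier[OF word_monoid])
  have "(u \<otimes>\<^bsub>FA\<^esub> v) [] = pairing (u \<otimes>\<^bsub>FA\<^esub> v) (\<lambda>a. if a = [] then 1 else 0)"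
    using ring.ring_simprules(5)[OF FA_ring assms]
    by (subst pairing_delta) (simp_all add: FA_def monoid_ring_carrier[OF word_monoid])
  also have "\<dots> = pairing u (\<lambda>a. pairing v (\<lambda>b. if a \<otimes>\<^bsub>word_monoid\<^esub> b = [] then 1 else 0))"
    using assms unfolding FA_def by (rule pairing_mult[OF word_monoid])
  also have "\<dots> = pairing u (\<lambda>a. (if a = [] then 1 else 0) * pairing v (\<lambda>b. if b = [] then 1 else 0))"
    by (intro pairing_cong) (auto simp: word_monoid_def pairing_def)
  also have "\<dots> = pairing u (\<lambda>a. if a = [] then 1 else 0) * pairing v (\<lambda>b. if b = [] then 1 else 0)"
    unfolding pairing_def[of u] sum_distrib_right by (simp only: mult.assoc)
  also have "\<dots> = u [] * v []" using fin by (simp add: pairing_delta)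
  finally show ?thesis .
qed

lemma constant_term_ideal: assumes "u \<in> env_ideal" shows "u [] = 0"
proof -
  interpret FA: ring FA by (rule FA_ring)
  have add: "(u \<oplus>\<^bsub>FA\<^esub> v) [] = u [] + v []" for u v :: "'g list \<Rightarrow> complex"
    by (simp add: FA_def monoid_ring_add[OF word_monoid])
  let ?J = "{u \<in> carrier FA. u [] = 0}"
  have "ideal ?J FA"
  proof (rule idealI[OF FA_ring])
    show "subgroup ?J (add_monoid FA)"
    proof (rule FA.add.subgroupI)
      show "?J \<noteq> {}"
        using FA.zero_closed by (auto simp: FA_def monoid_ring_zero[OF word_monoid] intro!: exI[of _ "\<lambda>x. 0"])
      show "\<ominus>\<^bsub>FA\<^esub> a \<in> ?J" if "a \<in> ?J" for a
        using that FA.a_inv_closed[of a] by (auto simp: FA_def monoid_ring_uminus[OF word_monoid])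
    qed (auto simp: add)
  qed (auto simp: constant_term_mult)
  moreover have "env_relators \<subseteq> ?J"
  proof
    have ev: "(u \<ominus>\<^bsub>FA\<^esub> v) [] = u [] - v []" if "u \<in> carrier FA" "v \<in> carrier FA" for u v
      using that by (simp add: FA_minus)
    have nil: "single (x # w) c [] = (0 :: complex)" for x :: 'g and w c by (simp add: single_def)
    fix r assume r: "r \<in> env_relators"
    hence "r [] = 0" unfolding env_relators_def by (auto simp: ev word_closed FA.minus_closed nil)
    thus "r \<in> ?J" using r env_relators_closed by blast
  qed
  ultimately show ?thesis
    using FA.genideal_minimal[of ?J env_relators] assms unfolding env_ideal_eq by blast
qed

lemma env_operators:
  "\<exists>\<rho> :: ('g list \<Rightarrow> complex) set \<Rightarrow> 'g list linop. inj_on \<rho> (carrier env) \<and>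
    (\<forall>s\<in>carrier env. \<forall>t\<in>carrier env. \<rho> (s \<otimes>\<^bsub>env\<^esub> t) = \<rho> s * \<rho> t \<and> \<rho> (s \<oplus>\<^bsub>env\<^esub> t) = \<rho> s + \<rho> t) \<and>
    (\<forall>r. \<rho> (env_scalar (of_real r)) = r *\<^sub>R 1)"
proof -
  have "\<exists>\<rho> :: ('g list \<Rightarrow> complex) set \<Rightarrow> 'g list linop. inj_on \<rho> (carrier (monoid_ring word_monoid Quot env_ideal)) \<and>
    (\<forall>s\<in>carrier (monoid_ring word_monoid Quot env_ideal). \<forall>t\<in>carrier (monoid_ring word_monoid Quot env_ideal).
       \<rho> (s \<otimes>\<^bsub>monoid_ring word_monoid Quot env_ideal\<^esub> t) = \<rho> s * \<rho> t \<and>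
       \<rho> (s \<oplus>\<^bsub>monoid_ring word_monoid Quot env_ideal\<^esub> t) = \<rho> s + \<rho> t) \<and>
    (\<forall>r. \<rho> (env_ideal +>\<^bsub>monoid_ring word_monoid\<^esub> single \<one>\<^bsub>word_monoid\<^esub> (of_real r)) = r *\<^sub>R 1)"
  proof (rule monoid_ring_quotient_operators[OF word_monoid, where \<epsilon> = "\<lambda>u. u []"])
    show "ideal env_ideal (monoid_ring word_monoid)" using env_ideal_ideal by (simp add: FA_def)
  qed (auto simp: constant_term_mult[unfolded FA_def] constant_term_ideal monoid_ring_add[OF word_monoid],
      simp add: single_def word_monoid_def)
  thus ?thesis by (simp add: env_def env_scalar_def word_monoid_def)
qed

definition rho :: "('g list \<Rightarrow> complex) set \<Rightarrow> 'g list linop" where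
  "rho = (SOME \<rho>. inj_on \<rho> (carrier env) \<and>
    (\<forall>s\<in>carrier env. \<forall>t\<in>carrier env. \<rho> (s \<otimes>\<^bsub>env\<^esub> t) = \<rho> s * \<rho> t \<and> \<rho> (s \<oplus>\<^bsub>env\<^esub> t) = \<rho> s + \<rho> t) \<and>
    (\<forall>r. \<rho> (env_scalar (of_real r)) = r *\<^sub>R 1))"

lemma rho:
  "inj_on rho (carrier env)"
  "s \<in> carrier env \<Longrightarrow> t \<in> carrier env \<Longrightarrow> rho (s \<otimes>\<^bsub>env\<^esub> t) = rho s * rho t"
  "s \<in> carrier env \<Longrightarrow> t \<in> carrier env \<Longrightarrow> rho (s \<oplus>\<^bsub>env\<^esub> t) = rho s + rho t"
  "rho (env_scalar (of_real r)) = r *\<^sub>R 1"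
  using someI_ex[OF env_operators, folded rho_def] by auto

lemma coset_env: "u \<in> carrier FA \<Longrightarrow> env_ideal +>\<^bsub>FA\<^esub> u \<in> carrier env"
  unfolding env_eq by (rule ring_hom_closed[OF ideal.rcos_ring_hom[OF env_ideal_ideal]])

lemma env_incl_eq: "env_incl x = env_ideal +>\<^bsub>FA\<^esub> single [x] 1"
  and env_scalar_eq: "env_scalar c = env_ideal +>\<^bsub>FA\<^esub> single [] c"
  by (simp_all add: env_incl_def env_scalar_def FA_def)

lemma env_incl_closed [simp]: "env_incl x \<in> carrier env" and env_scalar_closed [simp]: "env_scalar c \<in> carrier env"
  by (simp_all add: env_incl_eq env_scalar_eq coset_env word_closed)

lemma env_scalar_1: "env_scalar 1 = \<one>\<^bsub>env\<^esub>"
proof -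
  have "\<one>\<^bsub>FA\<^esub> = single [] 1" using monoid_ring_one[OF word_monoid] by (simp add: FA_def word_monoid_def)
  thus ?thesis using ring_hom_one[OF ideal.rcos_ring_hom[OF env_ideal_ideal]] by (simp add: env_scalar_eq env_eq)
qed

lemma rho_one: "rho \<one>\<^bsub>env\<^esub> = 1"
  using rho(4)[of 1] by (simp add: env_scalar_1)

lemma rho_zero: "rho \<zero>\<^bsub>env\<^esub> = 0"
  using rho(3)[of "\<zero>\<^bsub>env\<^esub>" "\<zero>\<^bsub>env\<^esub>"] ring.ring_simprules(2,8)[OF env_ring] by simp

lemma rho_uminus: assumes "s \<in> carrier env" shows "rho (\<ominus>\<^bsub>env\<^esub> s) = - rho s"
proof -
  interpret env: ring env by (rule env_ring)
  have "rho (\<ominus>\<^bsub>env\<^esub> s) + rho s = 0"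
    using assms by (simp add: rho(3)[symmetric] env.l_neg rho_zero)
  thus ?thesis by (simp add: eq_neg_iff_add_eq_0)
qed

lemma rho_minus: "s \<in> carrier env \<Longrightarrow> t \<in> carrier env \<Longrightarrow> rho (s \<ominus>\<^bsub>env\<^esub> t) = rho s - rho t"
  using ring.ring_simprules(3)[OF env_ring] by (simp add: a_minus_def rho(3) rho_uminus)

definition iota :: "'g \<Rightarrow> 'g list linop" where "iota x = rho (env_incl x)"

lemma coset_relator:
  assumes "u \<in> carrier FA" "v \<in> carrier FA" "u \<ominus>\<^bsub>FA\<^esub> v \<in> env_relators"
  shows "env_ideal +>\<^bsub>FA\<^esub> u = env_ideal +>\<^bsub>FA\<^esub> v"
  using ring.quotient_eq_iff_same_a_r_cos[OF FA_ring env_ideal_ideal assms(1,2)]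
    ring.genideal_self[OF FA_ring env_relators_closed] assms(3) by (auto simp: env_ideal_eq)

lemma rho_coset_add:
  "u \<in> carrier FA \<Longrightarrow> v \<in> carrier FA \<Longrightarrow> rho (env_ideal +>\<^bsub>FA\<^esub> (u \<oplus>\<^bsub>FA\<^esub> v)) = rho (env_ideal +>\<^bsub>FA\<^esub> u) + rho (env_ideal +>\<^bsub>FA\<^esub> v)"
  using ring_hom_add[OF ideal.rcos_ring_hom[OF env_ideal_ideal]] coset_env by (simp add: rho(3)[symmetric]) (simp add: env_eq)

lemma rho_coset_mult:
  "u \<in> carrier FA \<Longrightarrow> v \<in> carrier FA \<Longrightarrow> rho (env_ideal +>\<^bsub>FA\<^esub> (u \<otimes>\<^bsub>FA\<^esub> v)) = rho (env_ideal +>\<^bsub>FA\<^esub> u) * rho (env_ideal +>\<^bsub>FA\<^esub> v)"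
  using ring_hom_mult[OF ideal.rcos_ring_hom[OF env_ideal_ideal]] coset_env by (simp add: rho(2)[symmetric]) (simp add: env_eq)

lemma relator_sum:
  assumes "u \<in> carrier FA" "v \<in> carrier FA" "w \<in> carrier FA" "u \<ominus>\<^bsub>FA\<^esub> v \<ominus>\<^bsub>FA\<^esub> w \<in> env_relators"
  shows "rho (env_ideal +>\<^bsub>FA\<^esub> u) = rho (env_ideal +>\<^bsub>FA\<^esub> v) + rho (env_ideal +>\<^bsub>FA\<^esub> w)"
proof -
  interpret FA: ring FA by (rule FA_ring)
  have "u \<ominus>\<^bsub>FA\<^esub> (v \<oplus>\<^bsub>FA\<^esub> w) = u \<ominus>\<^bsub>FA\<^esub> v \<ominus>\<^bsub>FA\<^esub> w"
    using assms by (simp add: a_minus_def FA.minus_add FA.a_assoc)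
  hence "env_ideal +>\<^bsub>FA\<^esub> u = env_ideal +>\<^bsub>FA\<^esub> (v \<oplus>\<^bsub>FA\<^esub> w)"
    using assms by (intro coset_relator) auto
  thus ?thesis using rho_coset_add assms by simp
qed

lemma iota_add: "iota (x + y) = iota x + iota y"
  unfolding iota_def env_incl_eq
  by (rule relator_sum) (auto simp: word_closed env_relators_def)

lemma iota_scale: "iota (scale (of_real r) x) = r *\<^sub>R iota x"
proof -
  have "env_incl (scale (of_real r) x) = env_ideal +>\<^bsub>FA\<^esub> (single [] (of_real r) \<otimes>\<^bsub>FA\<^esub> single [x] 1)"
    unfolding env_incl_eq word_mult by (rule coset_relator) (auto simp: word_closed env_relators_def)
  thus ?thesis
    using rho(4)[of r] by (simp add: iota_def rho_coset_mult word_closed env_scalar_eq[symmetric] env_incl_eq)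
qed

lemma iota_br: "iota x * iota y - iota y * iota x = iota (br x y)"
proof -
  have "rho (env_ideal +>\<^bsub>FA\<^esub> single [x, y] 1) =
      rho (env_ideal +>\<^bsub>FA\<^esub> single [y, x] 1) + rho (env_ideal +>\<^bsub>FA\<^esub> single [br x y] 1)"
    by (rule relator_sum) (auto simp: word_closed env_relators_def)
  moreover have "rho (env_ideal +>\<^bsub>FA\<^esub> single [a, b] 1) = iota a * iota b" for a b
    using rho_coset_mult[OF word_closed word_closed, of "[a]" 1 "[b]" 1]
    by (simp add: word_mult iota_def env_incl_eq)
  ultimately show ?thesis by (simp add: iota_def env_incl_eq)
qed

lemma iota_0 [simp]: "iota 0 = 0"
  using iota_add[of 0 0] by simp

lemma iota_minus: "iota (- x) = - iota x"
  using iota_add[of x "- x"] by (simp add: eq_neg_iff_add_eq_0 add.commute)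

lemma iota_scale_int: "iota (scale (of_int z) x) = of_int z * iota x"
  using iota_scale[of "of_int z" x] by (simp add: scaleR_conv_of_real)

lemma iota_scale_nat: "iota (scale (of_nat n) x) = real n *\<^sub>R iota x"
  using iota_scale[of "of_nat n" x] by simp

lemma divided_power_closed [simp]: "divided_power x n \<in> carrier env"
proof -
  interpret env: ring env by (rule env_ring)
  show ?thesis by (simp add: divided_power_def)
qed

lemma rho_power: "u \<in> carrier env \<Longrightarrow> rho (u [^]\<^bsub>env\<^esub> (n::nat)) = rho u ^ n"
proof (induction n)
  interpret env: ring env by (rule env_ring)
  case 0 thus ?case by (simp add: rho_one)
next
  interpret env: ring env by (rule env_ring)
  case (Suc n) thus ?case by (simp add: rho(2) power_Suc2 del: power_Suc)
qed

lemma rho_divided_power: "rho (divided_power x n) = dpow (iota x) n"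
proof -
  interpret env: ring env by (rule env_ring)
  have "rho (env_scalar (1 / fact n)) = (1 / fact n) *\<^sub>R 1"
    using rho(4)[of "1 / fact n"] by simp
  thus ?thesis by (simp add: divided_power_def rho(2) rho_power dpow_def iota_def)
qed

lemma falling_factorial_closed: "falling_factorial x n \<in> carrier env"
proof -
  interpret env: ring env by (rule env_ring)
  show ?thesis by (induction n) (auto simp: env.minus_closed)
qed

lemma hbinom_closed [simp]: "hbinom x n \<in> carrier env"
  using ring.ring_simprules(5)[OF env_ring] falling_factorial_closed by (simp add: hbinom_def)

lemma rho_hbinom: "rho (hbinom x n) = bin (iota x) n"
proof -
  interpret env: ring env by (rule env_ring)
  have "rho (env_scalar (of_nat n)) = of_nat n" for n
    using rho(4)[of "of_nat n"] by (simp add: scaleR_conv_of_real)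
  hence s: "rho (falling_factorial x (Suc n)) = rho (falling_factorial x n) * (iota x - of_nat n)" for n
    by (simp add: rho(2) falling_factorial_closed env.minus_closed rho_minus iota_def)
  have "rho (falling_factorial x n) = fact n *\<^sub>R bin (iota x) n" for n
  proof (induction n)
    case 0 thus ?case by (simp add: rho_one)
  next
    case (Suc n)
    have "rho (falling_factorial x (Suc n)) = fact n *\<^sub>R (real (Suc n) *\<^sub>R bin (iota x) (Suc n))"
      unfolding s Suc bin_Suc by simp
    thus ?case by (simp add: mult.commute del: bin.simps)
  qed
  moreover have "rho (env_scalar (1 / fact n)) = (1 / fact n) *\<^sub>R 1"
    using rho(4)[of "1 / fact n"] by simp
  ultimately show ?thesis by (simp add: hbinom_def rho(2) falling_factorial_closed)
qed

lemma rho_generate_ring: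
  assumes "S \<subseteq> carrier env" shows "ring_closed (rho ` generate_ring env S)"
proof -
  interpret env: ring env by (rule env_ring)
  have c: "u \<in> carrier env" if "u \<in> generate_ring env S" for u
    using env.generate_ring_in_carrier[OF assms that] .
  show ?thesis
    unfolding ring_closed_def
  proof (intro conjI ballI)
    show "1 \<in> rho ` generate_ring env S"
      using rho_one generate_ring.one by (metis imageI)
  next
    fix x y assume "x \<in> rho ` generate_ring env S" "y \<in> rho ` generate_ring env S"
    then obtain u v where uv: "u \<in> generate_ring env S" "v \<in> generate_ring env S" "x = rho u" "y = rho v" by blast
    have "x + y = rho (u \<oplus>\<^bsub>env\<^esub> v)" "x * y = rho (u \<otimes>\<^bsub>env\<^esub> v)" using uv c rho by auto
    moreover have "rho (u \<oplus>\<^bsub>env\<^esub> v) \<in> rho ` generate_ring env S" "rho (u \<otimes>\<^bsub>env\<^esub> v) \<in> rho ` generate_ring env S"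
      by (intro imageI generate_ring.eng_add generate_ring.eng_mult uv)+
    ultimately show "x + y \<in> rho ` generate_ring env S" "x * y \<in> rho ` generate_ring env S" by simp_all
  next
    fix x assume "x \<in> rho ` generate_ring env S"
    then obtain u where u: "u \<in> generate_ring env S" "x = rho u" by blast
    have "- x = rho (\<ominus>\<^bsub>env\<^esub> u)" using u c rho_uminus by auto
    moreover have "rho (\<ominus>\<^bsub>env\<^esub> u) \<in> rho ` generate_ring env S"
      by (intro imageI generate_ring.a_inv u)
    ultimately show "- x \<in> rho ` generate_ring env S" by simp
  qed
qed

end

context chevalley_setup
begin

text \<open>
  The index \<open>n = 0\<close> is included: it gives the unit, and closure under these operators needs no
  case distinction.
\<close>

definition gens_simple :: "('g list \<Rightarrow> complex) set set" where
  "gens_simple = {divided_power (e \<beta>) n | \<beta> n. \<beta> \<in> P} \<union> {divided_power (f \<beta>) n | \<beta> n. \<beta> \<in> P}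
     \<union> {hbinom (h \<beta>) n | \<beta> n. \<beta> \<in> P}"

lemma xv_P: "\<beta> \<in> P \<Longrightarrow> xv \<beta> = e \<beta>" "\<beta> \<in> P \<Longrightarrow> xv (ng \<beta>) = f \<beta>"
  using P_Rp ng_notin_Rp by (auto simp: xv_def)

text \<open>
  The roots whose divided powers are generated are closed under going from the first to the last
  root of a string: the string vectors satisfy the hypotheses on the generating series.
\<close>

lemma divided_power_generated:
  assumes a: "\<alpha> \<in> R" shows "divided_power (xv \<alpha>) n \<in> generate_ring env gens_simple"
proof -
  interpret env: ring env by (rule env_ring)
  have sub: "gens_simple \<subseteq> carrier env" by (auto simp: gens_simple_def)
  define A where "A = rho ` generate_ring env gens_simple"
  have rc: "ring_closed A" unfolding A_def by (rule rho_generate_ring[OF sub])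
  define S where "S = {\<alpha> \<in> R. \<forall>n. dpow (iota (xv \<alpha>)) n \<in> A}"
  have "end_closed S"
    unfolding end_closed_def
  proof (intro ballI allI impI)
    fix \<alpha> \<beta> and p :: nat
    assume h: "\<alpha> \<in> R" "\<beta> \<in> R" "\<alpha> \<noteq> \<beta>" "\<alpha> \<noteq> ng \<beta>" "\<beta> \<in> S" "str \<alpha> \<beta> (- int p) \<in> S"
      "str \<alpha> \<beta> 1 \<notin> R" "\<forall>j > int p. str \<alpha> \<beta> (- j) \<notin> R"
    have "str \<alpha> \<beta> (- int p) \<in> R" using h by (simp add: S_def)
    then obtain v where v: "v 0 = xv (str \<alpha> \<beta> (- int p))"
        "\<And>i. br (xv \<beta>) (v i) = scale (of_nat (Suc i)) (v (Suc i))" "\<And>i. i > p \<Longrightarrow> v i = 0"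
        "v p = xv \<alpha> \<or> v p = - xv \<alpha>"
      using string_vectors[OF h(1-4,7), of p] h(8) by blast
    have "dpow (iota (v p)) n \<in> A" for n
    proof (rule string_end_dpow_mem[OF rc])
      show "iota (xv \<beta>) * iota (v i) - iota (v i) * iota (xv \<beta>) = real (Suc i) *\<^sub>R iota (v (Suc i))" for i
        unfolding iota_br v(2) iota_scale_nat ..
      show "iota (v i) = 0" if "i > p" for i using v(3)[OF that] by simp
      show "dpow (iota (xv \<beta>)) n \<in> A" for n using h by (simp add: S_def)
      show "dpow (iota (v 0)) n \<in> A" for n using h by (simp add: S_def v(1))
    qed
    moreover have "dpow (- iota (xv \<alpha>)) n = dpow (iota (xv \<alpha>)) n \<or> dpow (- iota (xv \<alpha>)) n = - dpow (iota (xv \<alpha>)) n" for n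
      by (cases "even n") (auto simp: dpow_def power_minus_odd)
    ultimately have "dpow (iota (xv \<alpha>)) n \<in> A" for n
      using v(4) rc_minus[OF rc] iota_minus by (metis minus_minus)
    thus "\<alpha> \<in> S" using h by (simp add: S_def)
  qed
  moreover have "\<beta> \<in> S \<and> ng \<beta> \<in> S" if b: "\<beta> \<in> P" for \<beta>
  proof -
    have "divided_power (e \<beta>) n \<in> generate_ring env gens_simple" "divided_power (f \<beta>) n \<in> generate_ring env gens_simple" for n
      using b by (auto simp: gens_simple_def intro!: generate_ring.incl)
    hence "dpow (iota (e \<beta>)) n \<in> A" "dpow (iota (f \<beta>)) n \<in> A" for n
      unfolding A_def rho_divided_power[symmetric] by blast+
    thus ?thesis using b basis(2) by (auto simp: S_def xv_P)
  qed
  ultimately have "R \<subseteq> S" by (rule roots_generated)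
  hence "rho (divided_power (xv \<alpha>) n) \<in> A" using a by (auto simp: S_def rho_divided_power)
  then obtain u where u: "u \<in> generate_ring env gens_simple" "rho (divided_power (xv \<alpha>) n) = rho u"
    unfolding A_def by blast
  have "divided_power (xv \<alpha>) n = u"
    by (rule inj_onD[OF rho(1) u(2)]) (use env.generate_ring_in_carrier[OF sub u(1)] in auto)
  thus ?thesis using u by simp
qed

definition gens :: "('g list \<Rightarrow> complex) set set" where "gens = gens_pos \<union> gens_neg \<union> gens_zero"

lemma gens_closed: "gens \<subseteq> carrier env"
  by (auto simp: gens_def gens_pos_def gens_neg_def gens_zero_def)

lemma UZ_eq: "UZ = env\<lparr>carrier := generate_ring env gens\<rparr>"
  by (simp add: UZ_def gens_def)

lemma UZ_carrier: "carrier UZ = generate_ring env gens"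
  by (simp add: UZ_eq)

lemma carrier_UZ_simple: "carrier UZ = generate_ring env gens_simple"
proof
  interpret env: ring env by (rule env_ring)
  have sub: "gens_simple \<subseteq> carrier env" by (auto simp: gens_simple_def)
  have dp0: "divided_power x 0 = \<one>\<^bsub>env\<^esub>" for x
    by (simp add: divided_power_def env_scalar_1)
  have hb0: "hbinom x 0 = \<one>\<^bsub>env\<^esub>" for x
    by (simp add: hbinom_def env_scalar_1)
  have "gens \<subseteq> generate_ring env gens_simple"
  proof
    fix u assume "u \<in> gens"
    then consider (e) \<alpha> n where "\<alpha> \<in> Rp" "u = divided_power (e \<alpha>) n" | (f) \<alpha> n where "\<alpha> \<in> Rp" "u = divided_power (f \<alpha>) n"
      | (h) \<beta> n where "\<beta> \<in> P" "u = hbinom (h \<beta>) n"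
      unfolding gens_def gens_pos_def gens_neg_def gens_zero_def Rp_def by blast
    thus "u \<in> generate_ring env gens_simple"
    proof cases
      case e thus ?thesis using divided_power_generated[OF Rp_R[OF e(1)], of n] by (simp add: xv_def)
    next
      case f thus ?thesis using divided_power_generated[OF Rp_ng[OF f(1)], of n] ng_notin_Rp by (simp add: xv_def)
    next
      case h thus ?thesis by (auto simp: gens_simple_def intro!: generate_ring.incl)
    qed
  qed
  thus "carrier UZ \<subseteq> generate_ring env gens_simple"
    unfolding UZ_carrier using env.generate_ring_is_subring[OF sub]
    by (intro env.generate_ring_min_subring1) (use gens_closed in auto)
  have "gens_simple \<subseteq> generate_ring env gens"
  proof
    fix u assume "u \<in> gens_simple"
    then obtain \<beta> n where b: "\<beta> \<in> P" and u: "u = divided_power (e \<beta>) n \<or> u = divided_power (f \<beta>) n \<or> u = hbinom (h \<beta>) n"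
      unfolding gens_simple_def by blast
    show "u \<in> generate_ring env gens"
    proof (cases "n = 0")
      case True thus ?thesis using u dp0 hb0 generate_ring.one by metis
    next
      case False
      hence "u \<in> gens"
        using u b P_Rp unfolding gens_def gens_pos_def gens_neg_def gens_zero_def Rp_def by blast
      thus ?thesis by (rule generate_ring.incl)
    qed
  qed
  thus "generate_ring env gens_simple \<subseteq> carrier UZ"
    unfolding UZ_carrier using env.generate_ring_is_subring[OF gens_closed]
    by (intro env.generate_ring_min_subring1) (use sub in auto)
qed

end

section \<open>Components in internal direct sums\<close>

locale direct_sum =
  fixes I :: "'i set" and N :: "'i \<Rightarrow> 'm::ab_group_add set" and M :: "'m set"
  assumes ids: "internal_direct_sum I N M"
    and N_zero: "\<And>i. i \<in> I \<Longrightarrow> 0 \<in> N i"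
    and N_add: "\<And>i x y. i \<in> I \<Longrightarrow> x \<in> N i \<Longrightarrow> y \<in> N i \<Longrightarrow> x + y \<in> N i"
    and M_add: "\<And>x y. x \<in> M \<Longrightarrow> y \<in> M \<Longrightarrow> x + y \<in> M"
begin

definition comp_spec :: "'m \<Rightarrow> ('i \<Rightarrow> 'm) \<Rightarrow> bool" where
  "comp_spec x v \<longleftrightarrow> (\<forall>i\<in>I. v i \<in> N i) \<and> (\<forall>i. i \<notin> I \<longrightarrow> v i = 0) \<and> finite {i. v i \<noteq> 0} \<and>
     x = (\<Sum>i | v i \<noteq> 0. v i)"

definition cmp :: "'m \<Rightarrow> 'i \<Rightarrow> 'm" where "cmp x = (THE v. comp_spec x v)"

lemma N_sub: "i \<in> I \<Longrightarrow> N i \<subseteq> M"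
  using ids by (auto simp: internal_direct_sum_def)

lemma comp_ex1: "x \<in> M \<Longrightarrow> \<exists>!v. comp_spec x v"
  using ids unfolding internal_direct_sum_def comp_spec_def by blast

lemma cmp_spec: "x \<in> M \<Longrightarrow> comp_spec x (cmp x)"
  unfolding cmp_def by (rule theI'[OF comp_ex1])

lemma cmp_mem: "x \<in> M \<Longrightarrow> i \<in> I \<Longrightarrow> cmp x i \<in> N i"
  and cmp_out: "x \<in> M \<Longrightarrow> i \<notin> I \<Longrightarrow> cmp x i = 0"
  and cmp_finite: "x \<in> M \<Longrightarrow> finite {i. cmp x i \<noteq> 0}"
  using cmp_spec[of x] unfolding comp_spec_def by blast+

lemma cmp_supp: "x \<in> M \<Longrightarrow> {i. cmp x i \<noteq> 0} \<subseteq> I"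
  using cmp_out by blast

lemma cmp_sum: assumes "x \<in> M" shows "(\<Sum>i | cmp x i \<noteq> 0. cmp x i) = x"
  using cmp_spec[OF assms] unfolding comp_spec_def by (elim conjE) (rule sym)

lemma cmp_superset:
  assumes "x \<in> M" "finite S" "{i. cmp x i \<noteq> 0} \<subseteq> S"
  shows "x = (\<Sum>i\<in>S. cmp x i)"
proof -
  have "(\<Sum>i | cmp x i \<noteq> 0. cmp x i) = (\<Sum>i\<in>S. cmp x i)"
    by (rule sum.mono_neutral_left[OF assms(2,3)]) blast
  thus ?thesis unfolding cmp_sum[OF assms(1)] .
qed

lemma cmp_finite_sum: "x \<in> M \<Longrightarrow> finite I \<Longrightarrow> x = (\<Sum>i\<in>I. cmp x i)"
  using cmp_superset[of x I] cmp_out[of x] by blast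

lemma cmp_eqI:
  assumes "x \<in> M" "finite S" "S \<subseteq> I" "\<And>i. i \<in> S \<Longrightarrow> v i \<in> N i" "\<And>i. i \<notin> S \<Longrightarrow> v i = 0" "x = (\<Sum>i\<in>S. v i)"
  shows "cmp x = v"
proof -
  have s: "{i. v i \<noteq> 0} \<subseteq> S" using assms(5) by blast
  have "comp_spec x v"
    unfolding comp_spec_def
  proof (intro conjI allI ballI impI)
    show "v i \<in> N i" if "i \<in> I" for i
      using assms(4,5)[of i] N_zero[OF that] by (cases "i \<in> S") auto
    show "v i = 0" if "i \<notin> I" for i using assms(3,5) that by blast
    show "finite {i. v i \<noteq> 0}" using s assms(2) by (rule finite_subset)
    show "x = (\<Sum>i | v i \<noteq> 0. v i)"
      unfolding assms(6) by (rule sum.mono_neutral_right[OF assms(2) s]) blast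
  qed
  thus ?thesis using comp_ex1[OF assms(1)] cmp_spec[OF assms(1)] by blast
qed

lemma cmp_single: assumes "i \<in> I" "m \<in> N i" shows "cmp m = (\<lambda>j. if j = i then m else 0)"
  by (rule cmp_eqI[of _ "{i}"]) (use assms N_sub in auto)

lemma cmp_add: assumes "x \<in> M" "y \<in> M" shows "cmp (x + y) i = cmp x i + cmp y i"
proof -
  let ?S = "{i. cmp x i \<noteq> 0} \<union> {i. cmp y i \<noteq> 0}"
  have S: "finite ?S" "?S \<subseteq> I" using assms by (simp_all add: cmp_finite cmp_supp)
  have "cmp (x + y) = (\<lambda>i. cmp x i + cmp y i)"
  proof (rule cmp_eqI[OF _ S])
    show "x + y = (\<Sum>i\<in>?S. cmp x i + cmp y i)"
      unfolding sum.distrib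
      by (rule arg_cong2[of _ _ _ _ "(+)", OF cmp_superset[OF assms(1) S(1)] cmp_superset[OF assms(2) S(1)]]) auto
  qed (use assms S(2) cmp_mem N_add M_add in auto)
  thus ?thesis by simp
qed

end

text \<open>
  The images of the components are components of the image, and components are unique.
\<close>

lemma cmp_hom:
  assumes 1: "direct_sum I N M" and 2: "direct_sum I' N' M'"
    and \<phi>: "\<And>x. x \<in> M \<Longrightarrow> \<phi> x \<in> M'" "\<And>x y. x \<in> M \<Longrightarrow> y \<in> M \<Longrightarrow> \<phi> (x + y) = \<phi> x + \<phi> y"
    and \<tau>: "inj_on \<tau> I" "\<tau> ` I \<subseteq> I'" "\<And>i x. i \<in> I \<Longrightarrow> x \<in> N i \<Longrightarrow> \<phi> x \<in> N' (\<tau> i)"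
    and 0: "0 \<in> M" and x: "x \<in> M" and i: "i \<in> I"
  shows "direct_sum.cmp I' N' (\<phi> x) (\<tau> i) = \<phi> (direct_sum.cmp I N x i)"
proof -
  interpret A: direct_sum I N M by fact
  interpret B: direct_sum I' N' M' by fact
  have z: "\<phi> 0 = 0" using \<phi>(2)[OF 0 0] by simp
  have \<phi>sum: "\<phi> (sum v S) = (\<Sum>i\<in>S. \<phi> (v i)) \<and> sum v S \<in> M" if "\<And>i. i \<in> S \<Longrightarrow> v i \<in> M" for v and S :: "'a set"
    using that by (induction S rule: infinite_finite_induct) (auto simp: z \<phi> 0 A.M_add)
  let ?S = "{i. A.cmp x i \<noteq> 0}"
  have S: "finite ?S" "?S \<subseteq> I" using x by (simp_all add: A.cmp_finite A.cmp_supp)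
  have injS: "inj_on \<tau> ?S" using \<tau>(1) S(2) by (rule inj_on_subset)
  define w where "w j = (if j \<in> \<tau> ` ?S then \<phi> (A.cmp x (inv_into ?S \<tau> j)) else 0)" for j
  have w: "w (\<tau> k) = \<phi> (A.cmp x k)" if "k \<in> ?S" for k
    using that inv_into_f_f[OF injS that] by (auto simp: w_def)
  have cM: "A.cmp x k \<in> M" if "k \<in> ?S" for k
    using that S(2) A.cmp_mem[OF x] A.N_sub by blast
  have "B.cmp (\<phi> x) = w"
  proof (rule B.cmp_eqI[of _ "\<tau> ` ?S"])
    show "\<phi> x \<in> M'" by (rule \<phi>(1)[OF x])
    show "finite (\<tau> ` ?S)" using S(1) by simp
    show "\<tau> ` ?S \<subseteq> I'" using S(2) \<tau>(2) by blast
    show "w j \<in> N' j" if "j \<in> \<tau> ` ?S" for j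
      using that w \<tau>(3) A.cmp_mem[OF x] S(2) by auto
    show "w j = 0" if "j \<notin> \<tau> ` ?S" for j using that by (simp add: w_def)
    have "\<phi> x = \<phi> (\<Sum>k\<in>?S. A.cmp x k)" by (simp only: A.cmp_sum[OF x])
    also have "\<dots> = (\<Sum>k\<in>?S. \<phi> (A.cmp x k))" by (rule \<phi>sum[THEN conjunct1]) (rule cM)
    also have "\<dots> = (\<Sum>k\<in>?S. w (\<tau> k))" using w by simp
    also have "\<dots> = (\<Sum>j\<in>\<tau> ` ?S. w j)" by (rule sum.reindex_cong[OF injS, symmetric]) auto
    finally show "\<phi> x = (\<Sum>j\<in>\<tau> ` ?S. w j)" .
  qed
  moreover have "w (\<tau> i) = \<phi> (A.cmp x i)"
  proof (cases "i \<in> ?S")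
    case False
    hence "\<tau> i \<notin> \<tau> ` ?S" using \<tau>(1) S(2) i by (auto dest: inj_onD)
    thus ?thesis using False z by (simp add: w_def)
  qed (rule w)
  ultimately show ?thesis by simp
qed

lemma finite_direct_sumI:
  assumes "finite I" "0 \<in> M" "\<And>i. i \<in> I \<Longrightarrow> N i \<subseteq> M" "\<And>i. i \<in> I \<Longrightarrow> 0 \<in> N i"
    and diff: "\<And>i x y. i \<in> I \<Longrightarrow> x \<in> N i \<Longrightarrow> y \<in> N i \<Longrightarrow> x - y \<in> N i"
    and ex: "\<And>x. x \<in> M \<Longrightarrow> \<exists>v. (\<forall>i\<in>I. v i \<in> N i) \<and> x = (\<Sum>i\<in>I. v i)"
    and zero: "\<And>v i. (\<And>i. i \<in> I \<Longrightarrow> v i \<in> N i) \<Longrightarrow> (\<Sum>i\<in>I. v i) = 0 \<Longrightarrow> i \<in> I \<Longrightarrow> v i = 0"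
  shows "internal_direct_sum I N (M :: 'm::ab_group_add set)"
  unfolding internal_direct_sum_def
proof (intro conjI ballI)
  fix x assume "x \<in> M"
  then obtain v where v: "\<forall>i\<in>I. v i \<in> N i" "x = (\<Sum>i\<in>I. v i)" using ex by blast
  have red: "(\<Sum>i | u i \<noteq> 0. u i) = (\<Sum>i\<in>I. u i)" if "\<forall>i. i \<notin> I \<longrightarrow> u i = 0" for u :: "_ \<Rightarrow> 'm"
    using that by (intro sum.mono_neutral_left assms(1)) auto
  show "\<exists>!v. (\<forall>i\<in>I. v i \<in> N i) \<and> (\<forall>i. i \<notin> I \<longrightarrow> v i = 0) \<and> finite {i. v i \<noteq> 0} \<and> x = (\<Sum>i | v i \<noteq> 0. v i)"
  proof (rule ex1I)
    let ?v = "\<lambda>i. if i \<in> I then v i else 0"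
    have "{i. ?v i \<noteq> 0} \<subseteq> I" by auto
    hence "finite {i. ?v i \<noteq> 0}" using assms(1) finite_subset by blast
    moreover have "x = (\<Sum>i | ?v i \<noteq> 0. ?v i)" by (subst red) (auto simp: v(2))
    ultimately show "(\<forall>i\<in>I. ?v i \<in> N i) \<and> (\<forall>i. i \<notin> I \<longrightarrow> ?v i = 0) \<and> finite {i. ?v i \<noteq> 0} \<and> x = (\<Sum>i | ?v i \<noteq> 0. ?v i)"
      using v(1) by auto
    fix u assume u: "(\<forall>i\<in>I. u i \<in> N i) \<and> (\<forall>i. i \<notin> I \<longrightarrow> u i = 0) \<and> finite {i. u i \<noteq> 0} \<and> x = (\<Sum>i | u i \<noteq> 0. u i)"
    hence "x = (\<Sum>i\<in>I. u i)" using red by auto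
    hence "(\<Sum>i\<in>I. u i - v i) = 0" using v by (simp add: sum_subtractf)
    hence "u i - v i = 0" if "i \<in> I" for i
      using zero[of "\<lambda>i. u i - v i" i] diff u v(1) that by blast
    thus "u = ?v" using u by auto
  qed
qed (use assms in auto)

section \<open>Modules over the hyperalgebra\<close>

context chevalley_setup
begin

lemma UZ_ring: "ring UZ"
  unfolding UZ_eq by (rule ring.generate_ring_is_ring[OF env_ring gens_closed])

lemma gens_parts_closed: "gens_zero \<subseteq> carrier env" "gens_pos \<subseteq> carrier env"
  using gens_closed by (auto simp: gens_def)

lemma UZ_zero_ring: "ring UZ_zero"
  unfolding UZ_zero_def by (rule ring.generate_ring_is_ring[OF env_ring gens_parts_closed(1)])

lemma UZ_pos_ring: "ring UZ_pos"
  unfolding UZ_pos_def by (rule ring.generate_ring_is_ring[OF env_ring gens_parts_closed(2)])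

lemma UZ_ops: "x \<otimes>\<^bsub>UZ\<^esub> y = x \<otimes>\<^bsub>env\<^esub> y" "x \<oplus>\<^bsub>UZ\<^esub> y = x \<oplus>\<^bsub>env\<^esub> y" "\<one>\<^bsub>UZ\<^esub> = \<one>\<^bsub>env\<^esub>"
  by (simp_all add: UZ_def)

lemma UZ_env: "a \<in> carrier UZ \<Longrightarrow> a \<in> carrier env"
  unfolding UZ_carrier by (rule ring.generate_ring_in_carrier[OF env_ring gens_closed])

lemma UZ_zero_sub: "UZ_zero = UZ\<lparr>carrier := carrier UZ_zero\<rparr>" "carrier UZ_zero \<subseteq> carrier UZ"
  using ring.mono_generate_ring[OF env_ring, of gens_zero gens] gens_closed
  by (auto simp: UZ_zero_def UZ_def gens_def)

lemma UZ_pos_sub: "UZ_pos = UZ\<lparr>carrier := carrier UZ_pos\<rparr>" "carrier UZ_pos \<subseteq> carrier UZ"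
  using ring.mono_generate_ring[OF env_ring, of gens_pos gens] gens_closed
  by (auto simp: UZ_pos_def UZ_def gens_def)

lemma simple_in_UZ:
  assumes "\<beta> \<in> P" shows "divided_power (e \<beta>) n \<in> carrier UZ" "divided_power (f \<beta>) n \<in> carrier UZ" "hbinom (h \<beta>) n \<in> carrier UZ"
  using assms unfolding carrier_UZ_simple by (auto simp: gens_simple_def intro!: generate_ring.incl)

lemma divided_power_in_UZ: "\<alpha> \<in> R \<Longrightarrow> divided_power (xv \<alpha>) n \<in> carrier UZ"
  unfolding carrier_UZ_simple by (rule divided_power_generated)

lemma divided_power_zero: "divided_power x 0 = \<one>\<^bsub>env\<^esub>"
  using ring.ring_simprules(6)[OF env_ring] by (simp add: divided_power_def env_scalar_1 ring.ring_simprules(12)[OF env_ring])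

lemma hbinom_in_UZ_zero: "\<beta> \<in> P \<Longrightarrow> hbinom (h \<beta>) n \<in> carrier UZ_zero"
proof (cases "n = 0")
  case True
  thus ?thesis using ring.ring_simprules(6)[OF env_ring]
    by (simp add: hbinom_def env_scalar_1 ring.ring_simprules(12)[OF env_ring] UZ_zero_def generate_ring.one)
qed (auto simp: UZ_zero_def gens_zero_def intro!: generate_ring.incl)

lemma e_in_UZ_pos: "\<beta> \<in> P \<Longrightarrow> divided_power (e \<beta>) n \<in> carrier UZ_pos"
proof (cases "n = 0")
  case True thus ?thesis by (simp add: divided_power_zero UZ_pos_def generate_ring.one)
next
  case False
  assume "\<beta> \<in> P"
  hence "\<beta> \<in> pos_roots H P" using P_Rp Rp_def by simp
  thus ?thesis using False by (auto simp: UZ_pos_def gens_pos_def intro!: generate_ring.incl)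
qed

text \<open>
  Kostant's integral form inside the ring of operators.
\<close>

definition AA :: "'g list linop set" where "AA = rho ` carrier UZ"

lemma AA_closed: "ring_closed AA"
  unfolding AA_def UZ_carrier by (rule rho_generate_ring[OF gens_closed])

lemma AA_gens:
  "\<alpha> \<in> R \<Longrightarrow> dpow (iota (xv \<alpha>)) n \<in> AA" "\<beta> \<in> P \<Longrightarrow> bin (iota (h \<beta>)) n \<in> AA"
  unfolding AA_def rho_divided_power[symmetric] rho_hbinom[symmetric]
  using divided_power_in_UZ simple_in_UZ by blast+

end

abbreviation KK :: "'k::field ring" where "KK \<equiv> ring_of_type_algebra"

lemma KK_simps: "carrier KK = UNIV" "x \<otimes>\<^bsub>KK\<^esub> y = x * y" "x \<oplus>\<^bsub>KK\<^esub> y = x + y" "\<one>\<^bsub>KK\<^esub> = 1" "\<zero>\<^bsub>KK\<^esub> = 0"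
  by (simp_all add: ring_of_type_algebra_def)

lemma KK_ring: "ring (KK :: 'k::field ring)" by (rule ring_from_type_algebra)

locale hyper_left_module = chevalley_setup scale br H P e f h
  for scale :: "complex \<Rightarrow> 'g::ab_group_add \<Rightarrow> 'g" and br H P e f h +
  fixes act :: "('g, 'k::field) hyperalg \<Rightarrow> 'm::ab_group_add \<Rightarrow> 'm" and M :: "'m set"
  assumes lm: "left_module U act M"
begin

sublocale T: tensor_product UZ "KK :: 'k ring"
  by (intro tensor_product.intro UZ_ring KK_ring)

sublocale Z: tensor_subring UZ "KK :: 'k ring" UZ_zero "carrier UZ_zero"
  using UZ_zero_sub
  by (intro tensor_subring.intro tensor_product.intro UZ_ring UZ_zero_ring KK_ring tensor_subring_axioms.intro)

sublocale Q: tensor_subring UZ "KK :: 'k ring" UZ_pos "carrier UZ_pos"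
  using UZ_pos_sub
  by (intro tensor_subring.intro tensor_product.intro UZ_ring UZ_pos_ring KK_ring tensor_subring_axioms.intro)

lemma U_T: "U = T.T" by (simp add: U_def)

text \<open>
  The actions of Kostant's integral form and of the field on the module. In \<open>op\<close> the elements
  of Kostant's form are given as operators, where they can be computed with in a type class.
\<close>

definition opr :: "('g list \<Rightarrow> complex) set \<Rightarrow> 'm \<Rightarrow> 'm" where "opr a m = act (T.tens a 1) m"
definition sc :: "'k \<Rightarrow> 'm \<Rightarrow> 'm" where "sc c m = act (scalar_U c) m"
definition op :: "'g list linop \<Rightarrow> 'm \<Rightarrow> 'm" where "op y = opr (inv_into (carrier env) rho y)"

lemma M_0: "0 \<in> M" and M_add: "x \<in> M \<Longrightarrow> y \<in> M \<Longrightarrow> x + y \<in> M" and M_uminus: "x \<in> M \<Longrightarrow> - x \<in> M"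
  and act_mem: "u \<in> carrier T.T \<Longrightarrow> x \<in> M \<Longrightarrow> act u x \<in> M"
  and act_one: "x \<in> M \<Longrightarrow> act \<one>\<^bsub>T.T\<^esub> x = x"
  and act_mult: "u \<in> carrier T.T \<Longrightarrow> v \<in> carrier T.T \<Longrightarrow> x \<in> M \<Longrightarrow> act (u \<otimes>\<^bsub>T.T\<^esub> v) x = act u (act v x)"
  and act_plus: "u \<in> carrier T.T \<Longrightarrow> v \<in> carrier T.T \<Longrightarrow> x \<in> M \<Longrightarrow> act (u \<oplus>\<^bsub>T.T\<^esub> v) x = act u x + act v x"
  and act_add: "u \<in> carrier T.T \<Longrightarrow> x \<in> M \<Longrightarrow> y \<in> M \<Longrightarrow> act u (x + y) = act u x + act u y"
  using lm unfolding left_module_def U_T by blast+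

lemma tens_closed [simp]: "a \<in> carrier UZ \<Longrightarrow> T.tens a c \<in> carrier T.T"
  by (rule T.tens_closed) (simp_all add: KK_simps)

lemma scalar_U_eq: "scalar_U c = T.tens \<one>\<^bsub>UZ\<^esub> c" by (simp add: scalar_U_def)

lemma UZ_one [simp]: "\<one>\<^bsub>UZ\<^esub> \<in> carrier UZ" by (rule ring.ring_simprules(6)[OF UZ_ring])

lemma tens_mult: "a \<in> carrier UZ \<Longrightarrow> b \<in> carrier UZ \<Longrightarrow> T.tens a c \<otimes>\<^bsub>T.T\<^esub> T.tens b d = T.tens (a \<otimes>\<^bsub>UZ\<^esub> b) (c * d)"
  using T.tens_mult[of a c b d] by (simp add: KK_simps)

lemma opr_mem: "a \<in> carrier UZ \<Longrightarrow> x \<in> M \<Longrightarrow> opr a x \<in> M"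
  and sc_mem: "x \<in> M \<Longrightarrow> sc c x \<in> M"
  by (simp_all add: opr_def sc_def scalar_U_eq act_mem)

lemma opr_add: "a \<in> carrier UZ \<Longrightarrow> x \<in> M \<Longrightarrow> y \<in> M \<Longrightarrow> opr a (x + y) = opr a x + opr a y"
  and sc_add: "x \<in> M \<Longrightarrow> y \<in> M \<Longrightarrow> sc c (x + y) = sc c x + sc c y"
  by (simp_all add: opr_def sc_def scalar_U_eq act_add)

lemma opr_mult: "a \<in> carrier UZ \<Longrightarrow> b \<in> carrier UZ \<Longrightarrow> x \<in> M \<Longrightarrow> opr (a \<otimes>\<^bsub>UZ\<^esub> b) x = opr a (opr b x)"
  by (simp add: opr_def act_mult[symmetric] tens_mult)

lemma opr_plus: "a \<in> carrier UZ \<Longrightarrow> b \<in> carrier UZ \<Longrightarrow> x \<in> M \<Longrightarrow> opr (a \<oplus>\<^bsub>UZ\<^esub> b) x = opr a x + opr b x"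
  by (simp add: opr_def act_plus[symmetric] T.tens_add_left KK_simps)

lemma opr_one: "x \<in> M \<Longrightarrow> opr \<one>\<^bsub>UZ\<^esub> x = x"
  using act_one[of x] by (simp add: opr_def T.tens_one KK_simps)

lemma sc_mult: "x \<in> M \<Longrightarrow> sc (c * d) x = sc c (sc d x)"
  by (simp add: sc_def scalar_U_eq act_mult[symmetric] tens_mult ring.ring_simprules(12)[OF UZ_ring])

lemma sc_plus: "x \<in> M \<Longrightarrow> sc (c + d) x = sc c x + sc d x"
  using T.tens_add_right[of "\<one>\<^bsub>UZ\<^esub>" c d] by (simp add: sc_def scalar_U_eq act_plus[symmetric] KK_simps)

lemma sc_1: "x \<in> M \<Longrightarrow> sc 1 x = x"
  using opr_one by (simp add: opr_def sc_def scalar_U_eq)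

lemma opr_sc: "a \<in> carrier UZ \<Longrightarrow> x \<in> M \<Longrightarrow> opr a (sc c x) = sc c (opr a x)"
  by (simp add: opr_def sc_def scalar_U_eq act_mult[symmetric] tens_mult ring.ring_simprules(12)[OF UZ_ring]
      ring.ring_simprules(12) ring.ring_simprules(13)[OF UZ_ring] monoid.r_one[OF ring.is_monoid[OF UZ_ring]])

lemma act_tens: "a \<in> carrier UZ \<Longrightarrow> x \<in> M \<Longrightarrow> act (T.tens a c) x = sc c (opr a x)"
  by (simp add: opr_def sc_def scalar_U_eq act_mult[symmetric] tens_mult monoid.l_one[OF ring.is_monoid[OF UZ_ring]])

lemma opr_zero: "a \<in> carrier UZ \<Longrightarrow> opr a 0 = 0"
  using opr_add[of a 0 0] M_0 by simp

lemma sc_zero: "sc c 0 = 0"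
  using sc_add[of 0 0 c] M_0 by simp

lemma sc_0: "x \<in> M \<Longrightarrow> sc 0 x = 0"
  using sc_plus[of x 0 0] by simp

lemma sc_uminus: "x \<in> M \<Longrightarrow> sc (- 1) x = - x"
  using sc_plus[of x "-1" 1] by (simp add: sc_0 sc_1 eq_neg_iff_add_eq_0)

lemma sc_minus: "x \<in> M \<Longrightarrow> sc (- c) x = - sc c x"
  using sc_mult[of x "- 1" c] sc_uminus[OF sc_mem] by simp

lemma act_zero: "x \<in> M \<Longrightarrow> act \<zero>\<^bsub>T.T\<^esub> x = 0"
  using act_plus[of "\<zero>\<^bsub>T.T\<^esub>" "\<zero>\<^bsub>T.T\<^esub>" x] by simp

lemma op_rho: "a \<in> carrier env \<Longrightarrow> op (rho a) = opr a"
  by (simp add: op_def inv_into_f_f[OF rho(1)])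

lemma op_mem: "y \<in> AA \<Longrightarrow> x \<in> M \<Longrightarrow> op y x \<in> M"
  by (auto simp: AA_def op_rho UZ_env opr_mem)

lemma op_mult: "y \<in> AA \<Longrightarrow> z \<in> AA \<Longrightarrow> x \<in> M \<Longrightarrow> op (y * z) x = op y (op z x)"
  by (auto simp: AA_def op_rho UZ_env opr_mult[symmetric] rho(2)[symmetric] UZ_ops[symmetric])

lemma op_plus: "y \<in> AA \<Longrightarrow> z \<in> AA \<Longrightarrow> x \<in> M \<Longrightarrow> op (y + z) x = op y x + op z x"
  by (auto simp: AA_def op_rho UZ_env opr_plus[symmetric] rho(3)[symmetric] UZ_ops[symmetric])

lemma op_add: "y \<in> AA \<Longrightarrow> x \<in> M \<Longrightarrow> x' \<in> M \<Longrightarrow> op y (x + x') = op y x + op y x'"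
  by (auto simp: AA_def op_rho UZ_env opr_add)

lemma op_sc: "y \<in> AA \<Longrightarrow> x \<in> M \<Longrightarrow> op y (sc c x) = sc c (op y x)"
  by (auto simp: AA_def op_rho UZ_env opr_sc)

lemma op_1: "x \<in> M \<Longrightarrow> op 1 x = x"
  using opr_one op_rho[OF UZ_env[OF UZ_one]] by (simp add: UZ_ops rho_one)

lemma op_0: "x \<in> M \<Longrightarrow> op 0 x = 0"
  using op_plus[of 0 0 x] rc_0[OF AA_closed] by simp

lemma op_zero: "y \<in> AA \<Longrightarrow> op y 0 = 0"
  using op_add[of y 0 0] M_0 by simp

lemma op_uminus: "y \<in> AA \<Longrightarrow> x \<in> M \<Longrightarrow> op (- y) x = - op y x"
  using op_plus[of "- y" y x] rc_minus[OF AA_closed, of y] op_0[of x] by (simp add: eq_neg_iff_add_eq_0)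

lemma op_sum: "(\<And>i. i \<in> S \<Longrightarrow> y i \<in> AA) \<Longrightarrow> x \<in> M \<Longrightarrow> op (sum y S) x = (\<Sum>i\<in>S. op (y i) x)"
  by (induction S rule: infinite_finite_induct) (auto simp: op_0 op_plus rc_sum[OF AA_closed])

text \<open>
  The simple divided powers and the binomials generate the hyperalgebra over the field, so it
  suffices to check these.
\<close>

lemma submoduleI:
  assumes N: "N \<subseteq> M" "0 \<in> N" "\<And>x y. x \<in> N \<Longrightarrow> y \<in> N \<Longrightarrow> x + y \<in> N"
    and c: "\<And>c x. x \<in> N \<Longrightarrow> sc c x \<in> N"
    and g: "\<And>a x. a \<in> gens_simple \<Longrightarrow> x \<in> N \<Longrightarrow> opr a x \<in> N"
  shows "left_module U act N"
proof -
  have um: "- x \<in> N" if "x \<in> N" for x using c[of x "- 1"] sc_uminus that N by auto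
  have o: "\<forall>x\<in>N. opr a x \<in> N" if "a \<in> generate_ring env gens_simple" for a
    using that
  proof (induction rule: generate_ring.induct)
    case one thus ?case using opr_one N(1) by (auto simp: UZ_ops[symmetric])
  next
    case (incl a) thus ?case using g by blast
  next
    case (a_inv a)
    show ?case
    proof
      fix x assume x: "x \<in> N"
      have a: "a \<in> carrier UZ" using a_inv(1) by (simp add: carrier_UZ_simple)
      have i: "\<ominus>\<^bsub>env\<^esub> a \<in> carrier UZ" using generate_ring.a_inv[OF a_inv(1)] by (simp add: carrier_UZ_simple)
      have "opr (\<ominus>\<^bsub>env\<^esub> a) x = op (- rho a) x"
        using op_rho[of "\<ominus>\<^bsub>env\<^esub> a"] UZ_env[OF a] UZ_env[OF i] by (simp add: rho_uminus)
      also have "\<dots> = - opr a x" using a x N(1) op_rho UZ_env[OF a] by (subst op_uminus) (auto simp: AA_def)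
      finally show "opr (\<ominus>\<^bsub>env\<^esub> a) x \<in> N" using um a_inv(2) x by simp
    qed
  next
    case (eng_add a b)
    thus ?case using N by (auto simp: UZ_ops[symmetric] opr_plus carrier_UZ_simple[symmetric])
  next
    case (eng_mult a b)
    thus ?case using N by (auto simp: UZ_ops[symmetric] opr_mult carrier_UZ_simple[symmetric])
  qed
  have a: "\<forall>x\<in>N. act u x \<in> N" if "u \<in> carrier T.T" for u
    using that
  proof (induction rule: T.tensor_induct)
    case zero thus ?case using act_zero N by auto
  next
    case (add t a b)
    thus ?case using N o[of a] c by (auto simp: act_plus act_tens carrier_UZ_simple[symmetric])
  qed
  show ?thesis
    unfolding left_module_def U_T
    using N um a lm[unfolded left_module_def U_T] by (meson subsetD)
qed

text \<open>
  The span over the field. The inductive form reduces statements on linear maps to the spanning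
  set.
\<close>

inductive_set kspan :: "'m set \<Rightarrow> 'm set" for B where
  zero: "0 \<in> kspan B"
| step: "b \<in> B \<Longrightarrow> x \<in> kspan B \<Longrightarrow> sc c b + x \<in> kspan B"

lemma kspan_M:
  assumes "B \<subseteq> M" "x \<in> kspan B" shows "x \<in> M"
  using assms(2) by (induction rule: kspan.induct) (use assms(1) in \<open>auto simp: M_0 M_add sc_mem\<close>)

lemma kspan_base: "B \<subseteq> M \<Longrightarrow> b \<in> B \<Longrightarrow> b \<in> kspan B"
  using kspan.step[of b B 0 1] kspan.zero sc_1[of b] by auto

lemma kspan_mono:
  assumes "B \<subseteq> C" "x \<in> kspan B" shows "x \<in> kspan C"
  using assms(2) by (induction rule: kspan.induct) (use assms(1) in \<open>auto intro: kspan.intros\<close>)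

lemma kspan_add: "x \<in> kspan B \<Longrightarrow> y \<in> kspan B \<Longrightarrow> x + y \<in> kspan B"
  by (induction rule: kspan.induct) (auto simp: add.assoc intro: kspan.intros)

lemma kspan_sc:
  assumes "B \<subseteq> M" "x \<in> kspan B" shows "sc c x \<in> kspan B"
  using assms(2)
proof (induction rule: kspan.induct)
  case (step b x d)
  have "sc c (sc d b + x) = sc (c * d) b + sc c x"
    using step assms(1) kspan_M[OF assms(1)] by (subst sc_add) (auto simp: sc_mem sc_mult)
  thus ?case using step by (auto intro: kspan.intros)
qed (auto simp: sc_zero intro: kspan.intros)

lemma kspan_map:
  assumes "B \<subseteq> M" "x \<in> kspan B" "\<phi> 0 = 0" "\<And>x y. x \<in> M \<Longrightarrow> y \<in> M \<Longrightarrow> \<phi> (x + y) = \<phi> x + \<phi> y"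
    and "\<And>c x. x \<in> M \<Longrightarrow> \<phi> (sc c x) = sc c (\<phi> x)" "C \<subseteq> M" "\<And>b. b \<in> B \<Longrightarrow> \<phi> b \<in> kspan C"
  shows "\<phi> x \<in> kspan C"
  using assms(2)
proof (induction rule: kspan.induct)
  case zero thus ?case using assms(3) kspan.zero by simp
next
  case (step b x c)
  have "\<phi> (sc c b + x) = sc c (\<phi> b) + \<phi> x"
    using assms(1,4,5) step kspan_M[OF assms(1)] by (simp add: sc_mem subset_iff)
  thus ?case using step assms(6,7) kspan_add kspan_sc by auto
qed

lemma kspan_sum: "(\<And>i. i \<in> S \<Longrightarrow> v i \<in> kspan B) \<Longrightarrow> sum v S \<in> kspan B"
  by (induction S rule: infinite_finite_induct) (auto intro: kspan_add kspan.zero)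

lemma kspan_subset:
  assumes "B \<subseteq> kspan C" "C \<subseteq> M" "x \<in> kspan B" shows "x \<in> kspan C"
  using assms(3)
  by (induction rule: kspan.induct) (use assms(1,2) in \<open>auto intro: kspan.intros kspan_add kspan_sc\<close>)

lemma finite_dim_kspan:
  assumes "finite_dim act N" "N \<subseteq> M" shows "\<exists>B. finite B \<and> B \<subseteq> N \<and> N \<subseteq> kspan B"
proof -
  obtain B where B: "finite B" "B \<subseteq> N" "\<And>x. x \<in> N \<Longrightarrow> \<exists>c. x = (\<Sum>b\<in>B. sc (c b) b)"
    using assms(1) unfolding finite_dim_def sc_def by meson
  have "x \<in> kspan B" if xN: "x \<in> N" for x
  proof -
    obtain c where x: "x = (\<Sum>b\<in>B. sc (c b) b)" using B(3)[OF xN] by blast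
    show ?thesis unfolding x using B(2) assms(2) by (intro kspan_sum kspan_sc kspan_base) auto
  qed
  thus ?thesis using B by blast
qed

lemma kspan_coeffs:
  assumes "finite B" "B \<subseteq> M" "x \<in> kspan B" shows "\<exists>c. x = (\<Sum>b\<in>B. sc (c b) b)"
  using assms(3)
proof (induction rule: kspan.induct)
  case zero
  have "(\<Sum>b\<in>B. sc 0 b) = (\<Sum>b\<in>B. 0)" using assms(2) by (intro sum.cong refl sc_0) auto
  hence "0 = (\<Sum>b\<in>B. sc 0 b)" by simp
  thus ?case by (intro exI[of _ "\<lambda>b. 0"])
next
  case (step b x d)
  then obtain c where x: "x = (\<Sum>b\<in>B. sc (c b) b)" by blast
  have "(\<Sum>b'\<in>B. sc ((if b' = b then d else 0) + c b') b') = (\<Sum>b'\<in>B. (if b' = b then sc d b' else 0) + sc (c b') b')"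
    using assms(2) by (intro sum.cong refl) (auto simp: sc_plus sc_0)
  also have "\<dots> = sc d b + x" using step(1) assms(1) by (simp add: sum.distrib x)
  finally show ?case by (intro exI[of _ "\<lambda>b'. (if b' = b then d else 0) + c b'"]) simp
qed

end

section \<open>Weight spaces\<close>

text \<open>
  Binomial coefficients whose upper argument may be negative; the division is exact.
\<close>

definition zchoose :: "int \<Rightarrow> nat \<Rightarrow> int" (infix "zchoose" 64) where
  "(z zchoose n) = (\<Prod>i<n. z - int i) div fact n"

lemma zchoose_0 [simp]: "z zchoose 0 = 1" by (simp add: zchoose_def)

lemma zchoose_pascal: "(z + 1) zchoose Suc k = (z zchoose k) + (z zchoose Suc k)"
  using gbinomial_int_Suc_Suc[of z k]
  unfolding gbinomial_prod_rev zchoose_def by (simp only: atLeast0LessThan)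

locale O_module = hyper_left_module scale br H P e f h act M
  for scale :: "complex \<Rightarrow> 'g::ab_group_add \<Rightarrow> 'g" and br H P e f h
    and act :: "('g, 'k::field) hyperalg \<Rightarrow> 'm::ab_group_add \<Rightarrow> 'm" and M +
  assumes wm: "weight_module act M" and lf: "locally_finite act M"
begin

abbreviation "L \<equiv> weight_lattice H"
abbreviation "ws \<equiv> weight_space act M"

lemma ws_M: "ws \<mu> \<subseteq> M"
  by (auto simp: weight_space_def)

text \<open>The weight spaces contain \<open>0\<close>, so the characters that define them exist.\<close>

lemma character_exists: assumes "\<mu> \<in> L" shows "\<exists>\<chi> :: ('g, 'k) hyperalg \<Rightarrow> 'k. weight_character \<mu> \<chi>"
proof -
  obtain v where "\<forall>i\<in>L. v i \<in> ws i"
    using wm M_0 unfolding weight_module_def internal_direct_sum_def by blast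
  thus ?thesis using assms unfolding weight_space_def by blast
qed

definition wval :: "('g \<Rightarrow> complex) \<Rightarrow> ('g \<Rightarrow> complex) \<Rightarrow> int" where
  "wval \<mu> \<beta> = (THE z. \<mu> (h \<beta>) = of_int z)"

lemma wval: "\<mu> \<in> L \<Longrightarrow> \<beta> \<in> P \<Longrightarrow> \<mu> (h \<beta>) = of_int (wval \<mu> \<beta>)"
  unfolding wval_def using weight_integer[of \<mu> \<beta>] by (auto intro: theI2)

lemma wval_eqI: "\<mu> (h \<beta>) = of_int z \<Longrightarrow> wval \<mu> \<beta> = z"
  unfolding wval_def by auto

lemma Z_tens_closed: "a \<in> carrier UZ_zero \<Longrightarrow> Z.small.tens a c \<in> carrier Z.small.T"
  by (rule Z.small.tens_closed) (simp_all add: KK_simps)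

lemma Z_incl: "a \<in> carrier UZ_zero \<Longrightarrow> to_U (Z.small.tens a c) = T.tens a c"
  unfolding to_U_def by (rule Z.incl_tens) (simp_all add: KK_simps)

lemma ws_act:
  assumes "\<mu> \<in> L" "m \<in> ws \<mu>" "\<beta> \<in> P"
  shows "opr (hbinom (h \<beta>) n) m = sc (of_int (wval \<mu> \<beta> zchoose n)) m"
proof (cases "n = 0")
  case True
  have "hbinom (h \<beta>) 0 = \<one>\<^bsub>UZ\<^esub>"
    using ring.ring_simprules(12)[OF env_ring] ring.ring_simprules(6)[OF env_ring]
    by (simp add: hbinom_def env_scalar_1 UZ_ops)
  moreover have "m \<in> M" using assms(2) ws_M by blast
  ultimately show ?thesis using True by (simp add: opr_one sc_1)
next
  case False
  obtain \<chi> :: "('g, 'k) hyperalg \<Rightarrow> 'k" where \<chi>: "weight_character \<mu> \<chi>"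
      "\<And>u. u \<in> carrier U_zero \<Longrightarrow> act (to_U u) m = act (scalar_U (\<chi> u)) m"
    using assms(2) unfolding weight_space_def by blast
  let ?u = "Z.small.tens (hbinom (h \<beta>) n) 1"
  have "?u \<in> carrier U_zero"
    unfolding U_zero_def by (rule Z_tens_closed) (rule hbinom_in_UZ_zero[OF assms(3)])
  hence "opr (hbinom (h \<beta>) n) m = sc (\<chi> ?u) m"
    using \<chi>(2)[of ?u] by (simp add: opr_def sc_def Z_incl hbinom_in_UZ_zero[OF assms(3)])
  moreover have "\<chi> ?u = of_int (wval \<mu> \<beta> zchoose n)"
    using \<chi>(1) wval[OF assms(1,3)] assms(3) False unfolding weight_character_def zchoose_def by blast
  ultimately show ?thesis by simp
qed

text \<open>
  A character of the torus part is determined by its values on the binomials, so a vector on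
  which these act by the prescribed scalars is a weight vector.
\<close>

lemma wsI:
  assumes "\<mu> \<in> L" "m \<in> M"
    and act: "\<And>\<beta> n. \<beta> \<in> P \<Longrightarrow> opr (hbinom (h \<beta>) n) m = sc (of_int (wval \<mu> \<beta> zchoose n)) m"
  shows "m \<in> ws \<mu>"
proof -
  obtain \<chi> :: "('g, 'k) hyperalg \<Rightarrow> 'k" where \<chi>: "weight_character \<mu> \<chi>"
    using character_exists[OF assms(1)] by blast
  have hom: "\<chi> \<in> ring_hom Z.small.T KK"
    using \<chi> by (simp add: weight_character_def U_zero_def)
  have \<chi>_add: "\<chi> (u \<oplus>\<^bsub>Z.small.T\<^esub> v) = \<chi> u + \<chi> v" if "u \<in> carrier Z.small.T" "v \<in> carrier Z.small.T" for u v
    using ring_hom_add[OF hom that] by (simp add: KK_simps)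
  have \<chi>_mult: "\<chi> (u \<otimes>\<^bsub>Z.small.T\<^esub> v) = \<chi> u * \<chi> v" if "u \<in> carrier Z.small.T" "v \<in> carrier Z.small.T" for u v
    using ring_hom_mult[OF hom that] by (simp add: KK_simps)
  have \<chi>_scalar: "\<chi> (Z.small.tens \<one>\<^bsub>UZ_zero\<^esub> c) = c" for c
    using \<chi> by (simp add: weight_character_def)
  have \<chi>_zero: "\<chi> \<zero>\<^bsub>Z.small.T\<^esub> = 0"
  proof -
    have "\<chi> \<zero>\<^bsub>Z.small.T\<^esub> + 0 = \<chi> \<zero>\<^bsub>Z.small.T\<^esub> + \<chi> \<zero>\<^bsub>Z.small.T\<^esub>"
      using \<chi>_add[OF Z.small.T.zero_closed Z.small.T.zero_closed]
      unfolding Z.small.T.l_zero[OF Z.small.T.zero_closed] add_0_right .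
    from add_left_imp_eq[OF this] show ?thesis by (rule sym)
  qed
  have eZ: "x \<otimes>\<^bsub>UZ_zero\<^esub> y = x \<otimes>\<^bsub>env\<^esub> y" "x \<oplus>\<^bsub>UZ_zero\<^esub> y = x \<oplus>\<^bsub>env\<^esub> y" "\<one>\<^bsub>UZ_zero\<^esub> = \<one>\<^bsub>env\<^esub>" "\<zero>\<^bsub>UZ_zero\<^esub> = \<zero>\<^bsub>env\<^esub>" for x y
    by (simp_all add: UZ_zero_def)
  have cZ: "carrier UZ_zero = generate_ring env gens_zero" by (simp add: UZ_zero_def)
  have t1: "Z.small.tens a 1 \<in> carrier Z.small.T" if "a \<in> generate_ring env gens_zero" for a
    using that by (intro Z_tens_closed) (simp add: cZ)
  have inUZ: "a \<in> carrier UZ" if "a \<in> generate_ring env gens_zero" for a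
    using that UZ_zero_sub(2) cZ by blast
  have gen: "opr a m = sc (\<chi> (Z.small.tens a 1)) m" if "a \<in> generate_ring env gens_zero" for a
    using that
  proof (induction rule: generate_ring.induct)
    case one
    show ?case using \<chi>_scalar[of 1] opr_one assms(2) by (simp add: eZ UZ_ops[symmetric] sc_1)
  next
    case (incl a)
    then obtain \<beta> n where a: "a = hbinom (h \<beta>) n" "\<beta> \<in> P" "n > 0" by (auto simp: gens_zero_def)
    have "\<chi> (Z.small.tens a 1) = of_int (wval \<mu> \<beta> zchoose n)"
      using \<chi> wval[OF assms(1) a(2)] a unfolding weight_character_def zchoose_def by blast
    thus ?case using act a by simp
  next
    case (a_inv a)
    let ?b = "\<ominus>\<^bsub>env\<^esub> a"
    have b: "?b \<in> generate_ring env gens_zero" using a_inv(1) by (rule generate_ring.a_inv)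
    have z: "a \<oplus>\<^bsub>env\<^esub> ?b = \<zero>\<^bsub>env\<^esub>" using ring.ring_simprules(16)[OF env_ring] UZ_env inUZ[OF a_inv(1)] by simp
    have "Z.small.tens a 1 \<oplus>\<^bsub>Z.small.T\<^esub> Z.small.tens ?b 1 = Z.small.tens (a \<oplus>\<^bsub>UZ_zero\<^esub> ?b) 1"
      using a_inv(1) b by (intro Z.small.tens_add_left[symmetric]) (auto simp: cZ KK_simps)
    also have "\<dots> = \<zero>\<^bsub>Z.small.T\<^esub>"
      using Z.small.tens_zero_left[of 1] by (simp add: eZ z KK_simps)
    finally have "\<chi> (Z.small.tens a 1) + \<chi> (Z.small.tens ?b 1) = 0"
      using \<chi>_add[OF t1[OF a_inv(1)] t1[OF b]] \<chi>_zero by simp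
    hence "\<chi> (Z.small.tens ?b 1) = - \<chi> (Z.small.tens a 1)" by (simp add: eq_neg_iff_add_eq_0 add.commute)
    moreover have "opr ?b m = - opr a m"
    proof -
      have "opr a m + opr ?b m = opr (a \<oplus>\<^bsub>UZ\<^esub> ?b) m" using inUZ a_inv(1) b assms(2) by (simp add: opr_plus)
      also have "\<dots> = op 0 m" using op_rho[of "\<zero>\<^bsub>env\<^esub>"] ring.ring_simprules(2)[OF env_ring] by (simp add: UZ_ops z rho_zero)
      finally have "opr a m + opr ?b m = 0" using op_0 assms(2) by simp
      thus ?thesis by (simp add: eq_neg_iff_add_eq_0 add.commute)
    qed
    ultimately show ?case using sc_minus[OF assms(2)] by (simp only: a_inv.IH)
  next
    case (eng_add a b)
    have "Z.small.tens (a \<oplus>\<^bsub>env\<^esub> b) 1 = Z.small.tens a 1 \<oplus>\<^bsub>Z.small.T\<^esub> Z.small.tens b 1"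
      using Z.small.tens_add_left[of a b 1] eng_add(1,2) by (simp add: cZ KK_simps eZ)
    hence "\<chi> (Z.small.tens (a \<oplus>\<^bsub>env\<^esub> b) 1) = \<chi> (Z.small.tens a 1) + \<chi> (Z.small.tens b 1)"
      using \<chi>_add t1 eng_add(1,2) by simp
    thus ?case using opr_plus[OF inUZ inUZ assms(2)] eng_add assms(2) by (simp add: UZ_ops sc_plus)
  next
    case (eng_mult a b)
    have "Z.small.tens (a \<otimes>\<^bsub>env\<^esub> b) 1 = Z.small.tens a 1 \<otimes>\<^bsub>Z.small.T\<^esub> Z.small.tens b 1"
      using Z.small.tens_mult[of a 1 b 1] eng_mult(1,2) by (simp add: cZ KK_simps eZ)
    hence "\<chi> (Z.small.tens (a \<otimes>\<^bsub>env\<^esub> b) 1) = \<chi> (Z.small.tens a 1) * \<chi> (Z.small.tens b 1)"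
      using \<chi>_mult t1 eng_mult(1,2) by simp
    moreover have "opr (a \<otimes>\<^bsub>env\<^esub> b) m = opr a (opr b m)"
      using opr_mult[OF inUZ inUZ assms(2)] eng_mult(1,2) by (simp add: UZ_ops)
    ultimately show ?case
      using eng_mult inUZ[OF eng_mult(1)] assms(2) by (simp add: opr_sc sc_mult[OF assms(2), symmetric] mult.commute)
  qed
  have "act (to_U u) m = sc (\<chi> u) m" if "u \<in> carrier Z.small.T" for u
    using that
  proof (induction rule: Z.small.tensor_induct)
    case zero
    show ?case using Z.incl_zero act_zero assms(2) by (simp add: to_U_def \<chi>_zero sc_0)
  next
    case (add t a c)
    have a: "a \<in> generate_ring env gens_zero" using add by (simp add: cZ)
    have tc: "Z.small.tens a c \<in> carrier Z.small.T" using add by (intro Z_tens_closed)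
    have "to_U (t \<oplus>\<^bsub>Z.small.T\<^esub> Z.small.tens a c) = to_U t \<oplus>\<^bsub>T.T\<^esub> T.tens a c"
      using Z.incl_add[OF add.hyps(1) tc] Z_incl[OF add.hyps(2)] by (simp add: to_U_def)
    moreover have "to_U t \<in> carrier T.T" unfolding to_U_def by (rule Z.incl_closed[OF add.hyps(1)])
    ultimately have 1: "act (to_U (t \<oplus>\<^bsub>Z.small.T\<^esub> Z.small.tens a c)) m = act (to_U t) m + sc c (opr a m)"
      using act_plus assms(2) inUZ[OF a] by (simp add: act_tens)
    have "Z.small.tens a c = Z.small.tens a 1 \<otimes>\<^bsub>Z.small.T\<^esub> Z.small.tens \<one>\<^bsub>UZ_zero\<^esub> c"
      using Z.small.tens_mult[of a 1 "\<one>\<^bsub>UZ_zero\<^esub>" c] add.hyps(2) ring.ring_simprules(6)[OF UZ_zero_ring]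
        monoid.r_one[OF ring.is_monoid[OF UZ_zero_ring]] by (simp add: KK_simps)
    hence "\<chi> (Z.small.tens a c) = \<chi> (Z.small.tens a 1) * c"
      using \<chi>_mult[OF t1[OF a] Z_tens_closed, of "\<one>\<^bsub>UZ_zero\<^esub>" c] ring.ring_simprules(6)[OF UZ_zero_ring]
      by (simp add: \<chi>_scalar)
    hence 2: "\<chi> (t \<oplus>\<^bsub>Z.small.T\<^esub> Z.small.tens a c) = \<chi> t + \<chi> (Z.small.tens a 1) * c"
      using \<chi>_add[OF add.hyps(1) tc] by simp
    show ?case unfolding 1 2 using add.IH gen[OF a] assms(2)
      by (simp add: sc_plus sc_mult[symmetric] mult.commute)
  qed
  thus ?thesis using \<chi> assms(2) unfolding weight_space_def U_zero_def sc_def by blast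
qed

lemma ws_zero: "\<mu> \<in> L \<Longrightarrow> 0 \<in> ws \<mu>"
  by (rule wsI) (simp_all add: M_0 opr_zero sc_zero simple_in_UZ)

lemma ws_add: "\<mu> \<in> L \<Longrightarrow> x \<in> ws \<mu> \<Longrightarrow> y \<in> ws \<mu> \<Longrightarrow> x + y \<in> ws \<mu>"
  using ws_M by (intro wsI) (auto simp: M_add opr_add sc_add simple_in_UZ ws_act subset_iff)

lemma ws_sc: "\<mu> \<in> L \<Longrightarrow> x \<in> ws \<mu> \<Longrightarrow> sc c x \<in> ws \<mu>"
  using ws_M by (intro wsI) (auto simp: sc_mem opr_sc simple_in_UZ ws_act subset_iff sc_mult[symmetric] mult.commute)

sublocale W: direct_sum "weight_lattice H" "weight_space act M" M
  by unfold_locales (use wm in \<open>auto simp: weight_module_def ws_zero ws_add M_add\<close>)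

lemma op_hbinom: "\<beta> \<in> P \<Longrightarrow> op (bin (iota (h \<beta>)) n) = opr (hbinom (h \<beta>) n)"
  using op_rho[of "hbinom (h \<beta>) n"] by (simp add: rho_hbinom)

lemma op_dpow: "op (dpow (iota x) n) = opr (divided_power x n)"
  using op_rho[of "divided_power x n"] by (simp add: rho_divided_power)

text \<open>
  Both sides obey Pascal's rule, which determines them upwards and downwards from the unshifted
  case.
\<close>

lemma shifted_binomial_action:
  assumes "\<mu> \<in> L" "m \<in> ws \<mu>" "\<beta> \<in> P"
  shows "op (bin (iota (h \<beta>) + of_int c) n) m = sc (of_int ((wval \<mu> \<beta> + c) zchoose n)) m"
proof -
  let ?b = "\<lambda>c. bin (iota (h \<beta>) + of_int c)" and ?z = "wval \<mu> \<beta>"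
  have mM: "m \<in> M" using assms(2) ws_M by blast
  have mem: "?b c n \<in> AA" for c n
    by (rule bin_shift_mem[OF AA_closed]) (rule AA_gens(2)[OF assms(3)])
  have z0: "op (?b c 0) m = sc (of_int ((?z + c) zchoose 0)) m" for c
    using mM by (simp add: op_1 sc_1)
  show ?thesis
  proof (induction c arbitrary: n rule: int_induct[where k = 0])
    case base
    show ?case using ws_act[OF assms] op_hbinom[OF assms(3)] by simp
  next
    case (step1 c)
    show ?case
    proof (cases n)
      case (Suc k)
      have "?b (c + 1) (Suc k) = ?b c (Suc k) + ?b c k"
        using bin_pascal[of "iota (h \<beta>) + of_int c" k] by (simp only: of_int_add of_int_1 add.assoc)
      hence "op (?b (c + 1) (Suc k)) m = op (?b c (Suc k)) m + op (?b c k) m"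
        using op_plus[OF mem mem mM] by (simp only:)
      moreover have "((?z + (c + 1)) zchoose Suc k) = ((?z + c) zchoose k) + ((?z + c) zchoose Suc k)"
        using zchoose_pascal[of "?z + c" k] by (simp add: add.assoc)
      ultimately show ?thesis using step1 mM Suc by (simp add: sc_plus add.commute del: bin.simps)
    qed (use z0 in simp)
  next
    case (step2 c)
    show ?case
    proof (induction n)
      case (Suc k)
      have "?b c (Suc k) = ?b (c - 1) (Suc k) + ?b (c - 1) k"
        using bin_pascal[of "iota (h \<beta>) + of_int (c - 1)" k] by (simp add: add.assoc del: bin.simps)
      hence "op (?b c (Suc k)) m = op (?b (c - 1) (Suc k)) m + op (?b (c - 1) k) m"
        using op_plus[OF mem mem mM] by (simp only:)
      moreover have "((?z + c) zchoose Suc k) = ((?z + (c - 1)) zchoose k) + ((?z + (c - 1)) zchoose Suc k)"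
        using zchoose_pascal[of "?z + (c - 1)" k] by (simp add: add.assoc)
      ultimately have "sc (of_int ((?z + (c - 1)) zchoose k) + of_int ((?z + (c - 1)) zchoose Suc k)) m =
          op (?b (c - 1) (Suc k)) m + op (?b (c - 1) k) m"
        using step2(2)[of "Suc k"] by simp
      thus ?case using Suc mM by (simp add: sc_plus del: bin.simps)
    qed (use z0 in simp)
  qed
qed

text \<open>
  The binomials of \<open>h\<^sub>\<beta>\<close> move past a divided power of \<open>x\<^sub>\<alpha>\<close> with a shift of their argument by a
  multiple of the Cartan integer, which is the change of the weight.
\<close>

lemma dpow_weight_shift:
  assumes \<mu>: "\<mu> \<in> L" and m: "m \<in> ws \<mu>" and a: "\<alpha> \<in> R"
  shows "opr (divided_power (xv \<alpha>) n) m \<in> ws (str \<mu> \<alpha> (int n))"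
proof (rule wsI)
  have mM: "m \<in> M" using m ws_M by blast
  show "str \<mu> \<alpha> (int n) \<in> L" by (rule weight_lattice_str[OF \<mu> a])
  show "opr (divided_power (xv \<alpha>) n) m \<in> M" by (rule opr_mem[OF divided_power_in_UZ[OF a] mM])
  fix \<beta> k assume b: "\<beta> \<in> P"
  have bR: "\<beta> \<in> R" using b basis(2) by blast
  let ?h = "iota (h \<beta>)" and ?x = "iota (xv \<alpha>)" and ?c = "cartan_int \<alpha> \<beta>"
  have "br (h \<beta>) (xv \<alpha>) = scale (of_int ?c) (xv \<alpha>)"
    using br_coroot[OF bR root_vector(2)[OF a]] by (simp add: coroot_P[OF b] cartan_int[OF a bR, unfolded coroot_P[OF b]])
  hence "?h * ?x - ?x * ?h = of_int ?c * ?x" by (simp add: iota_br iota_scale_int)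
  hence comm: "bin ?h k * dpow ?x n = dpow ?x n * bin (?h + of_int (int n * ?c)) k"
    by (rule bin_dpow_weight)
  have mem: "bin (?h + of_int (int n * ?c)) k \<in> AA"
    by (rule bin_shift_mem[OF AA_closed]) (rule AA_gens(2)[OF b])
  have "opr (hbinom (h \<beta>) k) (opr (divided_power (xv \<alpha>) n) m) = op (bin ?h k * dpow ?x n) m"
    using AA_gens a b mM by (simp add: op_mult op_hbinom op_dpow)
  also have "\<dots> = op (dpow ?x n) (op (bin (?h + of_int (int n * ?c)) k) m)"
    unfolding comm using mem AA_gens(1)[OF a] mM by (simp only: op_mult)
  also have "\<dots> = op (dpow ?x n) (sc (of_int ((wval \<mu> \<beta> + int n * ?c) zchoose k)) m)"
    by (simp only: shifted_binomial_action[OF \<mu> m b])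
  also have "\<dots> = sc (of_int ((wval \<mu> \<beta> + int n * ?c) zchoose k)) (opr (divided_power (xv \<alpha>) n) m)"
    using op_sc[OF AA_gens(1)[OF a] mM] by (simp add: op_dpow)
  also have "wval \<mu> \<beta> + int n * ?c = wval (str \<mu> \<alpha> (int n)) \<beta>"
    by (rule sym, rule wval_eqI) (simp add: str_apply wval[OF \<mu> b] cartan_int[OF a bR, unfolded coroot_P[OF b]])
  finally show "opr (hbinom (h \<beta>) k) (opr (divided_power (xv \<alpha>) n) m) =
      sc (of_int (wval (str \<mu> \<alpha> (int n)) \<beta> zchoose k)) (opr (divided_power (xv \<alpha>) n) m)" .
qed

lemma str_inj: "\<alpha> \<in> R \<Longrightarrow> inj_on (\<lambda>\<mu>. str \<mu> \<alpha> j) A"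
  by (auto simp: inj_on_def str_def fun_eq_iff)

lemma cmp_dpow:
  assumes "x \<in> M" "\<mu> \<in> L" "\<alpha> \<in> R"
  shows "W.cmp (opr (divided_power (xv \<alpha>) n) x) (str \<mu> \<alpha> (int n)) = opr (divided_power (xv \<alpha>) n) (W.cmp x \<mu>)"
  by (rule cmp_hom[OF W.direct_sum_axioms W.direct_sum_axioms, where \<tau> = "\<lambda>\<mu>. str \<mu> \<alpha> (int n)"])
    (use assms divided_power_in_UZ[OF assms(3)] in \<open>auto simp: opr_mem opr_add str_inj weight_lattice_str dpow_weight_shift M_0\<close>)

lemma cmp_sc:
  assumes "x \<in> M" "\<mu> \<in> L" shows "W.cmp (sc c x) \<mu> = sc c (W.cmp x \<mu>)"
  by (rule cmp_hom[OF W.direct_sum_axioms W.direct_sum_axioms, where \<tau> = "\<lambda>\<mu>. \<mu>"])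
    (use assms in \<open>auto simp: sc_mem sc_add ws_sc M_0\<close>)

end

section \<open>Finitely generated modules have finite-dimensional weight spaces\<close>

context O_module
begin

type_synonym 'x word = "(('x \<Rightarrow> complex) \<times> nat) list"

text \<open>
  The letter \<open>(\<beta>, k)\<close> stands for the divided power of \<open>f\<^sub>\<beta>\<close> with exponent \<open>k + 1\<close>, so that letters
  change the weight and words of bounded total exponent have bounded length.
\<close>

primrec word_act :: "'g word \<Rightarrow> 'm \<Rightarrow> 'm" where
  "word_act [] v = v"
| "word_act (l # w) v = opr (divided_power (f (fst l)) (Suc (snd l))) (word_act w v)"

primrec word_weight :: "'g word \<Rightarrow> ('g \<Rightarrow> complex) \<Rightarrow> 'g \<Rightarrow> complex" where
  "word_weight [] \<mu> = \<mu>"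
| "word_weight (l # w) \<mu> = str (word_weight w \<mu>) (fst l) (- int (Suc (snd l)))"

definition words :: "'g word set" where "words = lists (P \<times> UNIV)"

lemma words_simps [simp]: "[] \<in> words" "l # w \<in> words \<longleftrightarrow> fst l \<in> P \<and> w \<in> words"
  by (cases l; auto simp: words_def)+

lemma f_opr: assumes "\<beta> \<in> P" shows "divided_power (f \<beta>) n = divided_power (xv (ng \<beta>)) n"
  using assms by (simp add: xv_P)

lemma word_act_ws:
  "w \<in> words \<Longrightarrow> \<mu> \<in> L \<Longrightarrow> v \<in> ws \<mu> \<Longrightarrow> word_weight w \<mu> \<in> L \<and> word_act w v \<in> ws (word_weight w \<mu>)"
proof (induction w)
  case (Cons l w)
  have l: "fst l \<in> P" "ng (fst l) \<in> R" using Cons.prems basis(2) by auto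
  have "word_weight (l # w) \<mu> = str (word_weight w \<mu>) (ng (fst l)) (int (Suc (snd l)))"
    by (simp add: str_ng)
  thus ?case
    using Cons dpow_weight_shift[OF _ _ l(2), of "word_weight w \<mu>" "word_act w v" "Suc (snd l)"]
      weight_lattice_str[OF _ l(2), of "word_weight w \<mu>" "int (Suc (snd l))"] l by (auto simp: f_opr)
qed simp

definition word_total :: "'g word \<Rightarrow> nat" where "word_total w = (\<Sum>l\<leftarrow>w. Suc (snd l))"
definition word_count :: "'g word \<Rightarrow> ('g \<Rightarrow> complex) \<Rightarrow> nat" where
  "word_count w \<beta> = (\<Sum>l\<leftarrow>w. if fst l = \<beta> then Suc (snd l) else 0)"

lemma word_weight_count: "w \<in> words \<Longrightarrow> word_weight w \<mu> t = \<mu> t - (\<Sum>\<beta>\<in>P. of_nat (word_count w \<beta>) * \<beta> t)"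
proof (induction w)
  case (Cons l w)
  have "(\<Sum>\<beta>\<in>P. of_nat (word_count (l # w) \<beta>) * \<beta> t) =
      (\<Sum>\<beta>\<in>P. (if \<beta> = fst l then of_nat (Suc (snd l)) * \<beta> t else 0) + of_nat (word_count w \<beta>) * \<beta> t)"
    by (intro sum.cong refl) (auto simp: word_count_def algebra_simps)
  also have "\<dots> = of_nat (Suc (snd l)) * fst l t + (\<Sum>\<beta>\<in>P. of_nat (word_count w \<beta>) * \<beta> t)"
    using Cons.prems basis(1) by (simp add: sum.distrib del: of_nat_Suc)
  finally show ?case using Cons by (simp add: str_apply algebra_simps)
qed (simp add: word_count_def)

lemma word_total_count: "w \<in> words \<Longrightarrow> word_total w = (\<Sum>\<beta>\<in>P. word_count w \<beta>)"
proof (induction w)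
  case (Cons l w)
  have "(\<Sum>\<beta>\<in>P. word_count (l # w) \<beta>) = (\<Sum>\<beta>\<in>P. (if \<beta> = fst l then Suc (snd l) else 0) + word_count w \<beta>)"
    by (intro sum.cong refl) (auto simp: word_count_def)
  thus ?case using Cons basis(1) by (simp add: sum.distrib word_total_def)
qed (simp add: word_count_def word_total_def)

text \<open>
  The simple roots are independent, so a weight determines the total exponent of a word, and
  there are only finitely many words of a given total exponent.
\<close>

lemma finite_words_weight: "finite {w \<in> words. word_weight w \<nu> = \<mu>}"
proof (cases "\<exists>w0\<in>words. word_weight w0 \<nu> = \<mu>")
  case True
  then obtain w0 where w0: "w0 \<in> words" "word_weight w0 \<nu> = \<mu>" by blast
  have tot: "word_total w = word_total w0" if w: "w \<in> words" "word_weight w \<nu> = \<mu>" for w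
  proof -
    have "(of_nat (word_count w \<beta>) :: complex) = of_nat (word_count w0 \<beta>)" if "\<beta> \<in> P" for \<beta>
    proof (rule independent_coeffs[OF _ that, of "\<lambda>\<beta>. of_nat (word_count w \<beta>)" "\<lambda>\<beta>. of_nat (word_count w0 \<beta>)"])
      fix t
      have "word_weight w \<nu> t = word_weight w0 \<nu> t" using w w0 by simp
      thus "(\<Sum>\<beta>\<in>P. of_nat (word_count w \<beta>) * \<beta> t) = (\<Sum>\<beta>\<in>P. of_nat (word_count w0 \<beta>) * \<beta> t)"
        unfolding word_weight_count[OF w(1)] word_weight_count[OF w0(1)] by simp
    qed
    hence "word_count w \<beta> = word_count w0 \<beta>" if "\<beta> \<in> P" for \<beta> using that by simp
    thus ?thesis by (simp add: word_total_count w w0)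
  qed
  have b: "length w \<le> word_total w" "\<forall>l\<in>set w. snd l \<le> word_total w" for w :: "'g word"
    by (induction w) (auto simp: word_total_def)
  have "{w \<in> words. word_weight w \<nu> = \<mu>} \<subseteq> {w. set w \<subseteq> P \<times> {..word_total w0} \<and> length w \<le> word_total w0}"
  proof clarify
    fix w assume w: "w \<in> words" "\<mu> = word_weight w \<nu>"
    have "set w \<subseteq> P \<times> UNIV" using w(1) by (auto simp: words_def)
    thus "set w \<subseteq> P \<times> {..word_total w0} \<and> length w \<le> word_total w0"
      using b[of w] tot[OF w(1)] w(2) by auto
  qed
  thus ?thesis by (rule finite_subset) (simp add: finite_lists_length_le basis(1))
next
  case False
  hence "{w \<in> words. word_weight w \<nu> = \<mu>} = {}" by blast
  thus ?thesis by (simp only: finite.emptyI)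
qed

text \<open>
  By the commutation formulas a raising operator moves past a lowering word, and what arrives at
  \<open>V\<close> stays in the span of \<open>V\<close>.
\<close>

lemma lowering_span_submodule:
  assumes V: "\<And>v. v \<in> V \<Longrightarrow> \<exists>\<mu>\<in>L. v \<in> ws \<mu>"
    and raise: "\<And>v \<beta> n. v \<in> V \<Longrightarrow> \<beta> \<in> P \<Longrightarrow> opr (divided_power (e \<beta>) n) v \<in> kspan V"
  shows "left_module U act (kspan {word_act w v | w v. w \<in> words \<and> v \<in> V})"
proof -
  define G where "G = {word_act w v | w v. w \<in> words \<and> v \<in> V}"
  have Gws: "\<exists>\<mu>\<in>L. g \<in> ws \<mu>" if gG: "g \<in> G" for g
  proof -
    obtain w v where g: "g = word_act w v" "w \<in> words" "v \<in> V" using gG by (auto simp: G_def)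
    obtain \<mu> where "\<mu> \<in> L" "v \<in> ws \<mu>" using V[OF g(3)] by blast
    thus ?thesis using word_act_ws[OF g(2)] g(1) by blast
  qed
  have GM: "G \<subseteq> M" using Gws ws_M by blast
  have VG: "V \<subseteq> G" by (force simp: G_def intro: exI[of _ "[]"])
  have ext: "op y x \<in> kspan G" if y: "y \<in> AA" and g: "\<And>g. g \<in> G \<Longrightarrow> op y g \<in> kspan G" and x: "x \<in> kspan G" for y x
    by (rule kspan_map[OF GM x, of "op y"]) (use y g GM in \<open>auto simp: op_zero op_add op_sc\<close>)
  \<comment> \<open>The operators that preserve the span form a ring, so it suffices that this ring contains the
    simple divided powers and the binomials.\<close>
  define S where "S = {y \<in> AA. \<forall>x\<in>kspan G. op y x \<in> kspan G}"
  have kM: "x \<in> M" if "x \<in> kspan G" for x using kspan_M[OF GM that] .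
  have S: "ring_closed S"
    unfolding ring_closed_def
  proof (intro conjI ballI)
    show "1 \<in> S" using rc_1[OF AA_closed] op_1 kM by (auto simp: S_def)
    fix x assume x: "x \<in> S"
    show "- x \<in> S"
    proof -
      have "op (- x) u \<in> kspan G" if "u \<in> kspan G" for u
      proof -
        have "op (- x) u = sc (- 1) (op x u)"
          using x kM[OF that] by (simp add: S_def op_uminus sc_uminus op_mem)
        thus ?thesis using x that kspan_sc[OF GM] by (auto simp: S_def)
      qed
      thus ?thesis using x rc_minus[OF AA_closed] by (auto simp: S_def)
    qed
    fix y assume y: "y \<in> S"
    show "x + y \<in> S" "x * y \<in> S"
      using x y rc_add[OF AA_closed] rc_mult[OF AA_closed] kM by (auto simp: S_def op_plus op_mult kspan_add)
  qed
  have fS: "dpow (iota (f \<beta>)) n \<in> S" if b: "\<beta> \<in> P" for \<beta> n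
  proof (cases n)
    case 0 thus ?thesis using rc_1[OF S] by simp
  next
    case (Suc k)
    have A: "dpow (iota (f \<beta>)) n \<in> AA" using AA_gens(1)[of "ng \<beta>"] b basis(2) by (auto simp: xv_P)
    have "op (dpow (iota (f \<beta>)) n) g \<in> kspan G" if gG: "g \<in> G" for g
    proof -
      obtain w v where g: "g = word_act w v" "w \<in> words" "v \<in> V" using gG by (auto simp: G_def)
      have "op (dpow (iota (f \<beta>)) n) g = word_act ((\<beta>, k) # w) v"
        unfolding g(1) Suc by (simp only: op_dpow word_act.simps fst_conv snd_conv)
      moreover have "word_act ((\<beta>, k) # w) v \<in> G" unfolding G_def using g b by (intro CollectI exI[of _ "(\<beta>, k) # w"] exI[of _ v]) auto
      ultimately show ?thesis using kspan_base[OF GM] by simp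
    qed
    thus ?thesis using A ext by (auto simp: S_def)
  qed
  have hS: "bin (iota (h \<beta>)) n \<in> S" if b: "\<beta> \<in> P" for \<beta> n
  proof -
    have "op (bin (iota (h \<beta>)) n) g \<in> kspan G" if gG: "g \<in> G" for g
    proof -
      obtain \<mu> where "\<mu> \<in> L" "g \<in> ws \<mu>" using Gws[OF gG] by blast
      hence "op (bin (iota (h \<beta>)) n) g = sc (of_int (wval \<mu> \<beta> zchoose n)) g"
        by (simp only: op_hbinom[OF b] ws_act[OF _ _ b])
      thus ?thesis using kspan_sc[OF GM kspan_base[OF GM gG]] by simp
    qed
    thus ?thesis using AA_gens(2)[OF b] ext by (auto simp: S_def)
  qed
  have eA: "dpow (iota (e \<beta>)) n \<in> AA" if "\<beta> \<in> P" for \<beta> n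
    using AA_gens(1)[of \<beta>] that basis(2) by (auto simp: xv_P)
  \<comment> \<open>Induction on the word: \<open>e\<^sub>\<beta>\<close> commutes with \<open>f\<^sub>\<gamma>\<close> for \<open>\<gamma> \<noteq> \<beta>\<close>, and otherwise the commutation
    formula leaves operators of \<open>S\<close> on the left.\<close>
  have raise_word: "op (dpow (iota (e \<beta>)) n) (word_act w v) \<in> kspan G" if "w \<in> words" "v \<in> V" "\<beta> \<in> P" for w v \<beta> n
    using that(1)
  proof (induction w arbitrary: n)
    case Nil
    show ?case using raise[OF that(2,3)] kspan_mono[OF VG] by (simp add: op_dpow)
  next
    case (Cons l w)
    obtain \<gamma> k where l: "l = (\<gamma>, k)" "\<gamma> \<in> P" "w \<in> words" using Cons.prems by (cases l) auto
    let ?E = "dpow (iota (e \<beta>))" and ?F = "dpow (iota (f \<gamma>))"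
    have uG: "word_act w v \<in> G" using l that by (auto simp: G_def)
    hence u: "word_act w v \<in> M" using GM by blast
    have FS: "?F j \<in> S" for j using fS[OF l(2)] .
    have FA: "?F j \<in> AA" for j using FS by (simp add: S_def)
    have bR: "\<beta> \<in> R" "\<gamma> \<in> R" using that(3) l basis(2) by auto
    have "op (?E n) (word_act (l # w) v) = op (?E n * ?F (Suc k)) (word_act w v)"
      using eA[OF that(3)] FA u by (simp add: op_mult op_dpow l)
    also have "\<dots> \<in> kspan G"
    proof (cases "\<beta> = \<gamma>")
      case False
      have "br (xv \<beta>) (xv (ng \<gamma>)) = 0"
      proof (rule br_roots_zero)
        have "str (ng \<gamma>) \<beta> 1 = str \<beta> \<gamma> (- 1)" by (simp add: str_def ng_def)
        thus "str (ng \<gamma>) \<beta> 1 \<notin> R" using simple_difference[OF that(3) l(2) False] by simp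
        show "ng \<gamma> \<noteq> ng \<beta>" using False ng_ng by metis
      qed (use bR in auto)
      hence "iota (e \<beta>) * iota (f \<gamma>) = iota (f \<gamma>) * iota (e \<beta>)"
        using iota_br[of "e \<beta>" "f \<gamma>"] that(3) l(2) by (simp add: xv_P)
      hence "iota (e \<beta>) ^ n * iota (f \<gamma>) ^ Suc k = iota (f \<gamma>) ^ Suc k * iota (e \<beta>) ^ n"
        by (metis power_commuting_commutes)
      hence "?E n * ?F (Suc k) = ?F (Suc k) * ?E n" by (simp add: dpow_def del: power_Suc fact_Suc)
      hence "op (?E n * ?F (Suc k)) (word_act w v) = op (?F (Suc k)) (op (?E n) (word_act w v))"
        using eA[OF that(3)] FA u by (simp add: op_mult)
      thus ?thesis using FS Cons.IH[OF l(3), of n] by (auto simp: S_def)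
    next
      case True
      have ef: "iota (e \<beta>) * iota (f \<beta>) - iota (f \<beta>) * iota (e \<beta>) = iota (h \<beta>)"
        using iota_br chevalley(7) that(3) by simp
      have w: "iota (h \<beta>) * iota (xv \<alpha>) - iota (xv \<alpha>) * iota (h \<beta>) = of_int (cartan_int \<alpha> \<beta>) * iota (xv \<alpha>)" if "\<alpha> \<in> R" for \<alpha>
        using br_coroot[OF bR(1) root_vector(2)[OF that]]
        by (simp add: coroot_P[OF \<open>\<beta> \<in> P\<close>] cartan_int[OF that bR(1), unfolded coroot_P[OF \<open>\<beta> \<in> P\<close>]] iota_br iota_scale_int)
      have he: "iota (h \<beta>) * iota (e \<beta>) - iota (e \<beta>) * iota (h \<beta>) = of_int 2 * iota (e \<beta>)"
        using w[OF bR(1)] that(3) cartan_int_self[OF bR(1)] by (simp add: xv_P)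
      have hf: "iota (h \<beta>) * iota (f \<beta>) - iota (f \<beta>) * iota (h \<beta>) = of_int (- 2) * iota (f \<beta>)"
        using w[OF R_ng[OF bR(1)]] that(3) cartan_int_self[OF bR(1)] cartan_int_ng_left[OF bR(1) bR(1)] by (simp add: xv_P)
      let ?c = "\<lambda>t. (if t \<le> Suc k then dpow (iota (f \<beta>)) (Suc k - t) else 0) *
        bin (iota (h \<beta>) + of_int (2 * int t - int (Suc k) - int n)) t"
      have cS: "?c t \<in> S" for t
        by (intro rc_mult[OF S] bin_shift_mem[OF S] hS[OF that(3)]) (use fS[OF that(3)] rc_0[OF S] in auto)
      have cA: "?c t \<in> AA" for t using cS by (simp only: S_def mem_Collect_eq)
      have "op (?E n * ?F (Suc k)) (word_act w v) = op (\<Sum>t\<le>n. ?c t * ?E (n - t)) (word_act w v)"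
        using kostant_commutation[OF ef he hf, of n "Suc k"] by (simp only: True)
      also have "\<dots> = (\<Sum>t\<le>n. op (?c t * ?E (n - t)) (word_act w v))"
        by (rule op_sum) (intro rc_mult[OF AA_closed] cA eA[OF that(3)] u)+
      also have "\<dots> = (\<Sum>t\<le>n. op (?c t) (op (?E (n - t)) (word_act w v)))"
        by (intro sum.cong refl op_mult cA eA[OF that(3)] u)
      also have "\<dots> \<in> kspan G"
      proof (rule kspan_sum)
        fix t
        show "op (?c t) (op (?E (n - t)) (word_act w v)) \<in> kspan G"
          using cS[of t] Cons.IH[OF l(3), of "n - t"] unfolding S_def by blast
      qed
      finally show ?thesis .
    qed
    finally show ?case .
  qed
  have eS: "dpow (iota (e \<beta>)) n \<in> S" if b: "\<beta> \<in> P" for \<beta> n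
    using ext[OF eA[OF b]] raise_word b eA[OF b] unfolding S_def G_def by blast
  have "left_module U act (kspan G)"
  proof (rule submoduleI)
    show "kspan G \<subseteq> M" using kM by blast
    show "opr a x \<in> kspan G" if "a \<in> gens_simple" "x \<in> kspan G" for a x
    proof -
      have "rho a \<in> S" using that(1) eS fS hS unfolding gens_simple_def by (auto simp: rho_divided_power rho_hbinom)
      moreover have "a \<in> carrier env" using that(1) by (auto simp: gens_simple_def)
      ultimately show ?thesis using that(2) op_rho[of a] unfolding S_def by auto
    qed
  qed (auto intro: kspan.zero kspan_add kspan_sc[OF GM])
  thus ?thesis by (simp add: G_def)
qed

lemma kspan_cmp:
  assumes "B \<subseteq> M" "x \<in> kspan B" "\<mu> \<in> L" "C \<subseteq> M" "\<And>b. b \<in> B \<Longrightarrow> W.cmp b \<mu> \<in> kspan C"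
  shows "W.cmp x \<mu> \<in> kspan C"
proof (rule kspan_map[OF assms(1,2), of "\<lambda>x. W.cmp x \<mu>"])
  show "W.cmp 0 \<mu> = 0" using W.cmp_single[OF assms(3) ws_zero[OF assms(3)]] by simp
qed (use assms in \<open>auto simp: W.cmp_add cmp_sc\<close>)

text \<open>
  A finitely generated module is spanned by words applied to the weight components of finitely
  many vectors: local finiteness makes the raising operators preserve a finite-dimensional space
  that contains the generators, and with it the span of the weight components of a basis, because
  the raising operators map weight spaces to weight spaces.
\<close>

theorem finite_weight_spaces:
  assumes fg: "finitely_generated U act M"
  shows "\<exists>\<Lambda>. finite \<Lambda> \<and> \<Lambda> \<subseteq> L \<and> (\<forall>N. left_module U act N \<longrightarrow> (\<forall>\<mu>\<in>\<Lambda>. ws \<mu> \<subseteq> N) \<longrightarrow> N \<subseteq> M \<longrightarrow> N = M)"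
    and "\<And>\<mu>. \<mu> \<in> L \<Longrightarrow> \<exists>B. finite B \<and> B \<subseteq> M \<and> ws \<mu> \<subseteq> kspan B"
proof -
  obtain S where S: "finite S" "S \<subseteq> M" "\<And>N. left_module U act N \<Longrightarrow> S \<subseteq> N \<Longrightarrow> N \<subseteq> M \<Longrightarrow> N = M"
    using fg unfolding finitely_generated_def by blast
  have "\<exists>B. finite B \<and> B \<subseteq> M \<and> s \<in> kspan B \<and> (\<forall>b\<in>B. \<forall>\<beta>\<in>P. \<forall>n. opr (divided_power (e \<beta>) n) b \<in> kspan B)"
    if "s \<in> S" for s
  proof -
    obtain N where N: "s \<in> N" "N \<subseteq> M" "left_module U_pos (\<lambda>u. act (to_U u)) N" "finite_dim act N"
      using lf S(2) \<open>s \<in> S\<close> unfolding locally_finite_def by blast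
    obtain B where B: "finite B" "B \<subseteq> N" "N \<subseteq> kspan B" using finite_dim_kspan[OF N(4,2)] by blast
    have eN: "opr (divided_power (e \<beta>) n) b \<in> N" if "b \<in> N" "\<beta> \<in> P" for b \<beta> n
    proof -
      have c: "Q.small.tens (divided_power (e \<beta>) n) 1 \<in> carrier U_pos"
        unfolding U_pos_def by (rule Q.small.tens_closed) (simp_all add: e_in_UZ_pos that KK_simps)
      have "act (to_U (Q.small.tens (divided_power (e \<beta>) n) 1)) b \<in> N"
        using N(3) c that(1) unfolding left_module_def by blast
      moreover have "to_U (Q.small.tens (divided_power (e \<beta>) n) 1) = T.tens (divided_power (e \<beta>) n) 1"
        unfolding to_U_def by (rule Q.incl_tens) (simp_all add: e_in_UZ_pos that KK_simps)
      ultimately show ?thesis by (simp add: opr_def)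
    qed
    show ?thesis
    proof (intro exI[of _ B] conjI ballI allI)
      show "finite B" "B \<subseteq> M" "s \<in> kspan B" using B N(1,2) by auto
      show "opr (divided_power (e \<beta>) n) b \<in> kspan B" if "b \<in> B" "\<beta> \<in> P" for b \<beta> n
        using eN[OF _ that(2)] that(1) B(2,3) by blast
    qed
  qed
  then obtain Bs where Bs: "\<And>s. s \<in> S \<Longrightarrow> finite (Bs s)" "\<And>s. s \<in> S \<Longrightarrow> Bs s \<subseteq> M" "\<And>s. s \<in> S \<Longrightarrow> s \<in> kspan (Bs s)"
      "\<And>s b \<beta> n. s \<in> S \<Longrightarrow> b \<in> Bs s \<Longrightarrow> \<beta> \<in> P \<Longrightarrow> opr (divided_power (e \<beta>) n) b \<in> kspan (Bs s)"
    by metis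
  define B where "B = (\<Union>s\<in>S. Bs s)"
  have B: "finite B" "B \<subseteq> M" using S(1) Bs(1,2) by (auto simp: B_def)
  have SB: "s \<in> kspan B" if "s \<in> S" for s
    by (rule kspan_mono[OF _ Bs(3)[OF that]]) (use that in \<open>auto simp: B_def\<close>)
  have eB: "opr (divided_power (e \<beta>) n) b \<in> kspan B" if b: "b \<in> B" and bP: "\<beta> \<in> P" for b \<beta> n
  proof -
    obtain s where s: "s \<in> S" "b \<in> Bs s" using b by (auto simp: B_def)
    show ?thesis by (rule kspan_mono[OF _ Bs(4)[OF s bP]]) (use s in \<open>auto simp: B_def\<close>)
  qed
  \<comment> \<open>Each component is recorded with its weight, from which the weights of the words applied to
    it are computed.\<close>
  define V0 where "V0 = (\<Union>b\<in>B. (\<lambda>\<mu>. (W.cmp b \<mu>, \<mu>)) ` {\<mu>. W.cmp b \<mu> \<noteq> 0})"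
  define V where "V = fst ` V0"
  have V0: "\<mu> \<in> L \<and> v \<in> ws \<mu> \<and> v \<in> V" if "(v, \<mu>) \<in> V0" for v \<mu>
  proof -
    obtain b where b: "b \<in> B" "v = W.cmp b \<mu>" "W.cmp b \<mu> \<noteq> 0" using \<open>(v, \<mu>) \<in> V0\<close> by (auto simp: V0_def)
    hence bM: "b \<in> M" using B by blast
    have "\<mu> \<in> L" using W.cmp_out[OF bM] b(3) by blast
    thus ?thesis using W.cmp_mem[OF bM] b(2) that unfolding V_def by force
  qed
  have finV0: "finite V0" unfolding V0_def using B W.cmp_finite by auto
  have VM: "V \<subseteq> M" using V0 ws_M unfolding V_def by fastforce
  have cV: "W.cmp b \<mu> \<in> kspan V" if "b \<in> B" for b \<mu>
  proof (cases "W.cmp b \<mu> = 0")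
    case True thus ?thesis by (simp add: kspan.zero)
  next
    case False
    hence "(W.cmp b \<mu>, \<mu>) \<in> V0" using that by (auto simp: V0_def)
    thus ?thesis using V0 kspan_base[OF VM] by blast
  qed
  have BV: "B \<subseteq> kspan V"
  proof
    fix b assume b: "b \<in> B"
    hence "b = (\<Sum>\<mu> | W.cmp b \<mu> \<noteq> 0. W.cmp b \<mu>)" using W.cmp_sum B by auto
    moreover have "(\<Sum>\<mu> | W.cmp b \<mu> \<noteq> 0. W.cmp b \<mu>) \<in> kspan V" by (rule kspan_sum) (rule cV[OF b])
    ultimately show "b \<in> kspan V" by simp
  qed
  have Vw: "\<exists>\<mu>\<in>L. v \<in> ws \<mu>" if v: "v \<in> V" for v
  proof -
    obtain \<mu> where "(v, \<mu>) \<in> V0" using v by (auto simp: V_def)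
    thus ?thesis using V0 by blast
  qed
  have raise: "opr (divided_power (e \<beta>) n) v \<in> kspan V" if v: "v \<in> V" and b: "\<beta> \<in> P" for v \<beta> n
  proof -
    obtain \<mu> where vm: "(v, \<mu>) \<in> V0" using v by (auto simp: V_def)
    then obtain b where b': "b \<in> B" "v = W.cmp b \<mu>" by (auto simp: V0_def)
    have bR: "\<beta> \<in> R" using b basis(2) by blast
    have \<mu>: "\<mu> \<in> L" using V0[OF vm] by blast
    have "opr (divided_power (e \<beta>) n) v = W.cmp (opr (divided_power (e \<beta>) n) b) (str \<mu> \<beta> (int n))"
      using cmp_dpow[of b \<mu> \<beta> n] b' B \<mu> bR by (auto simp: xv_P[OF b])
    also have "\<dots> \<in> kspan V"
      by (rule kspan_cmp[OF B(2) eB[OF b'(1) b] weight_lattice_str[OF \<mu> bR] VM cV])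
    finally show ?thesis .
  qed
  define G where "G = {word_act w v | w v. w \<in> words \<and> v \<in> V}"
  have Gsub: "left_module U act (kspan G)"
    unfolding G_def by (rule lowering_span_submodule[OF Vw raise])
  have VG: "V \<subseteq> G" by (force simp: G_def intro: exI[of _ "[]"])
  have GM: "G \<subseteq> M" using word_act_ws Vw ws_M unfolding G_def by blast
  have "kspan G = M"
  proof (rule S(3)[OF Gsub])
    show "S \<subseteq> kspan G"
    proof
      fix s assume "s \<in> S"
      thus "s \<in> kspan G" using kspan_mono[OF VG kspan_subset[OF BV VM SB]] by blast
    qed
    show "kspan G \<subseteq> M" using kspan_M[OF GM] by blast
  qed
  note MG = this[symmetric]
  show "\<exists>\<Lambda>. finite \<Lambda> \<and> \<Lambda> \<subseteq> L \<and> (\<forall>N. left_module U act N \<longrightarrow> (\<forall>\<mu>\<in>\<Lambda>. ws \<mu> \<subseteq> N) \<longrightarrow> N \<subseteq> M \<longrightarrow> N = M)"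
  proof (intro exI[of _ "snd ` V0"] conjI allI impI)
    show "finite (snd ` V0)" using finV0 by simp
    show "snd ` V0 \<subseteq> L" using V0 by auto
    fix N assume N: "left_module U act N" "\<forall>\<mu>\<in>snd ` V0. ws \<mu> \<subseteq> N" "N \<subseteq> M"
    have N0: "0 \<in> N" and Nadd: "\<And>x y. x \<in> N \<Longrightarrow> y \<in> N \<Longrightarrow> x + y \<in> N"
      and Nact: "\<And>u x. u \<in> carrier T.T \<Longrightarrow> x \<in> N \<Longrightarrow> act u x \<in> N"
      using N(1) unfolding left_module_def U_T by blast+
    have VN: "v \<in> N" if v: "v \<in> V" for v
    proof -
      obtain \<mu> where vm: "(v, \<mu>) \<in> V0" using v by (auto simp: V_def)
      hence "\<mu> \<in> snd ` V0" by force
      thus ?thesis using bspec[OF N(2), of \<mu>] V0[OF vm] by blast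
    qed
    have "x \<in> N" if "x \<in> kspan V" for x
      using that by (induction rule: kspan.induct) (use VN N0 Nadd Nact in \<open>auto simp: sc_def scalar_U_eq\<close>)
    hence "S \<subseteq> N" using kspan_subset[OF BV VM SB] by blast
    thus "N = M" using S(3)[OF N(1)] N(3) by blast
  qed
  fix \<mu> assume \<mu>: "\<mu> \<in> L"
  define Gm where "Gm = (\<Union>(v, \<nu>)\<in>V0. (\<lambda>w. word_act w v) ` {w \<in> words. word_weight w \<nu> = \<mu>})"
  have "finite Gm" unfolding Gm_def using finV0 finite_words_weight by auto
  moreover have GmG: "Gm \<subseteq> G" using V0 unfolding Gm_def G_def by blast
  have GmM: "Gm \<subseteq> M" using GmG GM by blast
  moreover have "ws \<mu> \<subseteq> kspan Gm"
  proof
    fix x assume x: "x \<in> ws \<mu>"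
    hence "x \<in> kspan G" using ws_M MG by blast
    hence "W.cmp x \<mu> \<in> kspan Gm"
    proof (rule kspan_cmp[OF GM _ \<mu> GmM])
      fix g assume "g \<in> G"
      then obtain w v where g: "g = word_act w v" "w \<in> words" "v \<in> V" by (auto simp: G_def)
      then obtain \<nu> where vl: "(v, \<nu>) \<in> V0" by (auto simp: V_def)
      have gw: "word_weight w \<nu> \<in> L" "g \<in> ws (word_weight w \<nu>)"
        using word_act_ws[OF g(2)] V0[OF vl] g(1) by auto
      have "W.cmp g \<mu> = (if \<mu> = word_weight w \<nu> then g else 0)" using W.cmp_single[OF gw] by simp
      moreover have "g \<in> Gm" if "\<mu> = word_weight w \<nu>" using that vl g unfolding Gm_def by blast
      ultimately show "W.cmp g \<mu> \<in> kspan Gm" using kspan_base[OF GmM] kspan.zero by auto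
    qed
    thus "x \<in> kspan Gm" using W.cmp_single[OF \<mu> x] by simp
  qed
  ultimately show "\<exists>B. finite B \<and> B \<subseteq> M \<and> ws \<mu> \<subseteq> kspan B" by blast
qed

end

section \<open>Fitting endomorphisms and the Krull-Schmidt-Azumaya theorem\<close>

definition module_hom ::
  "('u, 'b) ring_scheme \<Rightarrow> ('u \<Rightarrow> 'm \<Rightarrow> 'm) \<Rightarrow> 'm::ab_group_add set \<Rightarrow> 'm set \<Rightarrow> ('m \<Rightarrow> 'm) \<Rightarrow> bool" where
  "module_hom A act M N \<phi> \<longleftrightarrow> (\<forall>x\<in>M. \<phi> x \<in> N) \<and> (\<forall>x\<in>M. \<forall>y\<in>M. \<phi> (x + y) = \<phi> x + \<phi> y) \<and>
     (\<forall>a\<in>carrier A. \<forall>x\<in>M. \<phi> (act a x) = act a (\<phi> x))"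

lemma module_homD:
  assumes "module_hom A act M N \<phi>"
  shows "x \<in> M \<Longrightarrow> \<phi> x \<in> N" "x \<in> M \<Longrightarrow> y \<in> M \<Longrightarrow> \<phi> (x + y) = \<phi> x + \<phi> y"
    "a \<in> carrier A \<Longrightarrow> x \<in> M \<Longrightarrow> \<phi> (act a x) = act a (\<phi> x)"
  using assms by (auto simp: module_hom_def)

lemma left_moduleD:
  assumes "left_module A act M"
  shows "0 \<in> M" "x \<in> M \<Longrightarrow> y \<in> M \<Longrightarrow> x + y \<in> M" "x \<in> M \<Longrightarrow> - x \<in> M"
    "a \<in> carrier A \<Longrightarrow> x \<in> M \<Longrightarrow> act a x \<in> M"
    "a \<in> carrier A \<Longrightarrow> x \<in> M \<Longrightarrow> y \<in> M \<Longrightarrow> act a (x + y) = act a x + act a y"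
  using assms by (auto simp: left_module_def)

lemma left_module_diff: "left_module A act M \<Longrightarrow> x \<in> M \<Longrightarrow> y \<in> M \<Longrightarrow> x - y \<in> M"
  using left_moduleD(2,3)[of A act M] by (metis add_uminus_conv_diff)

lemma left_submoduleI:
  assumes "left_module A act M" "T \<subseteq> M" "0 \<in> T" "\<And>x y. x \<in> T \<Longrightarrow> y \<in> T \<Longrightarrow> x + y \<in> T"
    "\<And>x. x \<in> T \<Longrightarrow> - x \<in> T" "\<And>a x. a \<in> carrier A \<Longrightarrow> x \<in> T \<Longrightarrow> act a x \<in> T"
  shows "left_module A act T"
  unfolding left_module_def
  using assms(3-) assms(1)[unfolded left_module_def] subsetD[OF assms(2)] by simp

lemma left_module_zero_act: "left_module A act M \<Longrightarrow> a \<in> carrier A \<Longrightarrow> act a 0 = 0"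
  using left_moduleD(5)[of A act M a 0 0] left_moduleD(1)[of A act M] by simp

lemma left_module_sum:
  assumes "left_module A act M" "\<And>i. i \<in> S \<Longrightarrow> v i \<in> M" shows "sum v S \<in> M"
  using assms(2) by (induction S rule: infinite_finite_induct) (auto simp: left_moduleD[OF assms(1)])

lemma left_module_act_sum:
  assumes "left_module A act M" "a \<in> carrier A" "\<And>i. i \<in> S \<Longrightarrow> v i \<in> M"
  shows "act a (sum v S) = (\<Sum>i\<in>S. act a (v i))"
  using assms(3)
  by (induction S rule: infinite_finite_induct)
    (simp_all add: left_module_zero_act[OF assms(1,2)] left_moduleD(5)[OF assms(1,2)] left_module_sum[OF assms(1)])

lemma zero_module: "left_module A act M \<Longrightarrow> left_module A act {0}"
  by (rule left_submoduleI[of A act M]) (auto simp: left_moduleD left_module_zero_act)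

lemma hom_0: "left_module A act M \<Longrightarrow> module_hom A act M N \<phi> \<Longrightarrow> \<phi> 0 = 0"
  using module_homD(2)[of A act M N \<phi> 0 0] left_moduleD(1)[of A act M] by simp

lemma hom_uminus:
  assumes "left_module A act M" "module_hom A act M N \<phi>" "x \<in> M" shows "\<phi> (- x) = - \<phi> x"
proof -
  have "\<phi> (- x) + \<phi> x = 0"
    using module_homD(2)[OF assms(2), of "- x" x] left_moduleD(3)[OF assms(1,3)] assms hom_0[OF assms(1,2)] by simp
  thus ?thesis by (simp add: eq_neg_iff_add_eq_0)
qed

lemma hom_diff:
  assumes "left_module A act M" "module_hom A act M N \<phi>" "x \<in> M" "y \<in> M" shows "\<phi> (x - y) = \<phi> x - \<phi> y"
  using module_homD(2)[OF assms(2,3), of "- y"] hom_uminus[OF assms(1,2,4)] left_moduleD(3)[OF assms(1,4)] by simp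

lemma hom_sum:
  assumes "left_module A act M" "module_hom A act M N \<phi>" "\<And>i. i \<in> S \<Longrightarrow> v i \<in> M"
  shows "\<phi> (sum v S) = (\<Sum>i\<in>S. \<phi> (v i))"
proof -
  have "\<phi> (sum v S) = (\<Sum>i\<in>S. \<phi> (v i)) \<and> sum v S \<in> M"
    using assms(3)
    by (induction S rule: infinite_finite_induct)
      (auto simp: hom_0[OF assms(1,2)] left_moduleD[OF assms(1)] module_homD(2)[OF assms(2)])
  thus ?thesis by blast
qed

lemma hom_comp: "module_hom A act M N \<phi> \<Longrightarrow> module_hom A act N N' \<psi> \<Longrightarrow> module_hom A act M N' (\<lambda>x. \<psi> (\<phi> x))"
  by (auto simp: module_hom_def)

lemma hom_mono: "module_hom A act M N \<phi> \<Longrightarrow> M' \<subseteq> M \<Longrightarrow> N \<subseteq> N' \<Longrightarrow> module_hom A act M' N' \<phi>"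
  unfolding module_hom_def by (meson subsetD)

lemma hom_funpow: "module_hom A act M M \<phi> \<Longrightarrow> module_hom A act M M (\<phi> ^^ n)"
  by (induction n) (auto simp: module_hom_def)

lemma preimage_submodule:
  assumes "left_module A act M" "module_hom A act M N \<phi>" "left_module A act T" "left_module A act N"
  shows "left_module A act {x \<in> M. \<phi> x \<in> T}"
  by (rule left_submoduleI[OF assms(1)])
    (use assms(1,3) in \<open>auto simp: left_moduleD[OF assms(1)] left_moduleD[OF assms(3)] hom_0[OF assms(1,2)]
      module_homD[OF assms(2)] hom_uminus[OF assms(1,2)]\<close>)

lemma image_submodule:
  assumes "left_module A act M" "module_hom A act M N \<phi>" "left_module A act N"
  shows "left_module A act (\<phi> ` M)"
proof (rule left_submoduleI[OF assms(3)])
  show "\<phi> ` M \<subseteq> N" using module_homD(1)[OF assms(2)] by blast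
  show "0 \<in> \<phi> ` M" using hom_0[OF assms(1,2)] left_moduleD(1)[OF assms(1)] by (metis imageI)
next
  fix x y assume "x \<in> \<phi> ` M" "y \<in> \<phi> ` M"
  then obtain u v where "u \<in> M" "v \<in> M" "x = \<phi> u" "y = \<phi> v" by blast
  thus "x + y \<in> \<phi> ` M" using module_homD(2)[OF assms(2)] left_moduleD(2)[OF assms(1)] by (metis imageI)
next
  fix x assume "x \<in> \<phi> ` M"
  then obtain u where "u \<in> M" "x = \<phi> u" by blast
  thus "- x \<in> \<phi> ` M" using hom_uminus[OF assms(1,2)] left_moduleD(3)[OF assms(1)] by (metis imageI)
next
  fix a x assume "a \<in> carrier A" "x \<in> \<phi> ` M"
  then obtain u where "u \<in> M" "x = \<phi> u" by blast
  thus "act a x \<in> \<phi> ` M"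
    using \<open>a \<in> carrier A\<close> module_homD(3)[OF assms(2)] left_moduleD(4)[OF assms(1)] by (metis imageI)
qed

text \<open>
  Components in a sum of two submodules are unique, so taking them is additive and commutes
  with the action.
\<close>

lemma two_summand_projection:
  assumes M: "left_module A act M" and Xs: "left_module A act Xs" and Ys: "left_module A act Ys"
    and int: "Xs \<inter> Ys = {0}" and sum: "M = {x + y | x y. x \<in> Xs \<and> y \<in> Ys}"
  shows "\<exists>q. module_hom A act M Xs q \<and> (\<forall>x\<in>Xs. q x = x) \<and> (\<forall>x\<in>M. x - q x \<in> Ys)"
proof -
  define q where "q m = (SOME x. x \<in> Xs \<and> m - x \<in> Ys)" for m
  have q: "q m \<in> Xs \<and> m - q m \<in> Ys" if m: "m \<in> M" for m
  proof -
    obtain x y where "x \<in> Xs" "y \<in> Ys" "m = x + y" using m unfolding sum by blast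
    hence "\<exists>x. x \<in> Xs \<and> m - x \<in> Ys" by (intro exI[of _ x]) simp
    from someI_ex[OF this] show ?thesis by (simp add: q_def)
  qed
  have uniq: "q m = x" if "m \<in> M" "x \<in> Xs" "m - x \<in> Ys" for m x
  proof -
    have "q m - x \<in> Xs" using left_module_diff[OF Xs] q[OF that(1)] that(2) by blast
    moreover have "(m - x) - (m - q m) \<in> Ys" using left_module_diff[OF Ys that(3)] q[OF that(1)] by blast
    ultimately have "q m - x \<in> Xs \<inter> Ys" by simp
    thus ?thesis using int by auto
  qed
  have "module_hom A act M Xs q"
    unfolding module_hom_def
  proof (intro conjI ballI)
    fix m assume m: "m \<in> M"
    show "q m \<in> Xs" using q[OF m] by blast
    fix m' assume m': "m' \<in> M"
    show "q (m + m') = q m + q m'"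
    proof (rule uniq)
      show "m + m' \<in> M" by (rule left_moduleD(2)[OF M m m'])
      show "q m + q m' \<in> Xs" using left_moduleD(2)[OF Xs] q m m' by blast
      have "(m - q m) + (m' - q m') \<in> Ys" using left_moduleD(2)[OF Ys] q m m' by blast
      thus "m + m' - (q m + q m') \<in> Ys" by (simp add: algebra_simps)
    qed
  next
    fix a m assume a: "a \<in> carrier A" and m: "m \<in> M"
    have XM: "Xs \<subseteq> M"
    proof
      fix x assume "x \<in> Xs"
      thus "x \<in> M" unfolding sum using left_moduleD(1)[OF Ys] by (intro CollectI exI[of _ x] exI[of _ 0]) simp
    qed
    show "q (act a m) = act a (q m)"
    proof (rule uniq)
      show "act a m \<in> M" by (rule left_moduleD(4)[OF M a m])
      show "act a (q m) \<in> Xs" using left_moduleD(4)[OF Xs a] q[OF m] by blast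
      have "act a (m - q m) \<in> Ys" using left_moduleD(4)[OF Ys a] q[OF m] by blast
      moreover have "act a ((m - q m) + q m) = act a (m - q m) + act a (q m)"
        using left_moduleD(5)[OF M a, of "m - q m" "q m"] left_module_diff[OF M m, of "q m"] q[OF m] XM by blast
      ultimately show "act a m - act a (q m) \<in> Ys" by simp
    qed
  qed
  moreover have "q x = x" if "x \<in> Xs" for x
  proof (rule uniq)
    show "x \<in> M" unfolding sum using left_moduleD(1)[OF Ys] that by (intro CollectI exI[of _ x] exI[of _ 0]) simp
  qed (use that left_moduleD(1)[OF Ys] in auto)
  ultimately show ?thesis using q by blast
qed

definition indecomposable :: "('u, 'b) ring_scheme \<Rightarrow> ('u \<Rightarrow> 'm \<Rightarrow> 'm) \<Rightarrow> 'm::ab_group_add set \<Rightarrow> bool" where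
  "indecomposable A act N \<longleftrightarrow> N \<noteq> {0} \<and>
     (\<forall>Xs Ys. left_module A act Xs \<and> left_module A act Ys \<and> Xs \<inter> Ys = {0} \<and> N = {a + b | a b. a \<in> Xs \<and> b \<in> Ys}
        \<longrightarrow> Xs = {0} \<or> Ys = {0})"

text \<open>
  The conclusion of Fitting's lemma. It makes the endomorphism ring of a non-zero module local.
\<close>

definition fitting :: "('u, 'b) ring_scheme \<Rightarrow> ('u \<Rightarrow> 'm \<Rightarrow> 'm) \<Rightarrow> 'm::ab_group_add set \<Rightarrow> bool" where
  "fitting A act N \<longleftrightarrow> (\<forall>\<phi>. module_hom A act N N \<phi> \<longrightarrow> bij_betw \<phi> N N \<or> (\<exists>n. \<forall>x\<in>N. (\<phi> ^^ n) x = 0))"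

text \<open>
  In a ring whose elements are units or nilpotent, \<open>1 - a\<close> is a unit for every nilpotent \<open>a\<close>;
  so a sum of two non-units is not a unit.
\<close>

lemma fitting_add:
  assumes N: "left_module A act N" and fit: "fitting A act N"
    and \<phi>: "module_hom A act N N \<phi>" and \<psi>: "module_hom A act N N \<psi>" and bij: "bij_betw (\<lambda>x. \<phi> x + \<psi> x) N N"
  shows "bij_betw \<phi> N N \<or> bij_betw \<psi> N N"
proof (rule disjCI)
  assume n\<psi>: "\<not> bij_betw \<psi> N N"
  define \<theta> where "\<theta> x = \<phi> x + \<psi> x" for x
  define \<theta>' where "\<theta>' = inv_into N \<theta>"
  have bt: "bij_betw \<theta> N N" using bij by (simp add: \<theta>_def[abs_def])
  have \<theta>: "module_hom A act N N \<theta>"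
    using module_homD[OF \<phi>] module_homD[OF \<psi>] left_moduleD[OF N] unfolding module_hom_def \<theta>_def by (auto simp: algebra_simps)
  have inv: "\<theta>' y \<in> N" "\<theta> (\<theta>' y) = y" if "y \<in> N" for y
    using that bt unfolding \<theta>'_def by (auto simp: bij_betw_def intro: inv_into_into f_inv_into_f)
  have inv': "\<theta>' (\<theta> x) = x" if "x \<in> N" for x
    using that bt unfolding \<theta>'_def by (simp add: bij_betw_def)
  have \<theta>'_hom: "module_hom A act N N \<theta>'"
    unfolding module_hom_def
  proof (intro conjI ballI)
    fix x assume x: "x \<in> N" thus "\<theta>' x \<in> N" by (rule inv)
    fix y assume y: "y \<in> N"
    have "\<theta> (\<theta>' x + \<theta>' y) = x + y" using module_homD(2)[OF \<theta>] inv x y by simp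
    thus "\<theta>' (x + y) = \<theta>' x + \<theta>' y" using inv'[of "\<theta>' x + \<theta>' y"] left_moduleD(2)[OF N] inv x y by simp
  next
    fix a x assume a: "a \<in> carrier A" and x: "x \<in> N"
    have "\<theta> (act a (\<theta>' x)) = act a x" using module_homD(3)[OF \<theta> a] inv x by simp
    thus "\<theta>' (act a x) = act a (\<theta>' x)" using inv'[of "act a (\<theta>' x)"] left_moduleD(4)[OF N a] inv x by simp
  qed
  \<comment> \<open>Division by the sum \<open>\<theta>\<close> reduces to the case that the sum is the identity: \<open>b\<close> and \<open>1 - b\<close>
    correspond to \<open>\<psi>\<close> and \<open>\<phi>\<close>.\<close>
  define b where "b x = \<theta>' (\<psi> x)" for x
  have b: "module_hom A act N N b" unfolding b_def by (rule hom_comp[OF \<psi> \<theta>'_hom])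
  have "\<not> bij_betw b N N"
  proof
    assume "bij_betw b N N"
    hence "bij_betw (\<theta> \<circ> b) N N" using bt by (rule bij_betw_trans)
    moreover have "(\<theta> \<circ> b) x = \<psi> x" if "x \<in> N" for x using inv module_homD(1)[OF \<psi> that] by (simp add: b_def)
    ultimately show False using n\<psi> bij_betw_cong[of N "\<theta> \<circ> b" \<psi>] by blast
  qed
  then obtain m where nil: "\<And>x. x \<in> N \<Longrightarrow> (b ^^ m) x = 0" using fit b unfolding fitting_def by blast
  note bp = hom_funpow[OF b]
  have c: "module_hom A act N N (\<lambda>x. x - b x)"
    using module_homD[OF b] left_module_diff[OF N] left_moduleD[OF N] unfolding module_hom_def
  proof (intro conjI ballI)
    fix a x assume a: "a \<in> carrier A" and x: "x \<in> N"
    have "act a ((x - b x) + b x) = act a (x - b x) + act a (b x)"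
      by (rule left_moduleD(5)[OF N a]) (use left_module_diff[OF N] module_homD(1)[OF b] x in auto)
    thus "act a x - b (act a x) = act a (x - b x)" using module_homD(3)[OF b a x] by simp
  qed auto
  have "inj_on (\<lambda>x. x - b x) N"
  proof (rule inj_onI)
    fix x y assume xy: "x \<in> N" "y \<in> N" "x - b x = y - b y"
    let ?z = "x - y"
    have z: "?z \<in> N" by (rule left_module_diff[OF N xy(1,2)])
    have "(x - b x) - (y - b y) = 0" using xy(3) by simp
    hence "(b x - b y) - ?z = 0" by (simp add: algebra_simps)
    hence "b ?z = ?z" using hom_diff[OF N b xy(1,2)] by simp
    hence "(b ^^ k) ?z = ?z" for k by (induction k) auto
    thus "x = y" using nil[OF z] by simp
  qed
  moreover have "y \<in> (\<lambda>x. x - b x) ` N" if y: "y \<in> N" for y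
  proof -
    \<comment> \<open>The geometric series inverts \<open>1 - b\<close> for the nilpotent \<open>b\<close>.\<close>
    let ?s = "\<lambda>k. \<Sum>i<k. (b ^^ i) y"
    have pN: "(b ^^ i) y \<in> N" for i using module_homD(1)[OF bp y] .
    have s: "?s k \<in> N \<and> ?s k - b (?s k) = y - (b ^^ k) y" for k
    proof (induction k)
      case 0 thus ?case using left_moduleD(1)[OF N] hom_0[OF N b] by simp
    next
      case (Suc k)
      have e: "?s (Suc k) = ?s k + (b ^^ k) y" by simp
      have sN: "?s k \<in> N" and eq: "?s k - b (?s k) = y - (b ^^ k) y" using Suc by blast+
      have be: "b (?s k + (b ^^ k) y) = b (?s k) + (b ^^ Suc k) y" using module_homD(2)[OF b sN pN] by simp
      have "?s (Suc k) - b (?s (Suc k)) = (?s k - b (?s k)) + ((b ^^ k) y - (b ^^ Suc k) y)"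
        unfolding e be by (rule add_diff_add)
      also have "\<dots> = y - (b ^^ Suc k) y" unfolding eq by simp
      finally show ?case unfolding e using left_moduleD(2)[OF N sN pN] by blast
    qed
    have "y = ?s m - b (?s m)" using s[of m] nil[OF y] by simp
    thus ?thesis using s[of m] by blast
  qed
  ultimately have "bij_betw (\<lambda>x. x - b x) N N"
    using module_homD(1)[OF c] unfolding bij_betw_def by blast
  hence "bij_betw (\<theta> \<circ> (\<lambda>x. x - b x)) N N" using bt by (rule bij_betw_trans)
  moreover have "(\<theta> \<circ> (\<lambda>x. x - b x)) x = \<phi> x" if "x \<in> N" for x
  proof -
    have "\<theta> (x - b x) = \<theta> x - \<theta> (b x)" by (rule hom_diff[OF N \<theta> that module_homD(1)[OF b that]])
    also have "\<theta> (b x) = \<psi> x" using inv module_homD(1)[OF \<psi> that] by (simp add: b_def)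
    finally show ?thesis by (simp add: \<theta>_def)
  qed
  ultimately show "bij_betw \<phi> N N" using bij_betw_cong[of N "\<theta> \<circ> (\<lambda>x. x - b x)" \<phi>] by blast
qed

lemma fitting_sum:
  assumes N: "left_module A act N" "N \<noteq> {0}" and fit: "fitting A act N" and "finite J"
    and \<theta>: "\<And>j. j \<in> J \<Longrightarrow> module_hom A act N N (\<theta> j)" and bij: "bij_betw (\<lambda>x. \<Sum>j\<in>J. \<theta> j x) N N"
  shows "\<exists>j\<in>J. bij_betw (\<theta> j) N N"
  using assms(4) \<theta> bij
proof (induction J rule: finite_induct)
  case empty
  obtain x where "x \<in> N" "x \<noteq> 0" using N left_moduleD(1)[OF N(1)] by blast
  hence "x \<in> (\<lambda>x. 0) ` N" using empty by (simp add: bij_betw_def)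
  thus ?case using \<open>x \<noteq> 0\<close> by auto
next
  case (insert j J)
  have s: "module_hom A act N N (\<lambda>x. \<Sum>j\<in>J. \<theta> j x)"
  proof -
    have mem: "(\<Sum>j\<in>J. \<theta> j x) \<in> N" if "x \<in> N" for x
      using left_module_sum[OF N(1), of J "\<lambda>j. \<theta> j x"] module_homD(1)[OF insert.prems(1)] that by blast
    have act_sum: "act a (\<Sum>j\<in>J. \<theta> j x) = (\<Sum>j\<in>J. act a (\<theta> j x))" if "a \<in> carrier A" "x \<in> N" for a x
      using left_module_act_sum[OF N(1) that(1), of J "\<lambda>j. \<theta> j x"] module_homD(1)[OF insert.prems(1)] that(2) by blast
    show ?thesis
      unfolding module_hom_def
    proof (intro conjI ballI)
      show "(\<Sum>j\<in>J. \<theta> j (x + y)) = (\<Sum>j\<in>J. \<theta> j x) + (\<Sum>j\<in>J. \<theta> j y)" if "x \<in> N" "y \<in> N" for x y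
        unfolding sum.distrib[symmetric] using module_homD(2)[OF insert.prems(1)] that by (intro sum.cong) auto
      show "(\<Sum>j\<in>J. \<theta> j (act a x)) = act a (\<Sum>j\<in>J. \<theta> j x)" if "a \<in> carrier A" "x \<in> N" for a x
        unfolding act_sum[OF that] using module_homD(3)[OF insert.prems(1)] that by (intro sum.cong) auto
    qed (rule mem)
  qed
  have "bij_betw (\<lambda>x. \<theta> j x + (\<Sum>j\<in>J. \<theta> j x)) N N" using insert by simp
  hence "bij_betw (\<theta> j) N N \<or> bij_betw (\<lambda>x. \<Sum>j\<in>J. \<theta> j x) N N"
    by (intro fitting_add[OF N(1) fit _ s]) (use insert.prems(1) in auto)
  thus ?case using insert by blast
qed

locale module_sum =
  fixes A :: "('u, 'b) ring_scheme" and act :: "'u \<Rightarrow> 'm::ab_group_add \<Rightarrow> 'm"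
    and I :: "'i set" and N :: "'i \<Rightarrow> 'm set" and M :: "'m set"
  assumes M: "left_module A act M" and N: "\<And>i. i \<in> I \<Longrightarrow> left_module A act (N i)"
    and ids: "internal_direct_sum I N M" and fin: "finite I"
begin

sublocale direct_sum I N M
  by unfold_locales (use ids N M left_moduleD in \<open>auto intro: left_moduleD(2)[OF M] left_moduleD(2)[OF N]\<close>)

lemma cmp_module_hom: assumes "i \<in> I" shows "module_hom A act M (N i) (\<lambda>x. cmp x i)"
  unfolding module_hom_def
proof (intro conjI ballI)
  show "cmp x i \<in> N i" if "x \<in> M" for x using cmp_mem[OF that assms] .
  show "cmp (x + y) i = cmp x i + cmp y i" if "x \<in> M" "y \<in> M" for x y using cmp_add[OF that] .
  show "cmp (act a x) i = act a (cmp x i)" if a: "a \<in> carrier A" and x: "x \<in> M" for a x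
    by (rule cmp_hom[OF direct_sum_axioms direct_sum_axioms, where \<tau> = "\<lambda>i. i"])
      (use a x assms left_moduleD[OF M] left_moduleD(4)[OF N] in auto)
qed

lemma sum_zeroD:
  assumes "\<And>i. i \<in> I \<Longrightarrow> v i \<in> N i" "(\<Sum>i\<in>I. v i) = 0" "i \<in> I" shows "v i = 0"
proof -
  have c0: "cmp 0 = (\<lambda>i. 0)"
    by (rule cmp_eqI[of _ "{}"]) (use left_moduleD(1)[OF M] in auto)
  have "cmp 0 = (\<lambda>i. if i \<in> I then v i else 0)"
    by (rule cmp_eqI[of _ I]) (use left_moduleD(1)[OF M] fin assms in auto)
  thus ?thesis using c0 assms(3) by (metis (full_types))
qed

text \<open>
  A submodule that projects bijectively to a summand can replace it: the difference of an
  element and the preimage of its component lies in the other summands.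
\<close>

lemma exchange:
  assumes k: "k \<in> I" and Xs: "left_module A act Xs" "Xs \<subseteq> M" and bij: "bij_betw (\<lambda>x. cmp x k) Xs (N k)"
  shows "internal_direct_sum I (N(k := Xs)) M"
proof (rule finite_direct_sumI[OF fin])
  show "0 \<in> M" by (rule left_moduleD(1)[OF M])
  show "(N(k := Xs)) i \<subseteq> M" "0 \<in> (N(k := Xs)) i" if "i \<in> I" for i
    using that Xs N_sub left_moduleD(1)[OF Xs(1)] left_moduleD(1)[OF N] by auto
  show "x - y \<in> (N(k := Xs)) i" if "i \<in> I" "x \<in> (N(k := Xs)) i" "y \<in> (N(k := Xs)) i" for i x y
    using that left_module_diff[OF Xs(1)] left_module_diff[OF N] by (auto split: if_splits)
next
  fix x assume x: "x \<in> M"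
  have "cmp x k \<in> (\<lambda>x. cmp x k) ` Xs" using cmp_mem[OF x k] bij by (simp add: bij_betw_def)
  then obtain y where y: "y \<in> Xs" "cmp x k = cmp y k" by blast
  hence yM: "y \<in> M" using Xs by blast
  have xy: "x - y \<in> M" by (rule left_module_diff[OF M x yM])
  have z: "cmp (x - y) k = 0" using hom_diff[OF M cmp_module_hom[OF k] x yM] y by simp
  let ?v = "\<lambda>i. if i = k then y else cmp (x - y) i"
  have "(\<Sum>i\<in>I. ?v i) = y + (\<Sum>i\<in>I - {k}. cmp (x - y) i)"
    using sum.remove[OF fin k, of ?v] by simp
  also have "(\<Sum>i\<in>I - {k}. cmp (x - y) i) = (\<Sum>i\<in>I. cmp (x - y) i)"
    using sum.remove[OF fin k, of "cmp (x - y)"] z by simp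
  also have "\<dots> = x - y" by (rule cmp_finite_sum[OF xy fin, symmetric])
  finally show "\<exists>v. (\<forall>i\<in>I. v i \<in> (N(k := Xs)) i) \<and> x = (\<Sum>i\<in>I. v i)"
    using y cmp_mem[OF xy] by (intro exI[of _ ?v]) auto
next
  fix v i assume v: "\<And>i. i \<in> I \<Longrightarrow> v i \<in> (N(k := Xs)) i" and s: "(\<Sum>i\<in>I. v i) = 0" and i: "i \<in> I"
  have vM: "v i \<in> M" if "i \<in> I" for i using v[OF that] Xs(2) N_sub[OF that] by (auto split: if_splits)
  have vN: "v i \<in> N i" if "i \<in> I" "i \<noteq> k" for i using v[OF that(1)] that(2) by simp
  have "0 = (\<Sum>i\<in>I. cmp (v i) k)"
    using hom_sum[OF M cmp_module_hom[OF k], of I v] vM s hom_0[OF M cmp_module_hom[OF k]] by simp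
  also have "\<dots> = cmp (v k) k + (\<Sum>i\<in>I - {k}. cmp (v i) k)" by (rule sum.remove[OF fin k])
  also have "(\<Sum>i\<in>I - {k}. cmp (v i) k) = 0"
    by (intro sum.neutral ballI) (use cmp_single vN in auto)
  finally have "cmp (v k) k = cmp 0 k" using hom_0[OF M cmp_module_hom[OF k]] by simp
  moreover have "v k \<in> Xs" "0 \<in> Xs" using v[OF k] left_moduleD(1)[OF Xs(1)] by auto
  ultimately have vk: "v k = 0" using bij unfolding bij_betw_def inj_on_def by blast
  have vi: "v i \<in> N i" if "i \<in> I" for i
    using vN[OF that] vk left_moduleD(1)[OF N[OF that]] by (cases "i = k") auto
  show "v i = 0" by (rule sum_zeroD[OF vi s i])
qed

end

lemma module_isomorphic_hom:
  assumes "left_module A act N'" "module_hom A act N' N e" "bij_betw e N' N"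
  shows "module_isomorphic A act N N'"
proof -
  let ?g = "inv_into N' e"
  have g: "?g x \<in> N'" "e (?g x) = x" if "x \<in> N" for x
    using that assms(3) by (auto simp: bij_betw_def intro: inv_into_into f_inv_into_f)
  have ge: "?g (e y) = y" if "y \<in> N'" for y using that assms(3) by (simp add: bij_betw_def)
  show ?thesis
    unfolding module_isomorphic_def
  proof (intro exI[of _ ?g] conjI ballI)
    show "bij_betw ?g N N'" by (rule bij_betw_inv_into[OF assms(3)])
    fix x assume x: "x \<in> N"
    show "?g (x + y) = ?g x + ?g y" if y: "y \<in> N" for y
      using ge[of "?g x + ?g y"] left_moduleD(2)[OF assms(1)] module_homD(2)[OF assms(2)] g x y by simp
  next
    fix a x assume a: "a \<in> carrier A" and x: "x \<in> N"
    show "?g (act a x) = act a (?g x)"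
      using ge[of "act a (?g x)"] left_moduleD(4)[OF assms(1) a] module_homD(3)[OF assms(2) a] g x by simp
  qed
qed

text \<open>
  The identity of a summand with local endomorphism ring is the sum of the
  maps through the summands of a second decomposition, so one of them is an isomorphism.
\<close>

lemma exchange_partner:
  assumes L: "module_sum A act I L M" and N: "module_sum A act J N M" and k: "k \<in> I"
    and fit: "fitting A act (L k)" "L k \<noteq> {0}" and ind: "\<And>j. j \<in> J \<Longrightarrow> indecomposable A act (N j)"
  shows "\<exists>j\<in>J. bij_betw (\<lambda>x. direct_sum.cmp I L x k) (N j) (L k)"
proof -
  interpret L: module_sum A act I L M by fact
  interpret N: module_sum A act J N M by fact
  define e where "e x = L.cmp x k" for x
  have e: "module_hom A act M (L k) e" unfolding e_def by (rule L.cmp_module_hom[OF k])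
  have LM: "L k \<subseteq> M" by (rule L.N_sub[OF k])
  have eL: "e x = x" if "x \<in> L k" for x using L.cmp_single[OF k that] by (simp add: e_def)
  define p where "p j x = N.cmp x j" for j x
  have p: "module_hom A act M (N j) (p j)" if "j \<in> J" for j unfolding p_def by (rule N.cmp_module_hom[OF that])
  have NM: "N j \<subseteq> M" if "j \<in> J" for j by (rule N.N_sub[OF that])
  have th: "module_hom A act (L k) (L k) (\<lambda>x. e (p j x))" if "j \<in> J" for j
    by (rule hom_comp[OF hom_mono[OF p[OF that] LM subset_refl] hom_mono[OF e NM[OF that] subset_refl]])
  have "(\<Sum>j\<in>J. e (p j x)) = x" if x: "x \<in> L k" for x
  proof -
    have xM: "x \<in> M" using x LM by blast
    have "(\<Sum>j\<in>J. e (p j x)) = e (\<Sum>j\<in>J. p j x)"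
      by (rule hom_sum[OF L.M e, symmetric]) (use module_homD(1)[OF p xM] NM in blast)
    also have "(\<Sum>j\<in>J. p j x) = x" unfolding p_def by (rule N.cmp_finite_sum[OF xM N.fin, symmetric])
    finally show ?thesis using eL x by simp
  qed
  hence "bij_betw (\<lambda>x. \<Sum>j\<in>J. e (p j x)) (L k) (L k)"
    using bij_betw_cong[of "L k" "\<lambda>x. \<Sum>j\<in>J. e (p j x)" "\<lambda>x. x" "L k"] bij_betw_id[of "L k"] by (simp add: id_def)
  then obtain j where j: "j \<in> J" and bj: "bij_betw (\<lambda>x. e (p j x)) (L k) (L k)"
    using fitting_sum[OF L.N[OF k] fit(2,1) N.fin, of "\<lambda>j x. e (p j x)"] th by blast
  have lmN: "left_module A act (N j)" by (rule N.N[OF j])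
  have pj: "module_hom A act (L k) (N j) (p j)" by (rule hom_mono[OF p[OF j] LM subset_refl])
  have ej: "module_hom A act (N j) (L k) e" by (rule hom_mono[OF e NM[OF j] subset_refl])
  \<comment> \<open>The bijection \<open>e \<circ> p j\<close> splits \<open>N j\<close> into the image of \<open>p j\<close> and the kernel of \<open>e\<close>; as
    \<open>N j\<close> is indecomposable, the kernel is zero.\<close>
  define Xs where "Xs = p j ` L k"
  define Ys where "Ys = {x \<in> N j. e x \<in> {0}}"
  have Xs: "left_module A act Xs" unfolding Xs_def by (rule image_submodule[OF L.N[OF k] pj lmN])
  have Ys: "left_module A act Ys" unfolding Ys_def
    by (rule preimage_submodule[OF lmN ej zero_module[OF lmN] L.N[OF k]])
  have inj: "y = 0" if "y \<in> L k" "e (p j y) = 0" for y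
  proof -
    have "e (p j y) = e (p j 0)" using that hom_0[OF L.N[OF k] th[OF j]] by simp
    thus ?thesis using that(1) bj left_moduleD(1)[OF L.N[OF k]] unfolding bij_betw_def inj_on_def by blast
  qed
  have "Xs \<inter> Ys = {0}"
  proof (intro equalityI subsetI)
    fix z assume "z \<in> Xs \<inter> Ys"
    then obtain y where "y \<in> L k" "z = p j y" "e z = 0" by (auto simp: Xs_def Ys_def)
    thus "z \<in> {0}" using inj hom_0[OF L.N[OF k] pj] by auto
  qed (use left_moduleD(1)[OF Xs] left_moduleD(1)[OF Ys] in auto)
  moreover have "N j = {a + b | a b. a \<in> Xs \<and> b \<in> Ys}"
  proof (intro equalityI subsetI)
    fix x assume x: "x \<in> N j"
    have "e x \<in> (\<lambda>x. e (p j x)) ` L k" using module_homD(1)[OF ej x] bj by (simp add: bij_betw_def)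
    then obtain y where y: "y \<in> L k" "e x = e (p j y)" by blast
    have py: "p j y \<in> N j" by (rule module_homD(1)[OF pj y(1)])
    have "x - p j y \<in> Ys"
      unfolding Ys_def using hom_diff[OF lmN ej x py] y left_module_diff[OF lmN x py] by simp
    moreover have "p j y \<in> Xs" using y by (simp add: Xs_def)
    ultimately show "x \<in> {a + b | a b. a \<in> Xs \<and> b \<in> Ys}"
      by (intro CollectI exI[of _ "p j y"] exI[of _ "x - p j y"]) simp
  next
    fix x assume "x \<in> {a + b | a b. a \<in> Xs \<and> b \<in> Ys}"
    then obtain a b where "x = a + b" "a \<in> Xs" "b \<in> Ys" by blast
    thus "x \<in> N j" using left_moduleD(2)[OF lmN] module_homD(1)[OF pj] by (auto simp: Xs_def Ys_def)
  qed
  ultimately have "Xs = {0} \<or> Ys = {0}" using ind[OF j] Xs Ys unfolding indecomposable_def by blast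
  moreover have "Xs \<noteq> {0}"
  proof
    assume X0: "Xs = {0}"
    have "y = 0" if "y \<in> L k" for y
    proof (rule inj[OF that])
      have "p j y = 0" using X0 that unfolding Xs_def by blast
      thus "e (p j y) = 0" using hom_0[OF lmN ej] by simp
    qed
    thus False using fit(2) left_moduleD(1)[OF L.N[OF k]] by blast
  qed
  ultimately have Y0: "Ys = {0}" by blast
  have "bij_betw e (N j) (L k)"
    unfolding bij_betw_def
  proof
    show "inj_on e (N j)"
    proof (rule inj_onI)
      fix x y assume xy: "x \<in> N j" "y \<in> N j" "e x = e y"
      hence "x - y \<in> Ys" using hom_diff[OF lmN ej] left_module_diff[OF lmN] by (simp add: Ys_def)
      thus "x = y" using Y0 by simp
    qed
    have "y \<in> e ` N j" if "y \<in> L k" for y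
    proof -
      have "y \<in> (\<lambda>x. e (p j x)) ` L k" using that bj by (simp add: bij_betw_def)
      thus ?thesis using module_homD(1)[OF pj] by blast
    qed
    thus "e ` N j = L k" using module_homD(1)[OF ej] by blast
  qed
  thus ?thesis using j unfolding e_def[abs_def] by blast
qed

text \<open>
  The summands of the first decomposition are exchanged one after the other. After \<open>k\<close> steps,
  the first \<open>k\<close> of them have been replaced by pairwise different summands of the second one.
  After the last step, these already exhaust the module.
\<close>

theorem krull_schmidt_azumaya:
  fixes n n' :: nat
  assumes N: "module_sum A act {..<n} N M" and N': "module_sum A act {..<n'} N' M"
    and fit: "\<And>i. i < n \<Longrightarrow> fitting A act (N i)" "\<And>i. i < n \<Longrightarrow> N i \<noteq> {0}"
    and ind: "\<And>j. j < n' \<Longrightarrow> indecomposable A act (N' j)"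
  shows "n = n' \<and> (\<exists>\<sigma>. bij_betw \<sigma> {..<n} {..<n'} \<and> (\<forall>i<n. module_isomorphic A act (N i) (N' (\<sigma> i))))"
proof -
  interpret N: module_sum A act "{..<n}" N M by fact
  interpret N': module_sum A act "{..<n'}" N' M by fact
  have "\<exists>\<sigma>. inj_on \<sigma> {..<k} \<and> \<sigma> ` {..<k} \<subseteq> {..<n'} \<and> (\<forall>i<k. module_isomorphic A act (N i) (N' (\<sigma> i))) \<and>
      internal_direct_sum {..<n} (\<lambda>i. if i < k then N' (\<sigma> i) else N i) M" if "k \<le> n" for k
    using that
  proof (induction k)
    case 0
    show ?case using N.ids by (intro exI[of _ "\<lambda>i. 0"]) simp
  next
    case (Suc k)
    then obtain \<sigma> where s: "inj_on \<sigma> {..<k}" "\<sigma> ` {..<k} \<subseteq> {..<n'}" "\<And>i. i < k \<Longrightarrow> module_isomorphic A act (N i) (N' (\<sigma> i))"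
      and d: "internal_direct_sum {..<n} (\<lambda>i. if i < k then N' (\<sigma> i) else N i) M" by auto
    let ?L = "\<lambda>i. if i < k then N' (\<sigma> i) else N i"
    have kn: "k < n" using Suc.prems by simp
    have msL: "module_sum A act {..<n} ?L M"
      by unfold_locales (use N.M N.N N'.N s(2) d in auto)
    interpret L: module_sum A act "{..<n}" ?L M by (rule msL)
    have kI: "k \<in> {..<n}" using kn by simp
    obtain j where j: "j < n'" "bij_betw (\<lambda>x. L.cmp x k) (N' j) (N k)"
      using exchange_partner[OF msL N' kI] fit[OF kn] ind by auto
    have jn: "j \<notin> \<sigma> ` {..<k}"
    proof
      assume "j \<in> \<sigma> ` {..<k}"
      then obtain i where i: "i < k" "j = \<sigma> i" by auto
      have "L.cmp x k = 0" if "x \<in> N' j" for x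
        using L.cmp_single[of i x] i that kn by simp
      hence "(\<lambda>x. L.cmp x k) ` N' j \<subseteq> {0}" by blast
      hence "N k \<subseteq> {0}" using j(2) by (simp add: bij_betw_def)
      thus False using fit(2)[OF kn] left_moduleD(1)[OF N.N[OF kI]] by blast
    qed
    have jI: "j \<in> {..<n'}" using j by simp
    have iso: "module_isomorphic A act (N k) (N' j)"
    proof (rule module_isomorphic_hom[OF N'.N[OF jI] _ j(2)])
      have "module_hom A act M (?L k) (\<lambda>x. L.cmp x k)" by (rule L.cmp_module_hom[OF kI])
      thus "module_hom A act (N' j) (N k) (\<lambda>x. L.cmp x k)" using N'.N_sub[OF jI] by (auto intro: hom_mono)
    qed
    have "internal_direct_sum {..<n} (?L(k := N' j)) M"
      by (rule L.exchange[OF kI N'.N[OF jI] N'.N_sub[OF jI]]) (use j(2) in simp)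
    moreover have "?L(k := N' j) = (\<lambda>i. if i < Suc k then N' ((\<sigma>(k := j)) i) else N i)"
      by (auto simp: fun_eq_iff less_Suc_eq)
    ultimately have "internal_direct_sum {..<n} (\<lambda>i. if i < Suc k then N' ((\<sigma>(k := j)) i) else N i) M" by simp
    moreover have "inj_on (\<sigma>(k := j)) {..<Suc k}"
      using s(1) jn by (auto simp: inj_on_def less_Suc_eq)
    moreover have "(\<sigma>(k := j)) ` {..<Suc k} \<subseteq> {..<n'}" using s(2) j(1) by (auto simp: less_Suc_eq image_subset_iff)
    moreover have "\<forall>i<Suc k. module_isomorphic A act (N i) (N' ((\<sigma>(k := j)) i))"
      using s(3) iso by (auto simp: less_Suc_eq)
    ultimately show ?case by blast
  qed
  from this[of n] obtain \<sigma> where s: "inj_on \<sigma> {..<n}" "\<sigma> ` {..<n} \<subseteq> {..<n'}" "\<And>i. i < n \<Longrightarrow> module_isomorphic A act (N i) (N' (\<sigma> i))"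
    and d: "internal_direct_sum {..<n} (\<lambda>i. if i < n then N' (\<sigma> i) else N i) M" by auto
  let ?L = "\<lambda>i. if i < n then N' (\<sigma> i) else N i"
  have msL: "module_sum A act {..<n} ?L M"
    by unfold_locales (use N.M N'.N s(2) d in auto)
  interpret L: module_sum A act "{..<n}" ?L M by (rule msL)
  have "{..<n'} \<subseteq> \<sigma> ` {..<n}"
  proof
    fix j assume j: "j \<in> {..<n'}"
    show "j \<in> \<sigma> ` {..<n}"
    proof (rule ccontr)
      assume nj: "j \<notin> \<sigma> ` {..<n}"
      have "N' j \<noteq> {0}" using ind j by (simp add: indecomposable_def)
      then obtain y where y: "y \<in> N' j" "y \<noteq> 0" using left_moduleD(1)[OF N'.N[OF j]] by blast
      have yM: "y \<in> M" using y N'.N_sub[OF j] by blast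
      have lM: "L.cmp y i \<in> M" if "i \<in> {..<n}" for i using L.cmp_mem[OF yM that] L.N_sub[OF that] by blast
      have "y = N'.cmp y j" using N'.cmp_single[OF j y(1)] by simp
      also have "\<dots> = N'.cmp (\<Sum>i<n. L.cmp y i) j" using L.cmp_finite_sum[OF yM] by simp
      also have "\<dots> = (\<Sum>i<n. N'.cmp (L.cmp y i) j)" by (rule hom_sum[OF N.M N'.cmp_module_hom[OF j] lM])
      also have "\<dots> = 0"
      proof (intro sum.neutral ballI)
        fix i assume i: "i \<in> {..<n}"
        have "L.cmp y i \<in> N' (\<sigma> i)" "\<sigma> i \<in> {..<n'}" "\<sigma> i \<noteq> j" using L.cmp_mem[OF yM i] s(2) i nj by auto
        thus "N'.cmp (L.cmp y i) j = 0" using N'.cmp_single by auto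
      qed
      finally show False using y by simp
    qed
  qed
  hence "bij_betw \<sigma> {..<n} {..<n'}" using s by (auto simp: bij_betw_def)
  moreover from bij_betw_same_card[OF this] have "n = n'" by simp
  ultimately show ?thesis using s(3) by blast
qed

section \<open>Fitting's lemma in the category O\<close>

context hyper_left_module
begin

definition ksub :: "'m set \<Rightarrow> bool" where
  "ksub W \<longleftrightarrow> W \<subseteq> M \<and> 0 \<in> W \<and> (\<forall>x\<in>W. \<forall>y\<in>W. x + y \<in> W) \<and> (\<forall>c. \<forall>x\<in>W. sc c x \<in> W)"

lemma ksubD:
  assumes "ksub W"
  shows "W \<subseteq> M" "0 \<in> W" "x \<in> W \<Longrightarrow> y \<in> W \<Longrightarrow> x + y \<in> W" "x \<in> W \<Longrightarrow> sc c x \<in> W"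
  using assms by (auto simp: ksub_def)

lemma ksub_diff: assumes "ksub W" "x \<in> W" "y \<in> W" shows "x - y \<in> W"
proof -
  have "x + sc (- 1) y \<in> W" by (intro ksubD(3,4)[OF assms(1)] assms(2,3))
  moreover have "sc (- 1) y = - y" using assms(3) ksubD(1)[OF assms(1)] by (intro sc_uminus) auto
  ultimately show ?thesis by simp
qed

lemma ksub_kspan: "B \<subseteq> M \<Longrightarrow> ksub (kspan B)"
  unfolding ksub_def using kspan_M[of B] kspan_add[of _ B] kspan_sc[of B] kspan.zero[of B] by blast

lemma ksub_Int: "ksub V \<Longrightarrow> ksub W \<Longrightarrow> ksub (V \<inter> W)"
  by (auto simp: ksub_def)

lemma kspan_insert:
  assumes "insert b B \<subseteq> M" "x \<in> kspan (insert b B)" shows "\<exists>c. \<exists>y\<in>kspan B. x = sc c b + y"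
  using assms(2)
proof (induction rule: kspan.induct)
  case zero
  have "0 = sc 0 b + 0" using assms(1) by (simp add: sc_0)
  thus ?case using kspan.zero by blast
next
  case (step b' x d)
  then obtain c y where x: "y \<in> kspan B" "x = sc c b + y" by blast
  show ?case
  proof (cases "b' = b")
    case True
    have "sc d b' + x = sc (d + c) b + y" using assms(1) x True by (simp add: sc_plus add.assoc)
    thus ?thesis using x by blast
  next
    case False
    have "sc d b' + x = sc c b + (sc d b' + y)" using x by (simp add: add.left_commute)
    moreover have "sc d b' + y \<in> kspan B" using step(1) False x by (intro kspan.step) auto
    ultimately show ?thesis by blast
  qed
qed

text \<open>
  A length function on the subspaces of a finite-dimensional space: each spanning vector
  contributes the dimension of the image in the corresponding one-dimensional quotient.
\<close>

lemma length_function: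
  assumes "finite B" "B \<subseteq> M"
  shows "\<exists>len::'m set \<Rightarrow> nat. \<forall>W W'. ksub W \<longrightarrow> ksub W' \<longrightarrow> W \<subset> W' \<longrightarrow> W' \<subseteq> kspan B \<longrightarrow> len W < len W'"
  using assms
proof (induction B rule: finite_induct)
  case empty
  have "x = 0" if "x \<in> kspan {}" for x using that by (induction rule: kspan.induct) auto
  hence "\<not> W \<subset> W'" if "ksub W" "W' \<subseteq> kspan {}" for W W' using that ksubD(2)[of W] by blast
  thus ?case by blast
next
  case (insert b B)
  have BM: "insert b B \<subseteq> M" "B \<subseteq> M" using insert.prems by auto
  obtain len :: "'m set \<Rightarrow> nat" where l: "\<And>W W'. ksub W \<Longrightarrow> ksub W' \<Longrightarrow> W \<subset> W' \<Longrightarrow> W' \<subseteq> kspan B \<Longrightarrow> len W < len W'"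
    using insert.IH[OF BM(2)] by blast
  define len' where "len' W = len (W \<inter> kspan B) + (if W \<subseteq> kspan B then 0 else 1)" for W
  have "len' W < len' W'" if W: "ksub W" and W': "ksub W'" and sub: "W \<subset> W'" and sp: "W' \<subseteq> kspan (insert b B)" for W W'
  proof (cases "W \<inter> kspan B = W' \<inter> kspan B")
    case False
    hence "len (W \<inter> kspan B) < len (W' \<inter> kspan B)"
      using sub by (intro l ksub_Int W W' ksub_kspan[OF BM(2)]) auto
    moreover have "(if W \<subseteq> kspan B then 0 else 1 :: nat) \<le> (if W' \<subseteq> kspan B then 0 else 1)" using sub by auto
    ultimately show ?thesis by (simp add: len'_def)
  next
    case True
    have nW': "\<not> W' \<subseteq> kspan B" using True sub by blast
    have "W \<subseteq> kspan B"
    proof (rule ccontr)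
      assume "\<not> W \<subseteq> kspan B"
      then obtain w where w: "w \<in> W" "w \<notin> kspan B" by blast
      then obtain c y where cy: "y \<in> kspan B" "w = sc c b + y" using kspan_insert[OF BM(1)] sub sp by blast
      have c: "c \<noteq> 0"
      proof
        assume "c = 0"
        hence "w = y" using cy sc_0[of b] BM(1) by simp
        thus False using w cy by simp
      qed
      have "w' \<in> W" if w': "w' \<in> W'" for w'
      proof -
        obtain c' y' where cy': "y' \<in> kspan B" "w' = sc c' b + y'" using kspan_insert[OF BM(1)] w' sp by blast
        let ?d = "c' / c"
        have bM: "b \<in> M" and yM: "y \<in> M" using BM(1) kspan_M[OF BM(2) cy(1)] by auto
        have "sc ?d w = sc c' b + sc ?d y"
          unfolding cy(2) using bM yM c by (simp add: sc_add sc_mem sc_mult[symmetric])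
        hence e: "w' - sc ?d w = y' - sc ?d y" by (simp add: cy'(2))
        have "y' - sc ?d y \<in> kspan B"
          by (rule ksub_diff[OF ksub_kspan[OF BM(2)] cy'(1) kspan_sc[OF BM(2) cy(1)]])
        moreover have "w' - sc ?d w \<in> W'"
          using sub w(1) by (intro ksub_diff[OF W' w'] ksubD(4)[OF W']) auto
        ultimately have "w' - sc ?d w \<in> W" using e True by auto
        hence "(w' - sc ?d w) + sc ?d w \<in> W" by (intro ksubD(3,4)[OF W] w(1))
        thus ?thesis by simp
      qed
      thus False using sub by blast
    qed
    thus ?thesis using True nW' by (simp add: len'_def)
  qed
  thus ?case by blast
qed

definition klin :: "'m set \<Rightarrow> ('m \<Rightarrow> 'm) \<Rightarrow> bool" where
  "klin F \<psi> \<longleftrightarrow> (\<forall>x\<in>F. \<psi> x \<in> F) \<and> (\<forall>x\<in>F. \<forall>y\<in>F. \<psi> (x + y) = \<psi> x + \<psi> y) \<and> (\<forall>c. \<forall>x\<in>F. \<psi> (sc c x) = sc c (\<psi> x))"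

lemma klin_funpow: "klin F \<psi> \<Longrightarrow> klin F (\<psi> ^^ n)"
  by (induction n) (auto simp: klin_def)

lemma klin_0: "ksub F \<Longrightarrow> klin F \<psi> \<Longrightarrow> \<psi> 0 = 0"
  using ksubD(2)[of F] unfolding klin_def by (metis add_0 add_cancel_right_right)

text \<open>
  The kernels of the powers of \<open>\<psi>\<close> become stable, say at \<open>n\<close>. An element of the kernel of \<open>\<psi>\<close> has
  the form \<open>\<psi>\<^sup>n y\<close>, so \<open>y\<close> lies in the kernel of \<open>\<psi>\<^sup>n\<^sup>+\<^sup>1\<close>, which is that of \<open>\<psi>\<^sup>n\<close>.
\<close>

lemma surjective_injective:
  assumes F: "ksub F" "F \<subseteq> kspan B" and B: "finite B" "B \<subseteq> M" and \<psi>: "klin F \<psi>" "\<psi> ` F = F"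
    and x: "x \<in> F" "\<psi> x = 0"
  shows "x = 0"
proof -
  obtain len :: "'m set \<Rightarrow> nat" where l: "\<And>W W'. ksub W \<Longrightarrow> ksub W' \<Longrightarrow> W \<subset> W' \<Longrightarrow> W' \<subseteq> kspan B \<Longrightarrow> len W < len W'"
    using length_function[OF B] by blast
  define K where "K n = {x \<in> F. (\<psi> ^^ n) x = 0}" for n
  have K: "ksub (K n)" for n
  proof -
    have "(\<psi> ^^ n) 0 = 0" by (rule klin_0[OF F(1) klin_funpow[OF \<psi>(1)]])
    thus ?thesis using ksubD[OF F(1)] klin_funpow[OF \<psi>(1), of n] sc_zero
      unfolding ksub_def K_def klin_def by auto
  qed
  have sub: "K n \<subseteq> K (Suc n)" for n using klin_0[OF F(1) \<psi>(1)] by (auto simp: K_def)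
  have "\<exists>n. K n = K (Suc n)"
  proof (rule ccontr)
    assume "\<nexists>n. K n = K (Suc n)"
    hence "K n \<subset> K (Suc n)" for n using sub by blast
    moreover have "K n \<subseteq> kspan B" for n using F(2) by (auto simp: K_def)
    ultimately have step: "len (K n) < len (K (Suc n))" for n by (intro l K)
    have ge: "n \<le> len (K n)" for n
      by (induction n) (use step in \<open>auto intro: Suc_leI le_less_trans\<close>)
    have "len (K n) \<le> len F" for n
    proof -
      have "K n \<subseteq> F" by (auto simp: K_def)
      then consider "K n = F" | "K n \<subset> F" by blast
      thus ?thesis by cases (simp, rule less_imp_le[OF l[OF K F(1) _ F(2)]])
    qed
    thus False using ge[of "Suc (len F)"] by (meson not_less_eq_eq order_trans)
  qed
  then obtain n where n: "K n = K (Suc n)" by blast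
  have "(\<psi> ^^ n) ` F = F"
  proof (induction n)
    case (Suc n) thus ?case using \<psi>(2) by (simp only: funpow.simps image_comp[symmetric])
  qed simp
  hence "x \<in> (\<psi> ^^ n) ` F" using x(1) by simp
  then obtain y where y: "y \<in> F" "(\<psi> ^^ n) y = x" by auto
  hence "y \<in> K (Suc n)" using x(2) by (simp add: K_def)
  thus ?thesis using n y by (auto simp: K_def)
qed

lemma images_stabilize:
  assumes F: "ksub F" "F \<subseteq> kspan B" and B: "finite B" "B \<subseteq> M" and \<psi>: "klin F \<psi>"
  shows "\<exists>n0. \<forall>n\<ge>n0. (\<psi> ^^ n) ` F = (\<psi> ^^ n0) ` F"
proof -
  obtain len :: "'m set \<Rightarrow> nat" where l: "\<And>W W'. ksub W \<Longrightarrow> ksub W' \<Longrightarrow> W \<subset> W' \<Longrightarrow> W' \<subseteq> kspan B \<Longrightarrow> len W < len W'"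
    using length_function[OF B] by blast
  define D where "D n = (\<psi> ^^ n) ` F" for n
  have DF: "D n \<subseteq> F" for n using klin_funpow[OF \<psi>, of n] by (auto simp: D_def klin_def)
  have D: "ksub (D n)" for n
    unfolding ksub_def
  proof (intro conjI ballI allI)
    note k = klin_funpow[OF \<psi>, of n, unfolded klin_def]
    show "D n \<subseteq> M" using DF ksubD(1)[OF F(1)] by blast
    show "0 \<in> D n" unfolding D_def using klin_0[OF F(1) klin_funpow[OF \<psi>, of n]] ksubD(2)[OF F(1)] by (metis imageI)
    fix x assume "x \<in> D n"
    then obtain u where u: "u \<in> F" "x = (\<psi> ^^ n) u" by (auto simp: D_def)
    show "sc c x \<in> D n" for c
    proof -
      have "sc c x = (\<psi> ^^ n) (sc c u)" using k u by simp
      thus ?thesis unfolding D_def using ksubD(4)[OF F(1) u(1)] by blast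
    qed
    fix y assume "y \<in> D n"
    then obtain v where v: "v \<in> F" "y = (\<psi> ^^ n) v" by (auto simp: D_def)
    have "x + y = (\<psi> ^^ n) (u + v)" using k u v by simp
    thus "x + y \<in> D n" unfolding D_def using ksubD(3)[OF F(1) u(1) v(1)] by blast
  qed
  have "D (Suc n) \<subseteq> D n" for n
  proof
    fix x assume "x \<in> D (Suc n)"
    then obtain u where "u \<in> F" "x = (\<psi> ^^ n) (\<psi> u)" by (auto simp: D_def funpow_swap1)
    thus "x \<in> D n" using \<psi> by (auto simp: D_def klin_def)
  qed
  hence mono: "D n \<subseteq> D m" if "m \<le> n" for m n using that by (rule lift_Suc_antimono_le)
  obtain n0 where n0: "\<And>n. len (D n0) \<le> len (D n)" using ex_has_least_nat[of "\<lambda>_. True" 0 "\<lambda>n. len (D n)"] by blast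
  have "D n = D n0" if "n \<ge> n0" for n
  proof (rule ccontr)
    assume "D n \<noteq> D n0"
    hence "D n \<subset> D n0" using mono[OF that] by blast
    hence "len (D n) < len (D n0)" using l[OF D D] DF F(2) by blast
    thus False using n0[of n] by simp
  qed
  thus ?thesis unfolding D_def by blast
qed

lemma scalar_closed: "scalar_U (c :: 'k) \<in> carrier U"
  by (simp add: U_T scalar_U_eq)

lemma tens_U: "a \<in> carrier UZ \<Longrightarrow> T.tens a c \<in> carrier U"
  by (simp add: U_T)

lemma hom_sc: "module_hom U act M N \<phi> \<Longrightarrow> x \<in> M \<Longrightarrow> \<phi> (sc c x) = sc c (\<phi> x)"
  unfolding sc_def by (rule module_homD(3)) (auto simp: scalar_closed)

lemma hom_opr: "module_hom U act M N \<phi> \<Longrightarrow> a \<in> carrier UZ \<Longrightarrow> x \<in> M \<Longrightarrow> \<phi> (opr a x) = opr a (\<phi> x)"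
  unfolding opr_def by (rule module_homD(3)) (auto simp: tens_U)

end

context O_module
begin

lemma hom_ws:
  assumes "module_hom U act M N \<phi>" "N \<subseteq> M" "\<mu> \<in> L" "x \<in> ws \<mu>" shows "\<phi> x \<in> ws \<mu>"
proof (rule wsI[OF assms(3)])
  have x: "x \<in> M" using assms(4) ws_M by blast
  show "\<phi> x \<in> M" using module_homD(1)[OF assms(1) x] assms(2) by blast
  show "opr (hbinom (h \<beta>) n) (\<phi> x) = sc (of_int (wval \<mu> \<beta> zchoose n)) (\<phi> x)" if "\<beta> \<in> P" for \<beta> n
    using hom_opr[OF assms(1) simple_in_UZ(3)[OF that] x, symmetric] ws_act[OF assms(3,4) that] hom_sc[OF assms(1) x] by simp
qed

lemma hom_cmp:
  assumes "module_hom U act M N \<phi>" "N \<subseteq> M" "x \<in> M" "\<mu> \<in> L"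
  shows "W.cmp (\<phi> x) \<mu> = \<phi> (W.cmp x \<mu>)"
  by (rule cmp_hom[OF W.direct_sum_axioms W.direct_sum_axioms, where \<tau> = "\<lambda>\<mu>. \<mu>"])
    (use assms module_homD[OF assms(1)] hom_ws[OF assms(1,2)] M_0 in auto)

text \<open>
  The projection commutes with taking weight components, and it maps a finite-dimensional
  submodule for the positive part to another one.
\<close>

lemma summand_cat_O:
  assumes N: "left_module U act N" "N \<subseteq> M" and p: "module_hom U act M N p" "\<And>x. x \<in> N \<Longrightarrow> p x = x"
  shows "cat_O act N"
proof -
  have wsN: "weight_space act N \<mu> = ws \<mu> \<inter> N" for \<mu> using N(2) by (auto simp: weight_space_def)
  have cN: "W.cmp x \<mu> \<in> N" if "x \<in> N" "\<mu> \<in> L" for x \<mu>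
  proof -
    have xM: "x \<in> M" using that N(2) by blast
    have "W.cmp x \<mu> = p (W.cmp x \<mu>)" using hom_cmp[OF p(1) N(2) xM that(2)] p(2)[OF that(1)] by simp
    moreover have "W.cmp x \<mu> \<in> M" using W.cmp_mem[OF xM that(2)] ws_M by blast
    ultimately show ?thesis using module_homD(1)[OF p(1)] by metis
  qed
  have "weight_module act N"
    unfolding weight_module_def internal_direct_sum_def
  proof (intro conjI ballI)
    show "weight_space act N \<mu> \<subseteq> N" for \<mu> using wsN by blast
    fix x assume x: "x \<in> N"
    hence xM: "x \<in> M" using N(2) by blast
    have s: "W.comp_spec x (W.cmp x)" by (rule W.cmp_spec[OF xM])
    show "\<exists>!v. (\<forall>i\<in>L. v i \<in> weight_space act N i) \<and> (\<forall>i. i \<notin> L \<longrightarrow> v i = 0) \<and> finite {i. v i \<noteq> 0} \<and> x = (\<Sum>i | v i \<noteq> 0. v i)"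
    proof (rule ex1I[of _ "W.cmp x"])
      show "(\<forall>i\<in>L. W.cmp x i \<in> weight_space act N i) \<and> (\<forall>i. i \<notin> L \<longrightarrow> W.cmp x i = 0) \<and> finite {i. W.cmp x i \<noteq> 0} \<and> x = (\<Sum>i | W.cmp x i \<noteq> 0. W.cmp x i)"
        using s cN[OF x] unfolding W.comp_spec_def wsN by blast
      fix v assume v: "(\<forall>i\<in>L. v i \<in> weight_space act N i) \<and> (\<forall>i. i \<notin> L \<longrightarrow> v i = 0) \<and> finite {i. v i \<noteq> 0} \<and> x = (\<Sum>i | v i \<noteq> 0. v i)"
      have "W.comp_spec x v" using v unfolding W.comp_spec_def wsN by blast
      thus "v = W.cmp x" using W.comp_ex1[OF xM] s by blast
    qed
  qed
  moreover have "locally_finite act N"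
    unfolding locally_finite_def
  proof (intro equalityI subsetI)
    fix x assume x: "x \<in> N"
    obtain V where V: "x \<in> V" "V \<subseteq> M" "left_module U_pos (\<lambda>u. act (to_U u)) V" "finite_dim act V"
      using lf x N(2) unfolding locally_finite_def by blast
    have toU: "to_U u \<in> carrier U" if "u \<in> carrier U_pos" for u :: "('g, 'k) hyperalg"
      using Q.incl_closed that by (simp add: to_U_def U_def U_pos_def)
    have pa: "p (act (to_U u) y) = act (to_U u) (p y)" if "u \<in> carrier U_pos" "y \<in> V" for u :: "('g, 'k) hyperalg" and y
      using module_homD(3)[OF p(1) toU[OF that(1)]] that(2) V(2) by blast
    have pv: "p (y + z) = p y + p z" if "y \<in> V" "z \<in> V" for y z
      using module_homD(2)[OF p(1)] that V(2) by blast
    have pm: "p (- y) = - p y" if "y \<in> V" for y using hom_uminus[OF lm p(1)] that V(2) by blast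
    note Vm = V(3)[unfolded left_module_def]
    have Va: "act (to_U u) y \<in> V" if "u \<in> carrier U_pos" "y \<in> V" for u :: "('g, 'k) hyperalg" and y
      using Vm that by blast
    have lmV: "left_module U_pos (\<lambda>u. act (to_U u)) (p ` V)"
      unfolding left_module_def
    proof (intro conjI ballI; (elim imageE)?; (simp only:)?)
      show "0 \<in> p ` V" using Vm hom_0[OF lm p(1)] by (metis imageI)
    next
      fix y z assume "y \<in> V" "z \<in> V"
      thus "p y + p z \<in> p ` V" using Vm pv by (metis imageI)
    next
      fix y assume "y \<in> V"
      thus "- p y \<in> p ` V" using Vm pm by (metis imageI)
    next
      fix u :: "('g, 'k) hyperalg" and y assume "u \<in> carrier U_pos" "y \<in> V"
      thus "act (to_U u) (p y) \<in> p ` V" using Vm pa by (metis imageI)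
    next
      fix y assume y: "y \<in> V"
      have "\<one>\<^bsub>U_pos\<^esub> \<in> carrier (U_pos :: ('g, 'k) hyperalg ring)" unfolding U_pos_def by (rule Q.small.T.one_closed)
      thus "act (to_U \<one>\<^bsub>U_pos\<^esub>) (p y) = p y" using Vm pa y by metis
    next
      fix u v :: "('g, 'k) hyperalg" and y assume uv: "u \<in> carrier U_pos" "v \<in> carrier U_pos" "y \<in> V"
      have "u \<otimes>\<^bsub>U_pos\<^esub> v \<in> carrier U_pos" using uv unfolding U_pos_def by (intro Q.small.T.m_closed)
      thus "act (to_U (u \<otimes>\<^bsub>U_pos\<^esub> v)) (p y) = act (to_U u) (act (to_U v) (p y))"
        using Vm pa uv by metis
    next
      fix u v :: "('g, 'k) hyperalg" and y assume uv: "u \<in> carrier U_pos" "v \<in> carrier U_pos" "y \<in> V"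
      have "u \<oplus>\<^bsub>U_pos\<^esub> v \<in> carrier U_pos" using uv unfolding U_pos_def by (intro Q.small.T.a_closed)
      hence "act (to_U (u \<oplus>\<^bsub>U_pos\<^esub> v)) (p y) = p (act (to_U u) y + act (to_U v) y)" using Vm pa uv by metis
      also have "\<dots> = act (to_U u) (p y) + act (to_U v) (p y)" by (simp only: pv pa Va uv)
      finally show "act (to_U (u \<oplus>\<^bsub>U_pos\<^esub> v)) (p y) = act (to_U u) (p y) + act (to_U v) (p y)" .
    next
      fix u :: "('g, 'k) hyperalg" and y z assume uv: "u \<in> carrier U_pos" "y \<in> V" "z \<in> V"
      have yz: "y + z \<in> V" "act (to_U u) (y + z) = act (to_U u) y + act (to_U u) z" using Vm uv by blast+
      have "act (to_U u) (p y + p z) = p (act (to_U u) (y + z))" by (simp only: pa pv uv yz(1))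
      also have "\<dots> = act (to_U u) (p y) + act (to_U u) (p z)" by (simp only: yz(2) pv pa Va uv)
      finally show "act (to_U u) (p y + p z) = act (to_U u) (p y) + act (to_U u) (p z)" .
    qed
    obtain B where B: "finite B" "B \<subseteq> V" "V \<subseteq> kspan B" using finite_dim_kspan[OF V(4,2)] by blast
    have pB: "p ` B \<subseteq> M" using B(2) V(2) module_homD(1)[OF p(1)] N(2) by blast
    have "p y \<in> kspan (p ` B)" if "y \<in> V" for y
      by (rule kspan_map[of B y p]) (use that B V(2) pB hom_0[OF lm p(1)] module_homD(2)[OF p(1)] hom_sc[OF p(1)] kspan_base[OF pB] in auto)
    hence "finite_dim act (p ` V)"
      unfolding finite_dim_def using B kspan_coeffs[of "p ` B"] pB
      by (intro exI[of _ "p ` B"]) (auto simp: sc_def)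
    moreover have "x \<in> p ` V" using V(1) p(2)[OF x] by (metis imageI)
    moreover have "p ` V \<subseteq> N" using module_homD(1)[OF p(1)] V(2) by blast
    ultimately show "x \<in> \<Union>{V. V \<subseteq> N \<and> left_module U_pos (\<lambda>u. act (to_U u)) V \<and> finite_dim act V}"
      using lmV by blast
  qed auto
  ultimately show ?thesis using N(1) by (simp add: cat_O_def)
qed

lemma cat_O_M: "cat_O act M"
  using lm wm lf by (simp add: cat_O_def)

text \<open>
  The submodules in a decomposition of an object into two summands are objects themselves.
\<close>

lemma indecomposable_O_iff: "indecomposable_O act M \<longleftrightarrow> indecomposable U act M"
proof
  assume ind: "indecomposable_O act M"
  show "indecomposable U act M"
    unfolding indecomposable_def
  proof (intro conjI allI impI)
    show "M \<noteq> {0}" using ind by (simp add: indecomposable_O_def)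
    fix V W assume h: "left_module U act V \<and> left_module U act W \<and> V \<inter> W = {0} \<and> M = {a + b | a b. a \<in> V \<and> b \<in> W}"
    have "\<exists>q. module_hom U act M V q \<and> (\<forall>x\<in>V. q x = x)"
      using two_summand_projection[OF lm, of V W] h by blast
    moreover have "W \<inter> V = {0}" "M = {a + b | a b. a \<in> W \<and> b \<in> V}" using h by (auto, metis add.commute, metis add.commute)
    hence "\<exists>q. module_hom U act M W q \<and> (\<forall>x\<in>W. q x = x)"
      using two_summand_projection[OF lm, of W V] h by blast
    moreover have "V \<subseteq> M" "W \<subseteq> M"
    proof -
      have 0: "0 \<in> V" "0 \<in> W" using h by blast+
      show "V \<subseteq> M"
      proof
        fix x assume "x \<in> V"
        moreover have "x = x + 0" by simp
        ultimately show "x \<in> M" using h 0 by blast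
      qed
      show "W \<subseteq> M"
      proof
        fix x assume "x \<in> W"
        moreover have "x = 0 + x" by simp
        ultimately show "x \<in> M" using h 0 by blast
      qed
    qed
    ultimately have "cat_O act V" "cat_O act W" using h summand_cat_O by blast+
    thus "V = {0} \<or> W = {0}" using ind h unfolding indecomposable_O_def by blast
  qed
next
  assume "indecomposable U act M"
  thus "indecomposable_O act M"
    unfolding indecomposable_def indecomposable_O_def using cat_O_M by (auto simp: cat_O_def)
qed

lemma ksub_ws: "\<mu> \<in> L \<Longrightarrow> ksub (ws \<mu>)"
  unfolding ksub_def using ws_M ws_zero ws_add ws_sc by blast

text \<open>
  Fitting's lemma. The module is not of finite length, but its weight spaces are
  finite-dimensional, and finitely many of them generate it: the former makes a surjective
  endomorphism of a weight space injective, the latter bounds the exponent.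
\<close>

theorem fitting_lemma:
  assumes fg: "finitely_generated U act M" and ind: "indecomposable U act M"
  shows "fitting U act M"
  unfolding fitting_def
proof (intro allI impI)
  fix \<phi> assume \<phi>: "module_hom U act M M \<phi>"
  obtain \<Lambda> where La: "finite \<Lambda>" "\<Lambda> \<subseteq> L"
      "\<And>N. left_module U act N \<Longrightarrow> (\<And>\<mu>. \<mu> \<in> \<Lambda> \<Longrightarrow> ws \<mu> \<subseteq> N) \<Longrightarrow> N \<subseteq> M \<Longrightarrow> N = M"
    using finite_weight_spaces(1)[OF fg] by metis
  have kl: "klin (ws \<mu>) \<chi>" if "module_hom U act M M \<chi>" "\<mu> \<in> L" for \<chi> \<mu>
    unfolding klin_def using hom_ws[OF that(1) subset_refl that(2)] module_homD(2)[OF that(1)] hom_sc[OF that(1)] ws_M by blast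
  have "\<exists>n0. \<forall>n\<ge>n0. (\<phi> ^^ n) ` ws \<mu> = (\<phi> ^^ n0) ` ws \<mu>" if \<mu>: "\<mu> \<in> \<Lambda>" for \<mu>
  proof -
    have \<mu>L: "\<mu> \<in> L" using \<mu> La(2) by blast
    obtain B where "finite B" "B \<subseteq> M" "ws \<mu> \<subseteq> kspan B" using finite_weight_spaces(2)[OF fg \<mu>L] by blast
    thus ?thesis using images_stabilize[OF ksub_ws[OF \<mu>L] _ _ _ kl[OF \<phi> \<mu>L]] by blast
  qed
  then obtain n0 where n0: "\<And>\<mu> n. \<mu> \<in> \<Lambda> \<Longrightarrow> n \<ge> n0 \<mu> \<Longrightarrow> (\<phi> ^^ n) ` ws \<mu> = (\<phi> ^^ n0 \<mu>) ` ws \<mu>" by metis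
  \<comment> \<open>Beyond all the exponents at which the images become stable, and positive, so that the kernel
    of \<open>\<phi>\<close> is contained in that of \<open>\<phi>\<^sup>m\<close>.\<close>
  define m where "m = Suc (\<Sum>\<mu>\<in>\<Lambda>. n0 \<mu>)"
  have mn: "n0 \<mu> \<le> m" if "\<mu> \<in> \<Lambda>" for \<mu>
    using member_le_sum[of \<mu> \<Lambda> n0] that La(1) by (simp add: m_def)
  define \<psi> where "\<psi> = \<phi> ^^ m"
  have \<psi>: "module_hom U act M M \<psi>" unfolding \<psi>_def by (rule hom_funpow[OF \<phi>])
  have \<psi>2: "module_hom U act M M (\<lambda>x. \<psi> (\<psi> x))" by (rule hom_comp[OF \<psi> \<psi>])
  define Im where "Im = \<psi> ` M"
  define Ker where "Ker = {x \<in> M. \<psi> x \<in> {0}}"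
  have lmIm: "left_module U act Im" unfolding Im_def by (rule image_submodule[OF lm \<psi> lm])
  have lmKer: "left_module U act Ker" unfolding Ker_def by (rule preimage_submodule[OF lm \<psi> zero_module[OF lm] lm])
  \<comment> \<open>The elements with image in the image of \<open>\<psi>\<^sup>2\<close> form a submodule that contains the generating
    weight spaces.\<close>
  have "{x \<in> M. \<psi> x \<in> (\<lambda>x. \<psi> (\<psi> x)) ` M} = M"
  proof (rule La(3))
    show "left_module U act {x \<in> M. \<psi> x \<in> (\<lambda>x. \<psi> (\<psi> x)) ` M}"
      by (rule preimage_submodule[OF lm \<psi> image_submodule[OF lm \<psi>2 lm] lm])
    show "ws \<mu> \<subseteq> {x \<in> M. \<psi> x \<in> (\<lambda>x. \<psi> (\<psi> x)) ` M}" if "\<mu> \<in> \<Lambda>" for \<mu>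
    proof
      fix x assume x: "x \<in> ws \<mu>"
      have "(\<phi> ^^ m) ` ws \<mu> = (\<phi> ^^ (m + m)) ` ws \<mu>"
        using n0[OF that mn[OF that]] n0[OF that trans_le_add1[OF mn[OF that]]] by simp
      hence "\<psi> x \<in> (\<phi> ^^ (m + m)) ` ws \<mu>" using x unfolding \<psi>_def by blast
      hence "\<psi> x \<in> (\<lambda>x. \<psi> (\<psi> x)) ` M" using ws_M unfolding \<psi>_def by (auto simp: funpow_add)
      thus "x \<in> {x \<in> M. \<psi> x \<in> (\<lambda>x. \<psi> (\<psi> x)) ` M}" using x ws_M by blast
    qed
  qed auto
  hence sq: "\<exists>y\<in>M. \<psi> x = \<psi> (\<psi> y)" if "x \<in> M" for x using that by blast
  have inter: "Im \<inter> Ker = {0}"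
  proof (intro equalityI subsetI)
    fix x assume "x \<in> Im \<inter> Ker"
    then obtain u where u: "u \<in> M" "x = \<psi> u" and x: "x \<in> M" "\<psi> x = 0" by (auto simp: Im_def Ker_def)
    have "W.cmp x \<mu> = 0" if \<mu>: "\<mu> \<in> L" for \<mu>
    proof -
      obtain B where B: "finite B" "B \<subseteq> M" "ws \<mu> \<subseteq> kspan B" using finite_weight_spaces(2)[OF fg \<mu>] by blast
      let ?F = "\<psi> ` ws \<mu>"
      have Fws: "?F \<subseteq> ws \<mu>" using hom_ws[OF \<psi> subset_refl \<mu>] by blast
      have F: "ksub ?F"
        unfolding ksub_def
      proof (intro conjI ballI allI)
        show "?F \<subseteq> M" using Fws ws_M by blast
        show "0 \<in> ?F" using hom_0[OF lm \<psi>] ws_zero[OF \<mu>] by (metis imageI)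
        fix a assume "a \<in> ?F"
        then obtain a' where a: "a' \<in> ws \<mu>" "a = \<psi> a'" by blast
        show "sc c a \<in> ?F" for c
          using hom_sc[OF \<psi>, of a' c] a ws_M ws_sc[OF \<mu> a(1), of c] by (metis imageI subsetD)
        fix b assume "b \<in> ?F"
        then obtain b' where b: "b' \<in> ws \<mu>" "b = \<psi> b'" by blast
        show "a + b \<in> ?F"
          using module_homD(2)[OF \<psi>, of a' b'] a b ws_M ws_add[OF \<mu> a(1) b(1)] by (metis imageI subsetD)
      qed
      have klF: "klin ?F \<psi>" using kl[OF \<psi> \<mu>] Fws unfolding klin_def by blast
      have "\<psi> ` ?F = ?F"
      proof
        show "\<psi> ` ?F \<subseteq> ?F" using Fws by blast
        show "?F \<subseteq> \<psi> ` ?F"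
        proof
          fix z assume "z \<in> ?F"
          then obtain a where a: "a \<in> ws \<mu>" "z = \<psi> a" by blast
          have aM: "a \<in> M" using a ws_M by blast
          obtain y where y: "y \<in> M" "\<psi> a = \<psi> (\<psi> y)" using sq[OF aM] by blast
          have zw: "z \<in> ws \<mu>" using Fws \<open>z \<in> ?F\<close> by blast
          have "z = W.cmp z \<mu>" using W.cmp_single[OF \<mu> zw] by simp
          also have "\<dots> = \<psi> (\<psi> (W.cmp y \<mu>))" using hom_cmp[OF \<psi>2 subset_refl y(1) \<mu>] y(2) a(2) by simp
          finally show "z \<in> \<psi> ` ?F" using W.cmp_mem[OF y(1) \<mu>] by blast
        qed
      qed
      moreover have "W.cmp x \<mu> \<in> ?F" using hom_cmp[OF \<psi> subset_refl u(1) \<mu>] W.cmp_mem[OF u(1) \<mu>] u(2) by simp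
      moreover have "\<psi> (W.cmp x \<mu>) = 0"
        using hom_cmp[OF \<psi> subset_refl x(1) \<mu>] x(2) W.cmp_single[OF \<mu> ws_zero[OF \<mu>]] by simp
      ultimately show ?thesis
        using surjective_injective[OF F _ B(1,2) klF] Fws B(3) by blast
    qed
    hence "W.cmp x \<mu> = 0" for \<mu> using W.cmp_out[OF x(1)] by blast
    thus "x \<in> {0}" using W.cmp_sum[OF x(1)] by simp
  qed (use left_moduleD(1)[OF lmIm] left_moduleD(1)[OF lmKer] in auto)
  have sum: "M = {a + b | a b. a \<in> Im \<and> b \<in> Ker}"
  proof (intro equalityI subsetI)
    fix x assume x: "x \<in> M"
    obtain y where y: "y \<in> M" "\<psi> x = \<psi> (\<psi> y)" using sq[OF x] by blast
    have yM: "\<psi> y \<in> M" by (rule module_homD(1)[OF \<psi> y(1)])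
    have "x - \<psi> y \<in> Ker" using hom_diff[OF lm \<psi> x yM] y left_module_diff[OF lm x yM] by (simp add: Ker_def)
    moreover have "\<psi> y \<in> Im" using y by (simp add: Im_def)
    ultimately show "x \<in> {a + b | a b. a \<in> Im \<and> b \<in> Ker}"
      by (intro CollectI exI[of _ "\<psi> y"] exI[of _ "x - \<psi> y"]) simp
  next
    fix x assume "x \<in> {a + b | a b. a \<in> Im \<and> b \<in> Ker}"
    thus "x \<in> M" using module_homD(1)[OF \<psi>] by (auto simp: Im_def Ker_def intro: M_add)
  qed
  have "Im = {0} \<or> Ker = {0}" using ind lmIm lmKer inter sum unfolding indecomposable_def by blast
  thus "bij_betw \<phi> M M \<or> (\<exists>n. \<forall>x\<in>M. (\<phi> ^^ n) x = 0)"
  proof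
    assume "Im = {0}"
    hence "\<forall>x\<in>M. (\<phi> ^^ m) x = 0" unfolding Im_def \<psi>_def by blast
    thus ?thesis by blast
  next
    assume K: "Ker = {0}"
    have "inj_on \<phi> M"
    proof (rule inj_onI)
      fix x y assume xy: "x \<in> M" "y \<in> M" "\<phi> x = \<phi> y"
      have "\<psi> x = \<psi> y" using xy(3) by (simp add: \<psi>_def m_def funpow_Suc_right del: funpow.simps)
      hence "x - y \<in> Ker" using hom_diff[OF lm \<psi> xy(1,2)] left_module_diff[OF lm xy(1,2)] by (simp add: Ker_def)
      thus "x = y" using K by simp
    qed
    moreover have "y \<in> \<phi> ` M" if y: "y \<in> M" for y
    proof -
      have "y \<in> Im" using y sum K by auto
      then obtain u where "u \<in> M" "y = \<phi> ((\<phi> ^^ (\<Sum>\<mu>\<in>\<Lambda>. n0 \<mu>)) u)" by (auto simp: Im_def \<psi>_def m_def)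
      thus ?thesis using module_homD(1)[OF hom_funpow[OF \<phi>]] by blast
    qed
    ultimately have "bij_betw \<phi> M M" using module_homD(1)[OF \<phi>] unfolding bij_betw_def by blast
    thus ?thesis by blast
  qed
qed

end

section \<open>Decompositions into indecomposable objects\<close>

context O_module
begin

text \<open>
  The preimage of a submodule of \<open>N\<close> under the projection is a submodule of \<open>M\<close>, so the images of
  generators of \<open>M\<close> generate \<open>N\<close>.
\<close>

lemma finitely_generated_summand:
  assumes fg: "finitely_generated U act M" and N: "left_module U act N" "N \<subseteq> M"
    and p: "module_hom U act M N p" "\<And>x. x \<in> N \<Longrightarrow> p x = x"
  shows "finitely_generated U act N"
proof -
  obtain S where S: "finite S" "S \<subseteq> M" "\<And>V. left_module U act V \<Longrightarrow> S \<subseteq> V \<Longrightarrow> V \<subseteq> M \<Longrightarrow> V = M"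
    using fg unfolding finitely_generated_def by blast
  show ?thesis
    unfolding finitely_generated_def
  proof (intro exI[of _ "p ` S"] conjI allI impI)
    show "finite (p ` S)" using S by simp
    show "p ` S \<subseteq> N" using S(2) module_homD(1)[OF p(1)] by blast
    fix V assume V: "left_module U act V \<and> p ` S \<subseteq> V \<and> V \<subseteq> N"
    hence lmV: "left_module U act V" by blast
    have "{x \<in> M. p x \<in> V} = M"
      by (rule S(3)[OF preimage_submodule[OF lm p(1) lmV N(1)]]) (use V S(2) in auto)
    hence pV: "p x \<in> V" if "x \<in> M" for x using that by blast
    have "N \<subseteq> V"
    proof
      fix x assume "x \<in> N"
      thus "x \<in> V" using pV[of x] p(2)[of x] N(2) by auto
    qed
    thus "V = N" using V by blast
  qed
qed

end

lemma sum_lessThan_add: "(\<Sum>i<m + n. g i) = (\<Sum>i<m. g i) + (\<Sum>i<n. g (m + i) :: 'a::comm_monoid_add)" for m n :: nat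
  by (induction n) (simp_all add: add.assoc)

lemma direct_sum_append:
  assumes 1: "module_sum A act {..<m} D V" and 2: "module_sum A act {..<n} E W"
    and M: "left_module A act M" "V \<inter> W = {0}" "M = {a + b | a b. a \<in> V \<and> b \<in> W}"
  shows "internal_direct_sum {..<m + n :: nat} (\<lambda>i. if i < m then D i else E (i - m)) M"
proof -
  interpret D: module_sum A act "{..<m}" D V by fact
  interpret E: module_sum A act "{..<n}" E W by fact
  let ?N = "\<lambda>i. if i < m then D i else E (i - m)"
  have 0: "0 \<in> V" "0 \<in> W" using left_moduleD(1)[OF D.M] left_moduleD(1)[OF E.M] by auto
  have VM: "V \<subseteq> M"
  proof
    fix x assume "x \<in> V"
    thus "x \<in> M" unfolding M(3) using 0 by (intro CollectI exI[of _ x] exI[of _ 0]) simp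
  qed
  have WM: "W \<subseteq> M"
  proof
    fix x assume "x \<in> W"
    thus "x \<in> M" unfolding M(3) using 0 by (intro CollectI exI[of _ 0] exI[of _ x]) simp
  qed
  have lmN: "left_module A act (?N i)" if "i < m + n" for i
  proof (cases "i < m")
    case True thus ?thesis using D.N[of i] by simp
  next
    case False
    have "i - m \<in> {..<n}" using that False by auto
    from E.N[OF this] False show ?thesis by simp
  qed
  show ?thesis
  proof (rule finite_direct_sumI)
    show "0 \<in> M" by (rule left_moduleD(1)[OF M(1)])
    show "?N i \<subseteq> M" if "i \<in> {..<m + n}" for i
    proof (cases "i < m")
      case True thus ?thesis using D.N_sub[of i] VM by auto
    next
      case False
      have "i - m \<in> {..<n}" using that False by auto
      from E.N_sub[OF this] False WM show ?thesis by auto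
    qed
    show "0 \<in> ?N i" if "i \<in> {..<m + n}" for i using left_moduleD(1)[OF lmN] that by auto
    show "x - y \<in> ?N i" if "i \<in> {..<m + n}" "x \<in> ?N i" "y \<in> ?N i" for i x y
      using left_module_diff[OF lmN] that by auto
  next
    fix x assume "x \<in> M"
    then obtain a b where x: "x = a + b" "a \<in> V" "b \<in> W" unfolding M(3) by blast
    let ?v = "\<lambda>i. if i < m then D.cmp a i else E.cmp b (i - m)"
    have "(\<Sum>i<m + n. ?v i) = a + b"
      unfolding sum_lessThan_add using D.cmp_finite_sum[OF x(2)] E.cmp_finite_sum[OF x(3)] by simp
    moreover have "\<forall>i\<in>{..<m + n}. ?v i \<in> ?N i"
    proof
      fix i assume i: "i \<in> {..<m + n}"
      show "?v i \<in> ?N i"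
      proof (cases "i < m")
        case True thus ?thesis using D.cmp_mem[OF x(2), of i] by simp
      next
        case False
        have "i - m \<in> {..<n}" using i False by auto
        from E.cmp_mem[OF x(3) this] False show ?thesis by simp
      qed
    qed
    ultimately show "\<exists>v. (\<forall>i\<in>{..<m + n}. v i \<in> ?N i) \<and> x = (\<Sum>i<m + n. v i)"
      using x(1) by (intro exI[of _ ?v]) simp
  next
    fix v i assume v: "\<And>i. i \<in> {..<m + n} \<Longrightarrow> v i \<in> ?N i" and s: "(\<Sum>i<m + n. v i) = 0" and i: "i \<in> {..<m + n}"
    have vD: "v i \<in> D i" if "i \<in> {..<m}" for i using v[of i] that by simp
    have vE: "v (m + i) \<in> E i" if "i \<in> {..<n}" for i using v[of "m + i"] that by simp
    let ?a = "\<Sum>i<m. v i" and ?b = "\<Sum>i<n. v (m + i)"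
    have ab: "?a + ?b = 0" using s unfolding sum_lessThan_add .
    have aV: "?a \<in> V" by (rule left_module_sum[OF D.M]) (use vD D.N_sub in blast)
    have bW: "?b \<in> W" by (rule left_module_sum[OF E.M]) (use vE E.N_sub in blast)
    have "?a = - ?b" using ab by (simp add: eq_neg_iff_add_eq_0)
    hence "?a \<in> V \<inter> W" using aV left_moduleD(3)[OF E.M bW] by simp
    hence a0: "?a = 0" using M(2) by blast
    hence b0: "?b = 0" using ab by simp
    show "v i = 0"
    proof (cases "i < m")
      case True thus ?thesis using D.sum_zeroD[OF vD a0] by simp
    next
      case False
      have "i - m \<in> {..<n}" using i False by auto
      with E.sum_zeroD[of "\<lambda>i. v (m + i)" "i - m", OF vE b0] have "v (m + (i - m)) = 0" by simp
      thus ?thesis using False by simp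
    qed
  qed simp
qed

context O_module
begin

lemma O_module_summand:
  assumes "left_module U act N" "N \<subseteq> M" "module_hom U act M N p" "\<And>x. x \<in> N \<Longrightarrow> p x = x"
  shows "O_module scale br H P e f h act N"
  using summand_cat_O[OF assms] by unfold_locales (auto simp: cat_O_def)

text \<open>
  Induction on the length of the intersection of a summand with the sum of finitely many
  generating weight spaces: the intersection with a non-zero summand is non-zero, because a
  projection maps these weight spaces into it.
\<close>

theorem decomposition_exists:
  assumes fg: "finitely_generated U act M"
  shows "\<exists>n D. indecomposable_decomposition act M n D"
proof -
  obtain \<Lambda> where La: "finite \<Lambda>" "\<Lambda> \<subseteq> L"
      "\<And>N. left_module U act N \<Longrightarrow> (\<And>\<mu>. \<mu> \<in> \<Lambda> \<Longrightarrow> ws \<mu> \<subseteq> N) \<Longrightarrow> N \<subseteq> M \<Longrightarrow> N = M"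
    using finite_weight_spaces(1)[OF fg] by metis
  have "\<forall>\<mu>\<in>\<Lambda>. \<exists>B. finite B \<and> B \<subseteq> M \<and> ws \<mu> \<subseteq> kspan B" using finite_weight_spaces(2)[OF fg] La(2) by blast
  then obtain Bs where Bs: "\<And>\<mu>. \<mu> \<in> \<Lambda> \<Longrightarrow> finite (Bs \<mu>)" "\<And>\<mu>. \<mu> \<in> \<Lambda> \<Longrightarrow> Bs \<mu> \<subseteq> M" "\<And>\<mu>. \<mu> \<in> \<Lambda> \<Longrightarrow> ws \<mu> \<subseteq> kspan (Bs \<mu>)"
    by metis
  define B where "B = (\<Union>\<mu>\<in>\<Lambda>. Bs \<mu>)"
  have B: "finite B" "B \<subseteq> M" using La(1) Bs(1,2) by (auto simp: B_def)
  obtain len :: "'m set \<Rightarrow> nat" where l: "\<And>W W'. ksub W \<Longrightarrow> ksub W' \<Longrightarrow> W \<subset> W' \<Longrightarrow> W' \<subseteq> kspan B \<Longrightarrow> len W < len W'"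
    using length_function[OF B] by blast
  \<comment> \<open>The sum of the generating weight spaces.\<close>
  define F where "F = {x \<in> M. \<forall>\<mu>. \<mu> \<notin> \<Lambda> \<longrightarrow> W.cmp x \<mu> = 0}"
  have wsF: "ws \<mu> \<subseteq> F" if "\<mu> \<in> \<Lambda>" for \<mu>
  proof
    fix x assume x: "x \<in> ws \<mu>"
    thus "x \<in> F" using W.cmp_single[of \<mu> x] that La(2) ws_M unfolding F_def by auto
  qed
  have FB: "F \<subseteq> kspan B"
  proof
    fix x assume x: "x \<in> F"
    hence xM: "x \<in> M" by (simp add: F_def)
    have "{\<mu>. W.cmp x \<mu> \<noteq> 0} \<subseteq> \<Lambda>" using x by (auto simp: F_def)
    hence e: "x = (\<Sum>\<mu>\<in>\<Lambda>. W.cmp x \<mu>)" by (rule W.cmp_superset[OF xM La(1)])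
    have "(\<Sum>\<mu>\<in>\<Lambda>. W.cmp x \<mu>) \<in> kspan B"
    proof (rule kspan_sum)
      fix \<mu> assume \<mu>: "\<mu> \<in> \<Lambda>"
      have "W.cmp x \<mu> \<in> kspan (Bs \<mu>)" using W.cmp_mem[OF xM] \<mu> La(2) Bs(3)[OF \<mu>] by blast
      thus "W.cmp x \<mu> \<in> kspan B" by (rule kspan_mono[rotated]) (use \<mu> in \<open>auto simp: B_def\<close>)
    qed
    thus "x \<in> kspan B" using e by simp
  qed
  have F: "ksub F"
    unfolding ksub_def
  proof (intro conjI ballI allI)
    show "F \<subseteq> M" by (auto simp: F_def)
    have "W.cmp 0 = (\<lambda>\<mu>. 0)" by (rule W.cmp_eqI[of _ "{}"]) (auto simp: M_0)
    thus "0 \<in> F" by (simp add: F_def M_0)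
    fix x assume x: "x \<in> F"
    show "x + y \<in> F" if "y \<in> F" for y using x that W.cmp_add by (auto simp: F_def M_add)
    show "sc c x \<in> F" for c
    proof -
      have xM: "x \<in> M" using x by (simp add: F_def)
      have "W.cmp (sc c x) \<mu> = 0" if "\<mu> \<notin> \<Lambda>" for \<mu>
        using W.cmp_out[OF sc_mem[OF xM], of \<mu> c] cmp_sc[OF xM, of \<mu> c] x that sc_zero[of c]
        by (cases "\<mu> \<in> L") (auto simp: F_def)
      thus ?thesis using sc_mem[OF xM] by (simp add: F_def)
    qed
  qed
  have ksubN: "ksub (N \<inter> F)" if "left_module U act N" "N \<subseteq> M" for N
  proof (rule ksub_Int[OF _ F])
    show "ksub N" unfolding ksub_def sc_def
      using that left_moduleD[OF that(1)] scalar_closed by auto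
  qed
  have nonzero: "N \<inter> F \<noteq> {0}"
    if N: "left_module U act N" "N \<subseteq> M" "N \<noteq> {0}" and p: "module_hom U act M N p" "\<And>x. x \<in> N \<Longrightarrow> p x = x" for N p
  proof
    assume NF: "N \<inter> F = {0}"
    have "{x \<in> M. p x \<in> {0}} = M"
    proof (rule La(3)[OF preimage_submodule[OF lm p(1) zero_module[OF lm] N(1)]])
      show "ws \<mu> \<subseteq> {x \<in> M. p x \<in> {0}}" if \<mu>: "\<mu> \<in> \<Lambda>" for \<mu>
      proof
        fix x assume x: "x \<in> ws \<mu>"
        have \<mu>L: "\<mu> \<in> L" using \<mu> La(2) by blast
        have xM: "x \<in> M" using x ws_M by blast
        have "p x \<in> ws \<mu>" by (rule hom_ws[OF p(1) N(2) \<mu>L x])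
        hence "p x \<in> N \<inter> F" using wsF[OF \<mu>] module_homD(1)[OF p(1) xM] by blast
        thus "x \<in> {x \<in> M. p x \<in> {0}}" using NF xM by blast
      qed
    qed auto
    hence "p x = 0" if "x \<in> M" for x using that by blast
    hence "x = 0" if "x \<in> N" for x using that N(2) p(2)[OF that] by auto
    thus False using N(3) left_moduleD(1)[OF N(1)] by blast
  qed
  have main: "\<exists>n D. indecomposable_decomposition act N n D"
    if "left_module U act N" "N \<subseteq> M" "module_hom U act M N p" "\<And>x. x \<in> N \<Longrightarrow> p x = x" for N p
    using that
  proof (induction "len (N \<inter> F)" arbitrary: N p rule: less_induct)
    case less
    note N = less.prems(1,2) and p = less.prems(3,4)
    interpret N: O_module scale br H P e f h act N by (rule O_module_summand[OF N p])
    consider "N = {0}" | "indecomposable U act N" | "N \<noteq> {0}" "\<not> indecomposable U act N" by blast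
    thus ?case
    proof cases
      case 1
      have "internal_direct_sum {..<0::nat} (\<lambda>_. {0}) N" unfolding 1 by (rule finite_direct_sumI) auto
      thus ?thesis unfolding indecomposable_decomposition_def by (intro exI[of _ 0] exI[of _ "\<lambda>_. {0}"]) simp
    next
      case 2
      have "internal_direct_sum {..<1::nat} (\<lambda>_. N) N"
        by (rule finite_direct_sumI) (use left_moduleD(1)[OF N(1)] left_module_diff[OF N(1)] in \<open>auto intro: exI[of _ "\<lambda>_. _"]\<close>)
      moreover have "indecomposable_O act N" using 2 N.indecomposable_O_iff by simp
      ultimately show ?thesis
        unfolding indecomposable_decomposition_def by (intro exI[of _ 1] exI[of _ "\<lambda>_. N"]) simp
    next
      case 3
      then obtain V W' where VW: "left_module U act V" "left_module U act W'" "V \<inter> W' = {0}"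
          "N = {a + b | a b. a \<in> V \<and> b \<in> W'}" "V \<noteq> {0}" "W' \<noteq> {0}"
        unfolding indecomposable_def by blast
      have WV1: "W' \<inter> V = {0}" using VW(3) by (simp only: Int_commute)
      have "{a + b | a b. a \<in> V \<and> b \<in> W'} = {a + b | a b. a \<in> W' \<and> b \<in> V}"
        by (intro Collect_cong) (metis add.commute)
      hence WV2: "N = {a + b | a b. a \<in> W' \<and> b \<in> V}" using VW(4) by simp
      note WV = WV1 WV2
      obtain q where q: "module_hom U act N V q" "\<And>x. x \<in> V \<Longrightarrow> q x = x"
        using two_summand_projection[OF N(1) VW(1,2,3,4)] by blast
      obtain q' where q': "module_hom U act N W' q'" "\<And>x. x \<in> W' \<Longrightarrow> q' x = x"
        using two_summand_projection[OF N(1) VW(2,1) WV] by blast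
      have 0: "0 \<in> V" "0 \<in> W'" using left_moduleD(1)[OF VW(1)] left_moduleD(1)[OF VW(2)] by auto
      have VN: "V \<subseteq> N"
      proof
        fix x assume "x \<in> V"
        thus "x \<in> N" unfolding VW(4) using 0 by (intro CollectI exI[of _ x] exI[of _ 0]) simp
      qed
      have WN: "W' \<subseteq> N"
      proof
        fix x assume "x \<in> W'"
        thus "x \<in> N" unfolding VW(4) using 0 by (intro CollectI exI[of _ 0] exI[of _ x]) simp
      qed
      have pV: "module_hom U act M V (\<lambda>x. q (p x))" "\<And>x. x \<in> V \<Longrightarrow> q (p x) = x"
        using hom_comp[OF p(1) q(1)] q(2) p(2) VN by auto
      have pW: "module_hom U act M W' (\<lambda>x. q' (p x))" "\<And>x. x \<in> W' \<Longrightarrow> q' (p x) = x"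
        using hom_comp[OF p(1) q'(1)] q'(2) p(2) WN by auto
      have VM: "V \<subseteq> M" "W' \<subseteq> M" using VN WN N(2) by auto
      have smaller: "len (V1 \<inter> F) < len (N \<inter> F)"
        if V12: "left_module U act V1" "V1 \<subseteq> N" "V1 \<inter> V2 = {0}" "V2 \<subseteq> N" "V2 \<inter> F \<noteq> {0}" "left_module U act V2" for V1 V2
      proof (rule l[OF ksubN[OF V12(1)] ksubN[OF N]])
        obtain y where "y \<in> V2 \<inter> F" "y \<noteq> 0"
          using V12(5) ksubD(2)[OF F] left_moduleD(1)[OF V12(6)] by blast
        thus "V1 \<inter> F \<subset> N \<inter> F" using V12(2,3,4) by blast
        show "V1 \<subseteq> M" using V12(2) N(2) by blast
        show "N \<inter> F \<subseteq> kspan B" using FB by blast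
      qed
      have V0: "V \<inter> F \<noteq> {0}" "W' \<inter> F \<noteq> {0}"
        using nonzero[OF VW(1) VM(1) VW(5) pV] nonzero[OF VW(2) VM(2) VW(6) pW] by auto
      obtain n1 D1 where D1: "indecomposable_decomposition act V n1 D1"
        using less.hyps[OF smaller[OF VW(1) VN VW(3) WN V0(2) VW(2)] VW(1) VM(1) pV] by blast
      obtain n2 D2 where D2: "indecomposable_decomposition act W' n2 D2"
        using less.hyps[OF smaller[OF VW(2) WN WV(1) VN V0(1) VW(1)] VW(2) VM(2) pW] by blast
      have ms: "module_sum U act {..<n} D V" if "indecomposable_decomposition act V n D" "left_module U act V" for n D V
        using that by unfold_locales (auto simp: indecomposable_decomposition_def indecomposable_O_def cat_O_def)
      have "internal_direct_sum {..<n1 + n2} (\<lambda>i. if i < n1 then D1 i else D2 (i - n1)) N"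
        by (rule direct_sum_append[OF ms[OF D1 VW(1)] ms[OF D2 VW(2)] N(1) VW(3,4)])
      moreover have "\<forall>i<n1 + n2. indecomposable_O act (if i < n1 then D1 i else D2 (i - n1))"
        using D1 D2 by (auto simp: indecomposable_decomposition_def)
      ultimately show ?thesis
        unfolding indecomposable_decomposition_def
        by (intro exI[of _ "n1 + n2"] exI[of _ "\<lambda>i. if i < n1 then D1 i else D2 (i - n1)"]) simp
    qed
  qed
  show ?thesis
    by (rule main[of M "\<lambda>x. x"]) (auto simp: lm module_hom_def)
qed

text \<open>
  The summands are finitely generated objects, so Fitting's lemma provides the hypothesis of the
  Krull-Schmidt-Azumaya theorem.
\<close>

theorem decomposition_unique:
  assumes fg: "finitely_generated U act M"
    and D: "indecomposable_decomposition act M n D" and D': "indecomposable_decomposition act M n' D'"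
  shows "n = n' \<and> (\<exists>\<sigma>. bij_betw \<sigma> {..<n} {..<n'} \<and> (\<forall>i<n. module_isomorphic U act (D i) (D' (\<sigma> i))))"
proof -
  have ms: "module_sum U act {..<n} D M" if "indecomposable_decomposition act M n D" for n D
    using that lm by unfold_locales (auto simp: indecomposable_decomposition_def indecomposable_O_def cat_O_def)
  have summand: "O_module scale br H P e f h act (D i) \<and> finitely_generated U act (D i)"
    if "indecomposable_decomposition act M n D" "i < n" for n D i
  proof -
    interpret S: module_sum U act "{..<n}" D M by (rule ms[OF that(1)])
    have i: "i \<in> {..<n}" using that(2) by simp
    have p: "module_hom U act M (D i) (\<lambda>x. S.cmp x i)" by (rule S.cmp_module_hom[OF i])
    have id: "S.cmp x i = x" if "x \<in> D i" for x using S.cmp_single[OF i that] by simp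
    show ?thesis
      using O_module_summand[OF S.N[OF i] S.N_sub[OF i] p id]
        finitely_generated_summand[OF fg S.N[OF i] S.N_sub[OF i] p id] by blast
  qed
  have ind: "indecomposable U act (D i)" if "indecomposable_decomposition act M n D" "i < n" for n D i
  proof -
    have "indecomposable_O act (D i)" using that by (simp add: indecomposable_decomposition_def)
    thus ?thesis using O_module.indecomposable_O_iff[OF conjunct1[OF summand[OF that]]] by (rule iffD1[rotated])
  qed
  show ?thesis
  proof (rule krull_schmidt_azumaya[OF ms[OF D] ms[OF D']])
    show "fitting U act (D i)" if "i < n" for i
      using O_module.fitting_lemma summand[OF D that] ind[OF D that] by blast
    show "D i \<noteq> {0}" if "i < n" for i using ind[OF D that] by (simp add: indecomposable_def)
    show "indecomposable U act (D' j)" if "j < n'" for j using ind[OF D' that] .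
  qed
qed

end

theorem proposition2p10:
  fixes scale :: "complex \<Rightarrow> 'g::ab_group_add \<Rightarrow> 'g"
    and br :: "'g \<Rightarrow> 'g \<Rightarrow> 'g"
    and H :: "'g set"
    and P :: "('g \<Rightarrow> complex) set"
    and e f h :: "('g \<Rightarrow> complex) \<Rightarrow> 'g"
    and p :: nat
    and act :: "('g, 'k::field) hyperalg \<Rightarrow> 'm::ab_group_add \<Rightarrow> 'm"
    and M :: "'m set"
  assumes "chevalley_setup scale br H P e f h"
    and "CHAR('k) = p" and "p > 0"
    and "chevalley_setup.cat_O scale br H P e f h act M"
    and "finitely_generated (chevalley_setup.U scale br H P e f h) act M"
  shows "(\<exists>n N. chevalley_setup.indecomposable_decomposition scale br H P e f h act M n N) \<and>
    (\<forall>n N n' N'.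
       chevalley_setup.indecomposable_decomposition scale br H P e f h act M n N \<and>
       chevalley_setup.indecomposable_decomposition scale br H P e f h act M n' N' \<longrightarrow>
       n = n' \<and>
       (\<exists>\<sigma>. bij_betw \<sigma> {..<n} {..<n'} \<and>
            (\<forall>i<n. module_isomorphic (chevalley_setup.U scale br H P e f h) act (N i) (N' (\<sigma> i)))))"
proof -
  interpret chevalley_setup scale br H P e f h by fact
  interpret O_module scale br H P e f h act M
    using assms(4) by unfold_locales (auto simp: cat_O_def)
  show ?thesis using decomposition_exists[OF assms(5)] decomposition_unique[OF assms(5)] by blast
qed

end
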